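(* Let $\mathcal{X}=\mathbb{T}^d$, $T>0$, $\mathcal{Q}=\mathcal{X}\times(0,T)$, and $\theta>0$. Assume $\beta>2+d/2$, $f\in H^\beta(\mathcal{X})$ with $f\ge f_{\min}>0$, and $u_0\in H^{1+\beta}(\mathcal{X})$. Then the problem $$\tfrac\theta2\Delta_xu-\partial_tu-fu=0\ \text{ on }\mathcal{X}\times(0,T],\qquad u(\cdot,0)=u_0\ \text{ on }\mathcal{X},$$ has a unique strong solution $u_{\theta,f}\in H^{2+\beta,1+\beta/2}(\mathcal{Q})$. Furthermore, there exists $C>0$ such that $$\|u_{\theta,f}\|_{H^{2+\beta,1+\beta/2}(\mathcal{Q})}\le C\big(1+\|f\|_{H^\beta(\mathcal{X})}^{1+\beta/2}\big).$$
   Context: $\mathbb{T}^d$ is the $d$-dimensional torus (periodic boundary conditions). $H^s(\mathcal{X})$ is the Sobolev space of order $s$; $H^{r,r/2}(\mathcal{Q})$ is the anisotropic parabolic Sobolev space of functions on $\mathcal{Q}$ of regularity $r$ in the space variable and $r/2$ in the time variable (Lions–Magenes). *)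

theory Defs
  imports "HOL-Analysis.Analysis"
begin

text \<open>Torus T^d = R^d / Z^d, functions represented as Z^d-periodic functions on R^d,
  integrated over the fundamental cube [0,1]^d.  The dimension d is CARD('d).\<close>

definition tcube :: "(real^'d) set" where
  "tcube = {x. \<forall>i. 0 \<le> x$i \<and> x$i \<le> 1}"

definition periodic_x :: "(real^'d \<Rightarrow> 'a) \<Rightarrow> bool" where
  "periodic_x g \<longleftrightarrow> (\<forall>x (k::int^'d). g (x + (\<chi> i. of_int (k$i))) = g x)"

definition kdot :: "int^'d \<Rightarrow> real^'d \<Rightarrow> real" where
  "kdot k x = (\<Sum>i\<in>UNIV. of_int (k$i) * x$i)"

definition ksq :: "int^'d \<Rightarrow> real" where
  "ksq k = (\<Sum>i\<in>UNIV. (of_int (k$i))^2)"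

definition fcoef :: "(real^'d \<Rightarrow> real) \<Rightarrow> int^'d \<Rightarrow> complex" where
  "fcoef g k = integral\<^sup>L lborel
     (\<lambda>x. indicator tcube x * (complex_of_real (g x) * cis (-2*pi*kdot k x)))"

definition sob_energy :: "real \<Rightarrow> (real^'d \<Rightarrow> real) \<Rightarrow> ennreal" where
  "sob_energy s g = (\<integral>\<^sup>+ k. ennreal ((1 + ksq k) powr s * (cmod (fcoef g k))^2) \<partial>count_space UNIV)"

definition in_Hs :: "real \<Rightarrow> (real^'d \<Rightarrow> real) \<Rightarrow> bool" where
  "in_Hs s g \<longleftrightarrow> periodic_x g \<and> g \<in> borel_measurable lborel \<and>
     (\<integral>\<^sup>+ x. indicator tcube x * ennreal ((g x)^2) \<partial>lborel) < \<infinity> \<and>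
     sob_energy s g < \<infinity>"

definition Hs_norm :: "real \<Rightarrow> (real^'d \<Rightarrow> real) \<Rightarrow> real" where
  "Hs_norm s g = sqrt (enn2real (sob_energy s g))"

definition Qset :: "real \<Rightarrow> ((real^'d) \<times> real) set" where
  "Qset T = tcube \<times> {0<..<T}"

definition L2Q_energy :: "real \<Rightarrow> (real^'d \<Rightarrow> real \<Rightarrow> real) \<Rightarrow> ennreal" where
  "L2Q_energy T w = (\<integral>\<^sup>+ p. indicator (Qset T) p * ennreal ((case_prod w p)^2) \<partial>lborel)"

definition L2Q :: "real \<Rightarrow> (real^'d \<Rightarrow> real \<Rightarrow> real) \<Rightarrow> bool" where
  "L2Q T w \<longleftrightarrow> case_prod w \<in> borel_measurable lborel \<and> L2Q_energy T w < \<infinity>"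

definition smooth_real :: "(real \<Rightarrow> real) \<Rightarrow> bool" where
  "smooth_real \<eta> \<longleftrightarrow> (\<forall>n x. ((deriv ^^ n) \<eta>) differentiable (at x))"

definition test_fun :: "real \<Rightarrow> (real \<Rightarrow> real) \<Rightarrow> bool" where
  "test_fun T \<eta> \<longleftrightarrow> smooth_real \<eta> \<and>
     (\<exists>a b. 0 < a \<and> a \<le> b \<and> b < T \<and> (\<forall>t. t \<notin> {a..b} \<longrightarrow> \<eta> t = 0))"

text \<open>w is the j-th weak time derivative of u on Q, as an L^2(X)-valued function of t
  (tested against all psi in L^2(X) and all eta in C_c^infinity(0,T)).\<close>
definition weak_dt :: "real \<Rightarrow> nat \<Rightarrow> (real^'d \<Rightarrow> real \<Rightarrow> real) \<Rightarrow> (real^'d \<Rightarrow> real \<Rightarrow> real) \<Rightarrow> bool" where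
  "weak_dt T j u w \<longleftrightarrow> (\<forall>\<psi> \<eta>. \<psi> \<in> borel_measurable lborel \<longrightarrow>
      (\<integral>\<^sup>+ x. indicator tcube x * ennreal ((\<psi> x)^2) \<partial>lborel) < \<infinity> \<longrightarrow> test_fun T \<eta> \<longrightarrow>
      (\<integral> p. indicator (Qset T) p * (u (fst p) (snd p) * \<psi> (fst p) * (deriv ^^ j) \<eta> (snd p)) \<partial>lborel)
      = (-1)^j * (\<integral> p. indicator (Qset T) p * (w (fst p) (snd p) * \<psi> (fst p) * \<eta> (snd p)) \<partial>lborel))"

text \<open>L is the weak Laplacian in x of u on Q (tested against e_k(x) eta(t),
  with e_k(x) = exp(2 pi i k.x), Delta e_k = -4 pi^2 |k|^2 e_k).\<close>
definition weak_lap :: "real \<Rightarrow> (real^'d \<Rightarrow> real \<Rightarrow> real) \<Rightarrow> (real^'d \<Rightarrow> real \<Rightarrow> real) \<Rightarrow> bool" where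
  "weak_lap T u L \<longleftrightarrow> (\<forall>(k::int^'d) \<eta>. test_fun T \<eta> \<longrightarrow>
      (\<integral> p. indicator (Qset T) p * (complex_of_real (u (fst p) (snd p) * \<eta> (snd p))
              * complex_of_real (-(4 * pi^2 * ksq k)) * cis (2*pi*kdot k (fst p))) \<partial>lborel)
      = (\<integral> p. indicator (Qset T) p * (complex_of_real (L (fst p) (snd p) * \<eta> (snd p))
              * cis (2*pi*kdot k (fst p))) \<partial>lborel))"

definition slob_energy :: "real \<Rightarrow> real \<Rightarrow> (real^'d \<Rightarrow> real \<Rightarrow> real) \<Rightarrow> ennreal" where
  "slob_energy T \<sigma> w = (\<integral>\<^sup>+ q. indicator ({0<..<T} \<times> {0<..<T}) q *
      (\<integral>\<^sup>+ x. indicator tcube x * ennreal ((w x (fst q) - w x (snd q))^2) \<partial>lborel) *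
      ennreal (1 / \<bar>fst q - snd q\<bar> powr (1 + 2*\<sigma>)) \<partial>lborel)"

definition time_energy :: "real \<Rightarrow> real \<Rightarrow> (real^'d \<Rightarrow> real \<Rightarrow> real) \<Rightarrow> ennreal" where
  "time_energy \<sigma> T u =
     (let m = nat \<lfloor>\<sigma>\<rfloor>; fr = \<sigma> - real m in
      INF w \<in> {w. w 0 = u \<and> (\<forall>j\<le>m. L2Q T (w j) \<and> weak_dt T j u (w j))}.
        (\<Sum>j\<le>m. L2Q_energy T (w j)) + (if fr > 0 then slob_energy T fr (w m) else 0))"

text \<open>Anisotropic space H^{r,r/2}(Q) = L^2(0,T;H^r(X)) \<inter> H^{r/2}(0,T;L^2(X)) (Lions-Magenes).\<close>
definition par_energy :: "real \<Rightarrow> real \<Rightarrow> (real^'d \<Rightarrow> real \<Rightarrow> real) \<Rightarrow> ennreal" where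
  "par_energy r T u = (\<integral>\<^sup>+ t. indicator {0<..<T} t * sob_energy r (\<lambda>x. u x t) \<partial>lborel)
                      + time_energy (r/2) T u"

definition in_par :: "real \<Rightarrow> real \<Rightarrow> (real^'d \<Rightarrow> real \<Rightarrow> real) \<Rightarrow> bool" where
  "in_par r T u \<longleftrightarrow> (\<forall>t. periodic_x (\<lambda>x. u x t)) \<and> case_prod u \<in> borel_measurable lborel \<and>
     par_energy r T u < \<infinity>"

definition par_norm :: "real \<Rightarrow> real \<Rightarrow> (real^'d \<Rightarrow> real \<Rightarrow> real) \<Rightarrow> real" where
  "par_norm r T u = sqrt (enn2real (par_energy r T u))"

text \<open>Strong solution of (theta/2) Lap_x u - d_t u - f u = 0 on X x (0,T], u(.,0) = u0:
  weak derivatives in L^2(Q), equation a.e. on Q, initial datum in the L^2(X) trace sense.\<close>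
definition strong_sol :: "real \<Rightarrow> real \<Rightarrow> (real^'d \<Rightarrow> real) \<Rightarrow> (real^'d \<Rightarrow> real)
                          \<Rightarrow> (real^'d \<Rightarrow> real \<Rightarrow> real) \<Rightarrow> bool" where
  "strong_sol \<theta> T f u0 u \<longleftrightarrow> L2Q T u \<and> (\<exists>L Dt. L2Q T L \<and> L2Q T Dt \<and>
      weak_lap T u L \<and> weak_dt T 1 u Dt \<and>
      (AE p in lborel. p \<in> Qset T \<longrightarrow>
         \<theta>/2 * L (fst p) (snd p) - Dt (fst p) (snd p) - f (fst p) * u (fst p) (snd p) = 0)) \<and>
    (\<forall>\<epsilon>>0. \<exists>\<delta>>0. AE t in lborel. 0 < t \<and> t < \<delta> \<and> t < T \<longrightarrow>
        (\<integral>\<^sup>+ x. indicator tcube x * ennreal ((u x t - u0 x)^2) \<partial>lborel) < ennreal \<epsilon>)"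

end

theory Submission
  imports Defs
begin

text \<open>In Fourier coefficients the problem is the linear system
  \<open>c\<^sub>k' = - \<lambda>\<^sub>k c\<^sub>k - (F * c)\<^sub>k\<close> with \<open>\<lambda>\<^sub>k = 2 \<pi>^2 \<theta> |k|^2\<close> and \<open>F\<close> the coefficients of \<open>f\<close>.  As
  \<open>\<beta> > d/2\<close>, convolution with \<open>F\<close> is bounded on the weighted square summable sequences of every
  order \<open>0 \<le> s \<le> \<beta>\<close>, so a Dyson series solves the system.  Put \<open>M = 1 + \<parallel>f\<parallel>\<close>.  Since \<open>f \<ge> 0\<close>, the
  \<open>L^2\<close> norm does not increase; maximal regularity bounds the squared norm of order \<open>\<beta> + 2\<close> by \<open>M^2\<close>
  times the one of order \<open>\<beta>\<close>, and interpolation at the frequencies \<open>|k|^2 \<sim> M\<close> absorbs the latter: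
  the squared norm of order \<open>s\<close> is \<open>O(M^s)\<close>.  Each time derivative costs a further
  factor \<open>M^2\<close> and two orders, and the fractional remainder is estimated mode by mode, splitting the
  kernel at distance \<open>1 / (1 + |k|^2 + M)\<close>.  Uniqueness follows from Duhamel's formula for each mode
  and a Gronwall argument.\<close>

text \<open>The exponent \<open>1 + \<beta>/2\<close> is half of the order
  \<open>\<beta> + 2\<close>: a squared norm of order \<open>s\<close> is allowed to grow like
  \<open>M powr s\<close>. This is parabolic scaling, with the potential weighed like the Laplacian
  at the frequencies where both have size \<open>M\<close>. A perturbation argument alone would lose
  it, since the Dyson series needs a damping that grows with \<open>f\<close> and so yields
  constants exponential in its norm. The series is therefore used qualitatively: it supplies a
  solution whose norm of order \<open>\<beta>\<close> is finite, and absorbing a term into the left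
  side of an estimate requires just this finiteness.

  The given notions test weak derivatives against all of L2 in space and take infima over families
  of derivatives. Completeness of the characters, Parseval and Riesz-Fischer translate all of this
  into statements on coefficients. Only the first time derivative of a coefficient is taken
  classically; the later ones are prescribed by the system and verified weakly. The estimate is
  claimed for every solution while only one is constructed, so uniqueness also transfers the
  bound.\<close>

abbreviation (input) esq :: "complex \<Rightarrow> ennreal" where
  "esq z \<equiv> ennreal ((cmod z)^2)"

abbreviation (input) bmeas :: "('a::topological_space \<Rightarrow> 'b::topological_space) set" where
  "bmeas \<equiv> borel_measurable borel"

abbreviation (input) bmeas2 :: "('a::topological_space \<times> 'b::topological_space \<Rightarrow> 'c::topological_space) set" where
  "bmeas2 \<equiv> borel_measurable (borel \<Otimes>\<^sub>M borel)"

abbreviation (input) cntM :: "'a measure" where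
  "cntM \<equiv> count_space UNIV"

subsection \<open>Characters of the torus\<close>

text \<open>Integration over the torus as a measure on the whole space: its sets are the Borel sets,
  its total mass is 1, and the faces of the cube that the torus identifies are null.\<close>

definition cubeM :: "(real^'d) measure" where
 "cubeM = density lborel (indicator tcube)"

definition timeM :: "real \<Rightarrow> real measure" where
 "timeM T = density lborel (indicator {0<..<T})"

definition chr :: "int^'d \<Rightarrow> real^'d \<Rightarrow> complex" where
 "chr k x = cis (2 * pi * kdot k x)"

abbreviation (input) QM :: "real \<Rightarrow> ((real^'d) \<times> real) measure" where
 "QM T \<equiv> cubeM \<Otimes>\<^sub>M timeM T"

lemma tcube_eq_cbox: "(tcube :: (real^'d) set) = cbox 0 1"
 by (auto simp: tcube_def mem_box_cart)

lemma tcube_sets [measurable]: "(tcube :: (real^'d) set) \<in> sets borel"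
 by (simp add: tcube_eq_cbox)

lemma sets_cubeM [measurable_cong, simp]: "sets cubeM = sets borel"
 by (simp add: cubeM_def)

lemma space_cubeM [simp]: "space cubeM = UNIV"
 by (simp add: cubeM_def)

lemma sets_timeM [measurable_cong, simp]: "sets (timeM T) = sets borel"
 by (simp add: timeM_def)

lemma space_timeM [simp]: "space (timeM T) = UNIV"
 by (simp add: timeM_def)

lemma borel_measurable_cubeM [simp]: "borel_measurable cubeM = bmeas"
 by (rule measurable_cong_sets) auto

lemma borel_measurable_timeM [simp]: "borel_measurable (timeM T) = bmeas"
 by (rule measurable_cong_sets) auto

lemma emeasure_cubeM: "emeasure (cubeM :: (real^'d) measure) UNIV = 1"
proof -
 have *: "(1 :: real^'d) \<bullet> b = 1" if "b \<in> Basis" for b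
  using that by (auto simp: Basis_vec_def inner_axis)
 have "emeasure (cubeM :: (real^'d) measure) UNIV = emeasure lborel (tcube :: (real^'d) set)"
  by (simp add: cubeM_def emeasure_density nn_integral_indicator)
 also have "\<dots> = 1"
  unfolding tcube_eq_cbox by (subst emeasure_lborel_cbox) (auto simp: *)
 finally show ?thesis .
qed

lemma finite_measure_cubeM: "finite_measure (cubeM :: (real^'d) measure)"
 by (rule finite_measureI) (simp add: emeasure_cubeM)

lemma emeasure_timeM: "T > 0 \<Longrightarrow> emeasure (timeM T) UNIV = ennreal T"
 by (simp add: timeM_def emeasure_density nn_integral_indicator)

lemma finite_measure_timeM: "finite_measure (timeM T)"
proof (rule finite_measureI)
 have "emeasure (timeM T) UNIV = emeasure lborel {0<..<T}"
  by (simp add: timeM_def emeasure_density nn_integral_indicator)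
 also have "\<dots> \<le> emeasure lborel {0..T}" by (rule emeasure_mono) auto
 also have "\<dots> < \<infinity>" by (cases "T \<ge> 0") auto
 finally show "emeasure (timeM T) (space (timeM T)) \<noteq> \<infinity>" by simp
qed

lemma sigma_finite_cubeM: "sigma_finite_measure (cubeM :: (real^'d) measure)"
 using finite_measure_cubeM finite_measure.axioms(1) by blast

lemma sigma_finite_timeM: "sigma_finite_measure (timeM T)"
 using finite_measure_timeM finite_measure.axioms(1) by blast

lemma nn_integral_cubeM:
 assumes [measurable]: "f \<in> bmeas"
 shows "(\<integral>\<^sup>+x. f x \<partial>cubeM) = (\<integral>\<^sup>+x. indicator tcube x * f x \<partial>lborel)"
 unfolding cubeM_def by (subst nn_integral_density) auto

lemma nn_integral_timeM:
 assumes [measurable]: "f \<in> bmeas"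
 shows "(\<integral>\<^sup>+t. f t \<partial>timeM T) = (\<integral>\<^sup>+t. indicator {0<..<T} t * f t \<partial>lborel)"
 unfolding timeM_def by (subst nn_integral_density) auto

lemma integral_cubeM:
 fixes f :: "real^'d \<Rightarrow> 'b::{banach, second_countable_topology}"
 assumes [measurable]: "f \<in> bmeas"
 shows "(\<integral>x. f x \<partial>cubeM) = (\<integral>x. indicator tcube x *\<^sub>R f x \<partial>lborel)"
proof -
 have *: "(indicator tcube :: _ \<Rightarrow> ennreal) = (\<lambda>x. ennreal (indicator tcube x))"
  by (simp add: fun_eq_iff ennreal_indicator)
 show ?thesis
  unfolding cubeM_def * by (subst integral_density) auto
qed

lemma integral_timeM:
 fixes f :: "real \<Rightarrow> 'b::{banach, second_countable_topology}"
 assumes [measurable]: "f \<in> bmeas"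
 shows "(\<integral>x. f x \<partial>timeM T) = (\<integral>x. indicator {0<..<T} x *\<^sub>R f x \<partial>lborel)"
proof -
 have *: "(indicator {0<..<T} :: _ \<Rightarrow> ennreal) = (\<lambda>x. ennreal (indicator {0<..<T} x))"
  by (simp add: fun_eq_iff ennreal_indicator)
 show ?thesis
  unfolding timeM_def * by (subst integral_density) auto
qed

lemma AE_cubeM: "(AE x in (cubeM :: (real^'d) measure). P x) \<longleftrightarrow> (AE x in lborel. x \<in> tcube \<longrightarrow> P x)"
 unfolding cubeM_def by (subst AE_density) (auto simp: indicator_def)

lemma AE_timeM: "(AE t in timeM T. P t) \<longleftrightarrow> (AE t in lborel. t \<in> {0<..<T} \<longrightarrow> P t)"
 unfolding timeM_def by (subst AE_density) (auto simp: indicator_def)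

text \<open>The definitions weight Lebesgue measure on the product by the indicator of
  \<open>Qset T\<close>; read as a product measure, the same integral is open to Fubini and to time
  slices.\<close>

lemma pair_cubeM_timeM:
 "QM T = density lborel (indicator (Qset T))"
proof -
 have "QM T
   = density (lborel \<Otimes>\<^sub>M lborel) (\<lambda>(x, y). indicator tcube x * indicator {0<..<T} y)"
  unfolding cubeM_def timeM_def
  by (rule pair_measure_density) (auto intro: lborel.sigma_finite_measure_axioms
    sigma_finite_timeM[unfolded timeM_def])
 also have "(\<lambda>(x::real^'d, y::real). indicator tcube x * indicator {0<..<T} y :: ennreal) = indicator (Qset T)"
  by (auto simp: Qset_def fun_eq_iff split: split_indicator)
 finally show ?thesis by (simp add: lborel_prod)
qed

section \<open>Characters and their orthogonality\<close>

lemma kdot_add: "kdot (k + l) x = kdot k x + kdot l x"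
 by (simp add: kdot_def sum.distrib algebra_simps)

lemma kdot_minus: "kdot (- k) x = - kdot k x"
 by (simp add: kdot_def sum_negf)

lemma continuous_kdot [continuous_intros]: "continuous_on S (kdot k)"
 unfolding kdot_def by (intro continuous_intros)

lemma continuous_chr: "continuous_on S (chr k)"
 unfolding chr_def by (intro continuous_intros)

lemma chr_measurable [measurable]: "chr k \<in> bmeas"
 using continuous_chr by (rule borel_measurable_continuous_onI)

lemma norm_chr [simp]: "cmod (chr k x) = 1"
 by (simp add: chr_def)

lemma chr_mult: "chr k x * chr l x = chr (k + l) x"
 by (simp add: chr_def cis_mult kdot_add algebra_simps)

lemma cnj_chr: "cnj (chr k x) = chr (- k) x"
 by (simp add: chr_def cis_cnj kdot_minus)

lemma chr_0 [simp]: "chr 0 x = 1"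
 by (simp add: chr_def kdot_def)

lemma chr_periodic: "periodic_x (chr (k :: int^'d))"
 unfolding periodic_x_def
proof (intro allI)
 fix x :: "real^'d" and l :: "int^'d"
 have "kdot k (x + (\<chi> i. of_int (l $ i))) = kdot k x + of_int (\<Sum>i\<in>UNIV. k $ i * l $ i)"
  by (simp add: kdot_def sum.distrib algebra_simps)
 then have "chr k (x + (\<chi> i. of_int (l $ i))) = chr k x * cis (2 * pi * of_int (\<Sum>i\<in>UNIV. k $ i * l $ i))"
  by (simp add: chr_def cis_mult algebra_simps)
 also have "cis (2 * pi * of_int (\<Sum>i\<in>UNIV. k $ i * l $ i)) = 1"
  by (rule cis_multiple_2pi) auto
 finally show "chr k (x + (\<chi> i. of_int (l $ i))) = chr k x" by simp
qed

lemma fcoef_eq: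
 assumes [measurable]: "g \<in> bmeas"
 shows "fcoef g k = (\<integral>x. complex_of_real (g x) * chr (- k) x \<partial>cubeM)"
proof -
 have "fcoef g k = (\<integral>x. indicator tcube x *\<^sub>R (complex_of_real (g x) * chr (- k) x) \<partial>lborel)"
  unfolding fcoef_def chr_def kdot_minus
  by (intro Bochner_Integration.integral_cong) (auto split: split_indicator)
 also have "\<dots> = (\<integral>x. complex_of_real (g x) * chr (- k) x \<partial>cubeM)"
  by (subst integral_cubeM) auto
 finally show ?thesis .
qed

lemma integrable_cubeM_mult_chr:
 fixes h :: "real^'d \<Rightarrow> complex"
 assumes "integrable cubeM h"
 shows "integrable cubeM (\<lambda>x. h x * chr k x)"
proof (rule Bochner_Integration.integrable_bound[OF assms])
 have [measurable]: "h \<in> bmeas"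
  using borel_measurable_integrable[OF assms] by simp
 show "(\<lambda>x. h x * chr k x) \<in> borel_measurable cubeM" by simp
qed (auto simp: norm_mult)

lemma integrable_chr: "integrable cubeM (chr k)"
 by (rule finite_measure.integrable_const_bound[OF finite_measure_cubeM, where B = 1]) auto

lemma cis_sum: "finite A \<Longrightarrow> cis (sum f A) = (\<Prod>a\<in>A. cis (f a))"
 by (induction A rule: finite_induct) (auto simp: cis_mult[symmetric])

text \<open>For integral frequency other than 0 the primitive of the exponential takes equal values
  at 0 and 1.\<close>

lemma integral_unit_interval_cis:
 assumes "n \<in> \<int>"
 shows "(\<integral>r. indicator {0..1} r *\<^sub>R cis (2 * pi * n * r) \<partial>lborel) = (if n = 0 then 1 else 0)"
proof (cases "n = 0")
 case False
 define F where "F r = cis (2 * pi * n * r) / (\<i> * of_real (2 * pi * n))" for r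
 have "(\<integral>r. indicator {0..1} r *\<^sub>R cis (2 * pi * n * r) \<partial>lborel) = F 1 - F 0"
 proof (rule integral_FTC_Icc)
  fix x :: real
  define a where "a = 2 * pi * n"
  have a: "a \<noteq> 0" using False by (simp add: a_def)
  have "((\<lambda>z. exp (\<i> * of_real a * z) / (\<i> * of_real a)) has_field_derivative exp (\<i> * of_real a * of_real x)) (at (of_real x))"
   using a by (auto intro!: derivative_eq_intros)
  from has_vector_derivative_real_field[OF this, of "{0..1}"]
  have "((\<lambda>x. exp (\<i> * of_real a * of_real x) / (\<i> * of_real a)) has_vector_derivative
    exp (\<i> * of_real a * of_real x)) (at x within {0..1})" .
  moreover have "(\<lambda>x. exp (\<i> * of_real a * of_real x) / (\<i> * of_real a)) = F"
   by (simp add: F_def fun_eq_iff cis_conv_exp a_def algebra_simps)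
  moreover have "exp (\<i> * of_real a * of_real x) = cis (2 * pi * n * x)"
   by (simp add: cis_conv_exp a_def algebra_simps)
  ultimately show "(F has_vector_derivative cis (2 * pi * n * x)) (at x within {0..1})"
   by simp
 qed (auto intro!: continuous_intros)
 also have "\<dots> = 0"
  using assms by (simp add: F_def cis_multiple_2pi)
 finally show ?thesis using False by simp
qed simp

lemma integral_chr: "(\<integral>x. chr (k :: int^'d) x \<partial>cubeM) = (if k = 0 then 1 else 0)"
proof -
 interpret product_sigma_finite "\<lambda>_::real^'d. lborel :: real measure" by standard
 \<comment> \<open>\<open>lborel\<close> is the image of a product measure indexed by
   \<open>Basis\<close>, not by the index type, so the frequency has to be read off along a basis
   vector.\<close>
 define \<kappa> :: "real^'d \<Rightarrow> real" where "\<kappa> b = b \<bullet> (\<chi> i. of_int (k $ i))" for b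
 define \<phi> where "\<phi> b r = (indicator {0..1} r *\<^sub>R cis (2 * pi * \<kappa> b * r) :: complex)" for b r
 have \<phi>m [measurable]: "\<phi> b \<in> bmeas" for b
  unfolding \<phi>_def
  by (intro borel_measurable_scaleR borel_measurable_indicator borel_measurable_continuous_onI)
   (auto intro!: continuous_intros)
 have inj: "inj (\<lambda>i. axis i (1::real) :: real^'d)" by (auto simp: inj_def axis_eq_axis)
 have Basis: "(Basis :: (real^'d) set) = (\<lambda>i. axis i 1) ` UNIV"
  by (auto simp: Basis_vec_def)
 have \<kappa>: "\<kappa> (axis i 1) = of_int (k $ i)" for i
  by (simp add: \<kappa>_def inner_axis_axis inner_axis')
 have prod: "indicator tcube x *\<^sub>R chr k x = (\<Prod>b\<in>Basis. \<phi> b (x \<bullet> b))" for x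
 proof -
  have "(\<Prod>b\<in>Basis. \<phi> b (x \<bullet> b)) = (\<Prod>i\<in>UNIV. \<phi> (axis i 1) (x $ i))"
   unfolding Basis by (subst prod.reindex[OF inj]) (auto simp: inner_axis)
  also have "\<dots> = (\<Prod>i\<in>UNIV. of_real (indicator {0..1} (x $ i)) * cis (2 * pi * of_int (k $ i) * x $ i))"
   by (simp add: \<phi>_def \<kappa> scaleR_conv_of_real)
  also have "\<dots> = (\<Prod>i\<in>UNIV. of_real (indicator {0..1} (x $ i))) * chr k x"
   by (simp add: prod.distrib chr_def kdot_def cis_sum sum_distrib_left mult.assoc)
  also have "(\<Prod>i\<in>UNIV. complex_of_real (indicator {0..1} (x $ i))) = of_real (indicator tcube x)"
   by (auto simp: tcube_def indicator_def prod_zero_iff intro!: prod.neutral)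
  finally show ?thesis by (simp add: scaleR_conv_of_real)
 qed
 have one: "integral\<^sup>L lborel (\<phi> b) = (if \<kappa> b = 0 then 1 else 0)" if "b \<in> Basis" for b
 proof -
  obtain i where "b = axis i 1" using \<open>b \<in> Basis\<close> Basis by auto
  then have "\<kappa> b \<in> \<int>" using \<kappa> by simp
  then show ?thesis using integral_unit_interval_cis[of "\<kappa> b"] by (simp add: \<phi>_def[abs_def])
 qed
 have int: "integrable lborel (\<phi> b)" for b
  unfolding \<phi>_def[abs_def]
  by (rule borel_integrable_compact) (auto intro!: continuous_intros)
 have "(\<integral>x. chr k x \<partial>cubeM) = (\<integral>x. (\<Prod>b\<in>Basis. \<phi> b (x \<bullet> b)) \<partial>lborel)"
  by (subst integral_cubeM) (auto simp: prod)
 also have "\<dots> = (\<integral>y. (\<Prod>b\<in>Basis. \<phi> b ((\<Sum>c\<in>Basis. y c *\<^sub>R c) \<bullet> b)) \<partial>(\<Pi>\<^sub>M b\<in>(Basis::(real^'d) set). lborel))"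
  by (subst lborel_eq, subst integral_distr) auto
 also have "\<dots> = (\<integral>y. (\<Prod>b\<in>Basis. \<phi> b (y b)) \<partial>(\<Pi>\<^sub>M b\<in>(Basis::(real^'d) set). lborel))"
  by (intro Bochner_Integration.integral_cong prod.cong refl) simp
 also have "\<dots> = (\<Prod>b\<in>Basis. integral\<^sup>L lborel (\<phi> b))"
  by (rule product_integral_prod) (auto intro: int)
 also have "\<dots> = (\<Prod>b\<in>Basis. if \<kappa> b = 0 then 1 else 0)"
  by (intro prod.cong refl one)
 also have "\<dots> = (\<Prod>i\<in>UNIV. if k $ i = 0 then 1 else 0)"
  unfolding Basis by (subst prod.reindex[OF inj]) (auto simp: \<kappa> cong: prod.cong)
 also have "\<dots> = (if k = 0 then 1 else 0)"
  by (auto simp: vec_eq_iff intro!: prod.neutral)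
 finally show ?thesis .
qed

subsection \<open>Completeness of the characters\<close>

text \<open>Trigonometric polynomials. Sums are generated by \<open>add\<close> rather than by index
  sets, so closure under products and integration against a fixed function go by rule
  induction.\<close>

inductive trigp :: "(real^'d \<Rightarrow> complex) \<Rightarrow> bool" where
 chr: "trigp (\<lambda>x. c * chr k x)"
| add: "trigp p \<Longrightarrow> trigp q \<Longrightarrow> trigp (\<lambda>x. p x + q x)"

lemma trigp_const: "trigp (\<lambda>x. c)"
 using trigp.chr[of c 0] by simp

lemma trigp_cmult: "trigp p \<Longrightarrow> trigp (\<lambda>x. c * p x)"
proof (induction rule: trigp.induct)
 case (chr d k)
 then show ?case using trigp.chr[of "c * d" k] by (simp add: mult.assoc)
next
 case (add p q)
 then show ?case using trigp.add by (fastforce simp: distrib_left)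
qed

lemma trigp_chr_mult: "trigp p \<Longrightarrow> trigp (\<lambda>x. c * chr k x * p x)"
proof (induction rule: trigp.induct)
 case (chr d l)
 have "(\<lambda>x. c * chr k x * (d * chr l x)) = (\<lambda>x. (c * d) * chr (k + l) x)"
  by (simp add: fun_eq_iff chr_mult[symmetric])
 then show ?case using trigp.chr[of "c * d" "k + l"] by simp
next
 case (add p q)
 then show ?case using trigp.add by (fastforce simp: distrib_left)
qed

lemma trigp_mult: "trigp p \<Longrightarrow> trigp q \<Longrightarrow> trigp (\<lambda>x. p x * q x)"
proof (induction rule: trigp.induct)
 case (chr d l)
 then show ?case using trigp_chr_mult by blast
next
 case (add p p')
 then show ?case using trigp.add by (fastforce simp: distrib_right)
qed

lemma trigp_sum: "finite A \<Longrightarrow> (\<And>a. a \<in> A \<Longrightarrow> trigp (p a)) \<Longrightarrow> trigp (\<lambda>x. \<Sum>a\<in>A. p a x)"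
 by (induction A rule: finite_induct) (auto intro: trigp_const trigp.add)

text \<open>Polynomials on the compact image of the cube pull back to trigonometric polynomials,
  which makes Stone-Weierstrass available. Opposite faces of the cube have the same image.\<close>

definition torus_embed :: "real^'d \<Rightarrow> complex^'d" where
 "torus_embed x = (\<chi> i. cis (2 * pi * x $ i))"

lemma continuous_torus_embed: "continuous_on S torus_embed"
 unfolding torus_embed_def by (intro continuous_on_vec_lambda continuous_intros)

lemma chr_axis: "chr (axis i 1) x = cis (2 * pi * x $ i)"
proof -
 have "kdot (axis i 1) x = (\<Sum>j\<in>UNIV. if j = i then x $ i else 0)"
  unfolding kdot_def by (rule sum.cong) (auto simp: axis_def)
 then show ?thesis by (simp add: chr_def)
qed

lemma trigp_cos: "trigp (\<lambda>x::real^'d. of_real (cos (2 * pi * x $ i)))"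
proof -
 have "complex_of_real (cos (2 * pi * x $ i)) = (1/2) * chr (axis i 1) x + (1/2) * chr (- axis i 1) x" for x :: "real^'d"
  unfolding cnj_chr[symmetric] chr_axis by (auto simp: complex_eq_iff)
 then show ?thesis by (simp only:) (intro trigp.intros)
qed

lemma trigp_sin: "trigp (\<lambda>x::real^'d. of_real (sin (2 * pi * x $ i)))"
proof -
 have "complex_of_real (sin (2 * pi * x $ i)) = (-\<i>/2) * chr (axis i 1) x + (\<i>/2) * chr (- axis i 1) x" for x :: "real^'d"
  unfolding cnj_chr[symmetric] chr_axis by (auto simp: complex_eq_iff)
 then show ?thesis by (simp only:) (intro trigp.intros)
qed

text \<open>A real linear functional on \<open>complex^'d\<close> is determined by its values on
  \<open>axis i 1\<close> and \<open>axis i \<i>\<close>; in this expansion the linear case of the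
  polynomial induction becomes a sum of cosines and sines.\<close>

lemma torus_embed_expand:
 "torus_embed x = (\<Sum>i\<in>UNIV. cos (2 * pi * x $ i) *\<^sub>R axis i 1 + sin (2 * pi * x $ i) *\<^sub>R axis i \<i>)"
proof -
 have "(\<Sum>i\<in>UNIV. cos (2 * pi * x $ i) *\<^sub>R axis i 1 + sin (2 * pi * x $ i) *\<^sub>R axis i \<i>) $ j
   = (\<Sum>i\<in>UNIV. if i = j then cis (2 * pi * x $ j) else 0)" for j
  unfolding sum_component by (rule sum.cong) (auto simp: axis_def complex_eq_iff)
 then show ?thesis by (simp add: vec_eq_iff torus_embed_def)
qed

lemma trigp_polynomial:
 fixes P :: "complex^'d \<Rightarrow> real"
 shows "real_polynomial_function P \<Longrightarrow> trigp (\<lambda>x. of_real (P (torus_embed x)))"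
proof (induction rule: real_polynomial_function.induct)
 case (linear f)
 interpret bounded_linear f by fact
 have "complex_of_real (f (torus_embed x))
   = (\<Sum>i\<in>UNIV. of_real (f (axis i 1)) * of_real (cos (2 * pi * x $ i)) + of_real (f (axis i \<i>)) * of_real (sin (2 * pi * x $ i)))"
  for x :: "real^'d"
  unfolding torus_embed_expand by (simp add: sum scale add mult.commute)
 then show ?case
  by (simp only:) (intro trigp_sum trigp.add trigp_cmult trigp_cos trigp_sin; simp)
next
 case (add f g)
 then show ?case using trigp.add by fastforce
next
 case (mult f g)
 then show ?case using trigp_mult by fastforce
qed (rule trigp_const)

lemma trigp_continuous: "trigp p \<Longrightarrow> continuous_on S p"
 by (induction rule: trigp.induct) (auto intro!: continuous_intros continuous_chr)

lemma integrable_cubeM_mult_bounded: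
 fixes h :: "real^'d \<Rightarrow> 'b::{real_normed_field, banach, second_countable_topology}"
 assumes h: "integrable cubeM h" and p: "continuous_on UNIV p"
 shows "integrable cubeM (\<lambda>x. h x * p x)"
proof -
 have "compact (tcube :: (real^'d) set)" by (simp add: tcube_eq_cbox)
 then have "bounded (p ` tcube)"
  using compact_continuous_image continuous_on_subset[OF p] compact_imp_bounded by blast
 then obtain B where B: "\<And>x. x \<in> tcube \<Longrightarrow> norm (p x) \<le> B"
  by (auto simp: bounded_iff)
 have [measurable]: "h \<in> bmeas"
  using borel_measurable_integrable[OF h] by simp
 have [measurable]: "p \<in> bmeas"
  by (rule borel_measurable_continuous_onI[OF p])
 show ?thesis
 proof (rule Bochner_Integration.integrable_bound)
  show "integrable cubeM (\<lambda>x. B * norm (h x))" using h by simp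
  have "AE x in cubeM. x \<in> (tcube :: (real^'d) set)" by (simp add: AE_cubeM)
  then show "AE x in cubeM. norm (h x * p x) \<le> norm (B * norm (h x))"
  proof eventually_elim
   case (elim x)
   have "norm (h x * p x) = norm (p x) * norm (h x)" by (simp add: norm_mult mult.commute)
   also have "\<dots> \<le> B * norm (h x)" by (intro mult_right_mono B elim) auto
   finally show ?case by (simp add: order_trans[OF _ abs_ge_self])
  qed
 qed auto
qed

section \<open>Functions all of whose Fourier coefficients vanish\<close>

context
 fixes g :: "real^'d \<Rightarrow> real"
 assumes g: "integrable cubeM g" and g0: "\<And>k. fcoef g k = 0"
begin

lemma g_meas [measurable]: "g \<in> bmeas"
 using borel_measurable_integrable[OF g] by simp

lemma integral_mult_trigp_eq_0: "trigp p \<Longrightarrow> (\<integral>x. of_real (g x) * p x \<partial>cubeM) = 0"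
proof (induction rule: trigp.induct)
 case (chr c k)
 have "(\<integral>x. complex_of_real (g x) * (c * chr k x) \<partial>cubeM) = c * (\<integral>x. complex_of_real (g x) * chr (- (- k)) x \<partial>cubeM)"
  by (simp add: mult.left_commute)
 also have "\<dots> = 0" using g0[of "- k"] by (subst (asm) fcoef_eq) auto
 finally show ?case .
next
 case (add p q)
 have "integrable cubeM (\<lambda>x. complex_of_real (g x) * p x)" "integrable cubeM (\<lambda>x. complex_of_real (g x) * q x)"
  by (auto intro!: integrable_cubeM_mult_bounded trigp_continuous add.hyps integrable_of_real g)
 then show ?case using add.IH by (simp add: distrib_left)
qed

text \<open>By Stone-Weierstrass \<open>H\<close> is uniformly close to polynomials on the compact
  image of the cube; the integrals of \<open>g\<close> against those vanish, and the error is at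
  most \<open>e\<close> times the L1 norm of \<open>g\<close>.\<close>

lemma integral_mult_torus_embed_eq_0:
 assumes H: "continuous_on UNIV (H :: complex^'d \<Rightarrow> real)"
 shows "(\<integral>x. g x * H (torus_embed x) \<partial>cubeM) = 0"
proof (rule ccontr)
 assume "\<not> ?thesis"
 then have pos: "\<bar>\<integral>x. g x * H (torus_embed x) \<partial>cubeM\<bar> > 0" (is "?I > 0") by simp
 define N where "N = (\<integral>x. \<bar>g x\<bar> \<partial>cubeM)"
 have N: "N \<ge> 0" by (simp add: N_def)
 \<comment> \<open>Small enough that the error \<open>e * N\<close> stays strictly below the value
   assumed to be nonzero; the summand 1 covers \<open>N = 0\<close>.\<close>
 define e where "e = ?I / (N + 1)"
 have e: "e > 0" using pos N by (simp add: e_def)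
 have "compact (torus_embed ` (tcube :: (real^'d) set))"
  by (intro compact_continuous_image continuous_torus_embed) (simp add: tcube_eq_cbox)
 then obtain P where P: "real_polynomial_function P"
   "\<And>z. z \<in> torus_embed ` (tcube :: (real^'d) set) \<Longrightarrow> \<bar>H z - P z\<bar> < e"
  by (rule Stone_Weierstrass_real_polynomial_function[OF _ continuous_on_subset[OF H] e]) auto
 have contP: "continuous_on UNIV (\<lambda>x::real^'d. P (torus_embed x))"
  by (rule continuous_on_compose2[OF continuous_on_polymonial_function continuous_torus_embed])
   (use P(1) in \<open>auto simp: real_polynomial_function_eq\<close>)
 have contH: "continuous_on UNIV (\<lambda>x::real^'d. H (torus_embed x))"
  by (rule continuous_on_compose2[OF H continuous_torus_embed]) auto
 have iP: "integrable cubeM (\<lambda>x. g x * P (torus_embed x))"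
  by (rule integrable_cubeM_mult_bounded[OF g contP])
 have iH: "integrable cubeM (\<lambda>x. g x * H (torus_embed x))"
  by (rule integrable_cubeM_mult_bounded[OF g contH])
 have "complex_of_real (\<integral>x. g x * P (torus_embed x) \<partial>cubeM) = 0"
  using integral_mult_trigp_eq_0[OF trigp_polynomial[OF P(1)]]
  by (simp flip: of_real_mult integral_complex_of_real)
 then have "?I = \<bar>\<integral>x. g x * H (torus_embed x) - g x * P (torus_embed x) \<partial>cubeM\<bar>"
  using iP iH by simp
 also have "\<dots> \<le> (\<integral>x. \<bar>g x * H (torus_embed x) - g x * P (torus_embed x)\<bar> \<partial>cubeM)"
  by (rule integral_abs_bound)
 also have "\<dots> \<le> (\<integral>x. e * \<bar>g x\<bar> \<partial>cubeM)"
 proof (rule integral_mono_AE)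
  have "AE x in cubeM. x \<in> (tcube :: (real^'d) set)" by (simp add: AE_cubeM)
  then show "AE x in cubeM. \<bar>g x * H (torus_embed x) - g x * P (torus_embed x)\<bar> \<le> e * \<bar>g x\<bar>"
  proof eventually_elim
   case (elim x)
   then have "\<bar>H (torus_embed x) - P (torus_embed x)\<bar> \<le> e" using P(2) less_imp_le by blast
   then have "\<bar>g x\<bar> * \<bar>H (torus_embed x) - P (torus_embed x)\<bar> \<le> \<bar>g x\<bar> * e" by (intro mult_left_mono) auto
   then show ?case by (simp add: abs_mult[symmetric] algebra_simps)
  qed
 qed (use iP iH g in auto)
 also have "\<dots> = e * N" by (simp add: N_def)
 also have "\<dots> < e * (N + 1)" using e by simp
 also have "\<dots> = ?I" using N by (simp add: e_def)
 finally show False by simp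
qed

text \<open>The indicator of \<open>K\<close> is a limit of continuous functions of the embedded
  point. Since \<open>K\<close> lies in the open cube, no other point of the closed cube shares an
  image with a point of \<open>K\<close>, so the limit really is the indicator of
  \<open>K\<close>.\<close>

lemma integral_compact_eq_0:
 assumes K: "compact K" "K \<subseteq> box 0 (1 :: real^'d)"
 shows "(\<integral>x. indicator K x * g x \<partial>cubeM) = 0"
proof (cases "K = {}")
 case False
 define \<Phi>K where "\<Phi>K = torus_embed ` K"
 have cl: "closed \<Phi>K"
  unfolding \<Phi>K_def by (intro compact_imp_closed compact_continuous_image continuous_torus_embed K)
 have ne: "\<Phi>K \<noteq> {}" using False by (simp add: \<Phi>K_def)
 \<comment> \<open>Tents over the image of \<open>K\<close>: equal to 1 on it, decreasing in
   \<open>n\<close>, and eventually 0 at each point outside because the image is closed.\<close>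
 define H where "H n z = max 0 (1 - real n * infdist z \<Phi>K)" for n z
 have contH: "continuous_on UNIV (H n)" for n
  unfolding H_def by (intro continuous_intros)
 have mem: "torus_embed x \<in> \<Phi>K \<longleftrightarrow> x \<in> K" if x: "x \<in> tcube" for x
 proof
  assume "torus_embed x \<in> \<Phi>K"
  then obtain y where y: "y \<in> K" "torus_embed x = torus_embed y" by (auto simp: \<Phi>K_def)
  have "x $ i = y $ i" for i
  proof -
   have "cis (2 * pi * x $ i) = cis (2 * pi * y $ i)"
    using y(2) by (simp add: torus_embed_def vec_eq_iff)
   then have "sin (2 * pi * x $ i) = sin (2 * pi * y $ i) \<and> cos (2 * pi * x $ i) = cos (2 * pi * y $ i)"
    by (simp add: complex_eq_iff)
   then obtain n :: int where n: "2 * pi * x $ i = 2 * pi * y $ i + 2 * pi * n"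
    unfolding sin_cos_eq_iff by auto
   then have "2 * pi * (x $ i - y $ i - n) = 0" by (simp add: algebra_simps)
   then have "x $ i - y $ i = n" by simp
   moreover have "0 < y $ i" "y $ i < 1" using y(1) K(2) by (auto simp: mem_box_cart subset_iff)
   moreover have "0 \<le> x $ i" "x $ i \<le> 1" using x by (auto simp: tcube_def)
   \<comment> \<open>One coordinate lies in the open unit interval and the other in the closed one,
     so their integral difference is strictly between -1 and 1.\<close>
   ultimately have "real_of_int n < 1" "real_of_int n > -1" by linarith+
   then have "n = 0" by linarith
   then show ?thesis using \<open>x $ i - y $ i = n\<close> by simp
  qed
  then have "x = y" by (simp add: vec_eq_iff)
  then show "x \<in> K" using y(1) by simp
 qed (auto simp: \<Phi>K_def)
 have Kb[measurable]: "K \<in> sets borel" using K(1) by (simp add: borel_compact)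
 have lim: "(\<lambda>n. H n (torus_embed x)) \<longlonglongrightarrow> indicator K x" if x: "x \<in> tcube" for x
 proof (cases "x \<in> K")
  case True
  then have "torus_embed x \<in> \<Phi>K" by (simp add: \<Phi>K_def)
  then have "H n (torus_embed x) = 1" for n by (simp add: H_def)
  then show ?thesis using True by simp
 next
  case F: False
  then have "torus_embed x \<notin> \<Phi>K" using mem x by blast
  then have p: "infdist (torus_embed x) \<Phi>K > 0"
   using in_closed_iff_infdist_zero[OF cl ne] infdist_nonneg[of "torus_embed x" \<Phi>K] by force
  then obtain m :: nat where m: "1 < real m * infdist (torus_embed x) \<Phi>K"
   using reals_Archimedean3 by blast
  have "H n (torus_embed x) = 0" if "n \<ge> m" for n
  proof -
   have "real m * infdist (torus_embed x) \<Phi>K \<le> real n * infdist (torus_embed x) \<Phi>K"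
    using that p by (intro mult_right_mono) auto
   then show ?thesis using m by (simp add: H_def)
  qed
  then have "eventually (\<lambda>n. H n (torus_embed x) = 0) sequentially"
   by (auto simp: eventually_sequentially)
  then show ?thesis using F by (simp add: tendsto_eventually)
 qed
 have "(\<lambda>n. \<integral>x. g x * H n (torus_embed x) \<partial>cubeM) \<longlonglongrightarrow> (\<integral>x. indicator K x * g x \<partial>cubeM)"
 proof (rule integral_dominated_convergence[where w = "\<lambda>x. \<bar>g x\<bar>"])
  have "AE x in cubeM. x \<in> (tcube :: (real^'d) set)" by (simp add: AE_cubeM)
  then show "AE x in cubeM. (\<lambda>n. g x * H n (torus_embed x)) \<longlonglongrightarrow> indicator K x * g x"
  proof eventually_elim
   case (elim x)
   show ?case using tendsto_mult[OF tendsto_const[of "g x"] lim[OF elim]] by (simp add: mult.commute)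
  qed
  have [measurable]: "(\<lambda>x. H n (torus_embed x)) \<in> bmeas" for n
   by (rule borel_measurable_continuous_onI, rule continuous_on_compose2[OF contH continuous_torus_embed]) auto
  show "(\<lambda>x. g x * H n (torus_embed x)) \<in> borel_measurable cubeM" for n by simp
  show "AE x in cubeM. norm (g x * H n (torus_embed x)) \<le> \<bar>g x\<bar>" for n
  proof (rule AE_I2)
   fix x :: "real^'d"
   have "\<bar>H n (torus_embed x)\<bar> \<le> 1" using infdist_nonneg[of "torus_embed x" \<Phi>K] by (simp add: H_def)
   then have "\<bar>g x\<bar> * \<bar>H n (torus_embed x)\<bar> \<le> \<bar>g x\<bar> * 1" by (intro mult_left_mono) auto
   then show "norm (g x * H n (torus_embed x)) \<le> \<bar>g x\<bar>" by (simp add: abs_mult)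
  qed
 qed (use g in auto)
 moreover have "(\<integral>x. g x * H n (torus_embed x) \<partial>cubeM) = 0" for n
  by (rule integral_mult_torus_embed_eq_0[OF contH])
 ultimately show ?thesis by (simp add: LIMSEQ_const_iff)
qed simp

text \<open>If \<open>g\<close> were positive on a set of positive measure, inner regularity would
  give a compact subset of positive measure. The integral of \<open>g\<close> over it is 0, although
  the integrand is positive there.\<close>

lemma AE_le_0: "AE x in cubeM. g x \<le> 0"
proof -
 define A where "A = {x \<in> box 0 (1::real^'d). g x > 0}"
 have Ab: "A \<in> sets borel" unfolding A_def by measurable
 have "emeasure lborel A = 0"
 proof (rule ccontr)
  assume ne: "emeasure lborel A \<noteq> 0"
  have "emeasure lborel A \<le> emeasure lborel (cbox 0 (1::real^'d))"
   by (rule emeasure_mono) (auto simp: A_def intro: box_subset_cbox[THEN subsetD])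
  also have "\<dots> < \<infinity>" by (simp add: emeasure_lborel_cbox_eq)
  finally have fin: "emeasure lborel A < \<infinity>" .
  define e where "e = enn2real (emeasure lborel A)"
  have e: "e > 0" "ennreal e = emeasure lborel A"
   using ne fin by (auto simp: e_def enn2real_positive_iff zero_less_iff_neq_zero)
  have "A \<in> sets lebesgue" using Ab by (simp add: sets_completionI_sets)
  \<comment> \<open>The tolerance is the full measure of \<open>A\<close>, so a null set
    \<open>K\<close> contradicts the strict inequality.\<close>
  then obtain K where K: "closed K" "K \<subseteq> A" "emeasure lebesgue (A - K) < ennreal e"
   using sets_lebesgue_inner_closed[OF _ e(1)] by metis
  have Kc: "compact K"
  proof -
   have "K \<subseteq> box 0 1" using K(2) by (auto simp: A_def)
   then have "bounded K" using bounded_box bounded_subset by blast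
   then show ?thesis using K(1) by (simp add: compact_eq_bounded_closed)
  qed
  have Kb [measurable]: "K \<in> sets borel" using Kc by (simp add: borel_compact)
  have Ksub: "K \<subseteq> box 0 1" using K(2) by (auto simp: A_def)
  have "(\<integral>x. indicator K x * g x \<partial>cubeM) = 0" by (rule integral_compact_eq_0[OF Kc Ksub])
  moreover have "integrable cubeM (\<lambda>x. indicator K x * g x)"
   using integrable_mult_indicator[OF _ g, of K] Kb by simp
  moreover have nn: "indicator K x * g x \<ge> 0" for x using K(2) by (auto simp: A_def indicator_def)
  ultimately have "AE x in cubeM. indicator K x * g x = 0"
   using integral_nonneg_eq_0_iff_AE[of cubeM "\<lambda>x. indicator K x * g x"] by simp
  then have "AE x in lborel. x \<notin> K"
   unfolding AE_cubeM
  proof eventually_elim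
   case (elim x)
   have "x \<in> tcube \<and> g x > 0" if "x \<in> K"
    using that K(2) box_subset_cbox[of 0 "1::real^'d"] by (auto simp: tcube_eq_cbox A_def)
   then show ?case using elim by (auto simp: indicator_def)
  qed
  then have K0: "emeasure lborel K = 0"
   using AE_iff_measurable[of K lborel "\<lambda>x. x \<notin> K"] Kb by simp
  have "emeasure lborel A = emeasure lborel ((A - K) \<union> K)" using K(2) by (simp add: Un_absorb2)
  also have "\<dots> \<le> emeasure lborel (A - K) + emeasure lborel K"
   using Ab Kb by (intro emeasure_subadditive) auto
  also have "\<dots> < ennreal e" using K(3) K0 Ab Kb by (simp add: emeasure_completion main_part_sets sets.Diff)
  finally show False using e by simp
 qed
 then have "AE x in lborel. x \<notin> A"
  using AE_iff_measurable[of A lborel "\<lambda>x. x \<notin> A"] Ab by simp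
 moreover have "AE x in lborel. x \<notin> cbox 0 1 - box 0 (1::real^'d)"
 proof -
  have "emeasure lborel (cbox 0 1 - box 0 (1::real^'d)) = 0"
   by (subst emeasure_Diff) (auto simp: emeasure_lborel_box_eq emeasure_lborel_cbox_eq box_subset_cbox)
  then show ?thesis by (intro AE_not_in) (auto simp: null_sets_def)
 qed
 ultimately show ?thesis unfolding AE_cubeM tcube_eq_cbox
  by eventually_elim (auto simp: A_def)
qed

end

lemma fcoef_eq_0_imp_AE_eq_0:
 fixes g :: "real^'d \<Rightarrow> real"
 assumes g: "integrable cubeM g" and g0: "\<And>k. fcoef g k = 0"
 shows "AE x in cubeM. g x = 0"
proof -
 have [measurable]: "g \<in> bmeas"
  using borel_measurable_integrable[OF g] by simp
 have "fcoef (\<lambda>x. - g x) k = 0" for k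
  using g0[of k] by (simp add: fcoef_eq)
 then have "AE x in cubeM. - g x \<le> 0"
  by (intro AE_le_0) (use g in auto)
 moreover have "AE x in cubeM. g x \<le> 0" by (rule AE_le_0[OF g g0])
 ultimately show ?thesis by eventually_elim auto
qed

subsection \<open>Weighted coefficient norms and convolution\<close>

text \<open>The squared Sobolev norm of a coefficient sequence, with values in
  \<open>ennreal\<close> so that estimates need no prior summability.\<close>

definition sE :: "real \<Rightarrow> (int^'d \<Rightarrow> complex) \<Rightarrow> ennreal" where
 "sE s a = (\<integral>\<^sup>+k. ennreal ((1 + ksq k) powr s * (cmod (a k))^2) \<partial>cntM)"

text \<open>As a Bochner integral over counting measure this is 0 wherever the series fails to
  converge absolutely. Bounds in absolute value therefore hold for arbitrary sequences, whereas
  additivity requires integrability.\<close>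

definition conv :: "(int^'d \<Rightarrow> complex) \<Rightarrow> (int^'d \<Rightarrow> complex) \<Rightarrow> int^'d \<Rightarrow> complex" where
 "conv f v k = (\<integral>l. f (k - l) * v l \<partial>cntM)"

text \<open>The norm of the Wiener algebra of absolutely convergent Fourier series.\<close>

definition l1 :: "(int^'d \<Rightarrow> complex) \<Rightarrow> ennreal" where
 "l1 a = (\<integral>\<^sup>+k. ennreal (cmod (a k)) \<partial>cntM)"

text \<open>The squared constant of the embedding of the Sobolev space of order
  \<open>\<beta>\<close> into absolutely convergent Fourier series. The dimension enters through a
  type, hence the \<open>itself\<close> argument.\<close>

definition bracket_sum :: "'d::finite itself \<Rightarrow> real \<Rightarrow> ennreal" where
 "bracket_sum d \<beta> = (\<integral>\<^sup>+k. ennreal ((1 + ksq (k::int^'d)) powr (- \<beta>)) \<partial>cntM)"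

lemma sob_energy_eq: "sob_energy s g = sE s (fcoef g)"
 by (simp add: sob_energy_def sE_def)

lemma ksq_nonneg [simp]: "0 \<le> ksq k"
 by (simp add: ksq_def sum_nonneg)

lemma ksq_pos [simp]: "0 < 1 + ksq k"
 using ksq_nonneg[of k] by linarith

lemma ksq_minus [simp]: "ksq (- k) = ksq k"
 by (simp add: ksq_def)

lemma ksq_neq [simp]: "1 + ksq k \<noteq> 0"
 using ksq_pos[of k] by linarith

lemma powr_sq: "((x::real) powr a)^2 = x powr (2 * a)"
 by (simp add: power2_eq_square powr_add[symmetric])

lemma sq_powr: "x \<ge> 0 \<Longrightarrow> ((x::real)^2) powr a = x powr (2 * a)"
 by (simp add: power2_eq_square powr_mult powr_add[symmetric])

lemma powr_pow: "x > 0 \<Longrightarrow> ((x::real) powr a) ^ n = x powr (a * real n)"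
 by (simp only: powr_realpow[symmetric] powr_gt_zero powr_powr)

lemma bij_minus_left: "bij (\<lambda>l. k - l :: 'a::ab_group_add)"
 by (rule o_bij[of "\<lambda>l. k - l"]) auto

lemma bij_minus_right: "bij (\<lambda>l. l - k :: 'a::ab_group_add)"
 by (rule o_bij[of "\<lambda>l. l + k"]) auto

lemma nn_integral_count_minus_left:
 "(\<integral>\<^sup>+l. f (k - l) \<partial>cntM) = (\<integral>\<^sup>+l. f l \<partial>count_space (UNIV :: 'a::ab_group_add set))"
 by (rule nn_integral_bij_count_space[OF bij_minus_left])

lemma nn_integral_count_minus_right:
 "(\<integral>\<^sup>+l. f (l - k) \<partial>cntM) = (\<integral>\<^sup>+l. f l \<partial>count_space (UNIV :: 'a::ab_group_add set))"
 by (rule nn_integral_bij_count_space[OF bij_minus_right])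

lemma nn_integral_count_swap:
 fixes F :: "'a::countable \<Rightarrow> 'b::countable \<Rightarrow> ennreal"
 shows "(\<integral>\<^sup>+k. \<integral>\<^sup>+l. F k l \<partial>cntM \<partial>cntM)
    = (\<integral>\<^sup>+l. \<integral>\<^sup>+k. F k l \<partial>cntM \<partial>cntM)"
 by (rule nn_integral_count_space_nn_integral) auto

text \<open>Reduces a bound on a sum over a countable type to finite partial sums, by enumerating
  the type through \<open>to_nat\<close>. Bessel's inequality arises in that finite form.\<close>

lemma nn_integral_count_le_finite:
 fixes f :: "'a::countable \<Rightarrow> ennreal"
 assumes "\<And>F. finite F \<Longrightarrow> (\<Sum>k\<in>F. f k) \<le> B"
 shows "(\<integral>\<^sup>+k. f k \<partial>cntM) \<le> B"
proof -
 define g where "g n = (if n \<in> range (to_nat :: 'a \<Rightarrow> nat) then f (from_nat n) else 0)" for n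
 have "(\<integral>\<^sup>+k. f k \<partial>cntM) = (\<integral>\<^sup>+k. g (to_nat (k :: 'a)) \<partial>cntM)"
  by (simp add: g_def)
 also have "\<dots> = (\<integral>\<^sup>+n. g n \<partial>count_space (range (to_nat :: 'a \<Rightarrow> nat)))"
  by (rule nn_integral_bij_count_space) (simp add: bij_betw_def inj_to_nat)
 also have "\<dots> = (\<integral>\<^sup>+n. g n \<partial>cntM)"
  by (rule nn_integral_count_space_eq) (auto simp: g_def)
 also have "\<dots> = (\<Sum>n. g n)" by (rule nn_integral_count_space_nat)
 also have "\<dots> \<le> B"
 proof (rule suminf_le_const[OF summableI])
  fix N
  have "(\<Sum>n<N. g n) = (\<Sum>n\<in>{..<N} \<inter> range (to_nat :: 'a \<Rightarrow> nat). f (from_nat n))"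
   by (simp add: g_def sum.If_cases Int_def)
  also have "{..<N} \<inter> range (to_nat :: 'a \<Rightarrow> nat) = to_nat ` {k :: 'a. to_nat k < N}" by auto
  also have "(\<Sum>n\<in>\<dots>. f (from_nat n)) = (\<Sum>k\<in>{k. to_nat k < N}. f k)"
   by (subst sum.reindex) (auto intro: inj_on_subset[OF inj_to_nat])
  also have "\<dots> \<le> B"
  proof (rule assms)
   have "finite (to_nat -` {..<N} :: 'a set)" by (rule finite_vimageI) auto
   then show "finite {k :: 'a. to_nat k < N}" by (simp add: vimage_def)
  qed
  finally show "(\<Sum>n<N. g n) \<le> B" .
 qed
 finally show ?thesis .
qed

section \<open>Summability of the Sobolev weights above the critical exponent\<close>

lemma nn_integral_int_bracket_finite:
 assumes "\<gamma> > 1/2"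
 shows "(\<integral>\<^sup>+n. ennreal ((1 + (real_of_int n)^2) powr (- \<gamma>)) \<partial>cntM) < \<infinity>"
proof -
 define f :: "int \<Rightarrow> ennreal" where "f n = ennreal ((1 + (real_of_int n)^2) powr (- \<gamma>))" for n
 have summ: "summable (\<lambda>n::nat. (1 + (real n)^2) powr (- \<gamma>))"
 proof (rule summable_comparison_test')
  show "summable (\<lambda>n. real n powr (- 2 * \<gamma>))"
   using assms by (subst summable_real_powr_iff) simp
  fix n :: nat assume n: "n \<ge> 1"
  have "(1 + (real n)^2) powr (- \<gamma>) \<le> ((real n)^2) powr (- \<gamma>)"
   using assms n by (intro powr_mono2') auto
  also have "\<dots> = real n powr (- 2 * \<gamma>)"
   by (simp add: sq_powr)
  finally show "norm ((1 + (real n)^2) powr (- \<gamma>)) \<le> real n powr (- 2 * \<gamma>)" by simp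
 qed
 have nat: "(\<integral>\<^sup>+n. f (int n) \<partial>cntM) < \<infinity>"
 proof -
  have "(\<Sum>n. ennreal ((1 + (real n)^2) powr (- \<gamma>))) \<noteq> top"
   by (rule ennreal_suminf_neq_top[OF summ]) auto
  then show ?thesis
   unfolding nn_integral_count_space_nat f_def of_int_of_nat_eq infinity_ennreal_def
   by (rule top.not_eq_extremum[THEN iffD1])
 qed
 have half: "(\<integral>\<^sup>+n. f n * indicator {0..} n \<partial>cntM) < \<infinity>"
 proof -
  have "(\<integral>\<^sup>+n. f n * indicator {0..} n \<partial>cntM) = (\<integral>\<^sup>+n. f n \<partial>count_space {0..})"
   by (rule nn_integral_count_space_indicator[symmetric]) simp
  also have "\<dots> = (\<integral>\<^sup>+n. f (int n) \<partial>cntM)"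
   by (rule nn_integral_bij_count_space[symmetric])
    (auto simp: bij_betw_def image_def intro!: inj_of_nat exI[of _ "nat _"])
  finally show ?thesis using nat by simp
 qed
 have half': "(\<integral>\<^sup>+n. f n * indicator {..0} n \<partial>cntM) < \<infinity>"
 proof -
  have "(\<integral>\<^sup>+n. f n * indicator {..0} n \<partial>cntM) = (\<integral>\<^sup>+n. f (0 - n) * indicator {..0} (0 - n) \<partial>cntM)"
   by (rule nn_integral_count_minus_left[symmetric])
  also have "\<dots> = (\<integral>\<^sup>+n. f n * indicator {0..} n \<partial>cntM)"
   by (rule nn_integral_cong) (auto simp: f_def indicator_def)
  finally show ?thesis using half by simp
 qed
 have "(\<integral>\<^sup>+n. f n \<partial>cntM) \<le> (\<integral>\<^sup>+n. f n * indicator {0..} n + f n * indicator {..0} n \<partial>cntM)"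
  by (rule nn_integral_mono) (auto simp: indicator_def)
 also have "\<dots> = (\<integral>\<^sup>+n. f n * indicator {0..} n \<partial>cntM) + (\<integral>\<^sup>+n. f n * indicator {..0} n \<partial>cntM)"
  by (rule nn_integral_add) auto
 also have "\<dots> < \<infinity>" using half half' by simp
 finally show ?thesis by (simp add: f_def)
qed

text \<open>The exponent is shared equally among the coordinates. Since \<open>1 + ksq k\<close>
  dominates \<open>1 + (k $ i)^2\<close> for every \<open>i\<close>, the weight is at most a product
  of one-dimensional weights, each with exponent \<open>\<beta> / CARD('d) > 1/2\<close>.\<close>

lemma bracket_sum_finite:
 assumes "\<beta> > real CARD('d) / 2"
 shows "bracket_sum TYPE('d::finite) \<beta> < \<infinity>"
proof -
 interpret product_sigma_finite "\<lambda>_::'d. count_space (UNIV :: int set)"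
  by (intro product_sigma_finite.intro sigma_finite_measure_count_space_countable) auto
 define \<gamma> where "\<gamma> = \<beta> / real CARD('d)"
 have \<gamma>: "\<gamma> > 1/2" using assms by (simp add: \<gamma>_def field_simps)
 define g :: "int \<Rightarrow> ennreal" where "g n = ennreal ((1 + (real_of_int n)^2) powr (- \<gamma>))" for n
 have le: "ennreal ((1 + ksq k) powr (- \<beta>)) \<le> (\<Prod>i\<in>UNIV. g (k $ i))" for k :: "int^'d"
 proof -
  have "(1 + ksq k) powr (- \<beta>) = (\<Prod>i\<in>(UNIV::'d set). (1 + ksq k) powr (- \<gamma>))"
   by (simp add: \<gamma>_def powr_pow)
  also have "\<dots> \<le> (\<Prod>i\<in>UNIV. (1 + (real_of_int (k $ i))^2) powr (- \<gamma>))"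
  proof (rule prod_mono)
   fix i :: 'd
   have "(real_of_int (k $ i))^2 \<le> ksq k"
    unfolding ksq_def by (rule member_le_sum) auto
   then show "0 \<le> (1 + ksq k) powr (- \<gamma>) \<and> (1 + ksq k) powr (- \<gamma>) \<le> (1 + (real_of_int (k $ i))^2) powr (- \<gamma>)"
    using \<gamma> by (auto intro!: powr_mono2' add_pos_nonneg)
  qed
  finally show ?thesis by (simp add: g_def prod_ennreal ennreal_leI)
 qed
 have bij: "bij_betw vec_lambda (UNIV :: ('d \<Rightarrow> int) set) UNIV"
  by (rule o_bij[of vec_nth]) (auto simp: fun_eq_iff)
 have "bracket_sum TYPE('d) \<beta> \<le> (\<integral>\<^sup>+k. (\<Prod>i\<in>(UNIV::'d set). g ((k :: int^'d) $ i)) \<partial>cntM)"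
  unfolding bracket_sum_def by (rule nn_integral_mono) (rule le)
 also have "\<dots> = (\<integral>\<^sup>+h. (\<Prod>i\<in>(UNIV::'d set). g (vec_lambda h $ i)) \<partial>cntM)"
  by (rule nn_integral_bij_count_space[OF bij, of "\<lambda>k. \<Prod>i\<in>UNIV. g (k $ i)", symmetric])
 also have "\<dots> = (\<integral>\<^sup>+h. (\<Prod>i\<in>(UNIV::'d set). g (h i)) \<partial>(\<Pi>\<^sub>M i\<in>(UNIV::'d set). cntM))"
  by (subst count_space_PiM_finite) auto
 also have "\<dots> = (\<Prod>i\<in>(UNIV::'d set). \<integral>\<^sup>+n. g n \<partial>cntM)"
  by (rule product_nn_integral_prod) auto
 also have "\<dots> < \<infinity>"
  using nn_integral_int_bracket_finite[OF \<gamma>] by (simp add: g_def power_less_top_ennreal)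
 finally show ?thesis .
qed

lemma sE_mono_exp: "s \<le> s' \<Longrightarrow> sE s a \<le> sE s' a"
 unfolding sE_def
 by (intro nn_integral_mono ennreal_leI mult_right_mono powr_mono) auto

lemma sE_cong: "(\<And>k. cmod (a k) = cmod (b k)) \<Longrightarrow> sE s a = sE s b"
 by (simp add: sE_def)

lemma sE_0_eq: "sE 0 a = (\<integral>\<^sup>+k. ennreal ((cmod (a k))^2) \<partial>cntM)"
proof -
 show ?thesis by (simp add: sE_def)
qed

lemma cmod_add_sq_le: "(cmod (a + b))^2 \<le> 2 * (cmod a)^2 + 2 * (cmod b)^2"
proof -
 have "(cmod (a + b))^2 \<le> (cmod a + cmod b)^2" by (intro power_mono norm_triangle_ineq) auto
 also have "\<dots> \<le> 2 * (cmod a)^2 + 2 * (cmod b)^2"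
  using sum_squares_ge_zero[of "cmod a - cmod b" 0] by (simp add: power2_eq_square algebra_simps)
 finally show ?thesis .
qed

lemma sE_add_le:
 fixes a b :: "int^'d \<Rightarrow> complex"
 shows "sE s (\<lambda>k. a k + b k) \<le> 2 * sE s a + 2 * sE s b"
proof -
 have "sE s (\<lambda>k. a k + b k) \<le> (\<integral>\<^sup>+k. 2 * ennreal ((1 + ksq k) powr s * (cmod (a k))^2) + 2 * ennreal ((1 + ksq k) powr s * (cmod (b k))^2) \<partial>cntM)"
  unfolding sE_def
 proof (rule nn_integral_mono)
  fix k :: "int^'d"
  have "(1 + ksq k) powr s * (cmod (a k + b k))^2 \<le> (1 + ksq k) powr s * (2 * (cmod (a k))^2 + 2 * (cmod (b k))^2)"
   by (intro mult_left_mono cmod_add_sq_le) auto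
  then have "ennreal ((1 + ksq k) powr s * (cmod (a k + b k))^2)
    \<le> ennreal (2 * ((1 + ksq k) powr s * (cmod (a k))^2) + 2 * ((1 + ksq k) powr s * (cmod (b k))^2))"
   by (intro ennreal_leI) (simp add: algebra_simps)
  also have "\<dots> = 2 * ennreal ((1 + ksq k) powr s * (cmod (a k))^2) + 2 * ennreal ((1 + ksq k) powr s * (cmod (b k))^2)"
   by (subst ennreal_plus) (auto simp: ennreal_mult')
  finally show "ennreal ((1 + ksq k) powr s * (cmod (a k + b k))^2) \<le> \<dots>" .
 qed
 also have "\<dots> = 2 * sE s a + 2 * sE s b"
  unfolding sE_def by (subst nn_integral_add) (auto simp: nn_integral_cmult)
 finally show ?thesis .
qed

lemma sE_point_le: "ennreal ((1 + ksq k) powr s * (cmod (a k))^2) \<le> sE s a"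
 unfolding sE_def by (rule nn_integral_ge_point) auto

lemma cmod_le_sE_0:
 assumes "sE 0 a \<le> ennreal (R^2)" "R \<ge> 0"
 shows "cmod (a k) \<le> R"
proof -
 have "ennreal ((cmod (a k))^2) \<le> ennreal (R^2)"
  using order_trans[OF sE_point_le[of k 0 a] assms(1)] by simp
 then have "(cmod (a k))^2 \<le> R^2" by (subst (asm) ennreal_le_iff) auto
 then show ?thesis using assms(2) by (rule power2_le_imp_le)
qed

lemma sE_ge_0_exp: "s \<ge> 0 \<Longrightarrow> sE 0 a \<le> sE s a"
 by (rule sE_mono_exp)

text \<open>Cauchy-Schwarz after inserting the weight to the powers \<open>- \<beta> / 2\<close> and
  \<open>\<beta> / 2\<close>.\<close>

lemma l1_sq_le:
 fixes a :: "int^'d \<Rightarrow> complex"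
 shows "(l1 a)^2 \<le> bracket_sum TYPE('d) \<beta> * sE \<beta> a"
proof -
 define A where "A k = ennreal ((1 + ksq k) powr (- \<beta> / 2))" for k :: "int^'d"
 define B where "B k = ennreal ((1 + ksq k) powr (\<beta> / 2) * cmod (a k))" for k
 have "A k * B k = ennreal (cmod (a k))" for k
 proof -
  have "(1 + ksq k) powr (- \<beta> / 2) * ((1 + ksq k) powr (\<beta> / 2) * cmod (a k)) = cmod (a k)"
   by (simp add: mult.assoc[symmetric] powr_add[symmetric])
  then show ?thesis by (simp add: A_def B_def flip: ennreal_mult)
 qed
 then have "(l1 a)^2 = (\<integral>\<^sup>+k. A k * B k \<partial>cntM)^2" by (simp add: l1_def)
 also have "\<dots> \<le> (\<integral>\<^sup>+k. (A k)^2 \<partial>cntM) * (\<integral>\<^sup>+k. (B k)^2 \<partial>cntM)"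
  by (rule Cauchy_Schwarz_nn_integral) auto
 also have "(\<integral>\<^sup>+k. (A k)^2 \<partial>cntM) = bracket_sum TYPE('d) \<beta>"
  unfolding bracket_sum_def A_def
  by (intro nn_integral_cong) (auto simp: ennreal_power powr_sq)
 also have "(\<integral>\<^sup>+k. (B k)^2 \<partial>cntM) = sE \<beta> a"
  unfolding sE_def B_def
  by (intro nn_integral_cong) (auto simp: ennreal_power powr_sq power_mult_distrib)
 finally show ?thesis .
qed

lemma l1_finite:
 fixes a :: "int^'d \<Rightarrow> complex"
 assumes "\<beta> > real CARD('d) / 2" "sE \<beta> a < \<infinity>"
 shows "l1 a < \<infinity>"
proof -
 have "(l1 a)^2 < \<infinity>"
  using bracket_sum_finite[OF assms(1)] assms(2)
  by (intro le_less_trans[OF l1_sq_le[of a \<beta>]]) (simp add: ennreal_mult_less_top)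
 then show ?thesis by (cases "l1 a = \<infinity>") (auto simp: less_top)
qed

lemma integrable_l1: "l1 a < \<infinity> \<Longrightarrow> integrable (cntM) a"
 by (rule integrableI_bounded) (auto simp: l1_def)

lemma conv_integrable:
 assumes "l1 f < \<infinity>" "\<And>l. cmod (v l) \<le> B"
 shows "integrable (cntM) (\<lambda>l. f (k - l) * v l)"
proof (rule Bochner_Integration.integrable_bound)
 have "integrable (cntM) (\<lambda>l. f (k - l))"
  by (subst integrable_bij_count_space[OF bij_minus_left]) (rule integrable_l1[OF assms(1)])
 then show "integrable (cntM) (\<lambda>l. B * cmod (f (k - l)))" by simp
 show "AE l in cntM. norm (f (k - l) * v l) \<le> norm (B * cmod (f (k - l)))"
 proof (rule AE_I2)
  fix l
  have "cmod (v l) * cmod (f (k - l)) \<le> B * cmod (f (k - l))" by (intro mult_right_mono assms) auto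
  also have "\<dots> \<le> \<bar>B * cmod (f (k - l))\<bar>" by simp
  finally show "norm (f (k - l) * v l) \<le> norm (B * cmod (f (k - l)))" by (simp add: norm_mult mult.commute)
 qed
qed auto

text \<open>For a function that is not integrable the left side is 0 by convention, so the bound may
  be used before any summability is known.\<close>

lemma cmod_integral_le:
 fixes h :: "'a \<Rightarrow> complex"
 shows "ennreal (cmod (\<integral>x. h x \<partial>M)) \<le> (\<integral>\<^sup>+x. ennreal (cmod (h x)) \<partial>M)"
 by (cases "integrable M h") (auto simp: integral_norm_bound_ennreal not_integrable_integral_eq)

lemma cmod_conv_le_l1:
 assumes "l1 f \<le> ennreal L" "L \<ge> 0" "\<And>l. cmod (v l) \<le> B"
 shows "cmod (conv f v k) \<le> L * B"
proof -
 have B: "B \<ge> 0" using assms(3)[of undefined] norm_ge_zero order_trans by blast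
 have "ennreal (cmod (conv f v k)) \<le> (\<integral>\<^sup>+l. ennreal (cmod (f (k - l) * v l)) \<partial>cntM)"
  unfolding conv_def by (rule cmod_integral_le)
 also have "\<dots> \<le> (\<integral>\<^sup>+l. ennreal (cmod (f (k - l))) * ennreal B \<partial>cntM)"
  by (intro nn_integral_mono) (auto simp: norm_mult intro!: ennreal_leI mult_left_mono assms simp flip: ennreal_mult'' simp: B)
 also have "\<dots> = l1 f * ennreal B"
  unfolding l1_def by (subst nn_integral_multc) (auto simp: nn_integral_count_minus_left[of "\<lambda>l. ennreal (cmod (f l))"])
 also have "\<dots> \<le> ennreal L * ennreal B" by (intro mult_right_mono assms) auto
 also have "\<dots> = ennreal (L * B)" using assms(2) B by (simp add: ennreal_mult)
 finally show ?thesis using B assms(2) by (simp add: ennreal_le_iff)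
qed

lemma ksq_add_le: "ksq (k + l) \<le> 2 * ksq k + 2 * ksq l"
proof -
 have "ksq (k + l) \<le> (\<Sum>i\<in>UNIV. 2 * (real_of_int (k $ i))^2 + 2 * (real_of_int (l $ i))^2)"
  unfolding ksq_def
 proof (rule sum_mono)
  fix i
  have "0 \<le> (real_of_int (k $ i) - real_of_int (l $ i))^2" by simp
  then show "(real_of_int ((k + l) $ i))^2 \<le> 2 * (real_of_int (k $ i))^2 + 2 * (real_of_int (l $ i))^2"
   by (simp add: power2_eq_square algebra_simps)
 qed
 then show ?thesis by (simp add: ksq_def sum.distrib sum_distrib_left)
qed

text \<open>\<open>x\<close> is at most four times the larger of \<open>y\<close> and
  \<open>z\<close>. If that is \<open>z\<close>, then \<open>x powr s\<close> is cancelled by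
  \<open>z powr (- s)\<close>; if it is \<open>y\<close>, the decay left in \<open>y\<close> is
  traded for decay in \<open>z\<close>, because the exponent \<open>s - \<beta>\<close> is not
  positive.\<close>

lemma kernel_bound:
 fixes x y z :: real
 assumes "0 < x" "1 \<le> y" "1 \<le> z" "x \<le> 2 * y + 2 * z" "0 \<le> s" "s \<le> \<beta>"
 shows "x powr s * y powr (- \<beta>) * z powr (- s) \<le> 4 powr \<beta> * (y powr (- \<beta>) + z powr (- \<beta>))"
proof (cases "y \<le> z")
 case True
 have "x powr s \<le> (4 * z) powr s" using assms True by (intro powr_mono2) auto
 also have "\<dots> = 4 powr s * z powr s" using assms by (simp add: powr_mult)
 finally have "x powr s * y powr (- \<beta>) * z powr (- s) \<le> 4 powr s * z powr s * y powr (- \<beta>) * z powr (- s)"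
  by (intro mult_right_mono) auto
 also have "\<dots> = 4 powr s * y powr (- \<beta>) * (z powr s * z powr (- s))" by simp
 also have "z powr s * z powr (- s) = 1" using assms by (simp add: powr_add[symmetric])
 also have "4 powr s * y powr (- \<beta>) * 1 \<le> 4 powr \<beta> * (y powr (- \<beta>) + z powr (- \<beta>))"
  using assms by (auto intro!: mult_mono powr_mono)
 finally show ?thesis .
next
 case False
 have "x powr s \<le> (4 * y) powr s" using assms False by (intro powr_mono2) auto
 also have "\<dots> = 4 powr s * y powr s" using assms by (simp add: powr_mult)
 finally have "x powr s * y powr (- \<beta>) * z powr (- s) \<le> 4 powr s * y powr s * y powr (- \<beta>) * z powr (- s)"
  by (intro mult_right_mono) auto
 also have "\<dots> = 4 powr s * y powr (s - \<beta>) * z powr (- s)" by (simp add: powr_add[symmetric] mult.assoc)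
 also have "\<dots> \<le> 4 powr s * z powr (s - \<beta>) * z powr (- s)"
  using assms False by (intro mult_right_mono mult_left_mono powr_mono2') auto
 also have "\<dots> = 4 powr s * z powr (- \<beta>)" by (simp add: powr_add[symmetric] mult.assoc)
 also have "\<dots> \<le> 4 powr \<beta> * (y powr (- \<beta>) + z powr (- \<beta>))"
  using assms by (auto intro!: mult_mono powr_mono)
 finally show ?thesis .
qed

text \<open>Cauchy-Schwarz in \<open>l\<close>, with weights distributed so that the square of the
  kernel \<open>A\<close> sums to a bound uniform in \<open>k\<close> by
  \<open>kernel_bound\<close>, while the double sum of the square of \<open>B\<close> factors into
  the two norms. It lets the potential act as a bounded operator at all orders up to
  \<open>\<beta>\<close>.\<close>

lemma sE_conv_le:
 fixes f v :: "int^'d \<Rightarrow> complex"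
 assumes s: "0 \<le> s" "s \<le> \<beta>"
 shows "sE s (conv f v) \<le> (2 * ennreal (4 powr \<beta>) * bracket_sum TYPE('d) \<beta>) * sE \<beta> f * sE s v"
proof -
 define S where "S = bracket_sum TYPE('d) \<beta>"
 define w where "w k = 1 + ksq k" for k :: "int^'d"
 have w1: "w k \<ge> 1" and w0: "w k > 0" "w k \<noteq> 0" for k
  using ksq_pos[of k] by (auto simp: w_def simp del: ksq_pos)
 \<comment> \<open>The weights at \<open>k - l\<close> and at \<open>l\<close> enter inversely here
   and are restored in \<open>B\<close>, so that \<open>A k l * B k l\<close> is the weighted
   summand itself.\<close>
 define A where "A k l = ennreal (w k powr (s/2) * w (k - l) powr (- \<beta>/2) * w l powr (- s/2))" for k l
 define B where "B k l = ennreal (w (k - l) powr (\<beta>/2) * cmod (f (k - l)) * (w l powr (s/2) * cmod (v l)))" for k l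
 have AB: "A k l * B k l = ennreal (w k powr (s/2) * cmod (f (k - l) * v l))" for k l
 proof -
  have "w k powr (s/2) * w (k - l) powr (- \<beta>/2) * w l powr (- s/2) * (w (k - l) powr (\<beta>/2) * cmod (f (k - l)) * (w l powr (s/2) * cmod (v l)))
   = w k powr (s/2) * (w (k - l) powr (- \<beta>/2) * w (k - l) powr (\<beta>/2)) * (w l powr (- s/2) * w l powr (s/2)) * (cmod (f (k - l)) * cmod (v l))"
   by (simp only: ac_simps)
  also have "\<dots> = w k powr (s/2) * cmod (f (k - l) * v l)"
   by (simp add: powr_add[symmetric] norm_mult w0)
  finally show ?thesis by (simp add: A_def B_def flip: ennreal_mult)
 qed
 have A2: "(\<integral>\<^sup>+l. (A k l)^2 \<partial>cntM) \<le> 2 * ennreal (4 powr \<beta>) * S" for k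
 proof -
  have "(\<integral>\<^sup>+l. (A k l)^2 \<partial>cntM)
    \<le> (\<integral>\<^sup>+l. ennreal (4 powr \<beta>) * (ennreal (w (k - l) powr (- \<beta>)) + ennreal (w l powr (- \<beta>))) \<partial>cntM)"
  proof (rule nn_integral_mono)
   fix l
   have "(A k l)^2 = ennreal (w k powr s * w (k - l) powr (- \<beta>) * w l powr (- s))"
    by (simp add: A_def ennreal_power power_mult_distrib powr_sq)
   also have "\<dots> \<le> ennreal (4 powr \<beta> * (w (k - l) powr (- \<beta>) + w l powr (- \<beta>)))"
    using ksq_add_le[of "k - l" l] s w0 w1 by (intro ennreal_leI kernel_bound) (auto simp: w_def)
   finally show "(A k l)^2 \<le> ennreal (4 powr \<beta>) * (ennreal (w (k - l) powr (- \<beta>)) + ennreal (w l powr (- \<beta>)))"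
    by (simp add: ennreal_mult)
  qed
  also have "\<dots> = ennreal (4 powr \<beta>) * ((\<integral>\<^sup>+l. ennreal (w (k - l) powr (- \<beta>)) \<partial>cntM) + (\<integral>\<^sup>+l. ennreal (w l powr (- \<beta>)) \<partial>cntM))"
   by (simp add: nn_integral_cmult nn_integral_add)
  also have "(\<integral>\<^sup>+l. ennreal (w (k - l) powr (- \<beta>)) \<partial>cntM) = S"
   unfolding nn_integral_count_minus_left[of "\<lambda>l. ennreal (w l powr (- \<beta>))"] by (simp add: S_def bracket_sum_def w_def)
  also have "(\<integral>\<^sup>+l. ennreal (w l powr (- \<beta>)) \<partial>cntM) = S"
   by (simp add: S_def bracket_sum_def w_def)
  finally show ?thesis by (simp add: mult_2[symmetric] ac_simps)
 qed
 have "sE s (conv f v) \<le> (\<integral>\<^sup>+k. (2 * ennreal (4 powr \<beta>) * S) * (\<integral>\<^sup>+l. (B k l)^2 \<partial>cntM) \<partial>cntM)"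
  unfolding sE_def
 proof (rule nn_integral_mono)
  fix k
  have "ennreal (w k powr (s/2) * cmod (conv f v k)) = ennreal (w k powr (s/2)) * ennreal (cmod (conv f v k))"
   by (simp add: ennreal_mult)
  also have "\<dots> \<le> ennreal (w k powr (s/2)) * (\<integral>\<^sup>+l. ennreal (cmod (f (k - l) * v l)) \<partial>cntM)"
   unfolding conv_def by (intro mult_left_mono cmod_integral_le) auto
  also have "\<dots> = (\<integral>\<^sup>+l. A k l * B k l \<partial>cntM)"
   by (simp add: AB ennreal_mult nn_integral_cmult)
  finally have *: "ennreal (w k powr (s/2) * cmod (conv f v k)) \<le> (\<integral>\<^sup>+l. A k l * B k l \<partial>cntM)" .
  have "ennreal ((1 + ksq k) powr s * (cmod (conv f v k))^2) = (ennreal (w k powr (s/2) * cmod (conv f v k)))^2"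
   by (simp add: ennreal_power power_mult_distrib powr_sq w_def)
  also have "\<dots> \<le> (\<integral>\<^sup>+l. A k l * B k l \<partial>cntM)^2"
   by (intro power_mono *) auto
  also have "\<dots> \<le> (\<integral>\<^sup>+l. (A k l)^2 \<partial>cntM) * (\<integral>\<^sup>+l. (B k l)^2 \<partial>cntM)"
   by (rule Cauchy_Schwarz_nn_integral) auto
  also have "\<dots> \<le> (2 * ennreal (4 powr \<beta>) * S) * (\<integral>\<^sup>+l. (B k l)^2 \<partial>cntM)"
   by (intro mult_right_mono A2) auto
  finally show "ennreal ((1 + ksq k) powr s * (cmod (conv f v k))^2) \<le> (2 * ennreal (4 powr \<beta>) * S) * (\<integral>\<^sup>+l. (B k l)^2 \<partial>cntM)" .
 qed
 also have "\<dots> = (2 * ennreal (4 powr \<beta>) * S) * (\<integral>\<^sup>+k. \<integral>\<^sup>+l. (B k l)^2 \<partial>cntM \<partial>cntM)"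
  by (rule nn_integral_cmult) auto
 also have "(\<integral>\<^sup>+k. \<integral>\<^sup>+l. (B k l)^2 \<partial>cntM \<partial>cntM)
   = (\<integral>\<^sup>+l. \<integral>\<^sup>+k. (B k l)^2 \<partial>cntM \<partial>cntM)"
  by (rule nn_integral_count_swap)
 also have "\<dots> = (\<integral>\<^sup>+l. sE \<beta> f * ennreal (w l powr s * (cmod (v l))^2) \<partial>cntM)"
 proof (rule nn_integral_cong)
  fix l
  have "(\<integral>\<^sup>+k. (B k l)^2 \<partial>cntM)
   = (\<integral>\<^sup>+k. ennreal (w (k - l) powr \<beta> * (cmod (f (k - l)))^2) * ennreal (w l powr s * (cmod (v l))^2) \<partial>cntM)"
   by (intro nn_integral_cong)
    (auto simp: B_def ennreal_power power_mult_distrib powr_sq simp flip: ennreal_mult)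
  also have "\<dots> = (\<integral>\<^sup>+k. ennreal (w (k - l) powr \<beta> * (cmod (f (k - l)))^2) \<partial>cntM) * ennreal (w l powr s * (cmod (v l))^2)"
   by (rule nn_integral_multc) auto
  also have "(\<integral>\<^sup>+k. ennreal (w (k - l) powr \<beta> * (cmod (f (k - l)))^2) \<partial>cntM) = sE \<beta> f"
   unfolding nn_integral_count_minus_right[of "\<lambda>k. ennreal (w k powr \<beta> * (cmod (f k))^2)"]
   by (simp add: sE_def w_def)
  finally show "(\<integral>\<^sup>+k. (B k l)^2 \<partial>cntM) = sE \<beta> f * ennreal (w l powr s * (cmod (v l))^2)" .
 qed
 also have "\<dots> = sE \<beta> f * sE s v"
  by (subst nn_integral_cmult) (auto simp: sE_def w_def)
 finally show ?thesis by (simp add: S_def ac_simps)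
qed

subsection \<open>Test functions in time\<close>

text \<open>The functions \<open>bump e n\<close> are closed under differentiation up to linear combinations, which gives
 smoothness by induction.\<close>

definition bump :: "real \<Rightarrow> nat \<Rightarrow> real \<Rightarrow> real" where
 "bump e n x = (if x > 0 then (1 / x) ^ n * exp (- e / x) else 0)"

text \<open>A quadratic bound forces the difference quotient at 0 to vanish, and 0 is the only point
  where differentiability of \<open>bump\<close> does not follow from calculus on a
  half-line.\<close>

lemma bump_bound:
 assumes "e > 0"
 obtains C where "\<And>x. \<bar>bump e n x\<bar> \<le> C * x^2"
proof -
 \<comment> \<open>Two powers beyond \<open>n\<close>: the bound
   \<open>exp (e / x) \<ge> (e / (m * x))^m\<close> leaves the factor \<open>x^2\<close> after
   cancelling \<open>(1 / x)^n\<close>.\<close>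
 define m where "m = n + 2"
 have m: "m > 0" by (simp add: m_def)
 define C where "C = (real m / e) ^ m"
 have "\<bar>bump e n x\<bar> \<le> C * x^2" for x
 proof (cases "x > 0")
  case True
  have "(1 + (e / x) / real m) ^ m \<le> exp (e / x)"
   using True assms m by (intro exp_ge_one_plus_x_over_n_power_n) (auto intro: order_trans[of _ 0])
  moreover have "((e / x) / real m) ^ m \<le> (1 + (e / x) / real m) ^ m"
   using True assms by (intro power_mono) auto
  ultimately have "((e / x) / real m) ^ m \<le> exp (e / x)" by linarith
  then have "exp (- e / x) \<le> 1 / ((e / x) / real m) ^ m"
   using True assms m by (simp add: exp_minus field_simps)
  also have "\<dots> = C * x ^ m"
   by (simp add: C_def power_divide power_mult_distrib)
  finally have "(1 / x) ^ n * exp (- e / x) \<le> (1 / x) ^ n * (C * x ^ m)"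
   using True by (intro mult_left_mono) auto
  also have "\<dots> = C * x^2"
   using True by (simp add: m_def power_add power_divide power2_eq_square)
  finally show ?thesis using True by (simp add: bump_def)
 qed (use assms in \<open>simp add: bump_def C_def\<close>)
 then show ?thesis using that by blast
qed

lemma bump_has_derivative:
 assumes "e > 0"
 shows "(bump e n has_real_derivative (- real n * bump e (n + 1) x + e * bump e (n + 2) x)) (at x)"
proof -
 consider "x > 0" | "x < 0" | "x = 0" by linarith
 then show ?thesis
 proof cases
  case 1
  have "((\<lambda>x. (1 / x) ^ n * exp (- e / x)) has_real_derivative
    (- real n * bump e (n + 1) x + e * bump e (n + 2) x)) (at x)"
  proof -
   have "((\<lambda>x. (1 / x) ^ n * exp (- e / x)) has_real_derivative
    (real n * (1 / x) ^ (n - 1) * (- 1 / x^2) * exp (- e / x) + (1 / x) ^ n * (exp (- e / x) * (e / x^2)))) (at x)"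
    using 1 by (auto intro!: derivative_eq_intros simp: power2_eq_square)
   moreover have "real n * (1 / x) ^ (n - 1) * (- 1 / x^2) * exp (- e / x) + (1 / x) ^ n * (exp (- e / x) * (e / x^2))
     = - real n * bump e (n + 1) x + e * bump e (n + 2) x"
    using 1 by (cases n) (simp_all add: bump_def power2_eq_square field_simps)
   ultimately show ?thesis by simp
  qed
  then show ?thesis
  proof (rule has_field_derivative_transform_within_open[where S = "{0<..}"])
  qed (use 1 in \<open>auto simp: bump_def\<close>)
 next
  case 2
  have "((\<lambda>x. 0) has_real_derivative (- real n * bump e (n + 1) x + e * bump e (n + 2) x)) (at x)"
   using 2 by (simp add: bump_def)
  then show ?thesis
  proof (rule has_field_derivative_transform_within_open[where S = "{..<0}"])
  qed (use 2 in \<open>auto simp: bump_def\<close>)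
 next
  case 3
  obtain C where C: "\<And>x. \<bar>bump e n x\<bar> \<le> C * x^2" using bump_bound[OF assms] by blast
  have "((\<lambda>h. bump e n h / h) \<longlongrightarrow> 0) (at 0)"
  proof (rule Lim_null_comparison)
   show "((\<lambda>h. C * \<bar>h\<bar>) \<longlongrightarrow> 0) (at (0::real))"
    by (auto intro!: tendsto_eq_intros)
   show "\<forall>\<^sub>F h in at 0. norm (bump e n h / h) \<le> C * \<bar>h\<bar>"
    unfolding eventually_at_filter
   proof (intro always_eventually allI impI)
    fix h :: real assume "h \<noteq> 0"
    then show "norm (bump e n h / h) \<le> C * \<bar>h\<bar>"
     using C[of h] by (simp add: abs_divide divide_le_eq power2_eq_square mult.assoc)
   qed
  qed
  then show ?thesis using 3 by (simp add: DERIV_def bump_def)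
 qed
qed

text \<open>A class closed under differentiation by construction. The rule \<open>base\<close>
  admits functions already known to be smooth, so that test functions can be combined with explicit
  ones.\<close>

inductive sm :: "(real \<Rightarrow> real) \<Rightarrow> bool" where
 base: "smooth_real f \<Longrightarrow> sm f"
| const: "sm (\<lambda>x. c)"
| bump: "e > 0 \<Longrightarrow> sm (\<lambda>x. bump e n (\<sigma> * x + a))"
| add: "sm f \<Longrightarrow> sm g \<Longrightarrow> sm (\<lambda>x. f x + g x)"
| mult: "sm f \<Longrightarrow> sm g \<Longrightarrow> sm (\<lambda>x. f x * g x)"
| expo: "sm (\<lambda>x. exp (c * x))"

lemma smooth_real_iff: "smooth_real f \<longleftrightarrow> (\<forall>x. f differentiable (at x)) \<and> smooth_real (deriv f)"
proof -
 have "(\<forall>n x. (deriv ^^ n) f differentiable at x)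
   \<longleftrightarrow> (\<forall>x. f differentiable at x) \<and> (\<forall>n x. (deriv ^^ Suc n) f differentiable at x)"
  by (metis funpow_0 not0_implies_Suc)
 then show ?thesis
  unfolding smooth_real_def by (simp only: funpow_Suc_right o_def)
qed

lemma has_derivD: "(\<And>x. (f has_real_derivative f' x) (at x)) \<Longrightarrow> deriv f = f'"
 by (auto simp: fun_eq_iff intro: DERIV_imp_deriv)

lemma smooth_real_has_derivative:
 "smooth_real f \<Longrightarrow> (f has_real_derivative deriv f x) (at x)"
 by (metis DERIV_deriv_iff_real_differentiable smooth_real_iff)

lemma sm_has_derivative: "sm f \<Longrightarrow> \<exists>f'. sm f' \<and> (\<forall>x. (f has_real_derivative f' x) (at x))"
proof (induction rule: sm.induct)
 case (base f)
 then show ?case using smooth_real_iff smooth_real_has_derivative sm.base by blast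
next
 case (const c)
 show ?case by (rule exI[of _ "\<lambda>x. 0"]) (auto intro: sm.const)
next
 case (bump e n \<sigma> a)
 have "((\<lambda>x. bump e n (\<sigma> * x + a)) has_real_derivative
   (- real n * bump e (n + 1) (\<sigma> * x + a) + e * bump e (n + 2) (\<sigma> * x + a)) * \<sigma>) (at x)" for x
  by (rule DERIV_chain2[OF bump_has_derivative[OF bump]]) (auto intro!: derivative_eq_intros)
 moreover have "sm (\<lambda>x. (- real n * bump e (n + 1) (\<sigma> * x + a) + e * bump e (n + 2) (\<sigma> * x + a)) * \<sigma>)"
  using bump by (intro sm.intros)
 ultimately show ?case by blast
next
 case (add f g)
 then obtain f' g' where "sm f'" "sm g'" "\<And>x. (f has_real_derivative f' x) (at x)" "\<And>x. (g has_real_derivative g' x) (at x)"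
  by blast
 then show ?case by (intro exI[of _ "\<lambda>x. f' x + g' x"]) (auto intro: sm.add DERIV_add)
next
 case (mult f g)
 then obtain f' g' where *: "sm f'" "sm g'" "\<And>x. (f has_real_derivative f' x) (at x)" "\<And>x. (g has_real_derivative g' x) (at x)"
  by blast
 then show ?case using mult.hyps
  by (intro exI[of _ "\<lambda>x. f' x * g x + g' x * f x"]) (auto intro: sm.add sm.mult DERIV_mult)
next
 case (expo c)
 have "((\<lambda>x. exp (c * x)) has_real_derivative exp (c * x) * c) (at x)" for x
  by (auto intro!: derivative_eq_intros)
 then show ?case by (intro exI[of _ "\<lambda>x. exp (c * x) * c"]) (auto intro: sm.expo sm.mult sm.const)
qed

lemma sm_imp_smooth_real: "sm f \<Longrightarrow> smooth_real f"
proof -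
 assume "sm f"
 have "sm ((deriv ^^ n) f)" for n
 proof (induction n)
  case (Suc n)
  then obtain f' where "sm f'" "\<And>x. ((deriv ^^ n) f has_real_derivative f' x) (at x)"
   using sm_has_derivative by blast
  then show ?case using has_derivD by fastforce
 qed (use \<open>sm f\<close> in simp)
 then show ?thesis
  unfolding smooth_real_def using sm_has_derivative real_differentiable_def by metis
qed

lemma test_fun_has_derivative: "test_fun T \<eta> \<Longrightarrow> (\<eta> has_real_derivative deriv \<eta> t) (at t)"
 by (simp add: test_fun_def smooth_real_has_derivative)

lemma test_fun_continuous: "test_fun T \<eta> \<Longrightarrow> continuous_on S \<eta>"
 by (meson DERIV_continuous_on has_field_derivative_at_within test_fun_has_derivative)

lemma test_fun_measurable: "test_fun T \<eta> \<Longrightarrow> \<eta> \<in> bmeas"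
 by (intro borel_measurable_continuous_onI test_fun_continuous)

lemma test_fun_eq_0: "test_fun T \<eta> \<Longrightarrow> t \<le> 0 \<or> T \<le> t \<Longrightarrow> \<eta> t = 0"
 by (force simp: test_fun_def)

lemma test_fun_deriv:
 assumes "test_fun T \<eta>"
 shows "test_fun T (deriv \<eta>)"
proof -
 obtain a b where ab: "0 < a" "a \<le> b" "b < T" "\<And>t. t \<notin> {a..b} \<Longrightarrow> \<eta> t = 0"
  using assms by (auto simp: test_fun_def)
 have "deriv \<eta> t = 0" if "t \<notin> {a..b}" for t
 proof -
  have "((\<lambda>_. 0) has_real_derivative 0) (at t)" by simp
  then have "(\<eta> has_real_derivative 0) (at t)"
   by (rule has_field_derivative_transform_within_open[where S = "- {a..b}"]) (use that ab in auto)
  then show ?thesis by (rule DERIV_imp_deriv)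
 qed
 then show ?thesis using assms ab smooth_real_iff[of \<eta>] unfolding test_fun_def by blast
qed

lemma test_fun_deriv_pow: "test_fun T \<eta> \<Longrightarrow> test_fun T ((deriv ^^ j) \<eta>)"
 by (induction j) (auto intro: test_fun_deriv)

lemma test_fun_bounded:
 assumes "test_fun T \<eta>"
 obtains B where "B \<ge> 0" "\<And>t. \<bar>\<eta> t\<bar> \<le> B"
proof -
 have "compact (\<eta> ` {0..T})"
  by (intro compact_continuous_image test_fun_continuous[OF assms]) auto
 then obtain B where "\<And>t. t \<in> {0..T} \<Longrightarrow> \<bar>\<eta> t\<bar> \<le> B"
  using compact_imp_bounded by (force simp: bounded_iff)
 then have "\<bar>\<eta> t\<bar> \<le> max B 0" for t
  using test_fun_eq_0[OF assms, of t] by (cases "t \<in> {0..T}") (auto simp: le_max_iff_disj)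
 then show ?thesis using that[of "max B 0"] by auto
qed

text \<open>Needed for integrating factors: the exponential is moved from the coefficient onto the
  test function.\<close>

lemma test_fun_mult_exp:
 assumes "test_fun T \<eta>"
 shows "test_fun T (\<lambda>t. exp (c * t) * \<eta> t)"
proof -
 have "smooth_real (\<lambda>t. exp (c * t) * \<eta> t)"
  using assms by (intro sm_imp_smooth_real[OF sm.mult[OF sm.expo sm.base]]) (simp add: test_fun_def)
 moreover obtain a b where "0 < a" "a \<le> b" "b < T" "\<And>t. t \<notin> {a..b} \<Longrightarrow> \<eta> t = 0"
  using assms by (auto simp: test_fun_def)
 ultimately show ?thesis unfolding test_fun_def by (intro conjI exI[of _ a] exI[of _ b]) auto
qed

text \<open>A smooth bump on the interval from \<open>a\<close> to \<open>b\<close>, positive inside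
  and 0 outside. As \<open>e\<close> tends to 0 it flattens to the indicator of the open
  interval.\<close>

definition bp :: "real \<Rightarrow> real \<Rightarrow> real \<Rightarrow> real \<Rightarrow> real" where
 "bp e a b t = bump e 0 (t - a) * bump e 0 (b - t)"

lemma sm_bp: "e > 0 \<Longrightarrow> sm (bp e a b)"
proof -
 assume "e > 0"
 then have "sm (\<lambda>t. bump e 0 (1 * t + (- a)) * bump e 0 ((-1) * t + b))"
  by (intro sm.mult sm.bump)
 then show ?thesis by (simp add: bp_def[abs_def] algebra_simps)
qed

lemma bp_eq_0: "t \<notin> {a..b} \<Longrightarrow> bp e a b t = 0"
 by (auto simp: bp_def bump_def)

lemma bp_01: "e > 0 \<Longrightarrow> 0 \<le> bp e a b t \<and> bp e a b t \<le> 1"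
 by (auto simp: bp_def bump_def intro!: mult_le_one)

lemma bp_pos: "a < t \<Longrightarrow> t < b \<Longrightarrow> 0 < bp e a b t"
 by (auto simp: bp_def bump_def)

lemma test_fun_bp: "e > 0 \<Longrightarrow> 0 < a \<Longrightarrow> a \<le> b \<Longrightarrow> b < T \<Longrightarrow> test_fun T (bp e a b)"
 unfolding test_fun_def using sm_imp_smooth_real[OF sm_bp] bp_eq_0 by blast

section \<open>Test functions detect null functions\<close>

lemma AE_timeM_Ioo: "AE t in timeM T. 0 < t \<and> t < T"
 by (simp add: AE_timeM)

lemma integrable_timeM_bounded:
 fixes g :: "real \<Rightarrow> 'b::{real_normed_field, banach, second_countable_topology}"
 assumes g: "integrable (timeM T) g" and p [measurable]: "p \<in> bmeas"
  and B: "\<And>t. norm (p t) \<le> B"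
 shows "integrable (timeM T) (\<lambda>t. g t * p t)"
proof (rule Bochner_Integration.integrable_bound)
 have [measurable]: "g \<in> bmeas"
  using borel_measurable_integrable[OF g] by simp
 show "integrable (timeM T) (\<lambda>t. B * norm (g t))" using g by simp
 show "(\<lambda>t. g t * p t) \<in> borel_measurable (timeM T)" by simp
 show "AE t in timeM T. norm (g t * p t) \<le> norm (B * norm (g t))"
 proof (rule AE_I2)
  fix t
  have "norm (p t) * norm (g t) \<le> B * norm (g t)" by (intro mult_right_mono B) auto
  then show "norm (g t * p t) \<le> norm (B * norm (g t))" by (simp add: norm_mult mult.commute order_trans[OF _ abs_ge_self])
 qed
qed

lemma integrable_timeM_test:
 fixes g :: "real \<Rightarrow> complex"
 assumes g: "integrable (timeM T) g" and "test_fun T \<eta>"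
 shows "integrable (timeM T) (\<lambda>t. g t * of_real (\<eta> t))"
proof -
 obtain B where "\<And>t. \<bar>\<eta> t\<bar> \<le> B" using test_fun_bounded[OF assms(2)] by blast
 moreover note [measurable] = test_fun_measurable[OF assms(2)]
 ultimately show ?thesis by (intro integrable_timeM_bounded[OF g]) auto
qed

text \<open>The positive and negative parts of \<open>g\<close> define finite measures that agree on
  open intervals, an intersection-stable generator of the Borel sets. So the two parts agree almost
  everywhere, which is possible only where \<open>g\<close> vanishes.\<close>

lemma AE_eq_0_of_intervals_real:
 fixes g :: "real \<Rightarrow> real"
 assumes g: "integrable M g" and M: "sets M = sets borel"
  and I: "\<And>a b. (\<integral>t. g t * indicator {a<..<b} t \<partial>M) = 0"
 shows "AE t in M. g t = 0"
proof -
 have [measurable]: "g \<in> borel_measurable M" using g by auto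
 note [measurable_cong] = M
 define P where "P = density M (\<lambda>t. ennreal (g t))"
 define N where "N = density M (\<lambda>t. ennreal (- g t))"
 have fin: "(\<integral>\<^sup>+t. ennreal (g t) \<partial>M) \<noteq> \<infinity>" "(\<integral>\<^sup>+t. ennreal (- g t) \<partial>M) \<noteq> \<infinity>"
  using g by (auto simp: real_integrable_def)
 have "P = N"
 proof (rule measure_eqI_generator_eq[where E = "range (\<lambda>(a, b). {a<..<b::real})" and \<Omega> = UNIV
    and A = "\<lambda>n. {- real n<..<real n}"])
  show "Int_stable (range (\<lambda>(a, b). {a<..<b::real}))"
  proof (rule Int_stableI_image)
   fix x y :: "real \<times> real"
   show "\<exists>z\<in>UNIV. (case x of (a, b) \<Rightarrow> {a<..<b}) \<inter> (case y of (a, b) \<Rightarrow> {a<..<b}) = (case z of (a, b) \<Rightarrow> {a<..<b})"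
    by (rule bexI[of _ "(max (fst x) (fst y), min (snd x) (snd y))"]) (auto simp: split_beta)
  qed
  show "sets P = sigma_sets UNIV (range (\<lambda>(a, b). {a<..<b::real}))"
   unfolding P_def sets_density M by (subst borel_eq_box) (simp add: split_beta')
  show "sets N = sigma_sets UNIV (range (\<lambda>(a, b). {a<..<b::real}))"
   unfolding N_def sets_density M by (subst borel_eq_box) (simp add: split_beta')
  show "(\<Union>n. {- real n<..<real n}) = UNIV"
  proof safe
   fix x :: real
   obtain n where "\<bar>x\<bar> < real n" using reals_Archimedean2 by blast
   then show "x \<in> (\<Union>n. {- real n<..<real n})" by (auto intro!: exI[of _ n])
  qed simp
  show "emeasure P {- real n<..<real n} \<noteq> \<infinity>" for n
  proof -
   have "emeasure P {- real n<..<real n} \<le> emeasure P UNIV" by (rule emeasure_mono) (auto simp: P_def M)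
   also have "\<dots> = (\<integral>\<^sup>+t. ennreal (g t) \<partial>M)"
    using sets_eq_imp_space_eq[OF M] by (auto simp: P_def emeasure_density M intro!: nn_integral_cong)
   finally show ?thesis using fin(1) by (auto simp: top_unique)
  qed
  fix X assume "X \<in> range (\<lambda>(a, b). {a<..<b::real})"
  then obtain a b where X: "X = {a<..<b}" by auto
  have X' [measurable]: "X \<in> sets M" by (simp add: X M)
  have int: "integrable M (\<lambda>t. g t * indicator X t)"
   using integrable_mult_indicator[OF X' g] by (simp add: mult.commute)
  have "emeasure P X = (\<integral>\<^sup>+t. ennreal (g t * indicator X t) \<partial>M)"
   unfolding P_def by (subst emeasure_density) (auto intro!: nn_integral_cong split: split_indicator)
  moreover have "emeasure N X = (\<integral>\<^sup>+t. ennreal (- (g t * indicator X t)) \<partial>M)"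
   unfolding N_def by (subst emeasure_density) (auto intro!: nn_integral_cong split: split_indicator)
  moreover have "enn2real (\<integral>\<^sup>+t. ennreal (g t * indicator X t) \<partial>M) = enn2real (\<integral>\<^sup>+t. ennreal (- (g t * indicator X t)) \<partial>M)"
   using real_lebesgue_integral_def[OF int] I[of a b] by (simp add: X)
  moreover have "(\<integral>\<^sup>+t. ennreal (g t * indicator X t) \<partial>M) < top" "(\<integral>\<^sup>+t. ennreal (- (g t * indicator X t)) \<partial>M) < top"
   using int by (auto simp: real_integrable_def top.not_eq_extremum)
  ultimately show "emeasure P X = emeasure N X" by (metis ennreal_enn2real)
 qed auto
 then have "AE t in M. ennreal (g t) = ennreal (- g t)"
  unfolding P_def N_def using fin by (subst (asm) finite_density_unique) auto
 then show ?thesis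
 proof eventually_elim
  case (elim t)
  then show ?case by (cases "g t \<ge> 0") (auto simp: ennreal_neg ennreal_eq_0_iff)
 qed
qed

text \<open>One small parameter does both jobs: it moves the support inside the open interval and
  sends both exponentials to 1 at every fixed interior point.\<close>

lemma bp_tendsto:
 assumes "a < b"
 shows "(\<lambda>n. bp (1 / real (Suc n)) (a + 1 / real (Suc n)) (b - 1 / real (Suc n)) t) \<longlonglongrightarrow> indicator {a<..<b} t"
proof (cases "t \<in> {a<..<b}")
 case True
 define e where "e n = 1 / real (Suc n)" for n
 have e0: "e \<longlonglongrightarrow> 0" unfolding e_def by (rule LIMSEQ_Suc[OF lim_1_over_n])
 have "(\<lambda>n. exp (- e n / (t - (a + e n))) * exp (- e n / ((b - e n) - t))) \<longlonglongrightarrow> exp (- 0 / (t - (a + 0))) * exp (- 0 / ((b - 0) - t))"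
  using True by (intro tendsto_intros e0) auto
 moreover have "\<forall>\<^sub>F n in sequentially. exp (- e n / (t - (a + e n))) * exp (- e n / ((b - e n) - t)) = bp (e n) (a + e n) (b - e n) t"
 proof -
  have "\<forall>\<^sub>F n in sequentially. e n < t - a" "\<forall>\<^sub>F n in sequentially. e n < b - t"
   using True by (auto intro!: order_tendstoD(2)[OF e0])
  then show ?thesis by eventually_elim (simp add: bp_def bump_def)
 qed
 ultimately show ?thesis using True
  by (auto simp: e_def elim: Lim_transform_eventually)
next
 case False
 have "bp (1 / real (Suc n)) (a + 1 / real (Suc n)) (b - 1 / real (Suc n)) t = 0" for n
  using False by (auto simp: bp_def bump_def not_less intro: order_trans[rotated] simp del: of_nat_Suc)
   (smt (verit) divide_pos_pos of_nat_0_less_iff zero_less_Suc)+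
 then show ?thesis using False by simp
qed

lemma AE_eq_0_of_test_real:
 fixes g :: "real \<Rightarrow> real"
 assumes g: "integrable (timeM T) g"
  and I: "\<And>e a b. e > 0 \<Longrightarrow> 0 < a \<Longrightarrow> a < b \<Longrightarrow> b < T \<Longrightarrow> (\<integral>t. g t * bp e a b t \<partial>timeM T) = 0"
 shows "AE t in timeM T. g t = 0"
proof (rule AE_eq_0_of_intervals_real[OF g])
 fix a b :: real
 have gm [measurable]: "g \<in> bmeas"
  using borel_measurable_integrable[OF g] by simp
 \<comment> \<open>Only the part of the interval inside \<open>(0, T)\<close> is seen by
   \<open>timeM T\<close>, and test functions must be supported there.\<close>
 define a' b' where "a' = max a 0" and "b' = min b T"
 have "(\<integral>t. g t * indicator {a<..<b} t \<partial>timeM T) = (\<integral>t. g t * indicator {a'<..<b'} t \<partial>timeM T)"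
 proof (rule integral_cong_AE)
  show "AE t in timeM T. g t * indicator {a<..<b} t = g t * indicator {a'<..<b'} t"
   using AE_timeM_Ioo[of T] by eventually_elim (auto simp: a'_def b'_def indicator_def)
 qed auto
 also have "\<dots> = 0"
 proof (cases "a' < b'")
  case True
  define e where "e n = 1 / real (Suc n)" for n
  have "(\<lambda>n. \<integral>t. g t * bp (e n) (a' + e n) (b' - e n) t \<partial>timeM T) \<longlonglongrightarrow> (\<integral>t. g t * indicator {a'<..<b'} t \<partial>timeM T)"
  proof (rule integral_dominated_convergence[where w = "\<lambda>t. \<bar>g t\<bar>"])
   have [measurable]: "bp (e n) a b \<in> bmeas" for n a b
   proof (rule borel_measurable_continuous_onI)
    have "sm (bp (e n) a b)" by (rule sm_bp) (simp add: e_def)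
    then show "continuous_on UNIV (bp (e n) a b)"
     using sm_has_derivative by (meson DERIV_continuous_on has_field_derivative_at_within)
   qed
   show "(\<lambda>t. g t * bp (e n) (a' + e n) (b' - e n) t) \<in> borel_measurable (timeM T)" for n by simp
   show "AE t in timeM T. (\<lambda>n. g t * bp (e n) (a' + e n) (b' - e n) t) \<longlonglongrightarrow> g t * indicator {a'<..<b'} t"
    unfolding e_def by (intro AE_I2 tendsto_mult tendsto_const bp_tendsto True)
   show "AE t in timeM T. norm (g t * bp (e n) (a' + e n) (b' - e n) t) \<le> \<bar>g t\<bar>" for n
   proof (rule AE_I2)
    fix t
    have "0 \<le> bp (e n) (a' + e n) (b' - e n) t" "bp (e n) (a' + e n) (b' - e n) t \<le> 1"
     using bp_01[of "e n"] by (auto simp: e_def)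
    then show "norm (g t * bp (e n) (a' + e n) (b' - e n) t) \<le> \<bar>g t\<bar>"
     by (simp add: abs_mult mult_left_le)
   qed
  qed (use g in auto)
  moreover have "(\<integral>t. g t * bp (e n) (a' + e n) (b' - e n) t \<partial>timeM T) = 0" for n
  \<comment> \<open>For small \<open>n\<close> the shrunken interval may be empty; the bump is then
    identically 0.\<close>
  proof (cases "a' + e n < b' - e n")
   case True
   moreover have "e n > 0" "a' \<ge> 0" "b' \<le> T" by (auto simp: e_def a'_def b'_def)
   ultimately show ?thesis by (intro I) linarith+
  next
   case False
   have "bp (e n) (a' + e n) (b' - e n) t = 0" for t using False by (auto simp: bp_def bump_def)
   then show ?thesis by simp
  qed
  ultimately show ?thesis by (simp add: LIMSEQ_const_iff)
 qed simp
 finally show "(\<integral>t. g t * indicator {a<..<b} t \<partial>timeM T) = 0" .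
qed simp

lemma AE_eq_0_of_test:
 fixes g :: "real \<Rightarrow> complex"
 assumes g: "integrable (timeM T) g"
  and I: "\<And>e a b. e > 0 \<Longrightarrow> 0 < a \<Longrightarrow> a < b \<Longrightarrow> b < T \<Longrightarrow> (\<integral>t. g t * of_real (bp e a b t) \<partial>timeM T) = 0"
 shows "AE t in timeM T. g t = 0"
proof -
 have int: "integrable (timeM T) (\<lambda>t. g t * of_real (bp e a b t))" if "e > 0" "0 < a" "a < b" "b < T" for e a b
  using that by (intro integrable_timeM_test[OF g] test_fun_bp) auto
 have "AE t in timeM T. Re (g t) = 0"
 proof (rule AE_eq_0_of_test_real)
  show "(\<integral>t. Re (g t) * bp e a b t \<partial>timeM T) = 0" if "e > 0" "0 < a" "a < b" "b < T" for e a b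
   using I[OF that] integral_Re[OF int[OF that]] by simp
 qed (use g in simp)
 moreover have "AE t in timeM T. Im (g t) = 0"
 proof (rule AE_eq_0_of_test_real)
  show "(\<integral>t. Im (g t) * bp e a b t \<partial>timeM T) = 0" if "e > 0" "0 < a" "a < b" "b < T" for e a b
   using I[OF that] integral_Im[OF int[OF that]] by simp
 qed (use g in simp)
 ultimately show ?thesis by eventually_elim (simp add: complex_eq_iff)
qed

subsection \<open>Weak derivatives in time\<close>

text \<open>Weak differentiability of a single Fourier mode, the scalar notion to which
  \<open>weak_dt\<close> is reduced coefficient by coefficient.\<close>

definition wder :: "real \<Rightarrow> (real \<Rightarrow> complex) \<Rightarrow> (real \<Rightarrow> complex) \<Rightarrow> bool" where
 "wder T g h \<longleftrightarrow> (\<forall>\<eta>. test_fun T \<eta> \<longrightarrow>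
   (\<integral>t. g t * of_real (deriv \<eta> t) \<partial>timeM T) = - (\<integral>t. h t * of_real (\<eta> t) \<partial>timeM T))"

lemma integral_timeM_interval:
 fixes f :: "real \<Rightarrow> 'b::{banach, second_countable_topology}"
 assumes "0 \<le> a" "b \<le> T" and [measurable]: "f \<in> bmeas"
 shows "(\<integral>t. indicator {a<..<b} t *\<^sub>R f t \<partial>timeM T) = (\<integral>t. indicator {a..b} t *\<^sub>R f t \<partial>lborel)"
proof -
 have "(\<integral>t. indicator {a<..<b} t *\<^sub>R f t \<partial>timeM T) = (\<integral>t. indicator {0<..<T} t *\<^sub>R indicator {a<..<b} t *\<^sub>R f t \<partial>lborel)"
  by (rule integral_timeM) measurable
 also have "\<dots> = (\<integral>t. indicator {a..b} t *\<^sub>R f t \<partial>lborel)"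
 proof (rule integral_cong_AE)
  have "AE t in lborel. t \<noteq> a" "AE t in lborel. t \<noteq> b" by (auto intro: AE_lborel_singleton)
  then show "AE t in lborel. indicator {0<..<T} t *\<^sub>R indicator {a<..<b} t *\<^sub>R f t = indicator {a..b} t *\<^sub>R f t"
   by eventually_elim (use assms(1,2) in \<open>auto simp: indicator_def\<close>)
 qed auto
 finally show ?thesis .
qed

lemma integral_timeM_interval_FTC:
 fixes F :: "real \<Rightarrow> 'b::euclidean_space"
 assumes "0 \<le> a" "a \<le> b" "b \<le> T" and [measurable]: "f \<in> bmeas"
  and "\<And>t. a \<le> t \<Longrightarrow> t \<le> b \<Longrightarrow> (F has_vector_derivative f t) (at t within {a..b})"
  and "continuous_on {a..b} f"
 shows "(\<integral>t. indicator {a<..<b} t *\<^sub>R f t \<partial>timeM T) = F b - F a"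
 using integral_timeM_interval[OF assms(1,3,4)] integral_FTC_Icc[OF assms(2,5,6)] by simp

lemma integral_timeM_FTC:
 fixes F :: "real \<Rightarrow> 'b::euclidean_space"
 assumes "0 < T" and [measurable]: "f \<in> bmeas"
  and "\<And>t. 0 \<le> t \<Longrightarrow> t \<le> T \<Longrightarrow> (F has_vector_derivative f t) (at t within {0..T})"
  and "continuous_on {0..T} f"
 shows "(\<integral>t. f t \<partial>timeM T) = F T - F 0"
proof -
 have "(\<integral>t. f t \<partial>timeM T) = (\<integral>t. indicator {0<..<T} t *\<^sub>R f t \<partial>timeM T)"
 proof (rule integral_cong_AE)
  show "AE t in timeM T. f t = indicator {0<..<T} t *\<^sub>R f t"
   using AE_timeM_Ioo[of T] by eventually_elim auto
 qed auto
 also have "\<dots> = F T - F 0"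
  by (rule integral_timeM_interval_FTC) (use assms in auto)
 finally show ?thesis .
qed

lemma integral_deriv_test_tail:
 assumes "test_fun T \<eta>" "0 < s" "s < T"
 shows "(\<integral>t. indicator {s<..} t * deriv \<eta> t \<partial>timeM T) = - \<eta> s"
proof -
 note d = test_fun_deriv[OF assms(1)]
 note [measurable] = test_fun_measurable[OF d]
 have "(\<integral>t. indicator {s<..} t * deriv \<eta> t \<partial>timeM T) = (\<integral>t. indicator {s<..<T} t *\<^sub>R deriv \<eta> t \<partial>timeM T)"
 proof (rule integral_cong_AE)
  show "AE t in timeM T. indicator {s<..} t * deriv \<eta> t = indicator {s<..<T} t *\<^sub>R deriv \<eta> t"
   using AE_timeM_Ioo[of T] by eventually_elim (auto simp: indicator_def)
 qed auto
 also have "\<dots> = \<eta> T - \<eta> s"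
  using assms test_fun_has_derivative[OF assms(1)]
  by (intro integral_timeM_interval_FTC test_fun_continuous[OF d])
   (auto intro: has_vector_derivative_at_within simp: has_real_derivative_iff_has_vector_derivative)
 finally show ?thesis using test_fun_eq_0[OF assms(1), of T] by simp
qed

text \<open>Mean zero is what makes the primitive vanish again to the right of the support.\<close>

lemma test_fun_antiderivative:
 assumes h: "test_fun T h" and h0: "(\<integral>t. h t \<partial>timeM T) = 0" and T: "T > 0"
 obtains \<eta> where "test_fun T \<eta>" "deriv \<eta> = h"
proof -
 obtain a b where ab: "0 < a" "a \<le> b" "b < T" "\<And>t. t \<notin> {a..b} \<Longrightarrow> h t = 0"
  using h by (auto simp: test_fun_def)
 \<comment> \<open>The base point lies to the left of the support; -1 leaves room to differentiate
   at times near 0, and for \<open>t < -1\<close> the integral is over the empty interval.\<close>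
 define \<eta> where "\<eta> t = integral {-1..t} h" for t
 have eta0: "\<eta> t = 0" if "t < a" for t
 proof -
  have "\<eta> t = integral {-1..t} (\<lambda>_. 0)"
   unfolding \<eta>_def by (rule integral_cong) (use that ab in auto)
  then show ?thesis by simp
 qed
 have der: "(\<eta> has_real_derivative h t) (at t)" for t
 proof (cases "t > -1")
  case True
  have "(\<eta> has_real_derivative h t) (at t within {-1..t + 1})"
   unfolding \<eta>_def using True by (intro integral_has_real_derivative test_fun_continuous[OF h]) auto
  moreover have "at t within {-1..t + 1} = at t"
   using True by (intro at_within_interior) auto
  ultimately show ?thesis by simp
 next
  case False
  have "((\<lambda>_. 0) has_real_derivative h t) (at t)" using False ab by simp
  then show ?thesis
   by (rule has_field_derivative_transform_within_open[where S = "{..<a}"]) (use False ab eta0 in auto)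
 qed
 have dh: "deriv \<eta> = h" using has_derivD der by blast
 note [measurable] = test_fun_measurable[OF h]
 have "\<eta> T - \<eta> 0 = 0"
  using integral_timeM_FTC[OF T _ _ test_fun_continuous[OF h], of \<eta>] der h0
  by (auto intro: has_vector_derivative_at_within simp: has_real_derivative_iff_has_vector_derivative)
 then have etaT: "\<eta> T = 0" using eta0[of 0] ab by simp
 have eta1: "\<eta> t = 0" if "t > b" for t
 proof -
  consider "t < T" | "t = T" | "t > T" by linarith
  then show ?thesis
  proof cases
   case 1
   then obtain z where z: "t < z" "\<eta> T - \<eta> t = (T - t) * h z" using MVT2[of t T \<eta> h] der by blast
   then show ?thesis using ab(4)[of z] that etaT by simp
  next
   case 3
   then obtain z where z: "T < z" "\<eta> t - \<eta> T = (t - T) * h z" using MVT2[of T t \<eta> h] der by blast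
   then show ?thesis using ab(3) ab(4)[of z] etaT by simp
  qed (use etaT in simp)
 qed
 have "smooth_real \<eta>"
  using smooth_real_iff[of \<eta>] der h unfolding dh by (auto simp: test_fun_def real_differentiable_def)
 moreover have "\<eta> t = 0" if "t \<notin> {a..b}" for t using that eta0 eta1 by force
 ultimately have "test_fun T \<eta>" unfolding test_fun_def using ab by blast
 then show ?thesis using that dh by blast
qed

lemma integrable_timeM_continuous_bounded:
 fixes p :: "real \<Rightarrow> 'b::{banach, second_countable_topology}"
 assumes "p \<in> bmeas" "\<And>t. norm (p t) \<le> B"
 shows "integrable (timeM T) p"
 by (rule finite_measure.integrable_const_bound[OF finite_measure_timeM, where B = B]) (use assms in auto)

lemma integrable_test_fun: "test_fun T \<eta> \<Longrightarrow> integrable (timeM T') \<eta>"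
 by (metis test_fun_bounded test_fun_measurable integrable_timeM_continuous_bounded real_norm_def)

text \<open>Fubini moves the outer integral onto \<open>deriv \<eta>\<close>, whose integral over
  the times after \<open>s\<close> is \<open>- \<eta> s\<close>.\<close>

lemma wder_primitive:
 assumes h: "integrable (timeM T) h"
  and D_def: "D = (\<lambda>t. \<integral>s. indicator {..<t} s *\<^sub>R h s \<partial>timeM T)"
 shows "wder T D h" "D \<in> bmeas" "\<And>t. cmod (D t) \<le> (\<integral>s. cmod (h s) \<partial>timeM T)"
proof -
 interpret tt: pair_sigma_finite "timeM T" "timeM T"
  by (intro pair_sigma_finite.intro sigma_finite_timeM)
 have [measurable]: "h \<in> bmeas"
  using borel_measurable_integrable[OF h] by simp
 have e1: "(\<lambda>p. indicator {..<snd p} (fst p :: real) :: real) = (\<lambda>p. if fst p < snd p then 1 else 0)"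
  and e2: "(\<lambda>p. indicator {..<fst p} (snd p :: real) :: real) = (\<lambda>p. if snd p < fst p then 1 else 0)"
  by (auto simp: indicator_def)
 have ind_meas [measurable]: "(\<lambda>p. indicator {..<snd p} (fst p :: real) :: real) \<in> bmeas2"
  unfolding e1 by measurable
 have ind_meas' [measurable]: "(\<lambda>p. indicator {..<fst p} (snd p :: real) :: real) \<in> bmeas2"
  unfolding e2 by measurable
 show "D \<in> bmeas"
 proof -
  have "(\<lambda>t. \<integral>s. (\<lambda>(t, s). indicator {..<t} s *\<^sub>R h s) (t, s) \<partial>timeM T) \<in> borel_measurable (timeM T)"
   by (rule sigma_finite_measure.borel_measurable_lebesgue_integral[OF sigma_finite_timeM],
     unfold split_beta', intro borel_measurable_scaleR)
    (use ind_meas' in \<open>simp_all cong: measurable_cong_sets\<close>)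
  then show ?thesis by (simp add: D_def)
 qed
 show "cmod (D t) \<le> (\<integral>s. cmod (h s) \<partial>timeM T)" for t
 proof -
  have "cmod (D t) \<le> (\<integral>s. norm (indicator {..<t} s *\<^sub>R h s) \<partial>timeM T)"
   unfolding D_def by (rule integral_norm_bound)
  also have "\<dots> \<le> (\<integral>s. cmod (h s) \<partial>timeM T)"
  proof (rule integral_mono)
   show "integrable (timeM T) (\<lambda>s. norm (indicator {..<t} s *\<^sub>R h s))"
    using h by (intro integrable_norm integrable_mult_indicator) auto
   show "integrable (timeM T) (\<lambda>s. cmod (h s))" using h by simp
  qed (auto simp: indicator_def)
  finally show ?thesis .
 qed
 show "wder T D h"
  unfolding wder_def
 proof (intro allI impI)
  fix \<eta> assume \<eta>: "test_fun T \<eta>"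
  note \<eta>' = test_fun_deriv[OF \<eta>]
  note [measurable] = test_fun_measurable[OF \<eta>'] test_fun_measurable[OF \<eta>]
  obtain B where B: "\<And>t. \<bar>deriv \<eta> t\<bar> \<le> B" using test_fun_bounded[OF \<eta>'] by blast
  have int: "integrable (timeM T \<Otimes>\<^sub>M timeM T) (\<lambda>(s, t). (indicator {..<t} s *\<^sub>R h s) * of_real (deriv \<eta> t))"
  proof (rule tt.Fubini_integrable)
   show "(\<lambda>(s, t). (indicator {..<t} s *\<^sub>R h s) * of_real (deriv \<eta> t)) \<in> borel_measurable (timeM T \<Otimes>\<^sub>M timeM T)"
    by (simp add: split_beta')
   have i2: "integrable (timeM T) (\<lambda>t. (indicator {..<t} s *\<^sub>R h s) * complex_of_real (deriv \<eta> t))" for s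
   proof (rule integrable_timeM_continuous_bounded[where B = "cmod (h s) * B"])
    have "(\<lambda>t. indicator {..<t} s :: real) = indicator {s<..}" by (auto simp: indicator_def)
    then have [measurable]: "(\<lambda>t. indicator {..<t} s :: real) \<in> bmeas" by simp
    show "(\<lambda>t. (indicator {..<t} s *\<^sub>R h s) * complex_of_real (deriv \<eta> t)) \<in> bmeas" by measurable
    show "norm ((indicator {..<t} s *\<^sub>R h s) * complex_of_real (deriv \<eta> t)) \<le> cmod (h s) * B" for t
     using B[of t] by (auto simp: norm_mult indicator_def intro!: mult_left_mono mult_nonneg_nonneg order_trans[OF abs_ge_zero B])
   qed
   then show "AE x in timeM T. integrable (timeM T) (\<lambda>y. case (x, y) of (s, t) \<Rightarrow> (indicator {..<t} s *\<^sub>R h s) * complex_of_real (deriv \<eta> t))"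
    by simp
   show "integrable (timeM T) (\<lambda>x. \<integral>y. norm (case (x, y) of (s, t) \<Rightarrow> (indicator {..<t} s *\<^sub>R h s) * complex_of_real (deriv \<eta> t)) \<partial>timeM T)"
   proof (rule Bochner_Integration.integrable_bound)
    show "integrable (timeM T) (\<lambda>s. cmod (h s) * (B * measure (timeM T) UNIV))" using h by simp
    show "(\<lambda>x. \<integral>y. norm (case (x, y) of (s, t) \<Rightarrow> (indicator {..<t} s *\<^sub>R h s) * complex_of_real (deriv \<eta> t)) \<partial>timeM T) \<in> borel_measurable (timeM T)"
     by (rule sigma_finite_measure.borel_measurable_lebesgue_integral[OF sigma_finite_timeM, where f = "\<lambda>x y. norm (case (x, y) of (s, t) \<Rightarrow> (indicator {..<t} s *\<^sub>R h s) * complex_of_real (deriv \<eta> t))"])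
      (simp add: split_beta')
    have B0: "B \<ge> 0" using B[of 0] by linarith
    show "AE s in timeM T. norm (\<integral>y. norm (case (s, y) of (s, t) \<Rightarrow> (indicator {..<t} s *\<^sub>R h s) * complex_of_real (deriv \<eta> t)) \<partial>timeM T) \<le> norm (cmod (h s) * (B * measure (timeM T) UNIV))"
    proof (rule AE_I2)
     fix s
     have "(\<integral>y. norm (case (s, y) of (s, t) \<Rightarrow> (indicator {..<t} s *\<^sub>R h s) * complex_of_real (deriv \<eta> t)) \<partial>timeM T) \<le> (\<integral>y. cmod (h s) * B \<partial>timeM T)"
     proof (rule integral_mono)
      show "integrable (timeM T) (\<lambda>y. norm (case (s, y) of (s, t) \<Rightarrow> (indicator {..<t} s *\<^sub>R h s) * complex_of_real (deriv \<eta> t)))"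
       unfolding prod.case by (rule integrable_norm[OF i2])
      show "integrable (timeM T) (\<lambda>y. cmod (h s) * B)"
       by (rule finite_measure.integrable_const[OF finite_measure_timeM])
     qed (use B B0 in \<open>auto simp: norm_mult indicator_def intro!: mult_left_mono\<close>)
     also have "\<dots> = cmod (h s) * (B * measure (timeM T) UNIV)" by simp
     finally show "norm (\<integral>y. norm (case (s, y) of (s, t) \<Rightarrow> (indicator {..<t} s *\<^sub>R h s) * complex_of_real (deriv \<eta> t)) \<partial>timeM T) \<le> norm (cmod (h s) * (B * measure (timeM T) UNIV))"
      using B0 by simp
    qed
   qed
  qed
  have "(\<integral>t. D t * of_real (deriv \<eta> t) \<partial>timeM T)
    = (\<integral>t. \<integral>s. (indicator {..<t} s *\<^sub>R h s) * of_real (deriv \<eta> t) \<partial>timeM T \<partial>timeM T)"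
   by (simp only: D_def integral_mult_left_zero)
  also have "\<dots> = (\<integral>s. \<integral>t. (indicator {..<t} s *\<^sub>R h s) * of_real (deriv \<eta> t) \<partial>timeM T \<partial>timeM T)"
   using tt.Fubini_integral[OF int] by simp
  also have "\<dots> = (\<integral>s. - (h s * of_real (\<eta> s)) \<partial>timeM T)"
  proof (rule integral_cong_AE)
   show "(\<lambda>s. \<integral>t. (indicator {..<t} s *\<^sub>R h s) * of_real (deriv \<eta> t) \<partial>timeM T) \<in> borel_measurable (timeM T)"
    by (rule sigma_finite_measure.borel_measurable_lebesgue_integral[OF sigma_finite_timeM, where f = "\<lambda>s t. (indicator {..<t} s *\<^sub>R h s) * of_real (deriv \<eta> t)"])
     (simp add: split_beta')
   show "AE s in timeM T. (\<integral>t. (indicator {..<t} s *\<^sub>R h s) * of_real (deriv \<eta> t) \<partial>timeM T) = - (h s * of_real (\<eta> s))"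
    using AE_timeM_Ioo[of T]
   proof eventually_elim
    case (elim s)
    have "(\<integral>t. (indicator {..<t} s *\<^sub>R h s) * of_real (deriv \<eta> t) \<partial>timeM T)
      = (\<integral>t. h s * of_real (indicator {s<..} t * deriv \<eta> t) \<partial>timeM T)"
     by (intro Bochner_Integration.integral_cong) (auto simp: indicator_def)
    also have "\<dots> = h s * of_real (\<integral>t. indicator {s<..} t * deriv \<eta> t \<partial>timeM T)"
     by (simp only: integral_mult_right_zero integral_complex_of_real)
    also have "\<dots> = - (h s * of_real (\<eta> s))"
     using integral_deriv_test_tail[OF \<eta>] elim by simp
    finally show ?case .
   qed
  qed simp
  finally show "(\<integral>t. D t * of_real (deriv \<eta> t) \<partial>timeM T) = - (\<integral>t. h t * of_real (\<eta> t) \<partial>timeM T)" by simp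
 qed
qed

text \<open>The lemma of du Bois-Reymond: after subtraction of a multiple of one fixed bump, a test
  function has mean zero and is therefore a derivative, against which \<open>q\<close> integrates to
  0.\<close>

lemma wder_0_imp_AE_const:
 fixes q :: "real \<Rightarrow> complex"
 assumes T: "T > 0" and q: "integrable (timeM T) q" and q0: "wder T q (\<lambda>_. 0)"
 obtains K where "AE t in timeM T. q t = K"
proof -
 \<comment> \<open>A reference bump in the middle third of the interval; its integral
   \<open>R\<close> normalizes the means of all others.\<close>
 define \<rho> where "\<rho> = bp 1 (T/3) (2*T/3)"
 have \<rho>: "test_fun T \<rho>" unfolding \<rho>_def using T by (intro test_fun_bp) auto
 have i\<rho>: "integrable (timeM T) \<rho>" by (rule integrable_test_fun[OF \<rho>])
 note [measurable] = test_fun_measurable[OF \<rho>]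
 define R where "R = (\<integral>t. \<rho> t \<partial>timeM T)"
 have R: "R > 0"
 proof (rule ccontr)
  assume "\<not> R > 0"
  moreover have nn: "AE t in timeM T. 0 \<le> \<rho> t" by (simp add: \<rho>_def bp_01)
  ultimately have "R = 0" using integral_nonneg_AE[OF nn] by (simp add: R_def)
  then have "AE t in timeM T. \<rho> t = 0"
   using integral_nonneg_eq_0_iff_AE[OF i\<rho> nn] by (simp add: R_def)
  then have "AE t in lborel. t \<notin> {T/3<..<2*T/3}"
   unfolding AE_timeM
  proof eventually_elim
   case (elim t)
   then show ?case using T bp_pos[of "T/3" t "2*T/3" 1] by (auto simp: \<rho>_def)
  qed
  then have "emeasure lborel {T/3<..<2*T/3} = 0"
   using AE_iff_null_sets[of "{T/3<..<2*T/3}" lborel] by (intro null_setsD1) simp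
  then show False using T by (simp add: ennreal_eq_0_iff)
 qed
 \<comment> \<open>The only candidate for the constant: the mean of \<open>q\<close> weighted by
   \<open>\<rho>\<close>.\<close>
 define K where "K = (\<integral>t. q t * of_real (\<rho> t) \<partial>timeM T) / of_real R"
 have iqK: "integrable (timeM T) (\<lambda>t. q t - K)"
  using q by (auto intro: finite_measure.integrable_const[OF finite_measure_timeM])
 have "AE t in timeM T. q t - K = 0"
 proof (rule AE_eq_0_of_test[OF iqK])
  fix e a b :: real assume e: "e > 0" "0 < a" "a < b" "b < T"
  define \<psi> where "\<psi> = bp e a b"
  have \<psi>: "test_fun T \<psi>" unfolding \<psi>_def using e by (intro test_fun_bp) auto
  have i\<psi>: "integrable (timeM T) \<psi>" by (rule integrable_test_fun[OF \<psi>])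
  define m where "m = (\<integral>t. \<psi> t \<partial>timeM T) / R"
  define h where "h t = \<psi> t + (- m) * \<rho> t" for t
  have "test_fun T h"
  proof -
   have "smooth_real h" unfolding h_def
    using \<psi> \<rho> by (intro sm_imp_smooth_real[OF sm.add[OF sm.base sm.mult[OF sm.const sm.base]]]) (auto simp: test_fun_def)
   moreover have "h t = 0" if "t \<notin> {min a (T/3)..max b (2*T/3)}" for t
   proof -
    have "t \<notin> {a..b}" "t \<notin> {T/3..2*T/3}" using that by auto
    then show ?thesis by (simp add: h_def \<psi>_def \<rho>_def bp_eq_0)
   qed
   ultimately show ?thesis unfolding test_fun_def using e T
    by (intro conjI exI[of _ "min a (T/3)"] exI[of _ "max b (2*T/3)"]) auto
  qed
  moreover have "(\<integral>t. h t \<partial>timeM T) = 0"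
   unfolding h_def using i\<psi> i\<rho> R by (simp add: m_def R_def[symmetric])
  ultimately obtain \<eta> where \<eta>: "test_fun T \<eta>" "deriv \<eta> = h"
   using test_fun_antiderivative T by blast
  have "(\<integral>t. q t * of_real (h t) \<partial>timeM T) = 0"
   using q0 \<eta> unfolding wder_def by fastforce
  moreover have "(\<integral>t. q t * of_real (h t) \<partial>timeM T)
    = (\<integral>t. q t * of_real (\<psi> t) \<partial>timeM T) - of_real m * (\<integral>t. q t * of_real (\<rho> t) \<partial>timeM T)"
  proof -
   have "(\<integral>t. q t * of_real (h t) \<partial>timeM T) = (\<integral>t. q t * of_real (\<psi> t) - of_real m * (q t * of_real (\<rho> t)) \<partial>timeM T)"
    by (intro Bochner_Integration.integral_cong) (auto simp: h_def algebra_simps)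
   then show ?thesis
    using integrable_timeM_test[OF q \<psi>] integrable_timeM_test[OF q \<rho>] by simp
  qed
  moreover have "(\<integral>t. (q t - K) * of_real (\<psi> t) \<partial>timeM T) = (\<integral>t. q t * of_real (\<psi> t) \<partial>timeM T) - K * of_real (\<integral>t. \<psi> t \<partial>timeM T)"
  proof -
   have "integrable (timeM T) (\<lambda>t. K * complex_of_real (\<psi> t))" using i\<psi> by (intro integrable_mult_right integrable_of_real)
   then show ?thesis
    using integrable_timeM_test[OF q \<psi>] by (simp add: left_diff_distrib)
  qed
  ultimately show "(\<integral>t. (q t - K) * of_real (bp e a b t) \<partial>timeM T) = 0"
   using R by (simp add: K_def m_def \<psi>_def field_simps)
 qed
 then show ?thesis using that[of K] by simp
qed

text \<open>Minus the primitive of \<open>h\<close>, the function \<open>g\<close> has weak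
  derivative 0. This replaces an identity under the integral sign by pointwise increments, on which
  both the fractional estimate and uniqueness rely.\<close>

lemma wder_imp_primitive:
 fixes g h :: "real \<Rightarrow> complex"
 assumes T: "T > 0" and g: "integrable (timeM T) g" and h: "integrable (timeM T) h" and w: "wder T g h"
 obtains K where "AE t in timeM T. g t = K + (\<integral>s. indicator {..<t} s *\<^sub>R h s \<partial>timeM T)"
proof -
 define D where "D = (\<lambda>t. \<integral>s. indicator {..<t} s *\<^sub>R h s \<partial>timeM T)"
 note D = wder_primitive[OF h D_def]
 have iD: "integrable (timeM T) D" by (rule integrable_timeM_continuous_bounded[OF D(2,3)])
 have "wder T (\<lambda>t. g t - D t) (\<lambda>_. 0)"
  unfolding wder_def
 proof (intro allI impI)
  fix \<eta> assume \<eta>: "test_fun T \<eta>"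
  have "(\<integral>t. (g t - D t) * of_real (deriv \<eta> t) \<partial>timeM T)
    = (\<integral>t. g t * of_real (deriv \<eta> t) \<partial>timeM T) - (\<integral>t. D t * of_real (deriv \<eta> t) \<partial>timeM T)"
   using integrable_timeM_test[OF g test_fun_deriv[OF \<eta>]] integrable_timeM_test[OF iD test_fun_deriv[OF \<eta>]]
   by (simp add: left_diff_distrib)
  also have "\<dots> = 0" using w D(1) \<eta> by (simp add: wder_def)
  finally show "(\<integral>t. (g t - D t) * of_real (deriv \<eta> t) \<partial>timeM T) = - (\<integral>t. 0 * of_real (\<eta> t) \<partial>timeM T)" by simp
 qed
 then obtain K where "AE t in timeM T. g t - D t = K"
  using wder_0_imp_AE_const[OF T] g iD by (metis Bochner_Integration.integrable_diff)
 then have "AE t in timeM T. g t = K + D t" by eventually_elim (simp add: algebra_simps)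
 then show ?thesis using that unfolding D_def by blast
qed

subsection \<open>Fourier synthesis\<close>

text \<open>The symmetry of the coefficients of a real function. It is carried along because the
  system is solved for complex coefficients while solutions are real-valued.\<close>

definition herm :: "(int^'d \<Rightarrow> complex) \<Rightarrow> bool" where
 "herm a \<longleftrightarrow> (\<forall>k. a (- k) = cnj (a k))"

text \<open>Taking the real part keeps the function real for every sequence; for \<open>herm\<close>
  sequences with finite \<open>l1\<close> norm nothing is lost, by
  \<open>synth_complex\<close>.\<close>

definition synth :: "(int^'d \<Rightarrow> complex) \<Rightarrow> real^'d \<Rightarrow> real" where
 "synth a x = Re (\<integral>k. a k * chr k x \<partial>cntM)"

definition l2 :: "(real^'d \<Rightarrow> real) \<Rightarrow> bool" where
 "l2 g \<longleftrightarrow> g \<in> bmeas \<and> (\<integral>\<^sup>+x. ennreal ((g x)^2) \<partial>cubeM) < \<infinity>"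

lemma bij_uminus: "bij (uminus :: 'a::ab_group_add \<Rightarrow> 'a)"
 by (rule o_bij[of uminus]) auto

lemma herm_fcoef:
 assumes [measurable]: "g \<in> bmeas"
 shows "herm (fcoef g)"
 unfolding herm_def fcoef_eq[OF assms] by (simp add: cnj_chr flip: Bochner_Integration.integral_cnj)

lemma case_measurable_count:
 fixes F :: "'k::countable \<Rightarrow> 'x \<Rightarrow> 'c::topological_space"
 assumes "\<And>k. F k \<in> borel_measurable M"
 shows "(\<lambda>(k, x). F k x) \<in> borel_measurable (cntM \<Otimes>\<^sub>M M)"
  and "(\<lambda>(x, k). F k x) \<in> borel_measurable (M \<Otimes>\<^sub>M cntM)"
proof -
 show "(\<lambda>(k, x). F k x) \<in> borel_measurable (cntM \<Otimes>\<^sub>M M)"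
  unfolding split_beta'
  by (rule measurable_compose_countable[where f = "\<lambda>k p. F k (snd p)" and g = fst])
   (auto intro: measurable_compose[OF measurable_snd assms])
 show "(\<lambda>(x, k). F k x) \<in> borel_measurable (M \<Otimes>\<^sub>M cntM)"
  unfolding split_beta'
  by (rule measurable_compose_countable[where f = "\<lambda>k p. F k (fst p)" and g = snd])
   (auto intro: measurable_compose[OF measurable_fst assms])
qed

lemma borel_measurable_count_integral:
 fixes F :: "'k::countable \<Rightarrow> 'x \<Rightarrow> complex"
 assumes "\<And>k. F k \<in> borel_measurable M"
 shows "(\<lambda>x. \<integral>k. F k x \<partial>cntM) \<in> borel_measurable M"
 by (rule sigma_finite_measure.borel_measurable_lebesgue_integral)
  (auto intro: sigma_finite_measure_count_space_countable case_measurable_count(2)[OF assms])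

lemma borel_measurable_count_nn_integral:
 fixes F :: "'k::countable \<Rightarrow> 'x \<Rightarrow> ennreal"
 assumes "\<And>k. F k \<in> borel_measurable M"
 shows "(\<lambda>x. \<integral>\<^sup>+k. F k x \<partial>cntM) \<in> borel_measurable M"
 using sigma_finite_measure.borel_measurable_nn_integral_fst[OF _ case_measurable_count(2)[OF assms]]
 by (simp add: sigma_finite_measure_count_space_countable)

lemma
 fixes F :: "'k::countable \<Rightarrow> 'x \<Rightarrow> complex"
 assumes M: "sigma_finite_measure M" and F: "\<And>k. F k \<in> borel_measurable M"
  and fin: "(\<integral>\<^sup>+k. \<integral>\<^sup>+x. ennreal (cmod (F k x)) \<partial>M \<partial>cntM) < \<infinity>"
 shows integral_count_swap: "(\<integral>x. \<integral>k. F k x \<partial>cntM \<partial>M) = (\<integral>k. \<integral>x. F k x \<partial>M \<partial>cntM)"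
  and integrable_count_swap: "integrable M (\<lambda>x. \<integral>k. F k x \<partial>cntM)"
  and AE_integrable_count_swap: "AE x in M. integrable (cntM) (\<lambda>k. F k x)"
proof -
 interpret P: pair_sigma_finite "count_space (UNIV :: 'k set)" M
  by (intro pair_sigma_finite.intro M sigma_finite_measure_count_space_countable) auto
 have [measurable]: "(\<lambda>(k, x). F k x) \<in> borel_measurable (cntM \<Otimes>\<^sub>M M)"
  by (rule case_measurable_count(1)[OF F])
 have int: "integrable (cntM \<Otimes>\<^sub>M M) (\<lambda>(k, x). F k x)"
 proof (rule integrableI_bounded)
  have "(\<integral>\<^sup>+p. ennreal (norm (case p of (k, x) \<Rightarrow> F k x)) \<partial>(cntM \<Otimes>\<^sub>M M))
    = (\<integral>\<^sup>+k. \<integral>\<^sup>+x. ennreal (norm (case (k, x) of (k, x) \<Rightarrow> F k x)) \<partial>M \<partial>cntM)"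
   by (rule sigma_finite_measure.nn_integral_fst[OF M, symmetric]) measurable
  then show "(\<integral>\<^sup>+p. ennreal (norm (case p of (k, x) \<Rightarrow> F k x)) \<partial>(cntM \<Otimes>\<^sub>M M)) < \<infinity>"
   using fin by simp
 qed measurable
 show "(\<integral>x. \<integral>k. F k x \<partial>cntM \<partial>M) = (\<integral>k. \<integral>x. F k x \<partial>M \<partial>cntM)"
  by (rule P.Fubini_integral[OF int])
 show "integrable M (\<lambda>x. \<integral>k. F k x \<partial>cntM)"
  using P.integrable_snd[OF int] by simp
 show "AE x in M. integrable (cntM) (\<lambda>k. F k x)"
  using P.AE_integrable_snd[OF int] by simp
qed

lemma integrable_synth: "l1 a < \<infinity> \<Longrightarrow> integrable (cntM) (\<lambda>k. a k * chr k x)"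
 by (rule integrableI_bounded) (auto simp: l1_def norm_mult)

lemma synth_complex:
 assumes "herm a" "l1 a < \<infinity>"
 shows "complex_of_real (synth a x) = (\<integral>k. a k * chr k x \<partial>cntM)" (is "_ = ?S")
proof -
 have "cnj ?S = (\<integral>k. a (- k) * chr (- k) x \<partial>cntM)"
  using assms(1) by (simp add: herm_def cnj_chr flip: Bochner_Integration.integral_cnj)
 also have "\<dots> = ?S" by (rule integral_bij_count_space[OF bij_uminus])
 finally have "cnj ?S = ?S" .
 then show ?thesis unfolding synth_def by (simp add: complex_eq_iff)
qed

lemma synth_measurable: "synth a \<in> bmeas"
proof -
 have "(\<lambda>x. \<integral>k. a k * chr k x \<partial>cntM) \<in> bmeas"
  by (rule borel_measurable_count_integral) measurable
 then show ?thesis unfolding synth_def[abs_def] by measurable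
qed

lemma synth_periodic: "periodic_x (synth a)"
 unfolding periodic_x_def synth_def
 by (simp add: chr_periodic[unfolded periodic_x_def, rule_format])

lemma abs_synth_le: "ennreal \<bar>synth a x\<bar> \<le> l1 a"
proof -
 have "ennreal \<bar>synth a x\<bar> \<le> ennreal (cmod (\<integral>k. a k * chr k x \<partial>cntM))"
  unfolding synth_def by (intro ennreal_leI abs_Re_le_cmod)
 also have "\<dots> \<le> (\<integral>\<^sup>+k. ennreal (cmod (a k * chr k x)) \<partial>cntM)"
  by (rule cmod_integral_le)
 finally show ?thesis by (simp add: l1_def norm_mult)
qed

declare emeasure_cubeM [simp]

lemma l2_integrable: "l2 g \<Longrightarrow> integrable cubeM g"
proof (rule integrableI_bounded)
 assume g: "l2 g"
 then have [measurable]: "g \<in> bmeas" by (simp add: l2_def)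
 show "g \<in> borel_measurable cubeM" by simp
 have "(\<integral>\<^sup>+x. ennreal (norm (g x)) \<partial>cubeM) \<le> (\<integral>\<^sup>+x. 1 + ennreal ((g x)^2) \<partial>cubeM)"
 proof (rule nn_integral_mono)
  fix x
  have "\<bar>g x\<bar> \<le> 1 + (g x)^2"
  proof -
   have "0 \<le> (\<bar>g x\<bar> - 1)^2" by simp
   then have "2 * \<bar>g x\<bar> \<le> 1 + (g x)^2" by (simp add: power2_eq_square algebra_simps)
   then show ?thesis using abs_ge_zero[of "g x"] by linarith
  qed
  then have "ennreal (norm (g x)) \<le> ennreal (1 + (g x)^2)" by (intro ennreal_leI) simp
  then show "ennreal (norm (g x)) \<le> 1 + ennreal ((g x)^2)" by simp
 qed
 also have "\<dots> = 1 + (\<integral>\<^sup>+x. ennreal ((g x)^2) \<partial>cubeM)"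
  by (subst nn_integral_add) auto
 also have "\<dots> < \<infinity>" using g by (simp add: l2_def)
 finally show "(\<integral>\<^sup>+x. ennreal (norm (g x)) \<partial>cubeM) < \<infinity>" .
qed

lemma l2_bounded:
 assumes [measurable]: "g \<in> bmeas" and "AE x in cubeM. \<bar>g x\<bar> \<le> B"
 shows "l2 g"
proof -
 have "(\<integral>\<^sup>+x. ennreal ((g x)^2) \<partial>cubeM) \<le> (\<integral>\<^sup>+x. ennreal (B^2) \<partial>(cubeM :: (real^'a) measure))"
 proof (rule nn_integral_mono_AE)
  show "AE x in cubeM. ennreal ((g x)^2) \<le> ennreal (B^2)"
   using assms(2) by eventually_elim (auto intro!: ennreal_leI power2_le_iff_abs_le[THEN iffD2] order_trans[OF abs_ge_zero])
 qed
 also have "\<dots> < \<infinity>" by simp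
 finally show ?thesis by (simp add: l2_def)
qed

lemma l2_synth: "l1 a < \<infinity> \<Longrightarrow> l2 (synth a)"
proof (rule l2_bounded[OF synth_measurable], rule AE_I2)
 fix x assume a: "l1 a < \<infinity>"
 have "ennreal \<bar>synth a x\<bar> \<le> ennreal (enn2real (l1 a))"
  using abs_synth_le[of a x] a by simp
 then show "\<bar>synth a x\<bar> \<le> enn2real (l1 a)" by (simp add: ennreal_le_iff)
qed

lemma fcoef_synth:
 assumes "herm a" "l1 a < \<infinity>"
 shows "fcoef (synth a) k = a k"
proof -
 have "fcoef (synth a) k = (\<integral>x. (\<integral>l. a l * chr l x \<partial>cntM) * chr (- k) x \<partial>cubeM)"
  by (subst fcoef_eq[OF synth_measurable]) (simp add: synth_complex[OF assms])
 also have "\<dots> = (\<integral>x. (\<integral>l. a l * chr (l - k) x \<partial>cntM) \<partial>cubeM)"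
  using integrable_synth[OF assms(2)]
  by (intro Bochner_Integration.integral_cong refl, subst integral_mult_left_zero[symmetric])
   (simp add: mult.assoc chr_mult)
 also have "\<dots> = (\<integral>l. \<integral>x. a l * chr (l - k) x \<partial>cubeM \<partial>cntM)"
  by (rule integral_count_swap[OF sigma_finite_cubeM])
   (use assms(2) in \<open>auto simp: norm_mult l1_def\<close>)
 also have "\<dots> = (\<integral>l. (if l = k then a l else 0) \<partial>cntM)"
  by (intro Bochner_Integration.integral_cong) (auto simp: integral_chr)
 also have "\<dots> = a k"
  by (subst lebesgue_integral_count_space_finite_support) (auto intro: finite_subset[of _ "{k}"])
 finally show ?thesis .
qed

lemma fcoef_diff:
 assumes "integrable cubeM g" "integrable cubeM h"
 shows "fcoef (\<lambda>x. g x - h x) k = fcoef g k - fcoef h k"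
proof -
 have [measurable]: "g \<in> bmeas" "h \<in> bmeas"
  using assms[THEN borel_measurable_integrable] by auto
 have i: "integrable cubeM (\<lambda>x. complex_of_real (g x) * chr (- k) x)" "integrable cubeM (\<lambda>x. complex_of_real (h x) * chr (- k) x)"
  using assms by (auto intro: integrable_cubeM_mult_chr)
 show ?thesis
  by (simp add: fcoef_eq left_diff_distrib Bochner_Integration.integral_diff[OF i])
qed

lemma fcoef_cong_AE:
 assumes "g \<in> bmeas" "h \<in> bmeas" "AE x in cubeM. g x = h x"
 shows "fcoef g k = fcoef h k"
 unfolding fcoef_eq[OF assms(1)] fcoef_eq[OF assms(2)]
proof (rule integral_cong_AE)
 note [measurable] = assms(1,2)
 show "(\<lambda>x. complex_of_real (g x) * chr (- k) x) \<in> borel_measurable cubeM"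
  "(\<lambda>x. complex_of_real (h x) * chr (- k) x) \<in> borel_measurable cubeM" by simp_all
 show "AE x in cubeM. complex_of_real (g x) * chr (- k) x = complex_of_real (h x) * chr (- k) x"
  using assms(3) by eventually_elim simp
qed

lemma AE_eq_of_fcoef_eq:
 assumes "integrable cubeM g" "integrable cubeM h" "\<And>k. fcoef g k = fcoef h k"
 shows "AE x in cubeM. g x = h x"
proof -
 have "AE x in cubeM. g x - h x = 0"
  by (rule fcoef_eq_0_imp_AE_eq_0) (use assms fcoef_diff[OF assms(1,2)] in auto)
 then show ?thesis by eventually_elim simp
qed

lemma AE_eq_synth:
 assumes "integrable cubeM g" "l1 (fcoef g) < \<infinity>"
 shows "AE x in cubeM. g x = synth (fcoef g) x"
proof (rule AE_eq_of_fcoef_eq[OF assms(1)])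
 show "integrable cubeM (synth (fcoef g))" by (rule l2_integrable[OF l2_synth[OF assms(2)]])
 have "g \<in> bmeas" using borel_measurable_integrable[OF assms(1)] by simp
 then show "fcoef g k = fcoef (synth (fcoef g)) k" for k
  by (simp add: fcoef_synth[OF herm_fcoef assms(2)])
qed

text \<open>\<open>f\<close> may be replaced by its absolutely convergent Fourier series, which is
  integrated term by term against \<open>v\<close>. Summable coefficients are asked of one factor
  only, so that solutions known merely to be square integrable in space are covered.\<close>

lemma fcoef_mult:
 assumes f: "integrable cubeM f" "l1 (fcoef f) < \<infinity>" and v: "integrable cubeM v"
 shows "fcoef (\<lambda>x. f x * v x) k = conv (fcoef f) (fcoef v) k"
proof -
 have [measurable]: "f \<in> bmeas" "v \<in> bmeas"
  using f v borel_measurable_integrable by fastforce+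
 note [measurable] = synth_measurable
 have hf: "herm (fcoef f)" by (rule herm_fcoef) measurable
 have "fcoef (\<lambda>x. f x * v x) k = fcoef (\<lambda>x. synth (fcoef f) x * v x) k"
 proof (rule fcoef_cong_AE)
  show "AE x in cubeM. f x * v x = synth (fcoef f) x * v x"
   using AE_eq_synth[OF f] by eventually_elim simp
 qed auto
 also have "\<dots> = (\<integral>x. (\<integral>l. fcoef f l * chr l x \<partial>cntM) * (v x * chr (- k) x) \<partial>cubeM)"
  by (subst fcoef_eq) (auto simp: synth_complex[OF hf f(2)] mult.assoc)
 also have "\<dots> = (\<integral>x. (\<integral>l. fcoef f l * (v x * chr (- (k - l)) x) \<partial>cntM) \<partial>cubeM)"
  using integrable_synth[OF f(2)]
  by (intro Bochner_Integration.integral_cong refl, subst integral_mult_left_zero[symmetric])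
   (simp add: ac_simps chr_mult)
 also have "\<dots> = (\<integral>l. \<integral>x. fcoef f l * (v x * chr (- (k - l)) x) \<partial>cubeM \<partial>cntM)"
 proof (rule integral_count_swap[OF sigma_finite_cubeM])
  have "(\<integral>\<^sup>+l. \<integral>\<^sup>+x. ennreal (cmod (fcoef f l * (v x * chr (- (k - l)) x))) \<partial>cubeM \<partial>cntM)
    = (\<integral>\<^sup>+l. ennreal (cmod (fcoef f l)) * (\<integral>\<^sup>+x. ennreal \<bar>v x\<bar> \<partial>cubeM) \<partial>cntM)"
   by (intro nn_integral_cong, subst nn_integral_cmult[symmetric]) (auto simp: norm_mult ennreal_mult)
  also have "\<dots> = l1 (fcoef f) * (\<integral>\<^sup>+x. ennreal \<bar>v x\<bar> \<partial>cubeM)"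
   by (simp add: l1_def nn_integral_multc)
  also have "\<dots> < \<infinity>"
  proof -
   have "(\<integral>\<^sup>+x. ennreal \<bar>v x\<bar> \<partial>cubeM) < \<infinity>"
    using v unfolding integrable_iff_bounded by simp
   then show ?thesis using f(2) by (simp add: ennreal_mult_less_top)
  qed
  finally show "(\<integral>\<^sup>+l. \<integral>\<^sup>+x. ennreal (cmod (fcoef f l * (v x * chr (- (k - l)) x))) \<partial>cubeM \<partial>cntM) < \<infinity>" .
 qed auto
 also have "\<dots> = (\<integral>l. fcoef f l * fcoef v (k - l) \<partial>cntM)"
  by (simp add: fcoef_eq)
 also have "\<dots> = (\<integral>l. fcoef f (k - (k - l)) * fcoef v (k - l) \<partial>cntM)"
  by simp
 also have "\<dots> = conv (fcoef f) (fcoef v) k"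
  unfolding conv_def by (rule integral_bij_count_space[OF bij_minus_left, of "\<lambda>l. fcoef f (k - l) * fcoef v l"])
 finally show ?thesis .
qed

lemma herm_conv:
 assumes "herm f" "herm v"
 shows "herm (conv f v)"
 unfolding herm_def
proof
 fix k
 have "cnj (f (k - l)) * cnj (v l) = f (- k - (- l)) * v (- l)" for l
 proof -
  have "- k - (- l) = - (k - l)" by simp
  then have "f (- k - (- l)) = cnj (f (k - l))" using assms(1) unfolding herm_def by metis
  then show ?thesis using assms(2) by (simp add: herm_def)
 qed
 then have "cnj (conv f v k) = (\<integral>l. f (- k - (- l)) * v (- l) \<partial>cntM)"
  unfolding conv_def by (simp only: Bochner_Integration.integral_cnj[symmetric] complex_cnj_mult)
 also have "\<dots> = conv f v (- k)"
  unfolding conv_def by (rule integral_bij_count_space[OF bij_uminus, of "\<lambda>l. f (- k - l) * v l"])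
 finally show "conv f v (- k) = cnj (conv f v k)" by simp
qed

section \<open>Bessel's inequality and completeness of L2\<close>

lemma integral_trig_sum_sq:
 fixes a :: "int^'d \<Rightarrow> complex"
 assumes "finite F"
 shows "(\<integral>\<^sup>+x. ennreal ((cmod (\<Sum>k\<in>F. a k * chr k x))^2) \<partial>cubeM) = (\<Sum>k\<in>F. ennreal ((cmod (a k))^2))"
proof -
 define S where "S x = (\<Sum>k\<in>F. a k * chr k x)" for x
 have cS: "continuous_on UNIV S" unfolding S_def by (intro continuous_intros continuous_chr)
 have [measurable]: "S \<in> bmeas" by (rule borel_measurable_continuous_onI[OF cS])
 have iS: "integrable cubeM (\<lambda>x. (cmod (S x))^2)"
 proof -
  have "integrable cubeM (\<lambda>x. (1::real) * (cmod (S x))^2)"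
   by (rule integrable_cubeM_mult_bounded)
    (auto intro!: finite_measure.integrable_const[OF finite_measure_cubeM] continuous_intros cS)
  then show ?thesis by simp
 qed
 have "complex_of_real (\<integral>x. (cmod (S x))^2 \<partial>cubeM) = (\<integral>x. S x * cnj (S x) \<partial>cubeM)"
  by (simp only: complex_norm_square[symmetric] integral_complex_of_real)
 also have "\<dots> = (\<integral>x. (\<Sum>k\<in>F. \<Sum>l\<in>F. (a k * cnj (a l)) * chr (k - l) x) \<partial>cubeM)"
  by (intro Bochner_Integration.integral_cong refl)
   (simp add: S_def sum_product cnj_chr ac_simps chr_mult)
 also have "\<dots> = (\<Sum>k\<in>F. \<Sum>l\<in>F. (a k * cnj (a l)) * (\<integral>x. chr (k - l) x \<partial>cubeM))"
  by (subst Bochner_Integration.integral_sum; (subst Bochner_Integration.integral_sum)?)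
   (auto intro!: Bochner_Integration.integrable_sum integrable_mult_right integrable_chr)
 also have "\<dots> = (\<Sum>k\<in>F. \<Sum>l\<in>F. if l = k then a k * cnj (a l) else 0)"
  by (intro sum.cong) (auto simp: integral_chr)
 also have "\<dots> = complex_of_real (\<Sum>k\<in>F. (cmod (a k))^2)"
  using assms by (simp only: of_real_sum complex_norm_square) (simp add: sum.delta)
 finally have *: "(\<integral>x. (cmod (S x))^2 \<partial>cubeM) = (\<Sum>k\<in>F. (cmod (a k))^2)" by (simp only: of_real_eq_iff)
 have "(\<integral>\<^sup>+x. ennreal ((cmod (S x))^2) \<partial>cubeM) = ennreal (\<integral>x. (cmod (S x))^2 \<partial>cubeM)"
  by (rule nn_integral_eq_integral[OF iS]) auto
 then show ?thesis unfolding * by (simp add: S_def sum_ennreal)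
qed

lemma bessel:
 fixes g :: "real^'d \<Rightarrow> real"
 assumes "l2 g"
 shows "sE 0 (fcoef g) \<le> (\<integral>\<^sup>+x. ennreal ((g x)^2) \<partial>cubeM)"
 unfolding sE_0_eq
proof (rule nn_integral_count_le_finite)
 fix F :: "(int^'d) set" assume F: "finite F"
 have gm [measurable]: "g \<in> bmeas" using assms by (simp add: l2_def)
 define S where "S x = (\<Sum>k\<in>F. fcoef g k * chr k x)" for x
 have cS: "continuous_on UNIV S" unfolding S_def by (intro continuous_intros continuous_chr)
 have [measurable]: "S \<in> bmeas" by (rule borel_measurable_continuous_onI[OF cS])
 define N where "N = (\<Sum>k\<in>F. (cmod (fcoef g k))^2)"
 have ig: "integrable cubeM g" by (rule l2_integrable[OF assms])
 have ig2: "integrable cubeM (\<lambda>x. (g x)^2)"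
  using assms by (intro integrableI_bounded) (auto simp: l2_def)
 have S2: "(\<integral>\<^sup>+x. ennreal ((cmod (S x))^2) \<partial>cubeM) = ennreal N"
  unfolding S_def N_def by (subst integral_trig_sum_sq[OF F]) (simp add: sum_ennreal)
 have iS: "integrable cubeM (\<lambda>x. (cmod (S x))^2)"
  by (rule integrableI_bounded) (auto simp: S2)
 have S2': "(\<integral>x. (cmod (S x))^2 \<partial>cubeM) = N"
  using nn_integral_eq_integral[OF iS] S2 by (simp add: N_def sum_nonneg)
 have igS: "integrable cubeM (\<lambda>x. complex_of_real (g x) * cnj (S x))"
  by (rule integrable_cubeM_mult_bounded) (auto intro!: integrable_of_real ig continuous_intros cS)
 have "(\<integral>x. complex_of_real (g x) * cnj (S x) \<partial>cubeM)
   = (\<integral>x. (\<Sum>k\<in>F. cnj (fcoef g k) * (complex_of_real (g x) * chr (- k) x)) \<partial>cubeM)"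
  by (intro Bochner_Integration.integral_cong) (auto simp: S_def cnj_chr sum_distrib_left ac_simps)
 also have "\<dots> = (\<Sum>k\<in>F. cnj (fcoef g k) * (\<integral>x. complex_of_real (g x) * chr (- k) x \<partial>cubeM))"
  by (subst Bochner_Integration.integral_sum)
   (auto intro!: integrable_mult_right integrable_cubeM_mult_chr integrable_of_real ig)
 also have "\<dots> = (\<Sum>k\<in>F. of_real ((cmod (fcoef g k))^2))"
  by (intro sum.cong refl) (simp only: fcoef_eq[OF gm, symmetric] complex_norm_square mult.commute)
 finally have gS: "(\<integral>x. complex_of_real (g x) * cnj (S x) \<partial>cubeM) = of_real N" by (simp add: N_def)
 \<comment> \<open>Expanding the squared distance from \<open>g\<close> to its partial sum
   \<open>S\<close>: the pairing of \<open>g\<close> with \<open>S\<close> and the squared norm of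
   \<open>S\<close> both equal \<open>N\<close>.\<close>
 have "0 \<le> (\<integral>x. (cmod (complex_of_real (g x) - S x))^2 \<partial>cubeM)" by simp
 also have "\<dots> = (\<integral>x. (g x)^2 - 2 * Re (complex_of_real (g x) * cnj (S x)) + (cmod (S x))^2 \<partial>cubeM)"
  by (intro Bochner_Integration.integral_cong refl) (simp add: cmod_power2, simp add: power2_eq_square algebra_simps)
 also have "\<dots> = (\<integral>x. (g x)^2 \<partial>cubeM) - 2 * Re (\<integral>x. complex_of_real (g x) * cnj (S x) \<partial>cubeM) + (\<integral>x. (cmod (S x))^2 \<partial>cubeM)"
  using ig2 iS integrable_Re[OF igS] integral_Re[OF igS]
  by (subst Bochner_Integration.integral_add, simp, simp, subst Bochner_Integration.integral_diff) auto
 also have "\<dots> = (\<integral>x. (g x)^2 \<partial>cubeM) - N" by (simp add: gS S2')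
 finally have "N \<le> (\<integral>x. (g x)^2 \<partial>cubeM)" by simp
 then have "ennreal N \<le> (\<integral>\<^sup>+x. ennreal ((g x)^2) \<partial>cubeM)"
  by (subst nn_integral_eq_integral[OF ig2]) (auto intro: ennreal_leI)
 then show "(\<Sum>k\<in>F. ennreal ((cmod (fcoef g k))^2)) \<le> (\<integral>\<^sup>+x. ennreal ((g x)^2) \<partial>cubeM)"
  by (simp add: N_def sum_ennreal)
qed

text \<open>Pointwise convergence along a rapidly Cauchy subsequence defines the limit, and Fatou's
  lemma turns this into convergence in mean of the full sequence. The subsequence is returned as
  well, since the energy of the limit is later bounded by Fatou along it.\<close>

lemma L2_complete:
 fixes f :: "nat \<Rightarrow> 'a \<Rightarrow> real"
 assumes f [measurable]: "\<And>n. f n \<in> borel_measurable M"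
  and cauchy: "\<And>e. e > 0 \<Longrightarrow> \<exists>N. \<forall>m\<ge>N. \<forall>n\<ge>N. (\<integral>\<^sup>+x. ennreal ((f m x - f n x)^2) \<partial>M) \<le> ennreal e"
 obtains w r where "w \<in> borel_measurable M" "strict_mono r"
  "AE x in M. (\<lambda>j. f (r j) x) \<longlonglongrightarrow> w x"
  "\<And>e. e > 0 \<Longrightarrow> \<exists>N. \<forall>n\<ge>N. (\<integral>\<^sup>+x. ennreal ((w x - f n x)^2) \<partial>M) \<le> ennreal e"
proof -
 have "\<exists>N. \<forall>m\<ge>N. \<forall>n\<ge>N. (\<integral>\<^sup>+x. ennreal ((f m x - f n x)^2) \<partial>M) \<le> ennreal ((1/4) ^ j)" for j :: nat
  by (rule cauchy) simp
 then obtain N where N: "\<And>j m n. m \<ge> N j \<Longrightarrow> n \<ge> N j \<Longrightarrow> (\<integral>\<^sup>+x. ennreal ((f m x - f n x)^2) \<partial>M) \<le> ennreal ((1/4) ^ j)"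
  by metis
 \<comment> \<open>Summing the thresholds and adding \<open>j\<close> makes the subsequence strictly
   increasing while keeping \<open>r j\<close> beyond \<open>N j\<close>.\<close>
 define r where "r j = (\<Sum>i\<le>j. N i) + j" for j
 have r: "strict_mono r" by (rule strict_monoI_Suc) (simp add: r_def)
 have rN: "r j \<ge> N j" for j
  unfolding r_def by (rule trans_le_add1) (rule member_le_sum, auto)
 \<comment> \<open>The energies of these increments decay like \<open>(1/4)^j\<close>, so a weight
   \<open>2^j\<close> can be afforded. Finiteness of the weighted sum at almost every point gives
   increments of size \<open>(1 / sqrt 2)^j\<close>, hence absolute convergence.\<close>
 define \<Delta> where "\<Delta> j x = f (r (Suc j)) x - f (r j) x" for j x
 have [measurable]: "\<Delta> j \<in> borel_measurable M" for j unfolding \<Delta>_def by measurable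
 have "(\<integral>\<^sup>+x. (\<Sum>j. ennreal (2 ^ j * (\<Delta> j x)^2)) \<partial>M) = (\<Sum>j. \<integral>\<^sup>+x. ennreal (2 ^ j * (\<Delta> j x)^2) \<partial>M)"
  by (rule nn_integral_suminf) measurable
 also have "\<dots> \<le> (\<Sum>j. ennreal ((1/2) ^ j))"
 proof (rule suminf_le)
  fix j
  have "(\<integral>\<^sup>+x. ennreal (2 ^ j * (\<Delta> j x)^2) \<partial>M) = ennreal (2 ^ j) * (\<integral>\<^sup>+x. ennreal ((\<Delta> j x)^2) \<partial>M)"
   by (simp add: ennreal_mult nn_integral_cmult)
  also have "\<dots> \<le> ennreal (2 ^ j) * ennreal ((1/4) ^ j)"
   unfolding \<Delta>_def by (intro mult_left_mono N) (auto intro: order_trans[OF rN] simp: strict_mono_less_eq[OF r])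
  also have "\<dots> = ennreal ((1/2) ^ j)" by (simp flip: ennreal_mult power_mult_distrib)
  finally show "(\<integral>\<^sup>+x. ennreal (2 ^ j * (\<Delta> j x)^2) \<partial>M) \<le> ennreal ((1/2) ^ j)" .
 qed auto
 also have "\<dots> < \<infinity>"
  unfolding infinity_ennreal_def
  by (rule top.not_eq_extremum[THEN iffD1], rule ennreal_suminf_neq_top) (auto intro: summable_geometric)
 finally have fin: "AE x in M. (\<Sum>j. ennreal (2 ^ j * (\<Delta> j x)^2)) \<noteq> \<infinity>"
  by (intro nn_integral_PInf_AE) auto
 define w where "w x = lim (\<lambda>j. f (r j) x)" for x
 have wm [measurable]: "w \<in> borel_measurable M" unfolding w_def by measurable
 have conv: "AE x in M. (\<lambda>j. f (r j) x) \<longlonglongrightarrow> w x"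
  using fin
 proof eventually_elim
  case (elim x)
  define S where "S = enn2real (\<Sum>j. ennreal (2 ^ j * (\<Delta> j x)^2))"
  have S: "ennreal S = (\<Sum>j. ennreal (2 ^ j * (\<Delta> j x)^2))" unfolding S_def
   by (rule ennreal_enn2real) (use elim in \<open>auto simp: less_top\<close>)
  have S0: "S \<ge> 0" by (simp add: S_def)
  have bnd: "\<bar>\<Delta> j x\<bar> \<le> sqrt S * (1 / sqrt 2) ^ j" for j
  proof -
   have "(\<Sum>i\<in>{j}. ennreal (2 ^ i * (\<Delta> i x)^2)) \<le> (\<Sum>i. ennreal (2 ^ i * (\<Delta> i x)^2))"
    by (rule sum_le_suminf[OF summableI]) auto
   then have "ennreal (2 ^ j * (\<Delta> j x)^2) \<le> ennreal S" unfolding S by simp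
   then have "2 ^ j * (\<Delta> j x)^2 \<le> S" using S0 by (subst (asm) ennreal_le_iff)
   then have "(\<Delta> j x)^2 \<le> S * (1/2) ^ j" by (simp add: field_simps)
   also have "\<dots> = (sqrt S * (1 / sqrt 2) ^ j)^2"
   proof -
    have "((1 / sqrt 2) ^ j)^2 = ((1 / sqrt 2)^2) ^ j" by (simp only: power_mult[symmetric] mult.commute[of j 2])
    also have "(1 / sqrt 2)^2 = 1/2" by (simp add: power_divide)
    finally show ?thesis using S0 by (simp add: power_mult_distrib)
   qed
   finally have "\<bar>\<Delta> j x\<bar> \<le> \<bar>sqrt S * (1 / sqrt 2) ^ j\<bar>" by (rule abs_le_square_iff[THEN iffD2])
   then show ?thesis using S0 by (simp add: abs_mult)
  qed
  have "summable (\<lambda>j. sqrt S * (1 / sqrt 2) ^ j)"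
   by (intro summable_mult summable_geometric) simp
  then have "summable (\<lambda>j. \<Delta> j x)"
   by (rule summable_comparison_test'[where N = 0]) (use bnd in simp)
  then have "(\<lambda>n. (\<Sum>j<n. \<Delta> j x) + f (r 0) x) \<longlonglongrightarrow> (\<Sum>j. \<Delta> j x) + f (r 0) x"
   by (intro tendsto_add summable_LIMSEQ tendsto_const)
  moreover have "(\<Sum>j<n. \<Delta> j x) + f (r 0) x = f (r n) x" for n
   unfolding \<Delta>_def by (subst sum_lessThan_telescope) simp
  ultimately have "(\<lambda>n. f (r n) x) \<longlonglongrightarrow> (\<Sum>j. \<Delta> j x) + f (r 0) x" by simp
  then show ?case unfolding w_def by (metis limI)
 qed
 have "\<exists>N. \<forall>n\<ge>N. (\<integral>\<^sup>+x. ennreal ((w x - f n x)^2) \<partial>M) \<le> ennreal e" if e: "e > 0" for e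
 proof -
  obtain N0 where N0: "\<And>m n. m \<ge> N0 \<Longrightarrow> n \<ge> N0 \<Longrightarrow> (\<integral>\<^sup>+x. ennreal ((f m x - f n x)^2) \<partial>M) \<le> ennreal e"
   using cauchy[OF e] by blast
  have "(\<integral>\<^sup>+x. ennreal ((w x - f n x)^2) \<partial>M) \<le> ennreal e" if n: "n \<ge> N0" for n
  proof -
   have "(\<integral>\<^sup>+x. ennreal ((w x - f n x)^2) \<partial>M) = (\<integral>\<^sup>+x. liminf (\<lambda>j. ennreal ((f (r j) x - f n x)^2)) \<partial>M)"
   proof (rule nn_integral_cong_AE)
    show "AE x in M. ennreal ((w x - f n x)^2) = liminf (\<lambda>j. ennreal ((f (r j) x - f n x)^2))"
     using conv
    proof eventually_elim
     case (elim x)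
     have "(\<lambda>j. ennreal ((f (r j) x - f n x)^2)) \<longlonglongrightarrow> ennreal ((w x - f n x)^2)"
      by (intro tendsto_ennrealI tendsto_intros elim)
     from lim_imp_Liminf[OF _ this] show ?case by simp
    qed
   qed
   also have "\<dots> \<le> liminf (\<lambda>j. \<integral>\<^sup>+x. ennreal ((f (r j) x - f n x)^2) \<partial>M)"
    by (rule nn_integral_liminf) measurable
   also have "\<dots> \<le> ennreal e"
   proof -
    have "\<forall>\<^sub>F j in sequentially. (\<integral>\<^sup>+x. ennreal ((f (r j) x - f n x)^2) \<partial>M) \<le> ennreal e"
     unfolding eventually_sequentially
    proof (intro exI[of _ N0] allI impI N0 n)
     fix j assume "N0 \<le> j"
     then show "N0 \<le> r j" using seq_suble[OF r, of j] by linarith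
    qed
    then have "liminf (\<lambda>j. \<integral>\<^sup>+x. ennreal ((f (r j) x - f n x)^2) \<partial>M) \<le> liminf (\<lambda>j. ennreal e)"
     by (rule Liminf_mono)
    then show ?thesis by (simp add: Liminf_const)
   qed
   finally show ?thesis .
  qed
  then show ?thesis by (intro exI[of _ N0]) simp
 qed
 then show ?thesis by (rule that[OF wm r conv])
qed

subsection \<open>Square integrable functions on the cylinder\<close>

text \<open>The squared norm of L2 in time with values of Sobolev order \<open>s\<close> in
  space.\<close>

definition tE :: "real \<Rightarrow> real \<Rightarrow> (int^'d \<Rightarrow> real \<Rightarrow> complex) \<Rightarrow> ennreal" where
 "tE T s a = (\<integral>\<^sup>+t. sE s (\<lambda>k. a k t) \<partial>timeM T)"

lemma sum_le_nn_integral_count: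
 fixes f :: "'a \<Rightarrow> ennreal"
 assumes "finite F"
 shows "(\<Sum>k\<in>F. f k) \<le> (\<integral>\<^sup>+k. f k \<partial>cntM)"
proof -
 have "(\<Sum>k\<in>F. f k) = (\<integral>\<^sup>+k. f k \<partial>count_space F)"
  by (rule nn_integral_count_space_finite[OF assms, symmetric])
 also have "\<dots> = (\<integral>\<^sup>+k. f k * indicator F k \<partial>count_space F)"
  by (rule nn_integral_cong) auto
 also have "\<dots> = (\<integral>\<^sup>+k. f k * indicator F k \<partial>cntM)"
  by (rule nn_integral_count_space_eq) auto
 also have "\<dots> \<le> (\<integral>\<^sup>+k. f k \<partial>cntM)"
  by (rule nn_integral_mono) (auto simp: indicator_def)
 finally show ?thesis .
qed

lemma tE_eq_count:
 assumes [measurable]: "\<And>k. a k \<in> bmeas"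
 shows "tE T s a = (\<integral>\<^sup>+k. \<integral>\<^sup>+t. ennreal ((1 + ksq k) powr s * (cmod (a k t))^2) \<partial>timeM T \<partial>cntM)"
 unfolding tE_def sE_def by (rule nn_integral_count_space_nn_integral) auto

section \<open>The cylinder as a product measure space\<close>

lemma pair_sigma_finite_Q: "pair_sigma_finite (cubeM :: (real^'d) measure) (timeM T)"
 by (intro pair_sigma_finite.intro sigma_finite_cubeM sigma_finite_timeM)

lemma sets_Q [measurable_cong]: "sets (QM T) = sets borel"
 by (subst pair_cubeM_timeM) simp

lemma borel_measurable_Q [simp]: "borel_measurable (QM T) = bmeas"
 by (rule measurable_cong_sets[OF sets_Q refl])

lemma borel_measurable_lborel_Q:
 "(f :: (real^'d) \<times> real \<Rightarrow> 'b::topological_space) \<in> borel_measurable lborel \<longleftrightarrow> f \<in> bmeas2"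
 by (simp add: borel_prod)

lemma finite_measure_Q: "finite_measure (QM T)"
 by (intro finite_measure_pair_measure finite_measure_cubeM finite_measure_timeM)

lemma Qset_sets [measurable]: "(Qset T :: ((real^'d) \<times> real) set) \<in> sets borel"
proof -
 have "(Qset T :: ((real^'d) \<times> real) set) \<in> sets (borel \<Otimes>\<^sub>M borel)"
  unfolding Qset_def by measurable
 then show ?thesis by (simp only: borel_prod)
qed

lemma AE_Q: "(AE p in QM T. P p) \<longleftrightarrow> (AE p in lborel. p \<in> Qset T \<longrightarrow> P p)"
 unfolding pair_cubeM_timeM by (subst AE_density) (auto simp: indicator_def)

text \<open>Fourier coefficients are taken slice by slice in time, whereas the definitions state
  equations almost everywhere on the cylinder.\<close>

lemma AE_Q_iff:
 assumes [measurable]: "Measurable.pred (borel \<Otimes>\<^sub>M borel) P"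
 shows "(AE p in lborel. p \<in> Qset T \<longrightarrow> P p) \<longleftrightarrow> (AE t in timeM T. AE x in (cubeM :: (real^'d) measure). P (x, t))"
proof -
 interpret Q: pair_sigma_finite "cubeM :: (real^'d) measure" "timeM T" by (rule pair_sigma_finite_Q)
 have "(AE p in lborel. p \<in> Qset T \<longrightarrow> P p) \<longleftrightarrow> (AE p in QM T. P p)"
  by (simp add: AE_Q)
 also have "\<dots> \<longleftrightarrow> (AE x in (cubeM :: (real^'d) measure). AE t in timeM T. P (x, t))"
 proof -
  have "Measurable.pred (QM T) P"
   using assms by (simp only: borel_prod borel_measurable_Q measurable_cong_sets[OF sets_Q refl])
  then have P: "{p \<in> space (QM T). P p} \<in> sets (QM T)"
   by (rule predE)
  from Q.AE_pair_iff[of "\<lambda>x t. P (x, t)"] P show ?thesis by simp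
 qed
 also have "\<dots> \<longleftrightarrow> (AE t in timeM T. AE x in (cubeM :: (real^'d) measure). P (x, t))"
 proof (rule Q.AE_commute)
  have "Measurable.pred (QM T) P"
   using assms by (simp only: borel_prod borel_measurable_Q measurable_cong_sets[OF sets_Q refl])
  then show "{p \<in> space (QM T). P (fst p, snd p)} \<in> sets (QM T)"
   unfolding prod.collapse by (rule predE)
 qed
 finally show ?thesis .
qed

lemma L2Q_energy_eq:
 assumes [measurable]: "case_prod w \<in> bmeas2"
 shows "L2Q_energy T w = (\<integral>\<^sup>+p. ennreal ((case_prod w p)^2) \<partial>(QM T))"
  and "L2Q_energy T w = (\<integral>\<^sup>+t. \<integral>\<^sup>+x. ennreal ((w x t)^2) \<partial>(cubeM :: (real^'d) measure) \<partial>timeM T)"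
proof -
 interpret Q: pair_sigma_finite "cubeM :: (real^'d) measure" "timeM T" by (rule pair_sigma_finite_Q)
 have m: "(\<lambda>p. ennreal ((case_prod w p)^2)) \<in> bmeas2" by measurable
 have m': "(\<lambda>p. ennreal ((case_prod w p)^2)) \<in> borel_measurable lborel"
  using m unfolding borel_measurable_lborel_Q .
 show *: "L2Q_energy T w = (\<integral>\<^sup>+p. ennreal ((case_prod w p)^2) \<partial>(QM T))"
  unfolding L2Q_energy_def pair_cubeM_timeM by (rule nn_integral_density[symmetric]) (use m' in auto)
 show "L2Q_energy T w = (\<integral>\<^sup>+t. \<integral>\<^sup>+x. ennreal ((w x t)^2) \<partial>(cubeM :: (real^'d) measure) \<partial>timeM T)"
  unfolding * by (subst Q.nn_integral_snd[symmetric]) (use m in \<open>auto simp: borel_prod\<close>)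
qed

lemma integral_Q_eq:
 fixes f :: "(real^'d) \<times> real \<Rightarrow> 'b::{banach, second_countable_topology}"
 assumes "f \<in> bmeas2"
 shows "(\<integral>p. indicator (Qset T) p *\<^sub>R f p \<partial>lborel) = (\<integral>p. f p \<partial>(QM T))"
proof -
 have [measurable]: "f \<in> borel_measurable lborel" using assms unfolding borel_measurable_lborel_Q .
 have *: "(indicator (Qset T) :: (real^'d) \<times> real \<Rightarrow> ennreal) = (\<lambda>x. ennreal (indicator (Qset T) x))"
  by (simp add: fun_eq_iff ennreal_indicator)
 show ?thesis unfolding pair_cubeM_timeM * by (subst integral_density) auto
qed

lemma L2Q_iff: "L2Q T w \<longleftrightarrow> case_prod w \<in> bmeas2 \<and> L2Q_energy T w < \<infinity>"
 unfolding L2Q_def borel_measurable_lborel_Q ..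

lemma L2Q_slice:
 assumes "L2Q T w"
 shows "AE t in timeM T. l2 (\<lambda>x. w x t)"
proof -
 have [measurable]: "case_prod w \<in> bmeas2" using assms by (simp add: L2Q_iff)
 have "AE t in timeM T. (\<integral>\<^sup>+x. ennreal ((w x t)^2) \<partial>cubeM) \<noteq> \<infinity>"
 proof (rule nn_integral_PInf_AE)
  have "(\<lambda>(t, x). ennreal ((w x t)^2)) \<in> borel_measurable (timeM T \<Otimes>\<^sub>M cubeM)" by measurable
  from sigma_finite_measure.borel_measurable_nn_integral_fst[OF sigma_finite_cubeM this]
  show "(\<lambda>t. \<integral>\<^sup>+x. ennreal ((w x t)^2) \<partial>cubeM) \<in> borel_measurable (timeM T)" by simp
  show "(\<integral>\<^sup>+t. \<integral>\<^sup>+x. ennreal ((w x t)^2) \<partial>cubeM \<partial>timeM T) \<noteq> \<infinity>"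
   using assms L2Q_energy_eq(2)[of w T] by (auto simp: L2Q_def)
 qed
 then show ?thesis
 proof eventually_elim
  case (elim t)
  have "(\<lambda>x. w x t) \<in> bmeas" by measurable
  then show ?case using elim by (simp add: l2_def top.not_eq_extremum)
 qed
qed

lemma L2Q_integrable:
 assumes "L2Q T w"
 shows "integrable (QM T) (case_prod w)"
  and "integrable (QM T) (\<lambda>p. (case_prod w p)^2)"
proof -
 have m: "case_prod w \<in> bmeas2" using assms by (simp add: L2Q_iff)
 have m' [measurable]: "case_prod w \<in> bmeas" using m by (simp add: borel_prod)
 show i2: "integrable (QM T) (\<lambda>p. (case_prod w p)^2)"
  using assms L2Q_energy_eq(1)[OF m, of T] by (intro integrableI_bounded) (auto simp: L2Q_def)
 show "integrable (QM T) (case_prod w)"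
 proof (rule Bochner_Integration.integrable_bound)
  show "integrable (QM T) (\<lambda>p. 1 + (case_prod w p)^2)"
   by (intro Bochner_Integration.integrable_add i2 finite_measure.integrable_const finite_measure_Q)
  show "AE p in QM T. norm (case_prod w p) \<le> norm (1 + (case_prod w p)^2)"
  proof (rule AE_I2)
   fix p
   have "0 \<le> (\<bar>case_prod w p\<bar> - 1)^2" by simp
   then have "2 * \<bar>case_prod w p\<bar> \<le> 1 + (case_prod w p)^2" by (simp add: power2_eq_square algebra_simps)
   then show "norm (case_prod w p) \<le> norm (1 + (case_prod w p)^2)" using abs_ge_zero[of "case_prod w p"] by simp
  qed
 qed simp
qed

lemma fcoef_time_measurable:
 assumes [measurable]: "case_prod w \<in> bmeas2"
 shows "(\<lambda>t. fcoef (\<lambda>x. w x t) k) \<in> bmeas"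
proof -
 have "(\<lambda>t. \<integral>x. complex_of_real (w x t) * chr (- k) x \<partial>cubeM) \<in> bmeas"
  by (rule sigma_finite_measure.borel_measurable_lebesgue_integral[OF sigma_finite_cubeM]) measurable
 moreover have "(\<lambda>t. fcoef (\<lambda>x. w x t) k) = (\<lambda>t. \<integral>x. complex_of_real (w x t) * chr (- k) x \<partial>cubeM)"
 proof
  fix t
  have "(\<lambda>x. w x t) \<in> bmeas" by measurable
  then show "fcoef (\<lambda>x. w x t) k = (\<integral>x. complex_of_real (w x t) * chr (- k) x \<partial>cubeM)" by (rule fcoef_eq)
 qed
 ultimately show ?thesis by simp
qed

lemma tE_fcoef_le:
 assumes "L2Q T w"
 shows "tE T 0 (\<lambda>k t. fcoef (\<lambda>x. w x t) k) \<le> L2Q_energy T w"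
proof -
 have m: "case_prod w \<in> bmeas2" using assms by (simp add: L2Q_iff)
 show ?thesis unfolding tE_def L2Q_energy_eq(2)[OF m]
 proof (rule nn_integral_mono_AE)
  show "AE t in timeM T. sE 0 (fcoef (\<lambda>x. w x t)) \<le> (\<integral>\<^sup>+x. ennreal ((w x t)^2) \<partial>cubeM)"
   using L2Q_slice[OF assms] by eventually_elim (rule bessel)
 qed
qed

lemma integrable_of_sq:
 fixes g :: "real \<Rightarrow> complex"
 assumes [measurable]: "g \<in> bmeas" and "(\<integral>\<^sup>+t. ennreal ((cmod (g t))^2) \<partial>timeM T) < \<infinity>"
 shows "integrable (timeM T) g" "integrable (timeM T) (\<lambda>t. (cmod (g t))^2)"
proof -
 show i2: "integrable (timeM T) (\<lambda>t. (cmod (g t))^2)"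
  by (rule integrableI_bounded) (use assms in auto)
 show "integrable (timeM T) g"
 proof (rule Bochner_Integration.integrable_bound)
  show "integrable (timeM T) (\<lambda>t. 1 + (cmod (g t))^2)"
   by (intro Bochner_Integration.integrable_add i2 finite_measure.integrable_const finite_measure_timeM)
  show "AE t in timeM T. norm (g t) \<le> norm (1 + (cmod (g t))^2)"
  proof (rule AE_I2)
   fix t
   have "0 \<le> (cmod (g t) - 1)^2" by simp
   then have "2 * cmod (g t) \<le> 1 + (cmod (g t))^2" by (simp add: power2_eq_square algebra_simps)
   then have "cmod (g t) \<le> 1 + (cmod (g t))^2" using norm_ge_zero[of "g t"] by linarith
   then show "norm (g t) \<le> norm (1 + (cmod (g t))^2)" by simp
  qed
 qed simp
qed

lemma tE_component:
 assumes "\<And>k. a k \<in> bmeas"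
 shows "(\<integral>\<^sup>+t. ennreal ((cmod (a k t))^2) \<partial>timeM T) \<le> tE T 0 a"
proof -
 have "(\<integral>\<^sup>+t. ennreal ((1 + ksq k) powr 0 * (cmod (a k t))^2) \<partial>timeM T) \<le> tE T 0 a"
  unfolding tE_eq_count[OF assms] by (rule nn_integral_ge_point[of k UNIV "\<lambda>k. \<integral>\<^sup>+t. ennreal ((1 + ksq k) powr 0 * (cmod (a k t))^2) \<partial>timeM T"]) simp
 then show ?thesis by simp
qed

lemma tE_integrable:
 assumes "\<And>k. a k \<in> bmeas" "tE T 0 a < \<infinity>"
 shows "integrable (timeM T) (a k)"
 by (rule integrable_of_sq(1)[OF assms(1)]) (rule le_less_trans[OF tE_component[OF assms(1)] assms(2)])

lemma Q_integral_chr: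
 fixes u :: "real^'d \<Rightarrow> real \<Rightarrow> real"
 assumes u: "L2Q T u" and [measurable]: "\<phi> \<in> bmeas" and B: "\<And>t. \<bar>\<phi> t\<bar> \<le> B"
 shows "integrable (QM T) (\<lambda>p. complex_of_real (u (fst p) (snd p) * \<phi> (snd p)) * chr k (fst p))"
  and "(\<integral>p. complex_of_real (u (fst p) (snd p) * \<phi> (snd p)) * chr k (fst p) \<partial>(QM T))
   = (\<integral>t. fcoef (\<lambda>x. u x t) (- k) * of_real (\<phi> t) \<partial>timeM T)"
proof -
 interpret Q: pair_sigma_finite "cubeM :: (real^'d) measure" "timeM T" by (rule pair_sigma_finite_Q)
 have um [measurable]: "case_prod u \<in> bmeas2" using u by (simp add: L2Q_iff)
 have B0: "B \<ge> 0" using B[of 0] by linarith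
 show i: "integrable (QM T) (\<lambda>p. complex_of_real (u (fst p) (snd p) * \<phi> (snd p)) * chr k (fst p))"
 proof (rule Bochner_Integration.integrable_bound)
  show "integrable (QM T) (\<lambda>p. B * case_prod u p)" using L2Q_integrable(1)[OF u] by simp
  show "(\<lambda>p. complex_of_real (u (fst p) (snd p) * \<phi> (snd p)) * chr k (fst p)) \<in> borel_measurable (QM T)"
   unfolding borel_measurable_Q borel_prod[symmetric] by measurable
  show "AE p in QM T. norm (complex_of_real (u (fst p) (snd p) * \<phi> (snd p)) * chr k (fst p)) \<le> norm (B * case_prod u p)"
  proof (rule AE_I2)
   fix p :: "(real^'d) \<times> real"
   have "\<bar>u (fst p) (snd p)\<bar> * \<bar>\<phi> (snd p)\<bar> \<le> \<bar>u (fst p) (snd p)\<bar> * B" by (intro mult_left_mono B) auto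
   then show "norm (complex_of_real (u (fst p) (snd p) * \<phi> (snd p)) * chr k (fst p)) \<le> norm (B * case_prod u p)"
    using B0 by (simp add: norm_mult abs_mult split_beta mult.commute flip: of_real_mult)
  qed
 qed
 have "(\<integral>p. complex_of_real (u (fst p) (snd p) * \<phi> (snd p)) * chr k (fst p) \<partial>(QM T))
   = (\<integral>t. \<integral>x. complex_of_real (u x t * \<phi> t) * chr k x \<partial>cubeM \<partial>timeM T)"
  using Q.integral_snd[of "\<lambda>x t. complex_of_real (u x t * \<phi> t) * chr k x"] i by (simp add: split_beta')
 also have "\<dots> = (\<integral>t. fcoef (\<lambda>x. u x t) (- k) * of_real (\<phi> t) \<partial>timeM T)"
 proof (intro Bochner_Integration.integral_cong refl)
  fix t
  have "(\<lambda>x. u x t) \<in> bmeas" by measurable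
  then have "fcoef (\<lambda>x. u x t) (- k) = (\<integral>x. complex_of_real (u x t) * chr k x \<partial>cubeM)"
   by (simp add: fcoef_eq)
  then show "(\<integral>x. complex_of_real (u x t * \<phi> t) * chr k x \<partial>cubeM) = fcoef (\<lambda>x. u x t) (- k) * of_real (\<phi> t)"
   by (simp only:) (subst integral_mult_left_zero[symmetric], simp add: ac_simps)
 qed
 finally show "(\<integral>p. complex_of_real (u (fst p) (snd p) * \<phi> (snd p)) * chr k (fst p) \<partial>(QM T))
   = (\<integral>t. fcoef (\<lambda>x. u x t) (- k) * of_real (\<phi> t) \<partial>timeM T)" .
qed

text \<open>By orthogonality the partial sums over growing finite sets are Cauchy in L2 of the
  cylinder. Fatou bounds the energy of the limit, and Bessel applied to its distance from the
  partial sums identifies the coefficients. These are only square summable, so \<open>synth\<close>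
  cannot be applied to the whole sequence.\<close>

lemma riesz_fischer:
 fixes a :: "int^'d \<Rightarrow> real \<Rightarrow> complex"
 assumes am [measurable]: "\<And>k. a k \<in> bmeas"
  and ah: "\<And>t. herm (\<lambda>k. a k t)" and fin: "tE T 0 a < \<infinity>"
 obtains w where "L2Q T w" "L2Q_energy T w \<le> tE T 0 a"
  "AE t in timeM T. \<forall>k. fcoef (\<lambda>x. w x t) k = a k t"
proof -
 interpret Q: pair_sigma_finite "cubeM :: (real^'d) measure" "timeM T" by (rule pair_sigma_finite_Q)
 let ?Q = "QM T"
 \<comment> \<open>Finite sets that exhaust the lattice and are symmetric under negation, so that
   truncation preserves \<open>herm\<close> and nothing is lost by taking real parts of the partial
   sums.\<close>
 define F where "F N = {k :: int^'d. to_nat k < N \<or> to_nat (- k) < N}" for N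
 have Ffin: "finite (F N)" for N
 proof -
  have "finite (to_nat -` {..<N} :: (int^'d) set)" by (rule finite_vimageI) auto
  moreover have "finite ((\<lambda>k. to_nat (- k)) -` {..<N} :: (int^'d) set)"
   by (rule finite_vimageI) (auto intro: injI)
  moreover have "F N = to_nat -` {..<N} \<union> (\<lambda>k. to_nat (- k)) -` {..<N}" by (auto simp: F_def)
  ultimately show ?thesis by simp
 qed
 have Fmono: "N \<le> N' \<Longrightarrow> F N \<subseteq> F N'" for N N' by (auto simp: F_def)
 have Fminus: "- k \<in> F N \<longleftrightarrow> k \<in> F N" for k N by (auto simp: F_def)
 define S where "S G p = (\<Sum>k\<in>G. a k (snd p) * chr k (fst p))" for G p
 have Sm [measurable]: "S G \<in> bmeas2" for G unfolding S_def by measurable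
 define f where "f N p = Re (S (F N) p)" for N p
 have fm [measurable]: "f N \<in> bmeas2" for N unfolding f_def by measurable
 define b where "b k = (\<integral>\<^sup>+t. ennreal ((cmod (a k t))^2) \<partial>timeM T)" for k
 have tEb: "tE T 0 a = (\<integral>\<^sup>+k. b k \<partial>cntM)"
  by (simp add: tE_eq_count b_def)
 have bsum: "(\<Sum>k\<in>G. b k) \<le> tE T 0 a" if "finite G" for G
  unfolding tEb by (rule sum_le_nn_integral_count[OF that])
 have S2: "(\<integral>\<^sup>+p. ennreal ((Re (S G p))^2) \<partial>?Q) \<le> (\<Sum>k\<in>G. b k)" if "finite G" for G
 proof -
  have "(\<integral>\<^sup>+p. ennreal ((Re (S G p))^2) \<partial>?Q) \<le> (\<integral>\<^sup>+p. ennreal ((cmod (S G p))^2) \<partial>?Q)"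
   by (intro nn_integral_mono ennreal_leI) (simp add: cmod_power2)
  also have "\<dots> = (\<integral>\<^sup>+t. \<integral>\<^sup>+x. ennreal ((cmod (S G (x, t)))^2) \<partial>cubeM \<partial>timeM T)"
   by (rule Q.nn_integral_snd[symmetric]) (use Sm[of G] in \<open>simp add: borel_prod\<close>)
  also have "\<dots> = (\<integral>\<^sup>+t. (\<Sum>k\<in>G. ennreal ((cmod (a k t))^2)) \<partial>timeM T)"
   by (simp add: S_def integral_trig_sum_sq[OF that])
  also have "\<dots> = (\<Sum>k\<in>G. b k)" unfolding b_def by (rule nn_integral_sum) auto
  finally show ?thesis .
 qed
 define B where "B k = enn2real (b k)" for k
 have bB: "b k = ennreal (B k)" for k
 proof -
  have "b k \<le> tE T 0 a" using bsum[of "{k}"] by simp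
  then have "b k < top" using fin by (simp add: le_less_trans)
  then show ?thesis by (simp add: B_def)
 qed
 have B0: "B k \<ge> 0" for k by (simp add: B_def)
 have diff: "(\<integral>\<^sup>+p. ennreal ((f m p - f n p)^2) \<partial>?Q) \<le> ennreal \<bar>(\<Sum>k\<in>F m. B k) - (\<Sum>k\<in>F n. B k)\<bar>" for m n
 proof -
  have *: "(\<integral>\<^sup>+p. ennreal ((f m p - f n p)^2) \<partial>?Q) \<le> ennreal ((\<Sum>k\<in>F m. B k) - (\<Sum>k\<in>F n. B k))" if "n \<le> m" for m n
  proof -
   have "f m p - f n p = Re (S (F m - F n) p)" for p
    unfolding f_def S_def using sum_diff[OF Ffin Fmono[OF that], of "\<lambda>k. a k (snd p) * chr k (fst p)"] by simp
   then have "(\<integral>\<^sup>+p. ennreal ((f m p - f n p)^2) \<partial>?Q) \<le> (\<Sum>k\<in>F m - F n. b k)"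
    using S2[of "F m - F n"] Ffin by simp
   also have "\<dots> = ennreal (\<Sum>k\<in>F m - F n. B k)" by (simp add: bB B0 sum_ennreal)
   also have "(\<Sum>k\<in>F m - F n. B k) = (\<Sum>k\<in>F m. B k) - (\<Sum>k\<in>F n. B k)"
    by (rule sum_diff[OF Ffin Fmono[OF that]])
   finally show ?thesis .
  qed
  show ?thesis
  proof (cases "n \<le> m")
   case True
   show ?thesis by (rule order_trans[OF *[OF True]]) (intro ennreal_leI abs_ge_self)
  next
   case False
   then have "m \<le> n" by simp
   have "(\<integral>\<^sup>+p. ennreal ((f m p - f n p)^2) \<partial>?Q) = (\<integral>\<^sup>+p. ennreal ((f n p - f m p)^2) \<partial>?Q)"
    by (simp add: power2_commute)
   also have "\<dots> \<le> ennreal \<bar>(\<Sum>k\<in>F m. B k) - (\<Sum>k\<in>F n. B k)\<bar>"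
    by (rule order_trans[OF *[OF \<open>m \<le> n\<close>]]) (intro ennreal_leI, linarith)
   finally show ?thesis .
  qed
 qed
 \<comment> \<open>The energies of the partial sums increase and stay below the total, so they form
   a Cauchy sequence of reals; by \<open>diff\<close> so do the partial sums in L2.\<close>
 have "Bseq (\<lambda>N. \<Sum>k\<in>F N. B k)"
 proof (rule BseqI'[where K = "enn2real (tE T 0 a)"])
  fix n :: nat
  have "ennreal (\<Sum>k\<in>F n. B k) \<le> ennreal (enn2real (tE T 0 a))"
   using bsum[OF Ffin[of n]] fin by (simp add: bB B0 sum_ennreal less_top)
  then show "norm (\<Sum>k\<in>F n. B k) \<le> enn2real (tE T 0 a)"
   by (simp add: ennreal_le_iff sum_nonneg B0)
 qed
 moreover have "\<forall>m. \<forall>n\<ge>m. (\<Sum>k\<in>F m. B k) \<le> (\<Sum>k\<in>F n. B k)"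
  by (intro allI impI sum_mono2 Ffin Fmono B0)
 ultimately have "Cauchy (\<lambda>N. \<Sum>k\<in>F N. B k)"
  by (intro convergent_Cauchy Bseq_mono_convergent) auto
 then have cauchy: "\<exists>N. \<forall>m\<ge>N. \<forall>n\<ge>N. (\<integral>\<^sup>+p. ennreal ((f m p - f n p)^2) \<partial>?Q) \<le> ennreal e" if "e > 0" for e
 proof -
  obtain N where N: "\<And>m n. m \<ge> N \<Longrightarrow> n \<ge> N \<Longrightarrow> dist (\<Sum>k\<in>F m. B k) (\<Sum>k\<in>F n. B k) < e"
   using \<open>Cauchy _\<close> \<open>e > 0\<close> unfolding Cauchy_def by metis
  show ?thesis
  proof (intro exI[of _ N] allI impI)
   fix m n assume "m \<ge> N" "n \<ge> N"
   then show "(\<integral>\<^sup>+p. ennreal ((f m p - f n p)^2) \<partial>?Q) \<le> ennreal e"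
    using N[of m n] by (intro order_trans[OF diff] ennreal_leI) (simp add: dist_real_def)
  qed
 qed
 have fmQ: "f n \<in> borel_measurable ?Q" for n using fm[of n] by (simp add: borel_prod)
 obtain wq r where wq: "wq \<in> borel_measurable ?Q" "strict_mono r" "AE p in ?Q. (\<lambda>j. f (r j) p) \<longlonglongrightarrow> wq p"
  "\<And>e. e > 0 \<Longrightarrow> \<exists>N. \<forall>n\<ge>N. (\<integral>\<^sup>+p. ennreal ((wq p - f n p)^2) \<partial>?Q) \<le> ennreal e"
  using L2_complete[OF fmQ cauchy] by blast
 define w where "w x t = wq (x, t)" for x t
 have wq': "case_prod w = wq" by (auto simp: w_def)
 have wm [measurable]: "wq \<in> bmeas2" using wq(1) by (simp add: borel_prod)
 have wm': "case_prod w \<in> bmeas2" using wm by (simp add: wq')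
 have "(\<integral>\<^sup>+p. ennreal ((wq p)^2) \<partial>?Q) = (\<integral>\<^sup>+p. liminf (\<lambda>j. ennreal ((f (r j) p)^2)) \<partial>?Q)"
 proof (rule nn_integral_cong_AE)
  show "AE p in ?Q. ennreal ((wq p)^2) = liminf (\<lambda>j. ennreal ((f (r j) p)^2))"
   using wq(3)
  proof eventually_elim
   case (elim p)
   have "(\<lambda>j. ennreal ((f (r j) p)^2)) \<longlonglongrightarrow> ennreal ((wq p)^2)"
    by (intro tendsto_ennrealI tendsto_intros elim)
   from lim_imp_Liminf[OF _ this] show ?case by simp
  qed
 qed
 also have "\<dots> \<le> liminf (\<lambda>j. \<integral>\<^sup>+p. ennreal ((f (r j) p)^2) \<partial>?Q)"
  by (rule nn_integral_liminf) (use fmQ in measurable)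
 also have "\<dots> \<le> liminf (\<lambda>j::nat. tE T 0 a)"
 proof (rule Liminf_mono, rule always_eventually, rule allI)
  fix j
  show "(\<integral>\<^sup>+p. ennreal ((f (r j) p)^2) \<partial>?Q) \<le> tE T 0 a"
   unfolding f_def by (rule order_trans[OF S2[OF Ffin] bsum[OF Ffin]])
 qed
 finally have energy: "L2Q_energy T w \<le> tE T 0 a"
  by (subst L2Q_energy_eq(1)[OF wm']) (simp add: wq' Liminf_const)
 have wL2: "L2Q T w" using energy fin wm' by (auto simp: L2Q_iff)
 have "AE t in timeM T. fcoef (\<lambda>x. w x t) k = a k t" for k
 proof -
  have gm [measurable]: "(\<lambda>t. fcoef (\<lambda>x. w x t) k) \<in> bmeas"
   by (rule fcoef_time_measurable[OF wm'])
  \<comment> \<open>Once \<open>k\<close> lies in \<open>F n\<close>, the partial sum has exactly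
    the coefficient \<open>a k t\<close>, so the error in this coefficient is bounded by the
    distance of \<open>w\<close> from the partial sum.\<close>
  have le: "(\<integral>\<^sup>+t. ennreal ((cmod (fcoef (\<lambda>x. w x t) k - a k t))^2) \<partial>timeM T) \<le> ennreal e" if "e > 0" for e
  proof -
   obtain N where N: "\<And>n. n \<ge> N \<Longrightarrow> (\<integral>\<^sup>+p. ennreal ((wq p - f n p)^2) \<partial>?Q) \<le> ennreal e"
    using wq(4)[OF \<open>e > 0\<close>] by blast
   define n where "n = max N (Suc (to_nat k))"
   have kn: "k \<in> F n" by (auto simp: F_def n_def)
   have "(\<integral>\<^sup>+t. ennreal ((cmod (fcoef (\<lambda>x. w x t) k - a k t))^2) \<partial>timeM T)
     \<le> (\<integral>\<^sup>+t. \<integral>\<^sup>+x. ennreal ((wq (x, t) - f n (x, t))^2) \<partial>cubeM \<partial>timeM T)"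
   proof (rule nn_integral_mono_AE)
    show "AE t in timeM T. ennreal ((cmod (fcoef (\<lambda>x. w x t) k - a k t))^2)
      \<le> (\<integral>\<^sup>+x. ennreal ((wq (x, t) - f n (x, t))^2) \<partial>cubeM)"
     using L2Q_slice[OF wL2]
    proof eventually_elim
     case (elim t)
     define an where "an l = (if l \<in> F n then a l t else 0)" for l
     have han: "herm an" using ah[of t] Fminus by (auto simp: herm_def an_def)
     have lan: "l1 an < \<infinity>"
     proof -
      have "l1 an = (\<integral>\<^sup>+l. ennreal (cmod (an l)) \<partial>count_space (F n))"
       unfolding l1_def by (rule nn_integral_count_space_eq) (auto simp: an_def)
      also have "\<dots> = (\<Sum>l\<in>F n. ennreal (cmod (an l)))" by (rule nn_integral_count_space_finite[OF Ffin])
      also have "\<dots> < \<infinity>" by (simp add: sum_ennreal)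
      finally show ?thesis .
     qed
     have fs: "(\<lambda>x. f n (x, t)) = synth an"
     proof
      fix x
      have "(\<integral>l. an l * chr l x \<partial>cntM) = (\<Sum>l\<in>{l. an l * chr l x \<noteq> 0}. an l * chr l x)"
       by (subst lebesgue_integral_count_space_finite_support) (auto intro: finite_subset[OF _ Ffin[of n]] simp: an_def)
      also have "\<dots> = (\<Sum>l\<in>F n. an l * chr l x)"
       by (rule sum.mono_neutral_left[OF Ffin]) (auto simp: an_def)
      also have "\<dots> = S (F n) (x, t)" by (simp add: S_def an_def)
      finally show "f n (x, t) = synth an x" by (simp add: f_def synth_def)
     qed
     have il: "integrable cubeM (\<lambda>x. w x t)" by (rule l2_integrable[OF elim])
     have isn: "integrable cubeM (\<lambda>x. f n (x, t))" unfolding fs by (rule l2_integrable[OF l2_synth[OF lan]])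
     have "fcoef (\<lambda>x. w x t - f n (x, t)) k = fcoef (\<lambda>x. w x t) k - a k t"
      using fcoef_diff[OF il isn] fcoef_synth[OF han lan] kn by (simp add: fs an_def)
     moreover have "ennreal ((cmod (fcoef (\<lambda>x. w x t - f n (x, t)) k))^2) \<le> (\<integral>\<^sup>+x. ennreal ((w x t - f n (x, t))^2) \<partial>cubeM)"
     proof (cases "l2 (\<lambda>x. w x t - f n (x, t))")
      case True
      have "ennreal ((cmod (fcoef (\<lambda>x. w x t - f n (x, t)) k))^2) \<le> sE 0 (fcoef (\<lambda>x. w x t - f n (x, t)))"
       using sE_point_le[of k 0] by simp
      also have "\<dots> \<le> (\<integral>\<^sup>+x. ennreal ((w x t - f n (x, t))^2) \<partial>cubeM)" by (rule bessel[OF True])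
      finally show ?thesis .
     next
      case False
      have "(\<lambda>x. w x t - f n (x, t)) \<in> bmeas" unfolding w_def by measurable
      then have "(\<integral>\<^sup>+x. ennreal ((w x t - f n (x, t))^2) \<partial>cubeM) = \<infinity>"
       using False by (simp add: l2_def not_less top_unique)
      then show ?thesis by simp
     qed
     ultimately show ?case by (simp add: w_def)
    qed
   qed
   also have "\<dots> = (\<integral>\<^sup>+p. ennreal ((wq p - f n p)^2) \<partial>?Q)"
    by (rule Q.nn_integral_snd) (use wq(1) fmQ in measurable)
   also have "\<dots> \<le> ennreal e" by (rule N) (simp add: n_def)
   finally show ?thesis .
  qed
  have "(\<integral>\<^sup>+t. ennreal ((cmod (fcoef (\<lambda>x. w x t) k - a k t))^2) \<partial>timeM T) \<le> 0"
   by (rule ennreal_le_epsilon) (use le in simp)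
  then have "AE t in timeM T. ennreal ((cmod (fcoef (\<lambda>x. w x t) k - a k t))^2) = 0"
   by (subst nn_integral_0_iff_AE[symmetric]) auto
  then show ?thesis by eventually_elim simp
 qed
 then have "AE t in timeM T. \<forall>k. fcoef (\<lambda>x. w x t) k = a k t" by (simp add: AE_all_countable)
 then show ?thesis using that wL2 energy by blast
qed

subsection \<open>The weak formulation in Fourier coefficients\<close>

lemma tE_const: "T > 0 \<Longrightarrow> tE T s (\<lambda>k t. a k) = sE s a * ennreal T"
 by (simp add: tE_def emeasure_timeM)

text \<open>The inequality missing from Bessel comes from Riesz-Fischer, for coefficients constant
  in time over an interval of length 1: the function obtained has the coefficients of
  \<open>g\<close> at almost every time, hence equals it, and its energy is at most their square
  sum.\<close>

lemma parseval:
 assumes g: "l2 g"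
 shows "(\<integral>\<^sup>+x. ennreal ((g x)^2) \<partial>cubeM) = sE 0 (fcoef g)"
proof (rule antisym)
 have gm: "g \<in> bmeas" using g by (simp add: l2_def)
 have fin: "tE 1 0 (\<lambda>k t. fcoef g k) < \<infinity>"
  using le_less_trans[OF bessel[OF g]] g by (simp add: tE_const l2_def)
 obtain w where w: "L2Q 1 w" "L2Q_energy 1 w \<le> tE 1 0 (\<lambda>k t. fcoef g k)"
  "AE t in timeM 1. \<forall>k. fcoef (\<lambda>x. w x t) k = fcoef g k"
  by (rule riesz_fischer[OF _ _ fin]) (auto intro: herm_fcoef[OF gm])
 have "(\<integral>\<^sup>+t. \<integral>\<^sup>+x. ennreal ((w x t)^2) \<partial>cubeM \<partial>timeM 1) = (\<integral>\<^sup>+t. (\<integral>\<^sup>+x. ennreal ((g x)^2) \<partial>cubeM) \<partial>timeM 1)"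
 proof (rule nn_integral_cong_AE)
  show "AE t in timeM 1. (\<integral>\<^sup>+x. ennreal ((w x t)^2) \<partial>cubeM) = (\<integral>\<^sup>+x. ennreal ((g x)^2) \<partial>cubeM)"
   using w(3) L2Q_slice[OF w(1)]
  proof eventually_elim
   case (elim t)
   have "AE x in cubeM. w x t = g x"
    by (rule AE_eq_of_fcoef_eq) (use elim g in \<open>auto intro: l2_integrable\<close>)
   then show ?case by (intro nn_integral_cong_AE) (auto elim: eventually_mono)
  qed
 qed
 also have "\<dots> = (\<integral>\<^sup>+x. ennreal ((g x)^2) \<partial>cubeM)" by (simp add: emeasure_timeM)
 finally show "(\<integral>\<^sup>+x. ennreal ((g x)^2) \<partial>cubeM) \<le> sE 0 (fcoef g)"
  using w(1,2) L2Q_energy_eq(2)[of w 1] by (simp add: tE_const L2Q_iff)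
qed (rule bessel[OF g])

lemma L2Q_mult_integrable:
 fixes u :: "real^'d \<Rightarrow> real \<Rightarrow> real"
 assumes u: "L2Q T u" and \<psi>: "l2 \<psi>" and [measurable]: "\<phi> \<in> bmeas" and B: "\<And>t. \<bar>\<phi> t\<bar> \<le> B"
 shows "integrable (QM T) (\<lambda>p. u (fst p) (snd p) * \<psi> (fst p) * \<phi> (snd p))"
proof (rule Bochner_Integration.integrable_bound)
 interpret Q: pair_sigma_finite "cubeM :: (real^'d) measure" "timeM T" by (rule pair_sigma_finite_Q)
 have [measurable]: "case_prod u \<in> bmeas2" using u by (simp add: L2Q_iff)
 have \<psi>m [measurable]: "\<psi> \<in> bmeas" using \<psi> by (simp add: l2_def)
 have B0: "B \<ge> 0" using B[of 0] by linarith
 have "L2Q T (\<lambda>x t. \<psi> x)"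
 proof -
  have m: "case_prod (\<lambda>x (t::real). \<psi> x) \<in> bmeas2" by measurable
  have "emeasure (timeM T) UNIV < \<infinity>"
   using finite_measure.emeasure_finite[OF finite_measure_timeM, of T UNIV] by (simp add: less_top)
  then have "L2Q_energy T (\<lambda>x t. \<psi> x) < \<infinity>"
   using \<psi> by (subst L2Q_energy_eq(2)[OF m]) (simp add: l2_def ennreal_mult_less_top)
  then show ?thesis using m by (simp add: L2Q_iff)
 qed
 from L2Q_integrable(2)[OF this] L2Q_integrable(2)[OF u]
 show "integrable (QM T) (\<lambda>p. B * ((case_prod u p)^2 + (case_prod (\<lambda>x t. \<psi> x) p)^2))" by auto
 show "(\<lambda>p. u (fst p) (snd p) * \<psi> (fst p) * \<phi> (snd p)) \<in> borel_measurable (QM T)"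
  unfolding borel_measurable_Q borel_prod[symmetric] by measurable
 show "AE p in QM T. norm (u (fst p) (snd p) * \<psi> (fst p) * \<phi> (snd p)) \<le> norm (B * ((case_prod u p)^2 + (case_prod (\<lambda>x t. \<psi> x) p)^2))"
 proof (rule AE_I2)
  fix p :: "(real^'d) \<times> real"
  define a b where "a = \<bar>u (fst p) (snd p)\<bar>" and "b = \<bar>\<psi> (fst p)\<bar>"
  have "0 \<le> (a - b)^2" "0 \<le> a * b" by (simp_all add: a_def b_def)
  moreover have "(a - b)^2 = a^2 + b^2 - 2 * (a * b)" by (simp add: power2_eq_square algebra_simps)
  ultimately have "a * b \<le> a^2 + b^2" by linarith
  then have "a * b * \<bar>\<phi> (snd p)\<bar> \<le> (a^2 + b^2) * B" by (intro mult_mono B) (auto simp: a_def b_def)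
  then show "norm (u (fst p) (snd p) * \<psi> (fst p) * \<phi> (snd p)) \<le> norm (B * ((case_prod u p)^2 + (case_prod (\<lambda>x t. \<psi> x) p)^2))"
   using B0 by (simp add: abs_mult a_def b_def split_beta mult.commute)
 qed
qed

lemma l2_iff_weak: "\<psi> \<in> borel_measurable lborel \<and> (\<integral>\<^sup>+ x. indicator tcube x * ennreal ((\<psi> x)^2) \<partial>lborel) < \<infinity> \<longleftrightarrow> l2 \<psi>"
 unfolding l2_def by (auto simp: nn_integral_cubeM)

lemma weak_dt_iff:
 fixes u w :: "real^'d \<Rightarrow> real \<Rightarrow> real"
 assumes [measurable]: "case_prod u \<in> bmeas2" "case_prod w \<in> bmeas2"
 shows "weak_dt T j u w \<longleftrightarrow> (\<forall>\<psi> \<eta>. l2 \<psi> \<longrightarrow> test_fun T \<eta> \<longrightarrow>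
  (\<integral>p. u (fst p) (snd p) * \<psi> (fst p) * (deriv ^^ j) \<eta> (snd p) \<partial>(QM T))
   = (-1)^j * (\<integral>p. w (fst p) (snd p) * \<psi> (fst p) * \<eta> (snd p) \<partial>(QM T)))"
proof -
 have *: "(\<integral>p. indicator (Qset T) p * (h (fst p) (snd p) * \<psi> (fst p) * \<phi> (snd p)) \<partial>lborel)
   = (\<integral>p. h (fst p) (snd p) * \<psi> (fst p) * \<phi> (snd p) \<partial>(QM T))"
  if hm [measurable]: "case_prod h \<in> bmeas2" and \<psi>: "l2 \<psi>" and \<phi>: "test_fun T \<phi>"
  for h :: "real^'d \<Rightarrow> real \<Rightarrow> real" and \<psi> \<phi>
 proof -
  have [measurable]: "\<psi> \<in> bmeas" using \<psi> by (simp add: l2_def)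
  note [measurable] = test_fun_measurable[OF \<phi>]
  have "(\<lambda>p. h (fst p) (snd p) * \<psi> (fst p) * \<phi> (snd p)) \<in> bmeas2" by measurable
  from integral_Q_eq[OF this, of T] show ?thesis by simp
 qed
 show ?thesis
  unfolding weak_dt_def
 proof (intro iffI allI impI)
  fix \<psi> :: "real^'d \<Rightarrow> real" and \<eta>
  assume H: "\<forall>\<psi> \<eta>. \<psi> \<in> borel_measurable lborel \<longrightarrow>
   (\<integral>\<^sup>+ x. indicator tcube x * ennreal ((\<psi> x)^2) \<partial>lborel) < \<infinity> \<longrightarrow> test_fun T \<eta> \<longrightarrow>
   (\<integral> p. indicator (Qset T) p * (u (fst p) (snd p) * \<psi> (fst p) * (deriv ^^ j) \<eta> (snd p)) \<partial>lborel)
   = (-1)^j * (\<integral> p. indicator (Qset T) p * (w (fst p) (snd p) * \<psi> (fst p) * \<eta> (snd p)) \<partial>lborel)"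
   and \<psi>: "l2 \<psi>" and \<eta>: "test_fun T \<eta>"
  show "(\<integral>p. u (fst p) (snd p) * \<psi> (fst p) * (deriv ^^ j) \<eta> (snd p) \<partial>(QM T))
   = (-1)^j * (\<integral>p. w (fst p) (snd p) * \<psi> (fst p) * \<eta> (snd p) \<partial>(QM T))"
  proof -
   have "\<psi> \<in> borel_measurable lborel" "(\<integral>\<^sup>+ x. indicator tcube x * ennreal ((\<psi> x)^2) \<partial>lborel) < \<infinity>"
    using l2_iff_weak[of \<psi>] \<psi> by blast+
   from H[rule_format, OF this \<eta>] show ?thesis
    by (simp only: *[OF assms(1) \<psi> test_fun_deriv_pow[OF \<eta>]] *[OF assms(2) \<psi> \<eta>])
  qed
 next
  fix \<psi> :: "real^'d \<Rightarrow> real" and \<eta>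
  assume H: "\<forall>\<psi> \<eta>. l2 \<psi> \<longrightarrow> test_fun T \<eta> \<longrightarrow>
   (\<integral>p. u (fst p) (snd p) * \<psi> (fst p) * (deriv ^^ j) \<eta> (snd p) \<partial>(QM T))
    = (-1)^j * (\<integral>p. w (fst p) (snd p) * \<psi> (fst p) * \<eta> (snd p) \<partial>(QM T))"
   and "\<psi> \<in> borel_measurable lborel" "(\<integral>\<^sup>+ x. indicator tcube x * ennreal ((\<psi> x)^2) \<partial>lborel) < \<infinity>"
   and \<eta>: "test_fun T \<eta>"
  then have \<psi>: "l2 \<psi>" using l2_iff_weak by blast
  show "(\<integral> p. indicator (Qset T) p * (u (fst p) (snd p) * \<psi> (fst p) * (deriv ^^ j) \<eta> (snd p)) \<partial>lborel)
   = (-1)^j * (\<integral> p. indicator (Qset T) p * (w (fst p) (snd p) * \<psi> (fst p) * \<eta> (snd p)) \<partial>lborel)"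
   using H[rule_format, OF \<psi> \<eta>]
   by (simp only: *[OF assms(1) \<psi> test_fun_deriv_pow[OF \<eta>]] *[OF assms(2) \<psi> \<eta>])
 qed
qed

text \<open>Weak derivatives are tested against all square integrable \<open>\<psi>\<close>, but
  characters suffice: after integration in time, the defect is an integrable function of
  \<open>x\<close> all of whose coefficients vanish.\<close>

lemma weak_dtI:
 fixes u w :: "real^'d \<Rightarrow> real \<Rightarrow> real"
 assumes u: "L2Q T u" and w: "L2Q T w"
  and eq: "\<And>k \<eta>. test_fun T \<eta> \<Longrightarrow> (\<integral>t. fcoef (\<lambda>x. u x t) k * of_real ((deriv ^^ j) \<eta> t) \<partial>timeM T)
    = (-1)^j * (\<integral>t. fcoef (\<lambda>x. w x t) k * of_real (\<eta> t) \<partial>timeM T)"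
 shows "weak_dt T j u w"
proof -
 interpret Q: pair_sigma_finite "cubeM :: (real^'d) measure" "timeM T" by (rule pair_sigma_finite_Q)
 let ?Q = "QM T"
 have um [measurable]: "case_prod u \<in> bmeas2" using u by (simp add: L2Q_iff)
 have wm [measurable]: "case_prod w \<in> bmeas2" using w by (simp add: L2Q_iff)
 show ?thesis
  unfolding weak_dt_iff[OF um wm]
 proof (intro allI impI)
  fix \<psi> :: "real^'d \<Rightarrow> real" and \<eta> assume \<psi>: "l2 \<psi>" and \<eta>: "test_fun T \<eta>"
  define \<phi> where "\<phi> = (deriv ^^ j) \<eta>"
  have \<phi>: "test_fun T \<phi>" unfolding \<phi>_def by (rule test_fun_deriv_pow[OF \<eta>])
  note \<eta>m [measurable] = test_fun_measurable[OF \<eta>] and \<phi>m [measurable] = test_fun_measurable[OF \<phi>]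
  have \<psi>m [measurable]: "\<psi> \<in> bmeas" using \<psi> by (simp add: l2_def)
  obtain B where B: "\<And>t. \<bar>\<eta> t\<bar> \<le> B" using test_fun_bounded[OF \<eta>] by blast
  obtain B' where B': "\<And>t. \<bar>\<phi> t\<bar> \<le> B'" using test_fun_bounded[OF \<phi>] by blast
  define c :: real where "c = (-1)^j"
  \<comment> \<open>The defect before multiplication by \<open>\<psi>\<close>. Its time integral
    \<open>h\<close> vanishes almost everywhere, a fact independent of
    \<open>\<psi>\<close>.\<close>
  define G where "G x t = u x t * \<phi> t - c * (w x t * \<eta> t)" for x t
  have one: "l2 (\<lambda>x::real^'d. 1)" by (rule l2_bounded[where B = 1]) auto
  have iG: "integrable ?Q (case_prod G)"
   using L2Q_mult_integrable[OF u one \<phi>m B'] L2Q_mult_integrable[OF w one \<eta>m B]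
   by (simp add: G_def split_beta')
  define h where "h x = (\<integral>t. G x t \<partial>timeM T)" for x
  have ih: "integrable cubeM h" unfolding h_def using Q.integrable_fst'[OF iG] by simp
  have hm: "h \<in> bmeas" using borel_measurable_integrable[OF ih] by simp
  have iGc: "integrable ?Q (\<lambda>p. complex_of_real (G (fst p) (snd p)) * chr (- k) (fst p))" for k
   using Q_integral_chr(1)[OF u \<phi>m B', of "- k"] Q_integral_chr(1)[OF w \<eta>m B, of "- k"]
   by (simp add: G_def left_diff_distrib mult.assoc)
  have "fcoef h k = 0" for k
  proof -
   have "fcoef h k = (\<integral>x. \<integral>t. complex_of_real (G x t) * chr (- k) x \<partial>timeM T \<partial>cubeM)"
    unfolding fcoef_eq[OF hm] by (simp add: h_def flip: integral_complex_of_real)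
   also have "\<dots> = (\<integral>p. complex_of_real (G (fst p) (snd p)) * chr (- k) (fst p) \<partial>?Q)"
    using Q.integral_fst'[OF iGc] by simp
   also have "\<dots> = (\<integral>p. complex_of_real (u (fst p) (snd p) * \<phi> (snd p)) * chr (- k) (fst p) \<partial>?Q)
      - of_real c * (\<integral>p. complex_of_real (w (fst p) (snd p) * \<eta> (snd p)) * chr (- k) (fst p) \<partial>?Q)"
   proof -
    have "(\<integral>p. complex_of_real (G (fst p) (snd p)) * chr (- k) (fst p) \<partial>?Q)
     = (\<integral>p. complex_of_real (u (fst p) (snd p) * \<phi> (snd p)) * chr (- k) (fst p)
       - of_real c * (complex_of_real (w (fst p) (snd p) * \<eta> (snd p)) * chr (- k) (fst p)) \<partial>?Q)"
     by (intro Bochner_Integration.integral_cong) (auto simp: G_def algebra_simps)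
    then show ?thesis
     using Q_integral_chr(1)[OF u \<phi>m B', of "- k"] Q_integral_chr(1)[OF w \<eta>m B, of "- k"] by simp
   qed
   also have "\<dots> = 0"
    unfolding Q_integral_chr(2)[OF u \<phi>m B'] Q_integral_chr(2)[OF w \<eta>m B]
    using eq[OF \<eta>, of k] by (simp add: \<phi>_def c_def)
   finally show ?thesis .
  qed
  then have h0: "AE x in cubeM. h x = 0" by (intro fcoef_eq_0_imp_AE_eq_0 ih)
  have iu: "integrable ?Q (\<lambda>p. u (fst p) (snd p) * \<psi> (fst p) * \<phi> (snd p))"
   by (rule L2Q_mult_integrable[OF u \<psi> \<phi>m B'])
  have iw: "integrable ?Q (\<lambda>p. w (fst p) (snd p) * \<psi> (fst p) * \<eta> (snd p))"
   by (rule L2Q_mult_integrable[OF w \<psi> \<eta>m B])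
  have iG\<psi>: "integrable ?Q (\<lambda>p. \<psi> (fst p) * G (fst p) (snd p))"
  proof -
   have "(\<lambda>p. \<psi> (fst p) * G (fst p) (snd p)) = (\<lambda>p. u (fst p) (snd p) * \<psi> (fst p) * \<phi> (snd p) - c * (w (fst p) (snd p) * \<psi> (fst p) * \<eta> (snd p)))"
    by (auto simp: G_def algebra_simps)
   then show ?thesis using iu iw by simp
  qed
  have "(\<integral>p. u (fst p) (snd p) * \<psi> (fst p) * \<phi> (snd p) \<partial>?Q) - c * (\<integral>p. w (fst p) (snd p) * \<psi> (fst p) * \<eta> (snd p) \<partial>?Q)
   = (\<integral>p. \<psi> (fst p) * G (fst p) (snd p) \<partial>?Q)"
  proof -
   have "(\<integral>p. \<psi> (fst p) * G (fst p) (snd p) \<partial>?Q) = (\<integral>p. u (fst p) (snd p) * \<psi> (fst p) * \<phi> (snd p) - c * (w (fst p) (snd p) * \<psi> (fst p) * \<eta> (snd p)) \<partial>?Q)"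
    by (intro Bochner_Integration.integral_cong) (auto simp: G_def algebra_simps)
   then show ?thesis using iu iw by simp
  qed
  also have "\<dots> = (\<integral>x. \<psi> x * h x \<partial>cubeM)"
   using Q.integral_fst'[OF iG\<psi>] by (simp add: h_def)
  also have "\<dots> = (\<integral>x. 0 \<partial>(cubeM :: (real^'d) measure))"
   by (rule integral_cong_AE) (use h0 hm in \<open>auto elim: eventually_mono\<close>)
  finally show "(\<integral>p. u (fst p) (snd p) * \<psi> (fst p) * (deriv ^^ j) \<eta> (snd p) \<partial>?Q)
   = (-1)^j * (\<integral>p. w (fst p) (snd p) * \<psi> (fst p) * \<eta> (snd p) \<partial>?Q)"
   by (simp add: \<phi>_def c_def)
 qed
qed

lemma weak_dt_coef:
 fixes u w :: "real^'d \<Rightarrow> real \<Rightarrow> real"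
 assumes u: "L2Q T u" and w: "L2Q T w" and wd: "weak_dt T j u w" and \<eta>: "test_fun T \<eta>"
 shows "(\<integral>t. fcoef (\<lambda>x. u x t) k * of_real ((deriv ^^ j) \<eta> t) \<partial>timeM T)
    = (-1)^j * (\<integral>t. fcoef (\<lambda>x. w x t) k * of_real (\<eta> t) \<partial>timeM T)"
proof -
 let ?Q = "QM T"
 have um [measurable]: "case_prod u \<in> bmeas2" using u by (simp add: L2Q_iff)
 have wm [measurable]: "case_prod w \<in> bmeas2" using w by (simp add: L2Q_iff)
 define \<phi> where "\<phi> = (deriv ^^ j) \<eta>"
 have \<phi>: "test_fun T \<phi>" unfolding \<phi>_def by (rule test_fun_deriv_pow[OF \<eta>])
 obtain B where B: "\<And>t. \<bar>\<eta> t\<bar> \<le> B" using test_fun_bounded[OF \<eta>] by blast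
 obtain B' where B': "\<And>t. \<bar>\<phi> t\<bar> \<le> B'" using test_fun_bounded[OF \<phi>] by blast
 note iu = Q_integral_chr[OF u test_fun_measurable[OF \<phi>] B', of "- k"]
 note iw = Q_integral_chr[OF w test_fun_measurable[OF \<eta>] B, of "- k"]
 \<comment> \<open>Admissible \<open>\<psi>\<close> are real, so the character is tested through its
   real and imaginary parts.\<close>
 have l2c: "l2 (\<lambda>x::real^'d. Re (chr (- k) x))" "l2 (\<lambda>x::real^'d. Im (chr (- k) x))"
  by (auto intro!: l2_bounded[where B = 1] order_trans[OF abs_Re_le_cmod] order_trans[OF abs_Im_le_cmod])
 note wd' = wd[unfolded weak_dt_iff[OF um wm], rule_format]
 have "(\<integral>p. complex_of_real (u (fst p) (snd p) * \<phi> (snd p)) * chr (- k) (fst p) \<partial>?Q)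
   = (-1)^j * (\<integral>p. complex_of_real (w (fst p) (snd p) * \<eta> (snd p)) * chr (- k) (fst p) \<partial>?Q)" (is "?L = (-1)^j * ?R")
 proof (rule complex_eqI)
  have sgn: "Re ((-1)^j * z) = (-1)^j * Re z" "Im ((-1)^j * z) = (-1)^j * Im z" for z
   by (cases "even j"; simp)+
  have "Re ?L = (\<integral>p. u (fst p) (snd p) * Re (chr (- k) (fst p)) * \<phi> (snd p) \<partial>?Q)"
   by (subst integral_Re[OF iu(1), symmetric]) (simp add: ac_simps)
  also have "\<dots> = (-1)^j * (\<integral>p. w (fst p) (snd p) * Re (chr (- k) (fst p)) * \<eta> (snd p) \<partial>?Q)"
   unfolding \<phi>_def by (rule wd'[OF l2c(1) \<eta>])
  also have "\<dots> = (-1)^j * Re ?R"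
   by (subst integral_Re[OF iw(1), symmetric]) (simp add: ac_simps)
  finally show "Re ?L = Re ((-1)^j * ?R)" by (simp add: sgn)
  have "Im ?L = (\<integral>p. u (fst p) (snd p) * Im (chr (- k) (fst p)) * \<phi> (snd p) \<partial>?Q)"
   by (subst integral_Im[OF iu(1), symmetric]) (simp add: ac_simps)
  also have "\<dots> = (-1)^j * (\<integral>p. w (fst p) (snd p) * Im (chr (- k) (fst p)) * \<eta> (snd p) \<partial>?Q)"
   unfolding \<phi>_def by (rule wd'[OF l2c(2) \<eta>])
  also have "\<dots> = (-1)^j * Im ?R"
   by (subst integral_Im[OF iw(1), symmetric]) (simp add: ac_simps)
  finally show "Im ?L = Im ((-1)^j * ?R)" by (simp add: sgn)
 qed
 then show ?thesis unfolding iu(2) iw(2) by (simp add: \<phi>_def)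
qed

lemma weak_lap_iff:
 fixes u L :: "real^'d \<Rightarrow> real \<Rightarrow> real"
 assumes u: "L2Q T u" and L: "L2Q T L"
 shows "weak_lap T u L \<longleftrightarrow> (\<forall>k \<eta>. test_fun T \<eta> \<longrightarrow>
   of_real (-(4 * pi^2 * ksq k)) * (\<integral>t. fcoef (\<lambda>x. u x t) k * of_real (\<eta> t) \<partial>timeM T)
   = (\<integral>t. fcoef (\<lambda>x. L x t) k * of_real (\<eta> t) \<partial>timeM T))"
proof -
 let ?Q = "QM T"
 have um [measurable]: "case_prod u \<in> bmeas2" using u by (simp add: L2Q_iff)
 have Lm [measurable]: "case_prod L \<in> bmeas2" using L by (simp add: L2Q_iff)
 have 1: "(\<integral>p. indicator (Qset T) p * (complex_of_real (u (fst p) (snd p) * \<eta> (snd p))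
       * complex_of_real c * cis (2*pi*kdot k (fst p))) \<partial>lborel)
   = of_real c * (\<integral>t. fcoef (\<lambda>x. u x t) (- k) * of_real (\<eta> t) \<partial>timeM T)"
  if \<eta>: "test_fun T \<eta>" and [measurable]: "case_prod u \<in> bmeas2" and u: "L2Q T u"
  for u :: "real^'d \<Rightarrow> real \<Rightarrow> real" and \<eta> k c
 proof -
  obtain B where B: "\<And>t. \<bar>\<eta> t\<bar> \<le> B" using test_fun_bounded[OF \<eta>] by blast
  note [measurable] = test_fun_measurable[OF \<eta>]
  have "(\<integral>p. indicator (Qset T) p * (complex_of_real (u (fst p) (snd p) * \<eta> (snd p))
       * complex_of_real c * cis (2*pi*kdot k (fst p))) \<partial>lborel)
    = (\<integral>p. indicator (Qset T) p *\<^sub>R (of_real c * (complex_of_real (u (fst p) (snd p) * \<eta> (snd p)) * chr k (fst p))) \<partial>lborel)"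
   by (intro Bochner_Integration.integral_cong) (auto simp: chr_def indicator_def)
  also have "\<dots> = (\<integral>p. of_real c * (complex_of_real (u (fst p) (snd p) * \<eta> (snd p)) * chr k (fst p)) \<partial>?Q)"
   by (rule integral_Q_eq) measurable
  also have "\<dots> = of_real c * (\<integral>p. complex_of_real (u (fst p) (snd p) * \<eta> (snd p)) * chr k (fst p) \<partial>?Q)"
   by (rule integral_mult_right_zero)
  finally show ?thesis by (simp only: Q_integral_chr(2)[OF u test_fun_measurable[OF \<eta>] B])
 qed
 have "weak_lap T u L \<longleftrightarrow> (\<forall>k \<eta>. test_fun T \<eta> \<longrightarrow>
   of_real (-(4 * pi^2 * ksq k)) * (\<integral>t. fcoef (\<lambda>x. u x t) (- k) * of_real (\<eta> t) \<partial>timeM T)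
   = (\<integral>t. fcoef (\<lambda>x. L x t) (- k) * of_real (\<eta> t) \<partial>timeM T))"
 proof -
  have 2: "(\<integral>p. indicator (Qset T) p * (complex_of_real (L (fst p) (snd p) * \<eta> (snd p)) * cis (2*pi*kdot k (fst p))) \<partial>lborel)
   = (\<integral>t. fcoef (\<lambda>x. L x t) (- k) * of_real (\<eta> t) \<partial>timeM T)" if "test_fun T \<eta>" for \<eta> k
  proof -
   have "(\<integral>p. indicator (Qset T) p * (complex_of_real (L (fst p) (snd p) * \<eta> (snd p)) * complex_of_real 1 * cis (2*pi*kdot k (fst p))) \<partial>lborel)
    = of_real 1 * (\<integral>t. fcoef (\<lambda>x. L x t) (- k) * of_real (\<eta> t) \<partial>timeM T)"
    by (rule 1[OF that Lm L])
   then show ?thesis by (simp only: of_real_1 mult_1_right mult_1)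
  qed
  show ?thesis unfolding weak_lap_def
   by (intro iff_allI imp_cong refl) (simp only: 1[OF _ um u] 2)
 qed
 also have "\<dots> \<longleftrightarrow> (\<forall>k \<eta>. test_fun T \<eta> \<longrightarrow>
   of_real (-(4 * pi^2 * ksq k)) * (\<integral>t. fcoef (\<lambda>x. u x t) k * of_real (\<eta> t) \<partial>timeM T)
   = (\<integral>t. fcoef (\<lambda>x. L x t) k * of_real (\<eta> t) \<partial>timeM T))"
 proof -
  \<comment> \<open>Testing with the character at \<open>k\<close> picks out the coefficient at
    \<open>- k\<close>; as \<open>ksq\<close> is even, the quantifier over all frequencies absorbs
    the sign.\<close>
  define P where "P k = (\<forall>\<eta>. test_fun T \<eta> \<longrightarrow> of_real (-(4 * pi^2 * ksq k)) * (\<integral>t. fcoef (\<lambda>x. u x t) k * of_real (\<eta> t) \<partial>timeM T)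
   = (\<integral>t. fcoef (\<lambda>x. L x t) k * of_real (\<eta> t) \<partial>timeM T))" for k
  have "(\<forall>k. P (- k)) \<longleftrightarrow> (\<forall>k. P k)" by (metis minus_minus)
  then show ?thesis unfolding P_def ksq_minus .
 qed
 finally show ?thesis .
qed

section \<open>Modification on null sets of the cylinder\<close>

lemma weak_dt_cong:
 fixes u v w :: "real^'d \<Rightarrow> real \<Rightarrow> real"
 assumes um [measurable]: "case_prod u \<in> bmeas2"
  and vm [measurable]: "case_prod v \<in> bmeas2"
  and wm: "case_prod w \<in> bmeas2"
  and eq: "AE p in lborel. p \<in> Qset T \<longrightarrow> case_prod u p = case_prod v p"
  and wd: "weak_dt T j v w"
 shows "weak_dt T j u w"
 unfolding weak_dt_iff[OF um wm]
proof (intro allI impI)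
 let ?Q = "QM T"
 fix \<psi> :: "real^'d \<Rightarrow> real" and \<eta> assume \<psi>: "l2 \<psi>" and \<eta>: "test_fun T \<eta>"
 note [measurable] = test_fun_measurable[OF test_fun_deriv_pow[OF \<eta>, of j]]
 have [measurable]: "\<psi> \<in> bmeas" using \<psi> by (simp add: l2_def)
 have "(\<integral>p. u (fst p) (snd p) * \<psi> (fst p) * (deriv ^^ j) \<eta> (snd p) \<partial>?Q)
   = (\<integral>p. v (fst p) (snd p) * \<psi> (fst p) * (deriv ^^ j) \<eta> (snd p) \<partial>?Q)"
 proof (rule integral_cong_AE)
  show "(\<lambda>p. u (fst p) (snd p) * \<psi> (fst p) * (deriv ^^ j) \<eta> (snd p)) \<in> borel_measurable ?Q"
   "(\<lambda>p. v (fst p) (snd p) * \<psi> (fst p) * (deriv ^^ j) \<eta> (snd p)) \<in> borel_measurable ?Q"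
   unfolding borel_measurable_Q borel_prod[symmetric] by measurable
  have "AE p in ?Q. case_prod u p = case_prod v p" using eq by (simp only: AE_Q)
  then show "AE p in ?Q. u (fst p) (snd p) * \<psi> (fst p) * (deriv ^^ j) \<eta> (snd p) = v (fst p) (snd p) * \<psi> (fst p) * (deriv ^^ j) \<eta> (snd p)"
   by eventually_elim (simp add: split_beta)
 qed
 also have "\<dots> = (-1)^j * (\<integral>p. w (fst p) (snd p) * \<psi> (fst p) * \<eta> (snd p) \<partial>?Q)"
  using wd[unfolded weak_dt_iff[OF vm wm]] \<psi> \<eta> by blast
 finally show "(\<integral>p. u (fst p) (snd p) * \<psi> (fst p) * (deriv ^^ j) \<eta> (snd p) \<partial>?Q) = (-1)^j * (\<integral>p. w (fst p) (snd p) * \<psi> (fst p) * \<eta> (snd p) \<partial>?Q)" .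
qed

text \<open>A family of derivatives of \<open>v\<close> serves for \<open>u\<close> once the entry
  of order 0, which must be the function itself, is replaced. As \<open>r \<ge> 2\<close>, the top
  order is at least 1, so the entry in the fractional seminorm stays the same.\<close>

lemma par_energy_mono_AE:
 fixes u v :: "real^'d \<Rightarrow> real \<Rightarrow> real"
 assumes um [measurable]: "case_prod u \<in> bmeas2"
  and vm [measurable]: "case_prod v \<in> bmeas2"
  and eq: "AE p in lborel. p \<in> Qset T \<longrightarrow> case_prod u p = case_prod v p"
  and r: "r \<ge> 2"
 shows "par_energy r T u \<le> par_energy r T v"
proof -
 have "Measurable.pred (borel \<Otimes>\<^sub>M borel) (\<lambda>p. case_prod u p = case_prod v p)" by measurable
 from AE_Q_iff[OF this] eq have ae: "AE t in timeM T. AE x in cubeM. u x t = v x t" by simp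
 have "(\<integral>\<^sup>+ t. indicator {0<..<T} t * sob_energy r (\<lambda>x. u x t) \<partial>lborel)
   = (\<integral>\<^sup>+ t. indicator {0<..<T} t * sob_energy r (\<lambda>x. v x t) \<partial>lborel)"
 proof (rule nn_integral_cong_AE)
  show "AE t in lborel. indicator {0<..<T} t * sob_energy r (\<lambda>x. u x t) = indicator {0<..<T} t * sob_energy r (\<lambda>x. v x t)"
   using ae unfolding AE_timeM
  proof eventually_elim
   case (elim t)
   have "(\<lambda>x. u x t) \<in> bmeas" "(\<lambda>x. v x t) \<in> bmeas" by measurable
   then have "fcoef (\<lambda>x. u x t) = fcoef (\<lambda>x. v x t)" if "t \<in> {0<..<T}"
    using elim that by (intro ext fcoef_cong_AE) auto
   then show ?case by (cases "t \<in> {0<..<T}") (auto simp: sob_energy_def)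
  qed
 qed
 moreover have "time_energy (r/2) T u \<le> time_energy (r/2) T v"
 proof -
  define m where "m = nat \<lfloor>r/2\<rfloor>"
  have m: "m \<ge> 1" using r by (simp add: m_def le_nat_iff le_floor_iff)
  have euv: "L2Q_energy T u = L2Q_energy T v"
  proof -
   have "AE p in QM T. case_prod u p = case_prod v p" using eq by (simp only: AE_Q)
   then show ?thesis
    unfolding L2Q_energy_eq(1)[OF um] L2Q_energy_eq(1)[OF vm]
    by (intro nn_integral_cong_AE) (auto elim: eventually_mono)
  qed
  show ?thesis
   unfolding time_energy_def Let_def m_def[symmetric]
  proof (rule INF_mono)
   fix w assume "w \<in> {w. w 0 = v \<and> (\<forall>j\<le>m. L2Q T (w j) \<and> weak_dt T j v (w j))}"
   then have w: "w 0 = v" "\<And>j. j \<le> m \<Longrightarrow> L2Q T (w j)" "\<And>j. j \<le> m \<Longrightarrow> weak_dt T j v (w j)" by auto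
   define w' where "w' = w(0 := u)"
   have L: "L2Q T (w' j)" if "j \<le> m" for j
    using w(1) w(2)[OF that] um euv by (cases "j = 0") (auto simp: w'_def L2Q_iff)
   have W: "weak_dt T j u (w' j)" if "j \<le> m" for j
   proof (cases "j = 0")
    case True
    then show ?thesis by (simp add: w'_def weak_dt_def)
   next
    case False
    then show ?thesis
     using weak_dt_cong[OF um vm _ eq w(3)[OF that]] w(2)[OF that] by (simp add: w'_def L2Q_iff)
   qed
   have "(\<Sum>j\<le>m. L2Q_energy T (w' j)) = (\<Sum>j\<le>m. L2Q_energy T (w j))"
    by (rule sum.cong) (auto simp: w'_def w(1) euv)
   moreover have "w' m = w m" using m by (simp add: w'_def)
   ultimately show "\<exists>w'\<in>{w. w 0 = u \<and> (\<forall>j\<le>m. L2Q T (w j) \<and> weak_dt T j u (w j))}.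
     (\<Sum>j\<le>m. L2Q_energy T (w' j)) + (if 0 < r / 2 - real m then slob_energy T (r / 2 - real m) (w' m) else 0)
     \<le> (\<Sum>j\<le>m. L2Q_energy T (w j)) + (if 0 < r / 2 - real m then slob_energy T (r / 2 - real m) (w m) else 0)"
    using L W by (intro bexI[of _ w']) (auto simp: w'_def)
  qed
 qed
 ultimately show ?thesis unfolding par_energy_def by (simp add: add_left_mono)
qed

subsection \<open>Dyson series for the coefficient system\<close>

text \<open>Dominated convergence in the lattice sum, with the summable majorant
  \<open>cmod (F (k - l)) * B\<close>.\<close>

lemma conv_continuous:
 fixes F :: "int^'d \<Rightarrow> complex" and v :: "int^'d \<Rightarrow> real \<Rightarrow> complex"
 assumes F: "l1 F < \<infinity>" and v: "\<And>l. continuous_on S (v l)" and B: "\<And>l t. t \<in> S \<Longrightarrow> cmod (v l t) \<le> B"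
 shows "continuous_on S (\<lambda>t. conv F (\<lambda>l. v l t) k)"
 unfolding continuous_on_sequentially
proof (intro allI ballI impI)
 fix x :: "nat \<Rightarrow> real" and a assume a: "a \<in> S" and x: "(\<forall>n. x n \<in> S) \<and> x \<longlonglongrightarrow> a"
 have "(\<lambda>n. \<integral>l. F (k - l) * v l (x n) \<partial>cntM) \<longlonglongrightarrow> (\<integral>l. F (k - l) * v l a \<partial>cntM)"
 proof (rule integral_dominated_convergence[where w = "\<lambda>l. cmod (F (k - l)) * B"])
  have "integrable (cntM) (\<lambda>l. F (k - l))"
   by (subst integrable_bij_count_space[OF bij_minus_left]) (rule integrable_l1[OF F])
  then show "integrable (cntM) (\<lambda>l. cmod (F (k - l)) * B)" by simp
  show "AE l in cntM. (\<lambda>n. F (k - l) * v l (x n)) \<longlonglongrightarrow> F (k - l) * v l a"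
  proof (rule AE_I2)
   fix l
   have "(\<lambda>n. v l (x n)) \<longlonglongrightarrow> v l a"
    using v[of l] a x unfolding continuous_on_sequentially by (auto simp: o_def)
   then show "(\<lambda>n. F (k - l) * v l (x n)) \<longlonglongrightarrow> F (k - l) * v l a" by (intro tendsto_intros)
  qed
  show "AE l in cntM. norm (F (k - l) * v l (x n)) \<le> cmod (F (k - l)) * B" for n
   using x B by (auto simp: norm_mult intro!: AE_I2 mult_left_mono)
 qed auto
 then show "((\<lambda>t. conv F (\<lambda>l. v l t) k) \<circ> x) \<longlonglongrightarrow> conv F (\<lambda>l. v l a) k"
  by (simp add: conv_def o_def)
qed

text \<open>Duhamel's integral of \<open>g\<close> against the kernel
  \<open>exp (- \<nu> * (t - s))\<close>, with the factor depending on \<open>t\<close> taken out so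
  that the product rule and the fundamental theorem give its derivative.\<close>

definition duh :: "real \<Rightarrow> (real \<Rightarrow> complex) \<Rightarrow> real \<Rightarrow> complex" where
 "duh \<nu> g t = of_real (exp (- \<nu> * t)) * integral {0..t} (\<lambda>s. of_real (exp (\<nu> * s)) * g s)"

lemma nn_integral_exp_le:
 assumes "\<mu> > 0" "t \<ge> 0"
 shows "(\<integral>\<^sup>+s. ennreal (exp (- \<mu> * (t - s))) * indicator {0..t} s \<partial>lborel) \<le> ennreal (1 / \<mu>)"
proof -
 have "(\<integral>\<^sup>+s. ennreal (exp (- \<mu> * (t - s))) * indicator {0..t} s \<partial>lborel) = exp (- \<mu> * (t - t)) / \<mu> - exp (- \<mu> * (t - 0)) / \<mu>"
  by (rule nn_integral_FTC_Icc) (use assms in \<open>auto intro!: derivative_eq_intros\<close>)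
 also have "\<dots> \<le> ennreal (1 / \<mu>)" using assms by (intro ennreal_leI) simp
 finally show ?thesis .
qed

text \<open>Cauchy-Schwarz with half of the exponential kernel on each factor. One factor integrates
  to at most \<open>1 / \<mu>\<close>; the other retains the kernel, so that a second
  \<open>1 / \<mu>\<close> is gained when that integral is evaluated.\<close>

lemma duh_sq_le:
 assumes g: "continuous_on {0..t} g" and t: "t \<ge> 0" and \<nu>: "\<nu> \<ge> \<mu>" "\<mu> > 0"
 shows "ennreal ((cmod (duh \<nu> g t))^2) \<le> ennreal (1 / \<mu>) *
   (\<integral>\<^sup>+s. ennreal (exp (- \<mu> * (t - s)) * (cmod (g s))^2) * indicator {0..t} s \<partial>lborel)"
proof -
 define h where "h s = of_real (exp (\<nu> * s)) * g s" for s
 have ch: "continuous_on {0..t} h" unfolding h_def by (intro continuous_intros g)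
 \<comment> \<open>\<open>g\<close> is continuous on the interval only; extended by 0 it is
   measurable on the line.\<close>
 define gz where "gz s = indicator {0..t} s *\<^sub>R g s" for s
 have gz [measurable]: "gz \<in> bmeas"
  unfolding gz_def by (rule borel_measurable_continuous_on_indicator) (use g in auto)
 define E where "E s = exp (- \<mu> * (t - s) / 2)" for s
 have [measurable]: "E \<in> bmeas" unfolding E_def by measurable
 have EE: "(E s)^2 = exp (- \<mu> * (t - s))" for s
  by (simp add: E_def power2_eq_square exp_add[symmetric])
 define A where "A s = ennreal (E s * indicator {0..t} s)" for s
 define B where "B s = ennreal (E s * cmod (gz s))" for s
 have "integral {0..t} h = (\<integral>s. indicator {0..t} s *\<^sub>R h s \<partial>lborel)"
  using set_borel_integral_eq_integral(2)[of "{0..t}" h] borel_integrable_compact[of "{0..t}" h] ch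
  by (simp add: set_lebesgue_integral_def set_integrable_def)
 moreover have dh: "duh \<nu> g t = of_real (exp (- \<nu> * t)) * integral {0..t} h" by (simp add: duh_def h_def[abs_def])
 ultimately have "cmod (duh \<nu> g t) = cmod (\<integral>s. of_real (exp (- \<nu> * t)) * (indicator {0..t} s *\<^sub>R h s) \<partial>lborel)"
  by (simp only: dh integral_mult_right_zero)
 then have "ennreal (cmod (duh \<nu> g t)) \<le> (\<integral>\<^sup>+s. ennreal (cmod (of_real (exp (- \<nu> * t)) * (indicator {0..t} s *\<^sub>R h s))) \<partial>lborel)"
  using cmod_integral_le[of lborel "\<lambda>s. of_real (exp (- \<nu> * t)) * (indicator {0..t} s *\<^sub>R h s)"] by simp
 also have "\<dots> \<le> (\<integral>\<^sup>+s. A s * B s \<partial>lborel)"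
 proof (rule nn_integral_mono)
  fix s
  show "ennreal (cmod (of_real (exp (- \<nu> * t)) * (indicator {0..t} s *\<^sub>R h s))) \<le> A s * B s"
  proof (cases "s \<in> {0..t}")
   case True
   have "exp (- \<nu> * t) * exp (\<nu> * s) = exp (- \<nu> * (t - s))" by (simp add: exp_add[symmetric] algebra_simps)
   also have "\<dots> \<le> exp (- \<mu> * (t - s))" using True \<nu> by (auto intro!: mult_right_mono)
   finally have "exp (- \<nu> * t) * exp (\<nu> * s) * cmod (g s) \<le> exp (- \<mu> * (t - s)) * cmod (g s)" by (intro mult_right_mono) auto
   also have "\<dots> = (E s * indicator {0..t} s) * (E s * cmod (gz s))"
    using True EE[of s] by (simp add: gz_def power2_eq_square)
   finally have "cmod (of_real (exp (- \<nu> * t)) * (indicator {0..t} s *\<^sub>R h s)) \<le> (E s * indicator {0..t} s) * (E s * cmod (gz s))"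
    using True by (simp add: h_def norm_mult mult.assoc)
   then show ?thesis unfolding A_def B_def by (subst ennreal_mult[symmetric]) (auto simp: E_def intro: ennreal_leI)
  qed simp
 qed
 finally have "(ennreal (cmod (duh \<nu> g t)))^2 \<le> (\<integral>\<^sup>+s. A s * B s \<partial>lborel)^2" by (rule power_mono) simp
 also have "\<dots> \<le> (\<integral>\<^sup>+s. (A s)^2 \<partial>lborel) * (\<integral>\<^sup>+s. (B s)^2 \<partial>lborel)"
  by (rule Cauchy_Schwarz_nn_integral) (auto simp: A_def B_def)
 also have "(\<integral>\<^sup>+s. (A s)^2 \<partial>lborel) = (\<integral>\<^sup>+s. ennreal (exp (- \<mu> * (t - s))) * indicator {0..t} s \<partial>lborel)"
  unfolding EE[symmetric] A_def by (intro nn_integral_cong) (auto simp: ennreal_power E_def indicator_def)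
 also have "(\<integral>\<^sup>+s. (B s)^2 \<partial>lborel) = (\<integral>\<^sup>+s. ennreal (exp (- \<mu> * (t - s)) * (cmod (g s))^2) * indicator {0..t} s \<partial>lborel)"
  unfolding EE[symmetric] B_def
  by (intro nn_integral_cong) (auto simp: ennreal_power E_def gz_def indicator_def power_mult_distrib)
 also have "(\<integral>\<^sup>+s. ennreal (exp (- \<mu> * (t - s))) * indicator {0..t} s \<partial>lborel) * (\<integral>\<^sup>+s. ennreal (exp (- \<mu> * (t - s)) * (cmod (g s))^2) * indicator {0..t} s \<partial>lborel)
   \<le> ennreal (1 / \<mu>) * (\<integral>\<^sup>+s. ennreal (exp (- \<mu> * (t - s)) * (cmod (g s))^2) * indicator {0..t} s \<partial>lborel)"
  by (intro mult_right_mono nn_integral_exp_le \<nu> t) auto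
 finally show ?thesis by (simp add: ennreal_power)
qed

lemma duh_le:
 assumes g: "continuous_on {0..t} g" and t: "t \<ge> 0" and \<nu>: "\<nu> \<ge> \<mu>" "\<mu> > 0"
  and G: "\<And>s. s \<in> {0..t} \<Longrightarrow> cmod (g s) \<le> G" "G \<ge> 0"
 shows "cmod (duh \<nu> g t) \<le> G / \<mu>"
proof -
 have "ennreal ((cmod (duh \<nu> g t))^2) \<le> ennreal (1 / \<mu>) *
   (\<integral>\<^sup>+s. ennreal (exp (- \<mu> * (t - s)) * (cmod (g s))^2) * indicator {0..t} s \<partial>lborel)"
  by (rule duh_sq_le) fact+
 also have "\<dots> \<le> ennreal (1 / \<mu>) * (\<integral>\<^sup>+s. ennreal (G^2) * (ennreal (exp (- \<mu> * (t - s))) * indicator {0..t} s) \<partial>lborel)"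
 proof (intro mult_left_mono nn_integral_mono)
  fix s
  show "ennreal (exp (- \<mu> * (t - s)) * (cmod (g s))^2) * indicator {0..t} s \<le> ennreal (G^2) * (ennreal (exp (- \<mu> * (t - s))) * indicator {0..t} s)"
  proof (cases "s \<in> {0..t}")
   case True
   have "exp (- \<mu> * (t - s)) * (cmod (g s))^2 \<le> exp (- \<mu> * (t - s)) * G^2"
    using G True by (intro mult_left_mono power_mono) auto
   then show ?thesis using True by (simp add: mult.commute flip: ennreal_mult)
  qed simp
 qed auto
 also have "\<dots> \<le> ennreal (1 / \<mu>) * (ennreal (G^2) * ennreal (1 / \<mu>))"
 proof -
  have m: "(\<lambda>s. ennreal (exp (- \<mu> * (t - s))) * indicator {0..t} s) \<in> borel_measurable lborel" by measurable
  show ?thesis unfolding nn_integral_cmult[OF m] by (intro mult_left_mono nn_integral_exp_le \<nu> t) auto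
 qed
 also have "\<dots> = ennreal ((G / \<mu>)^2)"
  using \<nu> by (simp add: power2_eq_square flip: ennreal_mult)
 finally have "(cmod (duh \<nu> g t))^2 \<le> (G / \<mu>)^2" by (subst (asm) ennreal_le_iff) auto
 then show ?thesis by (rule power2_le_imp_le) (use G \<nu> in auto)
qed

lemma duh_deriv:
 assumes g: "continuous_on {0..T} g" and t: "t \<in> {0..T}"
 shows "(duh \<nu> g has_vector_derivative (- of_real \<nu> * duh \<nu> g t + g t)) (at t within {0..T})"
proof -
 have "((\<lambda>t. integral {0..t} (\<lambda>s. complex_of_real (exp (\<nu> * s)) * g s)) has_vector_derivative complex_of_real (exp (\<nu> * t)) * g t) (at t within {0..T})"
  by (rule integral_has_vector_derivative[OF _ t]) (intro continuous_intros g)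
 moreover have "((\<lambda>t. complex_of_real (exp (- \<nu> * t))) has_vector_derivative of_real (- \<nu> * exp (- \<nu> * t))) (at t within {0..T})"
  by (auto intro!: derivative_eq_intros simp: has_vector_derivative_def has_field_derivative_def)
   (auto intro!: derivative_eq_intros simp: scaleR_conv_of_real mult_ac)
 ultimately have "(duh \<nu> g has_vector_derivative (complex_of_real (exp (- \<nu> * t)) * (complex_of_real (exp (\<nu> * t)) * g t)
   + of_real (- \<nu> * exp (- \<nu> * t)) * integral {0..t} (\<lambda>s. complex_of_real (exp (\<nu> * s)) * g s))) (at t within {0..T})"
  unfolding duh_def[abs_def] by (intro has_vector_derivative_mult)
 moreover have "complex_of_real (exp (- \<nu> * t)) * (complex_of_real (exp (\<nu> * t)) * g t) = g t"
  by (simp add: mult.assoc[symmetric] exp_minus flip: of_real_mult)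
 moreover have "of_real (- \<nu> * exp (- \<nu> * t)) * integral {0..t} (\<lambda>s. complex_of_real (exp (\<nu> * s)) * g s) = - of_real \<nu> * duh \<nu> g t"
  by (simp add: duh_def)
 ultimately show ?thesis by (simp only: add.commute)
qed

text \<open>Iterate \<open>n\<close> contains \<open>n\<close> convolutions with \<open>F\<close>,
  separated by damped free evolution; the sign is that of the convolution in the equation.\<close>

primrec dyson :: "(int^'d \<Rightarrow> real) \<Rightarrow> (int^'d \<Rightarrow> complex) \<Rightarrow> (int^'d \<Rightarrow> complex) \<Rightarrow> nat \<Rightarrow> int^'d \<Rightarrow> real \<Rightarrow> complex" where
 "dyson \<nu> F a0 0 k t = of_real (exp (- \<nu> k * t)) * a0 k"
| "dyson \<nu> F a0 (Suc n) k t = - duh (\<nu> k) (\<lambda>s. conv F (\<lambda>l. dyson \<nu> F a0 n l s) k) t"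

lemma exp_vderiv:
 "((\<lambda>t. complex_of_real (exp (c * t)) * z) has_vector_derivative of_real c * (complex_of_real (exp (c * t)) * z)) (at t within S)"
proof -
 have "((\<lambda>z'. exp (of_real c * z') * z) has_field_derivative of_real c * (exp (of_real c * of_real t) * z)) (at (of_real t))"
  by (auto intro!: derivative_eq_intros)
 from has_vector_derivative_real_field[OF this, of S]
 show ?thesis by (simp add: exp_of_real flip: of_real_mult)
qed

lemma ennreal_mult4:
 "a \<ge> 0 \<Longrightarrow> b \<ge> 0 \<Longrightarrow> c \<ge> 0 \<Longrightarrow> d \<ge> 0 \<Longrightarrow>
  ennreal a * ennreal b * ennreal c * ennreal d = ennreal (a * b * c * d)"
 by (metis ennreal_mult mult_nonneg_nonneg)

lemma nn_integral_count_half: "(\<integral>\<^sup>+n. ennreal ((1/2)^n) \<partial>count_space (UNIV :: nat set)) = 2"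
proof -
 have s: "(\<lambda>n. (1/2::real)^n) sums 2" using geometric_sums[of "1/2::real"] by simp
 have "(\<Sum>n. ennreal ((1/2)^n)) = ennreal 2" by (rule suminf_ennreal_eq[OF _ s]) simp
 then show ?thesis unfolding nn_integral_count_space_nat by simp
qed

section \<open>Convergence of the Dyson series under strong damping\<close>

context
 fixes \<nu> :: "int^'d \<Rightarrow> real" and F a0 :: "int^'d \<Rightarrow> complex" and \<mu> \<Lambda> B T :: real
 assumes \<nu>: "\<And>k. \<nu> k \<ge> \<mu>" and \<mu>: "\<mu> > 0" and F: "l1 F \<le> ennreal \<Lambda>" "\<Lambda> \<ge> 0"
  and small: "\<Lambda> / \<mu> \<le> 1/2"
  and a0: "\<And>k. cmod (a0 k) \<le> B" and T: "T > 0"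
begin

lemma dyson_B0: "B \<ge> 0"
 using a0[of undefined] norm_ge_zero order_trans by blast

lemma dyson_l1: "l1 F < \<infinity>"
 by (rule le_less_trans[OF F(1)]) simp

text \<open>Each iteration costs the factor \<open>\<Lambda>\<close> of the convolution and gains
  \<open>1 / \<mu>\<close> from the damping. Bound and continuity are proved together because the
  next convolution is continuous only thanks to the uniform bound on the present iterate.\<close>

lemma dyson_basic:
 "continuous_on {0..T} (dyson \<nu> F a0 n k) \<and> (\<forall>t\<in>{0..T}. cmod (dyson \<nu> F a0 n k t) \<le> B * (1/2)^n)"
proof (induction n arbitrary: k)
 case 0
 have "cmod (dyson \<nu> F a0 0 k t) \<le> B" if "t \<in> {0..T}" for t
 proof -
  have "\<nu> k * t \<ge> 0" using \<nu>[of k] \<mu> that by (intro mult_nonneg_nonneg) auto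
  then have "exp (- \<nu> k * t) * cmod (a0 k) \<le> 1 * B" using a0[of k] by (intro mult_mono) auto
  then show ?thesis by (simp add: norm_mult)
 qed
 moreover have "continuous_on {0..T} (dyson \<nu> F a0 0 k)"
  unfolding dyson.simps(1)[abs_def] by (intro continuous_intros)
 ultimately show ?case by simp
next
 case (Suc n)
 define g where "g s = conv F (\<lambda>l. dyson \<nu> F a0 n l s) k" for s
 have g: "continuous_on {0..T} g"
  unfolding g_def by (rule conv_continuous[OF dyson_l1, where B = "B * (1/2)^n"]) (use Suc in auto)
 have gB: "cmod (g s) \<le> \<Lambda> * (B * (1/2)^n)" if "s \<in> {0..T}" for s
  unfolding g_def by (rule cmod_conv_le_l1[OF F]) (use Suc that in auto)
 have eq: "dyson \<nu> F a0 (Suc n) k = (\<lambda>t. - duh (\<nu> k) g t)" by (simp add: g_def[abs_def] fun_eq_iff)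
 have "continuous_on {0..T} (duh (\<nu> k) g)"
  using duh_deriv[OF g] by (intro continuous_on_vector_derivative) auto
 moreover have "cmod (duh (\<nu> k) g t) \<le> B * (1/2)^(Suc n)" if "t \<in> {0..T}" for t
 proof -
  have "cmod (duh (\<nu> k) g t) \<le> (\<Lambda> * (B * (1/2)^n)) / \<mu>"
   by (rule duh_le) (use that \<nu> \<mu> gB F dyson_B0 in \<open>auto intro: continuous_on_subset[OF g]\<close>)
  also have "\<dots> = (\<Lambda> / \<mu>) * (B * (1/2)^n)" by simp
  also have "\<dots> \<le> (1/2) * (B * (1/2)^n)" using small dyson_B0 by (intro mult_right_mono) auto
  finally show ?thesis by simp
 qed
 ultimately show ?case unfolding eq by (auto intro: continuous_on_minus)
qed

lemma dyson_conv_bound: "t \<in> {0..T} \<Longrightarrow> cmod (conv F (\<lambda>l. dyson \<nu> F a0 n l t) k) \<le> \<Lambda> * (B * (1/2)^n)"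
 by (rule cmod_conv_le_l1[OF F]) (use dyson_basic in auto)

definition dsol :: "int^'d \<Rightarrow> real \<Rightarrow> complex" where
 "dsol k t = (\<Sum>n. dyson \<nu> F a0 n k t)"

lemma dyson_summable: "t \<in> {0..T} \<Longrightarrow> summable (\<lambda>n. cmod (dyson \<nu> F a0 n k t))"
proof (rule summable_comparison_test'[where N = 0])
 show "summable (\<lambda>n. B * (1/2)^n)" by (intro summable_mult summable_geometric) simp
qed (use dyson_basic in auto)

lemma dsol_sums: "t \<in> {0..T} \<Longrightarrow> (\<lambda>n. dyson \<nu> F a0 n k t) sums dsol k t"
 unfolding dsol_def by (rule summable_sums[OF summable_norm_cancel[OF dyson_summable]])

lemma conv_dsol_sums:
 assumes t: "t \<in> {0..T}"
 shows "(\<lambda>n. conv F (\<lambda>l. dyson \<nu> F a0 n l t) k) sums conv F (\<lambda>l. dsol l t) k"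
 unfolding conv_def
proof -
 have int: "integrable (cntM) (\<lambda>l. F (k - l) * dyson \<nu> F a0 n l t)" for n
  by (rule conv_integrable[OF dyson_l1, where B = "B * (1/2)^n"]) (use dyson_basic t in auto)
 have iF: "integrable (cntM) (\<lambda>l. cmod (F (k - l)))"
  by (subst integrable_norm) (auto simp: integrable_bij_count_space[OF bij_minus_left] integrable_l1[OF dyson_l1])
 have "(\<lambda>n. \<integral>l. F (k - l) * dyson \<nu> F a0 n l t \<partial>cntM) sums (\<integral>l. (\<Sum>n. F (k - l) * dyson \<nu> F a0 n l t) \<partial>cntM)"
 proof (rule sums_integral[OF int])
  show "AE l in cntM. summable (\<lambda>n. norm (F (k - l) * dyson \<nu> F a0 n l t))"
   using dyson_summable[OF t] by (auto simp: norm_mult intro!: AE_I2 summable_mult)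
  show "summable (\<lambda>n. \<integral>l. norm (F (k - l) * dyson \<nu> F a0 n l t) \<partial>cntM)"
  proof (rule summable_comparison_test'[where N = 0])
   show "summable (\<lambda>n. (\<integral>l. cmod (F (k - l)) \<partial>cntM) * (B * (1/2)^n))"
    by (intro summable_mult summable_geometric) simp
   fix n :: nat
   have "(\<integral>l. norm (F (k - l) * dyson \<nu> F a0 n l t) \<partial>cntM) \<le> (\<integral>l. cmod (F (k - l)) * (B * (1/2)^n) \<partial>cntM)"
   proof (rule integral_mono)
    show "integrable (cntM) (\<lambda>l. norm (F (k - l) * dyson \<nu> F a0 n l t))" by (rule integrable_norm[OF int])
    show "integrable (cntM) (\<lambda>l. cmod (F (k - l)) * (B * (1/2)^n))" using iF by simp
    show "norm (F (k - l) * dyson \<nu> F a0 n l t) \<le> cmod (F (k - l)) * (B * (1/2)^n)" for l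
     unfolding norm_mult using dyson_basic[of n l] t by (intro mult_left_mono) auto
   qed
   then show "norm (\<integral>l. norm (F (k - l) * dyson \<nu> F a0 n l t) \<partial>cntM) \<le> (\<integral>l. cmod (F (k - l)) \<partial>cntM) * (B * (1/2)^n)"
    by simp
  qed
 qed
 moreover have "(\<Sum>n. F (k - l) * dyson \<nu> F a0 n l t) = F (k - l) * dsol l t" for l
  using dsol_sums[OF t, of l] by (simp add: dsol_def suminf_mult sums_iff)
 ultimately show "(\<lambda>n. \<integral>l. F (k - l) * dyson \<nu> F a0 n l t \<partial>cntM) sums (\<integral>l. F (k - l) * dsol l t \<partial>cntM)"
  by simp
qed

lemma dsol_0: "dsol k 0 = a0 k"
proof -
 have "dyson \<nu> F a0 n k 0 = (if n = 0 then a0 k else 0)" for n by (cases n) (auto simp: duh_def)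
 then have "(\<lambda>n. dyson \<nu> F a0 n k 0) sums a0 k" using sums_single[of 0 "\<lambda>_. a0 k"] by simp
 then show ?thesis unfolding dsol_def by (rule sums_unique[symmetric])
qed

text \<open>Term-by-term differentiation, justified by uniform convergence of the derivatives. The
  derivative of iterate \<open>n\<close> contains the convolution with iterate \<open>n - 1\<close>,
  so the convolution series appears shifted by one, with 0 in front.\<close>

lemma dsol_deriv:
 assumes t: "t \<in> {0..T}"
 shows "(dsol k has_vector_derivative (- of_real (\<nu> k) * dsol k t - conv F (\<lambda>l. dsol l t) k)) (at t within {0..T})"
proof -
 define cn where "cn n t = (case n of 0 \<Rightarrow> 0 | Suc m \<Rightarrow> conv F (\<lambda>l. dyson \<nu> F a0 m l t) k)" for n t
 define d where "d n t = - of_real (\<nu> k) * dyson \<nu> F a0 n k t - cn n t" for n t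
 have der: "(dyson \<nu> F a0 n k has_vector_derivative d n t) (at t within {0..T})" if t: "t \<in> {0..T}" for n t
 proof (cases n)
  case 0
  have "dyson \<nu> F a0 0 k = (\<lambda>t. of_real (exp (- \<nu> k * t)) * a0 k)" by (simp add: fun_eq_iff)
  then show ?thesis using 0 exp_vderiv[of "- \<nu> k" "a0 k" t "{0..T}"] by (simp add: d_def cn_def)
 next
  case (Suc m)
  define g where "g s = conv F (\<lambda>l. dyson \<nu> F a0 m l s) k" for s
  have g: "continuous_on {0..T} g"
   unfolding g_def by (rule conv_continuous[OF dyson_l1, where B = "B * (1/2)^m"]) (use dyson_basic in auto)
  have "dyson \<nu> F a0 n k = (\<lambda>t. - duh (\<nu> k) g t)" by (simp add: Suc g_def[abs_def] fun_eq_iff)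
  moreover have "((\<lambda>t. - duh (\<nu> k) g t) has_vector_derivative - (- of_real (\<nu> k) * duh (\<nu> k) g t + g t)) (at t within {0..T})"
   by (rule has_vector_derivative_minus[OF duh_deriv[OF g t]])
  ultimately show ?thesis by (simp add: d_def cn_def Suc g_def algebra_simps)
 qed
 \<comment> \<open>The factor 2 pays for the index shift: the convolution with iterate
   \<open>n - 1\<close> is of size \<open>(1/2)^(n - 1)\<close>.\<close>
 define M where "M n = \<bar>\<nu> k\<bar> * (B * (1/2)^n) + 2 * (\<Lambda> * (B * (1/2)^n))" for n :: nat
 have M: "summable M" unfolding M_def by (intro summable_add summable_mult summable_geometric) auto
 have dM: "cmod (d n t) \<le> M n" if t: "t \<in> {0..T}" for n t
 proof -
  have "cmod (d n t) \<le> cmod (of_real (\<nu> k) * dyson \<nu> F a0 n k t) + cmod (cn n t)"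
   unfolding d_def using norm_triangle_ineq4[of "- of_real (\<nu> k) * dyson \<nu> F a0 n k t" "cn n t"] by (simp add: norm_minus_cancel)
  also have "\<dots> \<le> M n"
  proof -
   have "cmod (of_real (\<nu> k) * dyson \<nu> F a0 n k t) \<le> \<bar>\<nu> k\<bar> * (B * (1/2)^n)"
    unfolding norm_mult using dyson_basic[of n k] t by (auto intro!: mult_left_mono)
   moreover have "cmod (cn n t) \<le> 2 * (\<Lambda> * (B * (1/2)^n))"
   proof (cases n)
    case 0
    then show ?thesis using F dyson_B0 by (simp add: cn_def)
   next
    case (Suc m)
    then show ?thesis using dyson_conv_bound[OF t, of m k] by (simp add: cn_def)
   qed
   ultimately show ?thesis by (simp add: M_def)
  qed
  finally show ?thesis .
 qed
 define g' where "g' t h = h *\<^sub>R (\<Sum>n. d n t)" for t h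
 have ul: "uniform_limit {0..T} (\<lambda>n t. \<Sum>i<n. d i t) (\<lambda>t. \<Sum>n. d n t) sequentially"
  by (rule Weierstrass_m_test[OF dM M])
 have "\<exists>g. \<forall>x\<in>{0..T}. (\<lambda>n. dyson \<nu> F a0 n k x) sums g x \<and> (g has_derivative g' x) (at x within {0..T})"
 proof (rule has_derivative_series[where f' = "\<lambda>n x h. h *\<^sub>R d n x"])
  show "convex {0..T}" by simp
  show "(dyson \<nu> F a0 n k has_derivative (\<lambda>h. h *\<^sub>R d n x)) (at x within {0..T})" if "x \<in> {0..T}" for n x
   using der[OF that] by (simp add: has_vector_derivative_def)
  show "\<forall>\<^sub>F n in sequentially. \<forall>x\<in>{0..T}. \<forall>h. norm ((\<Sum>i<n. h *\<^sub>R d i x) - g' x h) \<le> e * norm h" if "e > 0" for e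
   using uniform_limitD[OF ul that]
  proof eventually_elim
   case (elim n)
   have "norm ((\<Sum>i<n. h *\<^sub>R d i x) - g' x h) \<le> e * norm h" if "x \<in> {0..T}" for x h
   proof -
    have "(\<Sum>i<n. h *\<^sub>R d i x) - g' x h = h *\<^sub>R ((\<Sum>i<n. d i x) - (\<Sum>n. d n x))"
     by (simp add: g'_def scaleR_sum_right scaleR_diff_right)
    then have "norm ((\<Sum>i<n. h *\<^sub>R d i x) - g' x h) = \<bar>h\<bar> * dist (\<Sum>i<n. d i x) (\<Sum>n. d n x)" by (simp add: dist_norm)
    also have "\<dots> \<le> \<bar>h\<bar> * e" using elim that by (intro mult_left_mono) (auto intro: less_imp_le)
    finally show ?thesis by (simp add: mult.commute)
   qed
   then show ?case by blast
  qed
  show "0 \<in> {0..T}" using T by simp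
  show "(\<lambda>n. dyson \<nu> F a0 n k 0) sums dsol k 0" by (rule dsol_sums) (use T in simp)
 qed
 then obtain g where g: "\<And>x. x \<in> {0..T} \<Longrightarrow> (\<lambda>n. dyson \<nu> F a0 n k x) sums g x"
  "\<And>x. x \<in> {0..T} \<Longrightarrow> (g has_derivative g' x) (at x within {0..T})" by blast
 have gd: "g x = dsol k x" if "x \<in> {0..T}" for x using g(1)[OF that] dsol_sums[OF that] by (rule sums_unique2)
 have "(g has_vector_derivative (\<Sum>n. d n t)) (at t within {0..T})"
  using g(2)[OF t] by (simp add: has_vector_derivative_def g'_def[abs_def])
 then have "(dsol k has_vector_derivative (\<Sum>n. d n t)) (at t within {0..T})"
  by (rule has_vector_derivative_transform[OF t, rotated]) (simp add: gd)
 moreover have "(\<lambda>n. d n t) sums (- of_real (\<nu> k) * dsol k t - conv F (\<lambda>l. dsol l t) k)"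
 proof -
  have "(\<lambda>n. cn n t) sums (conv F (\<lambda>l. dsol l t) k)"
   using conv_dsol_sums[OF t, of k] sums_Suc_iff[of "\<lambda>n. cn n t" "conv F (\<lambda>l. dsol l t) k"] by (simp add: cn_def)
  then show ?thesis unfolding d_def by (intro sums_diff sums_mult dsol_sums t)
 qed
 ultimately show ?thesis by (simp add: sums_iff)
qed

lemma dyson_herm:
 assumes "herm F" "herm a0" "\<And>k. \<nu> (- k) = \<nu> k"
 shows "herm (\<lambda>k. dyson \<nu> F a0 n k t)"
proof (induction n arbitrary: t)
 case 0
 then show ?case using assms by (simp add: herm_def)
next
 case (Suc n)
 have "conv F (\<lambda>l. dyson \<nu> F a0 n l s) (- k) = cnj (conv F (\<lambda>l. dyson \<nu> F a0 n l s) k)" for s k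
  using herm_conv[OF assms(1) Suc] by (simp add: herm_def)
 then show ?case by (simp add: herm_def duh_def assms(3) Henstock_Kurzweil_Integration.integral_cnj)
qed

lemma dsol_herm:
 assumes "herm F" "herm a0" "\<And>k. \<nu> (- k) = \<nu> k" "t \<in> {0..T}"
 shows "herm (\<lambda>k. dsol k t)"
 unfolding herm_def
proof
 fix k
 have "(\<lambda>n. cnj (dyson \<nu> F a0 n k t)) sums cnj (dsol k t)"
  using dsol_sums[OF assms(4)] by (simp only: sums_cnj)
 moreover have "(\<lambda>n. cnj (dyson \<nu> F a0 n k t)) sums dsol (- k) t"
  using dsol_sums[OF assms(4), of "- k"] dyson_herm[OF assms(1-3)] by (simp add: herm_def)
 ultimately show "dsol (- k) t = cnj (dsol k t)" by (rule sums_unique2[symmetric])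
qed

text \<open>The iteration of \<open>dyson_basic\<close> in the norm of order \<open>s\<close>:
  squared norms gain \<open>K / \<mu>^2\<close>, with one \<open>1 / \<mu>\<close> from
  \<open>duh_sq_le\<close> and one from integrating the remaining kernel in time.\<close>

lemma dyson_sE:
 assumes K: "\<And>v. sE s (conv F v) \<le> ennreal K * sE s v" "K \<ge> 0" "K / \<mu>^2 \<le> 1/4" and t: "t \<in> {0..T}"
 shows "sE s (\<lambda>k. dyson \<nu> F a0 n k t) \<le> sE s a0 * ennreal ((1/4)^n)"
 using t
proof (induction n arbitrary: t)
 case 0
 have "cmod (dyson \<nu> F a0 0 k t) \<le> cmod (a0 k)" for k
 proof -
  have "\<nu> k * t \<ge> 0" using \<nu>[of k] \<mu> 0 by (intro mult_nonneg_nonneg) auto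
  then have "exp (- \<nu> k * t) * cmod (a0 k) \<le> 1 * cmod (a0 k)" by (intro mult_right_mono) auto
  then show ?thesis by (simp add: norm_mult)
 qed
 then show ?case unfolding sE_def
  by (auto intro!: nn_integral_mono ennreal_leI mult_left_mono power_mono simp del: dyson.simps)
next
 case (Suc n)
 define g where "g k s = conv F (\<lambda>l. dyson \<nu> F a0 n l s) k" for k s
 have g: "continuous_on {0..T} (g k)" for k
  unfolding g_def by (rule conv_continuous[OF dyson_l1, where B = "B * (1/2)^n"]) (use dyson_basic in auto)
 define gz where "gz k s = indicator {0..t} s *\<^sub>R g k s" for k s
 have gzm [measurable]: "gz k \<in> bmeas" for k
  unfolding gz_def by (rule borel_measurable_continuous_on_indicator)
   (use Suc.prems in \<open>auto intro: continuous_on_subset[OF g]\<close>)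
 have "sE s (\<lambda>k. dyson \<nu> F a0 (Suc n) k t)
   \<le> (\<integral>\<^sup>+k. (\<integral>\<^sup>+\<tau>. ennreal (1 / \<mu>) * (ennreal (exp (- \<mu> * (t - \<tau>))) * indicator {0..t} \<tau> * ennreal ((1 + ksq k) powr s * (cmod (gz k \<tau>))^2)) \<partial>lborel) \<partial>cntM)"
  unfolding sE_def
 proof (rule nn_integral_mono)
  fix k
  have "ennreal ((1 + ksq k) powr s * (cmod (dyson \<nu> F a0 (Suc n) k t))^2) = ennreal ((1 + ksq k) powr s) * ennreal ((cmod (duh (\<nu> k) (g k) t))^2)"
   by (simp add: g_def[abs_def] ennreal_mult)
  also have "\<dots> \<le> ennreal ((1 + ksq k) powr s) * (ennreal (1 / \<mu>) *
    (\<integral>\<^sup>+\<tau>. ennreal (exp (- \<mu> * (t - \<tau>)) * (cmod (g k \<tau>))^2) * indicator {0..t} \<tau> \<partial>lborel))"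
   by (intro mult_left_mono duh_sq_le \<nu> \<mu>) (use Suc.prems in \<open>auto intro: continuous_on_subset[OF g]\<close>)
  also have "(\<integral>\<^sup>+\<tau>. ennreal (exp (- \<mu> * (t - \<tau>)) * (cmod (g k \<tau>))^2) * indicator {0..t} \<tau> \<partial>lborel)
   = (\<integral>\<^sup>+\<tau>. ennreal (exp (- \<mu> * (t - \<tau>)) * (cmod (gz k \<tau>))^2) * indicator {0..t} \<tau> \<partial>lborel)"
   by (intro nn_integral_cong) (auto simp: gz_def indicator_def)
  also have "ennreal ((1 + ksq k) powr s) * (ennreal (1 / \<mu>) * \<dots>)
   = (\<integral>\<^sup>+\<tau>. ennreal (1 / \<mu>) * (ennreal (exp (- \<mu> * (t - \<tau>))) * indicator {0..t} \<tau> * ennreal ((1 + ksq k) powr s * (cmod (gz k \<tau>))^2)) \<partial>lborel)"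
   by (subst nn_integral_cmult[symmetric], measurable, subst nn_integral_cmult[symmetric], measurable)
    (auto simp: ennreal_mult ac_simps)
  finally show "ennreal ((1 + ksq k) powr s * (cmod (dyson \<nu> F a0 (Suc n) k t))^2)
   \<le> (\<integral>\<^sup>+\<tau>. ennreal (1 / \<mu>) * (ennreal (exp (- \<mu> * (t - \<tau>))) * indicator {0..t} \<tau> * ennreal ((1 + ksq k) powr s * (cmod (gz k \<tau>))^2)) \<partial>lborel)" .
 qed
 also have "\<dots> = (\<integral>\<^sup>+\<tau>. (\<integral>\<^sup>+k. ennreal (1 / \<mu>) * (ennreal (exp (- \<mu> * (t - \<tau>))) * indicator {0..t} \<tau> * ennreal ((1 + ksq k) powr s * (cmod (gz k \<tau>))^2)) \<partial>cntM) \<partial>lborel)"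
  by (rule nn_integral_count_space_nn_integral[symmetric]) auto
 also have "\<dots> \<le> (\<integral>\<^sup>+\<tau>. (ennreal (1 / \<mu>) * (ennreal K * (sE s a0 * ennreal ((1/4)^n)))) * (ennreal (exp (- \<mu> * (t - \<tau>))) * indicator {0..t} \<tau>) \<partial>lborel)"
 proof (rule nn_integral_mono)
  fix \<tau>
  show "(\<integral>\<^sup>+k. ennreal (1 / \<mu>) * (ennreal (exp (- \<mu> * (t - \<tau>))) * indicator {0..t} \<tau> * ennreal ((1 + ksq k) powr s * (cmod (gz k \<tau>))^2)) \<partial>cntM)
   \<le> (ennreal (1 / \<mu>) * (ennreal K * (sE s a0 * ennreal ((1/4)^n)))) * (ennreal (exp (- \<mu> * (t - \<tau>))) * indicator {0..t} \<tau>)"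
  proof (cases "\<tau> \<in> {0..t}")
   case True
   then have \<tau>: "\<tau> \<in> {0..T}" using Suc.prems by auto
   have "(\<integral>\<^sup>+k. ennreal (1 / \<mu>) * (ennreal (exp (- \<mu> * (t - \<tau>))) * indicator {0..t} \<tau> * ennreal ((1 + ksq k) powr s * (cmod (gz k \<tau>))^2)) \<partial>cntM)
    = ennreal (1 / \<mu>) * ennreal (exp (- \<mu> * (t - \<tau>))) * sE s (conv F (\<lambda>l. dyson \<nu> F a0 n l \<tau>))"
    unfolding sE_def by (subst nn_integral_cmult[symmetric]) (use True in \<open>auto simp: gz_def g_def mult.assoc\<close>)
   also have "\<dots> \<le> ennreal (1 / \<mu>) * ennreal (exp (- \<mu> * (t - \<tau>))) * (ennreal K * (sE s a0 * ennreal ((1/4)^n)))"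
    by (intro mult_left_mono order_trans[OF K(1)] Suc.IH[OF \<tau>]) auto
   finally show ?thesis using True by (simp add: ac_simps)
  qed simp
 qed
 also have "\<dots> \<le> (ennreal (1 / \<mu>) * (ennreal K * (sE s a0 * ennreal ((1/4)^n)))) * ennreal (1 / \<mu>)"
 proof -
  have m: "(\<lambda>s. ennreal (exp (- \<mu> * (t - s))) * indicator {0..t} s) \<in> borel_measurable lborel" by measurable
  show ?thesis unfolding nn_integral_cmult[OF m]
   by (intro mult_left_mono nn_integral_exp_le \<mu>) (use Suc.prems in auto)
 qed
 also have "\<dots> = sE s a0 * ennreal ((K / \<mu>^2) * (1/4)^n)"
 proof -
  have "ennreal (1 / \<mu>) * (ennreal K * (sE s a0 * ennreal ((1/4)^n))) * ennreal (1 / \<mu>)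
    = sE s a0 * (ennreal (1 / \<mu>) * ennreal K * ennreal (1 / \<mu>) * ennreal ((1/4)^n))" by (simp only: ac_simps)
  also have "ennreal (1 / \<mu>) * ennreal K * ennreal (1 / \<mu>) * ennreal ((1/4)^n) = ennreal (1 / \<mu> * K * (1 / \<mu>) * (1/4)^n)"
   using \<mu> K(2) by (intro ennreal_mult4) auto
  also have "1 / \<mu> * K * (1 / \<mu>) * (1/4)^n = (K / \<mu>^2) * (1/4)^n" by (simp add: power2_eq_square)
  finally show ?thesis .
 qed
 also have "\<dots> \<le> sE s a0 * ennreal ((1/4) * (1/4)^n)"
  using K(3) by (intro mult_left_mono ennreal_leI mult_right_mono) auto
 finally show ?case by simp
qed

text \<open>Cauchy-Schwarz in \<open>n\<close> with weights \<open>(1/2)^n\<close> and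
  \<open>2^n\<close>: the first sums to 2, and \<open>2^n\<close> times the decay
  \<open>(1/4)^n\<close> sums to 2 again, whence the 4.\<close>

lemma dsol_sE:
 assumes K: "\<And>v. sE s (conv F v) \<le> ennreal K * sE s v" "K \<ge> 0" "K / \<mu>^2 \<le> 1/4" and t: "t \<in> {0..T}"
 shows "sE s (\<lambda>k. dsol k t) \<le> 4 * sE s a0"
proof -
 have pt: "ennreal ((cmod (dsol k t))^2) \<le> 2 * (\<integral>\<^sup>+n. ennreal (2^n * (cmod (dyson \<nu> F a0 n k t))^2) \<partial>cntM)" for k
 proof -
  have "ennreal (cmod (dsol k t)) \<le> (\<Sum>n. ennreal (cmod (dyson \<nu> F a0 n k t)))"
   unfolding dsol_def using summable_norm[OF dyson_summable[OF t]]
   by (subst suminf_ennreal2) (auto intro: dyson_summable[OF t] ennreal_leI)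
  also have "\<dots> = (\<integral>\<^sup>+n. ennreal (sqrt ((1/2)^n)) * ennreal (sqrt (2^n) * cmod (dyson \<nu> F a0 n k t)) \<partial>cntM)"
   unfolding nn_integral_count_space_nat[symmetric]
  proof (rule nn_integral_cong)
   fix n :: nat
   have "sqrt ((1/2)^n) * sqrt (2^n) = 1"
    unfolding real_sqrt_mult[symmetric] power_mult_distrib[symmetric] by simp
   then have "sqrt ((1/2)^n) * (sqrt (2^n) * cmod (dyson \<nu> F a0 n k t)) = cmod (dyson \<nu> F a0 n k t)"
    unfolding mult.assoc[symmetric] by simp
   then show "ennreal (cmod (dyson \<nu> F a0 n k t)) = ennreal (sqrt ((1/2)^n)) * ennreal (sqrt (2^n) * cmod (dyson \<nu> F a0 n k t))"
    by (subst ennreal_mult[symmetric]) (simp_all del: power_one_over)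
  qed
  finally have "(ennreal (cmod (dsol k t)))^2 \<le> (\<integral>\<^sup>+n. ennreal (sqrt ((1/2)^n)) * ennreal (sqrt (2^n) * cmod (dyson \<nu> F a0 n k t)) \<partial>cntM)^2"
   by (rule power_mono) simp
  also have "\<dots> \<le> (\<integral>\<^sup>+n. (ennreal (sqrt ((1/2)^n)))^2 \<partial>cntM) * (\<integral>\<^sup>+n. (ennreal (sqrt (2^n) * cmod (dyson \<nu> F a0 n k t)))^2 \<partial>cntM)"
   by (rule Cauchy_Schwarz_nn_integral) auto
  also have "\<dots> = 2 * (\<integral>\<^sup>+n. ennreal (2^n * (cmod (dyson \<nu> F a0 n k t))^2) \<partial>cntM)"
   unfolding nn_integral_count_half[symmetric] by (intro arg_cong2[where f = times] nn_integral_cong) (auto simp: ennreal_power power_mult_distrib simp del: power_one_over)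
  finally show ?thesis by (simp add: ennreal_power)
 qed
 have "sE s (\<lambda>k. dsol k t) \<le> (\<integral>\<^sup>+k. 2 * (\<integral>\<^sup>+n. ennreal (2^n) * ennreal ((1 + ksq k) powr s * (cmod (dyson \<nu> F a0 n k t))^2) \<partial>cntM) \<partial>cntM)"
  unfolding sE_def
 proof (rule nn_integral_mono)
  fix k
  have "ennreal ((1 + ksq k) powr s * (cmod (dsol k t))^2) \<le> ennreal ((1 + ksq k) powr s) * (2 * (\<integral>\<^sup>+n. ennreal (2^n * (cmod (dyson \<nu> F a0 n k t))^2) \<partial>cntM))"
   by (subst ennreal_mult) (auto intro!: mult_left_mono pt)
  also have "\<dots> = 2 * (\<integral>\<^sup>+n. ennreal (2^n) * ennreal ((1 + ksq k) powr s * (cmod (dyson \<nu> F a0 n k t))^2) \<partial>cntM)"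
   by (subst mult.left_commute, subst nn_integral_cmult[symmetric]) (auto simp: ennreal_mult ac_simps)
  finally show "ennreal ((1 + ksq k) powr s * (cmod (dsol k t))^2) \<le> \<dots>" .
 qed
 also have "\<dots> = 2 * (\<integral>\<^sup>+n. ennreal (2^n) * sE s (\<lambda>k. dyson \<nu> F a0 n k t) \<partial>cntM)"
  unfolding sE_def
  by (subst nn_integral_cmult, simp, subst nn_integral_count_swap) (simp add: nn_integral_cmult)
 also have "\<dots> \<le> 2 * (\<integral>\<^sup>+n. sE s a0 * ennreal ((1/2)^n) \<partial>cntM)"
 proof (intro mult_left_mono nn_integral_mono)
  fix n :: nat
  have "ennreal (2^n) * sE s (\<lambda>k. dyson \<nu> F a0 n k t) \<le> ennreal (2^n) * (sE s a0 * ennreal ((1/4)^n))"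
   by (intro mult_left_mono dyson_sE[OF K t]) auto
  also have "\<dots> = sE s a0 * ennreal ((1/2)^n)"
   by (subst mult.left_commute) (simp add: power_mult_distrib[symmetric] flip: ennreal_mult)
  finally show "ennreal (2^n) * sE s (\<lambda>k. dyson \<nu> F a0 n k t) \<le> sE s a0 * ennreal ((1/2)^n)" .
 qed auto
 also have "\<dots> = 4 * sE s a0"
 proof -
  have "(\<integral>\<^sup>+n. sE s a0 * ennreal ((1/2)^n) \<partial>cntM) = sE s a0 * 2"
   unfolding nn_integral_count_half[symmetric] by (rule nn_integral_cmult) simp
  then show ?thesis by (simp only: mult.commute[of "sE s a0"] mult.assoc[symmetric]) simp
 qed
 finally show ?thesis .
qed

end

subsection \<open>Energy estimates\<close>

text \<open>The Fourier symbol of \<open>- \<theta>/2\<close> times the Laplacian, from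
  \<open>\<theta>/2 * (4 * pi^2)\<close>.\<close>

definition symb :: "real \<Rightarrow> int^'d \<Rightarrow> real" where
 "symb \<theta> k = 2 * pi^2 * \<theta> * ksq k"

lemma symb_nonneg: "\<theta> \<ge> 0 \<Longrightarrow> symb \<theta> k \<ge> 0"
 by (simp add: symb_def)

lemma symb_minus: "symb \<theta> (- k) = symb \<theta> k"
 by (simp add: symb_def)

lemma conv_cmult: "conv F (\<lambda>l. z * v l) k = z * conv F v k"
proof -
 have "conv F (\<lambda>l. z * v l) k = (\<integral>l. z * (F (k - l) * v l) \<partial>cntM)"
  unfolding conv_def by (intro Bochner_Integration.integral_cong) (auto simp: ac_simps)
 then show ?thesis by (simp add: conv_def)
qed

lemma sE_cmult: "sE s (\<lambda>k. z * a k) = ennreal ((cmod z)^2) * sE s a"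
proof -
 have "sE s (\<lambda>k. z * a k) = (\<integral>\<^sup>+k. ennreal ((cmod z)^2) * ennreal ((1 + ksq k) powr s * (cmod (a k))^2) \<partial>cntM)"
  unfolding sE_def
  by (intro nn_integral_cong) (simp add: norm_mult power_mult_distrib ac_simps flip: ennreal_mult)
 then show ?thesis by (simp add: nn_integral_cmult sE_def)
qed

text \<open>The system is solved with an additional damping \<open>\<mu>\<close>, for which the
  Dyson series converges on all of \<open>{0..T}\<close>, and the result is multiplied by
  \<open>exp (\<mu> * t)\<close>. Hence \<open>R\<close> may be exponentially large in
  \<open>F\<close> and serves only as a finite bound.\<close>

lemma coef_solution_exists:
 fixes F a0 :: "int^'d \<Rightarrow> complex"
 assumes T: "T > 0" and \<theta>: "\<theta> > 0" and \<beta>: "\<beta> > real CARD('d) / 2"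
  and F: "herm F" "sE \<beta> F < \<infinity>" and a0: "herm a0" "sE \<beta> a0 < \<infinity>"
 obtains c R where "\<And>k. continuous_on UNIV (c k)" "\<And>t. herm (\<lambda>k. c k t)" "R \<ge> 0"
  "\<And>t. sE \<beta> (\<lambda>k. c k t) \<le> ennreal R" "\<And>k. c k 0 = a0 k"
  "\<And>k t. t \<in> {0..T} \<Longrightarrow> (c k has_vector_derivative
    (- of_real (symb \<theta> k) * c k t - conv F (\<lambda>l. c l t) k)) (at t within {0..T})"
proof -
 define \<Lambda> where "\<Lambda> = enn2real (l1 F)"
 have l1F: "l1 F < \<infinity>" by (rule l1_finite[OF \<beta> F(2)])
 have \<Lambda>: "l1 F \<le> ennreal \<Lambda>" "\<Lambda> \<ge> 0" using l1F by (auto simp: \<Lambda>_def less_top)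
 define Ke where "Ke = (2 * ennreal (4 powr \<beta>) * bracket_sum TYPE('d) \<beta>) * sE \<beta> F"
 have Kfin: "Ke < \<infinity>" using bracket_sum_finite[OF \<beta>] F(2) by (simp add: Ke_def ennreal_mult_less_top)
 define K where "K = enn2real Ke"
 have K: "K \<ge> 0" "ennreal K = Ke" using Kfin by (auto simp: K_def less_top)
 have \<beta>0: "\<beta> \<ge> 0" using \<beta> by (rule order_trans[OF _ less_imp_le, rotated]) simp
 have Kc: "sE \<beta> (conv F v) \<le> ennreal K * sE \<beta> v" for v
  using sE_conv_le[OF \<beta>0 order_refl, of F v] by (simp add: K(2) Ke_def)
 \<comment> \<open>Large enough for both contraction conditions:
   \<open>\<Lambda> / \<mu> \<le> 1/2\<close> for absolute bounds and
   \<open>K / \<mu>^2 \<le> 1/4\<close> in the squared norm of order \<open>\<beta>\<close>.\<close>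
 define \<mu> where "\<mu> = 1 + 2 * \<Lambda> + 2 * sqrt K"
 have \<mu>: "\<mu> > 0" using \<Lambda> K by (simp add: \<mu>_def add_pos_nonneg)
 have small: "\<Lambda> / \<mu> \<le> 1/2" using \<mu> \<Lambda> K by (simp add: divide_le_eq \<mu>_def)
 have small': "K / \<mu>^2 \<le> 1/4"
 proof -
  have "(2 * sqrt K)^2 \<le> \<mu>^2" using \<Lambda> K by (intro power_mono) (auto simp: \<mu>_def)
  then show ?thesis using \<mu> K by (simp add: divide_le_eq power_mult_distrib)
 qed
 define \<nu> where "\<nu> k = symb \<theta> k + \<mu>" for k :: "int^'d"
 have \<nu>: "\<nu> k \<ge> \<mu>" for k using symb_nonneg[of \<theta> k] \<theta> by (simp add: \<nu>_def)
 have \<nu>m: "\<nu> (- k) = \<nu> k" for k by (simp add: \<nu>_def symb_minus)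
 define B where "B = sqrt (enn2real (sE 0 a0))"
 have a0B: "cmod (a0 k) \<le> B" for k
 proof (rule cmod_le_sE_0)
  have "sE 0 a0 < \<infinity>" using sE_ge_0_exp[OF \<beta>0, of a0] a0(2) by (rule le_less_trans)
  then show "sE 0 a0 \<le> ennreal (B^2)" by (simp add: B_def less_top)
 qed (simp add: B_def)
 define d where "d = dsol \<nu> F a0"
 \<comment> \<open>Freezing time outside \<open>{0..T}\<close> makes the coefficients continuous and
   bounded on the whole line, so that later statements carry no restriction on
   \<open>t\<close>.\<close>
 define cl where "cl t = max 0 (min T t)" for t
 have cl: "cl t \<in> {0..T}" for t using T by (auto simp: cl_def)
 have clT: "cl t = t" if "t \<in> {0..T}" for t using that by (auto simp: cl_def)
 define c where "c k t = of_real (exp (\<mu> * cl t)) * d k (cl t)" for k t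
 have dder: "(d k has_vector_derivative (- of_real (\<nu> k) * d k t - conv F (\<lambda>l. d l t) k)) (at t within {0..T})"
  if "t \<in> {0..T}" for k t unfolding d_def by (rule dsol_deriv[OF \<nu> \<mu> \<Lambda> small a0B T that])
 have dcont: "continuous_on {0..T} (d k)" for k
  using dder by (intro continuous_on_vector_derivative) auto
 have clc: "continuous_on UNIV cl" unfolding cl_def by (intro continuous_intros)
 show ?thesis
 proof (rule that)
  show "continuous_on UNIV (c k)" for k
   unfolding c_def by (intro continuous_intros clc continuous_on_compose2[OF dcont clc]) (use cl in auto)
  show "herm (\<lambda>k. c k t)" for t
   using dsol_herm[where \<nu> = \<nu>, OF \<nu> \<mu> \<Lambda> small a0B T F(1) a0(1) \<nu>m cl[of t]] by (simp add: herm_def c_def d_def)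
  show "c k 0 = a0 k" for k
   using dsol_0[OF \<nu> \<mu> \<Lambda> small a0B T] clT[of 0] T by (simp add: c_def d_def)
  have "sE \<beta> (\<lambda>k. c k t) \<le> ennreal ((exp (\<mu> * T))^2) * (4 * sE \<beta> a0)" for t
  proof -
   have "exp (\<mu> * cl t) \<le> exp (\<mu> * T)" using cl[of t] \<mu> by simp
   then show ?thesis
    unfolding c_def sE_cmult d_def
    by (intro mult_mono dsol_sE[OF \<nu> \<mu> \<Lambda> small a0B T Kc K(1) small' cl] ennreal_leI) (auto intro!: power_mono)
  qed
  also have "ennreal ((exp (\<mu> * T))^2) * (4 * sE \<beta> a0) = ennreal (enn2real (ennreal ((exp (\<mu> * T))^2) * (4 * sE \<beta> a0)))"
   using a0(2) by (intro ennreal_enn2real[symmetric]) (simp add: ennreal_mult_less_top)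
  finally show "sE \<beta> (\<lambda>k. c k t) \<le> ennreal (enn2real (ennreal ((exp (\<mu> * T))^2) * (4 * sE \<beta> a0)))" for t .
  fix k t assume t: "t \<in> {0..T}"
  have "((\<lambda>t. of_real (exp (\<mu> * t)) * d k t) has_vector_derivative
    (of_real (exp (\<mu> * t)) * (- of_real (\<nu> k) * d k t - conv F (\<lambda>l. d l t) k) + of_real \<mu> * (of_real (exp (\<mu> * t)) * 1) * d k t)) (at t within {0..T})"
   using has_vector_derivative_mult[OF exp_vderiv[of \<mu> 1 t "{0..T}"] dder[OF t, of k]] by simp
  moreover have "of_real (exp (\<mu> * t)) * (- of_real (\<nu> k) * d k t - conv F (\<lambda>l. d l t) k) + of_real \<mu> * (of_real (exp (\<mu> * t)) * 1) * d k t
    = - of_real (symb \<theta> k) * c k t - conv F (\<lambda>l. c l t) k"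
  proof -
   have "conv F (\<lambda>l. c l t) k = of_real (exp (\<mu> * t)) * conv F (\<lambda>l. d l t) k"
    by (simp only: c_def clT[OF t] conv_cmult)
   then show ?thesis by (simp only:) (simp add: c_def clT[OF t] \<nu>_def algebra_simps)
  qed
  ultimately have "((\<lambda>t. of_real (exp (\<mu> * t)) * d k t) has_vector_derivative
    (- of_real (symb \<theta> k) * c k t - conv F (\<lambda>l. c l t) k)) (at t within {0..T})" by simp
  then show "(c k has_vector_derivative (- of_real (symb \<theta> k) * c k t - conv F (\<lambda>l. c l t) k)) (at t within {0..T})"
   by (rule has_vector_derivative_transform[OF t, rotated]) (simp add: c_def clT)
 qed simp
qed

lemma integrable_timeM_cont:
 fixes p :: "real \<Rightarrow> 'b::{banach, second_countable_topology}"
 assumes "continuous_on UNIV p"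
 shows "integrable (timeM T) p"
proof -
 have "compact (p ` {0..T})" by (intro compact_continuous_image continuous_on_subset[OF assms]) auto
 then obtain B where B: "\<And>t. t \<in> {0..T} \<Longrightarrow> norm (p t) \<le> B"
  using compact_imp_bounded by (force simp: bounded_iff)
 show ?thesis
 proof (rule finite_measure.integrable_const_bound[OF finite_measure_timeM, where B = B])
  show "AE t in timeM T. norm (p t) \<le> B" using AE_timeM_Ioo[of T] by eventually_elim (use B in auto)
  show "p \<in> borel_measurable (timeM T)" using borel_measurable_continuous_onI[OF assms] by simp
 qed
qed

text \<open>Both inequalities come from integrating the derivative of \<open>(cmod (y t))^2\<close>.
  For the second, the identity is multiplied by \<open>l\<close> and half of the damping term
  absorbs the forcing by Young's inequality: maximal regularity for a single mode.\<close>

lemma mode_energy: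
 fixes y g :: "real \<Rightarrow> complex"
 assumes T: "T > 0" and y: "continuous_on UNIV y" and g: "continuous_on UNIV g" and l: "l \<ge> 0"
  and der: "\<And>t. t \<in> {0..T} \<Longrightarrow> (y has_vector_derivative (- of_real l * y t - g t)) (at t within {0..T})"
 shows "(cmod (y T))^2 \<le> (cmod (y 0))^2 - 2 * (\<integral>t. y t \<bullet> g t \<partial>timeM T)"
  and "l^2 * (\<integral>t. (cmod (y t))^2 \<partial>timeM T) \<le> l * (cmod (y 0))^2 + (\<integral>t. (cmod (g t))^2 \<partial>timeM T)"
proof -
 have [measurable]: "y \<in> bmeas" "g \<in> bmeas"
  using y g borel_measurable_continuous_onI by blast+
 have iy: "integrable (timeM T) (\<lambda>t. (cmod (y t))^2)" and ig: "integrable (timeM T) (\<lambda>t. (cmod (g t))^2)"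
  and iyg: "integrable (timeM T) (\<lambda>t. y t \<bullet> g t)"
  by (intro integrable_timeM_cont continuous_intros y g)+
 have "(\<integral>t. - 2 * l * (cmod (y t))^2 - 2 * (y t \<bullet> g t) \<partial>timeM T) = (cmod (y T))^2 - (cmod (y 0))^2"
 proof (rule integral_timeM_FTC[OF T])
  fix t assume "0 \<le> t" "t \<le> T"
  then have d: "(y has_vector_derivative (- of_real l * y t - g t)) (at t within {0..T})" by (intro der) auto
  have "((\<lambda>t. y t \<bullet> y t) has_vector_derivative (y t \<bullet> (- of_real l * y t - g t) + (- of_real l * y t - g t) \<bullet> y t)) (at t within {0..T})"
   by (rule bounded_bilinear.has_vector_derivative[OF bounded_bilinear_inner d d])
  moreover have "y t \<bullet> (- of_real l * y t - g t) + (- of_real l * y t - g t) \<bullet> y t = - 2 * l * (cmod (y t))^2 - 2 * (y t \<bullet> g t)"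
   unfolding power2_norm_eq_inner by (simp add: inner_complex_def algebra_simps)
  ultimately show "((\<lambda>t. (cmod (y t))^2) has_vector_derivative (- 2 * l * (cmod (y t))^2 - 2 * (y t \<bullet> g t))) (at t within {0..T})"
   by (simp add: power2_norm_eq_inner)
 qed (auto intro!: continuous_intros continuous_on_subset[OF y] continuous_on_subset[OF g])
 then have eq: "(cmod (y T))^2 = (cmod (y 0))^2 - 2 * l * (\<integral>t. (cmod (y t))^2 \<partial>timeM T) - 2 * (\<integral>t. y t \<bullet> g t \<partial>timeM T)"
  using iy iyg by simp
 then have "l * (\<integral>t. (cmod (y t))^2 \<partial>timeM T) \<ge> 0" using l by simp
 then show "(cmod (y T))^2 \<le> (cmod (y 0))^2 - 2 * (\<integral>t. y t \<bullet> g t \<partial>timeM T)" unfolding eq by simp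
 have "(\<integral>t. - 2 * l * (y t \<bullet> g t) \<partial>timeM T) \<le> (\<integral>t. l^2 * (cmod (y t))^2 + (cmod (g t))^2 \<partial>timeM T)"
 proof (rule integral_mono)
  fix t
  have "0 \<le> (cmod (of_real l * y t + g t))^2" by simp
  also have "\<dots> = l^2 * (cmod (y t))^2 + (cmod (g t))^2 + 2 * l * (y t \<bullet> g t)"
   by (simp only: cmod_power2) (simp add: inner_complex_def power2_eq_square algebra_simps)
  finally show "- 2 * l * (y t \<bullet> g t) \<le> l^2 * (cmod (y t))^2 + (cmod (g t))^2" by simp
 qed (use iy ig iyg in auto)
 then have 1: "- 2 * l * (\<integral>t. y t \<bullet> g t \<partial>timeM T) \<le> l^2 * (\<integral>t. (cmod (y t))^2 \<partial>timeM T) + (\<integral>t. (cmod (g t))^2 \<partial>timeM T)"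
  using iy ig iyg by simp
 have "l * (cmod (y T))^2 \<ge> 0" using l by simp
 then have "0 \<le> l * (cmod (y 0))^2 - 2 * l^2 * (\<integral>t. (cmod (y t))^2 \<partial>timeM T) - 2 * l * (\<integral>t. y t \<bullet> g t \<partial>timeM T)"
  unfolding eq by (simp add: algebra_simps power2_eq_square)
 with 1 show "l^2 * (\<integral>t. (cmod (y t))^2 \<partial>timeM T) \<le> l * (cmod (y 0))^2 + (\<integral>t. (cmod (g t))^2 \<partial>timeM T)"
  by linarith
qed

text \<open>By Fubini and \<open>synth_complex\<close> the pairing is the integral of
  \<open>f\<close> times the square of the synthesized function. The sign of the potential enters
  here.\<close>

lemma conv_pairing_nonneg:
 fixes f :: "real^'d \<Rightarrow> real"
 assumes f: "integrable cubeM f" "l1 (fcoef f) < \<infinity>" "\<And>x. f x \<ge> 0" and v: "herm v" "l1 v < \<infinity>"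
 shows "0 \<le> (\<integral>k. v k \<bullet> conv (fcoef f) v k \<partial>cntM)"
  and "integrable (cntM) (\<lambda>k. v k \<bullet> conv (fcoef f) v k)"
proof -
 define u where "u = synth v"
 have fm [measurable]: "f \<in> bmeas" using borel_measurable_integrable[OF f(1)] by simp
 have um [measurable]: "u \<in> bmeas" unfolding u_def by (rule synth_measurable)
 have iu: "integrable cubeM u" unfolding u_def by (rule l2_integrable[OF l2_synth[OF v(2)]])
 have fv: "fcoef u = v" unfolding u_def by (rule ext) (rule fcoef_synth[OF v])
 have c: "conv (fcoef f) v k = fcoef (\<lambda>x. f x * u x) k" for k
  unfolding fcoef_mult[OF f(1,2) iu] fv ..
 have ub: "\<bar>u x\<bar> \<le> enn2real (l1 v)" for x
 proof -
  have "ennreal \<bar>u x\<bar> \<le> ennreal (enn2real (l1 v))" using abs_synth_le[of v x] v(2) by (simp add: u_def less_top)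
  then show ?thesis by (simp add: ennreal_le_iff)
 qed
 have ifu: "integrable cubeM (\<lambda>x. f x * u x)"
 proof (rule Bochner_Integration.integrable_bound)
  show "integrable cubeM (\<lambda>x. f x * enn2real (l1 v))" using f(1) by simp
  show "AE x in cubeM. norm (f x * u x) \<le> norm (f x * enn2real (l1 v))"
   using ub by (auto simp: abs_mult intro!: AE_I2 mult_left_mono)
 qed simp
 have fin: "(\<integral>\<^sup>+k. \<integral>\<^sup>+x. ennreal (cmod (cnj (v k) * (of_real (f x * u x) * chr (- k) x))) \<partial>cubeM \<partial>cntM) < \<infinity>"
 proof -
  have "(\<integral>\<^sup>+k. \<integral>\<^sup>+x. ennreal (cmod (cnj (v k) * (of_real (f x * u x) * chr (- k) x))) \<partial>cubeM \<partial>cntM)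
    = (\<integral>\<^sup>+k. ennreal (cmod (v k)) * (\<integral>\<^sup>+x. ennreal (norm (f x * u x)) \<partial>cubeM) \<partial>cntM)"
   by (intro nn_integral_cong, subst nn_integral_cmult[symmetric]) (auto simp: norm_mult ennreal_mult abs_mult)
  also have "\<dots> = l1 v * (\<integral>\<^sup>+x. ennreal (norm (f x * u x)) \<partial>cubeM)"
   by (simp add: l1_def nn_integral_multc)
  also have "\<dots> < \<infinity>"
  proof -
   have "(\<integral>\<^sup>+x. ennreal (norm (f x * u x)) \<partial>cubeM) < \<infinity>" using ifu unfolding integrable_iff_bounded by simp
   then show ?thesis using v(2) by (simp add: ennreal_mult_less_top)
  qed
  finally show ?thesis .
 qed
 have m: "(\<lambda>x. cnj (v k) * (complex_of_real (f x * u x) * chr (- k) x)) \<in> borel_measurable cubeM" for k by simp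
 have vc: "cnj (v k) * conv (fcoef f) v k = (\<integral>x. cnj (v k) * (of_real (f x * u x) * chr (- k) x) \<partial>cubeM)" for k
  unfolding c by (subst fcoef_eq) auto
 have inner: "v k \<bullet> conv (fcoef f) v k = Re (cnj (v k) * conv (fcoef f) v k)" for k
  by (simp add: inner_complex_def)
 have swap: "(\<integral>x. \<integral>k. cnj (v k) * (of_real (f x * u x) * chr (- k) x) \<partial>cntM \<partial>cubeM)
   = (\<integral>k. cnj (v k) * conv (fcoef f) v k \<partial>cntM)"
  unfolding vc by (rule integral_count_swap[OF sigma_finite_cubeM m fin])
 have int: "integrable (cntM) (\<lambda>k. cnj (v k) * conv (fcoef f) v k)"
 proof (rule integrableI_bounded)
  have "(\<integral>\<^sup>+k. ennreal (norm (cnj (v k) * conv (fcoef f) v k)) \<partial>cntM)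
    \<le> (\<integral>\<^sup>+k. \<integral>\<^sup>+x. ennreal (cmod (cnj (v k) * (of_real (f x * u x) * chr (- k) x))) \<partial>cubeM \<partial>cntM)"
   unfolding vc by (intro nn_integral_mono cmod_integral_le)
  then show "(\<integral>\<^sup>+k. ennreal (norm (cnj (v k) * conv (fcoef f) v k)) \<partial>cntM) < \<infinity>" using fin by (rule le_less_trans)
 qed simp
 show "integrable (cntM) (\<lambda>k. v k \<bullet> conv (fcoef f) v k)"
  unfolding inner by (rule integrable_Re[OF int])
 have "(\<integral>k. cnj (v k) * (of_real (f x * u x) * chr (- k) x) \<partial>cntM) = of_real (f x * (u x)^2)" for x
 proof -
  have "(\<integral>k. cnj (v k) * (of_real (f x * u x) * chr (- k) x) \<partial>cntM)
    = (\<integral>k. of_real (f x * u x) * cnj (v k * chr k x) \<partial>cntM)"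
   by (intro Bochner_Integration.integral_cong) (auto simp: cnj_chr)
  also have "\<dots> = of_real (f x * u x) * cnj (of_real (u x))"
   unfolding u_def synth_complex[OF v] by (simp only: integral_mult_right_zero Bochner_Integration.integral_cnj)
  finally show ?thesis by (simp add: power2_eq_square)
 qed
 then have "(\<integral>k. cnj (v k) * conv (fcoef f) v k \<partial>cntM) = of_real (\<integral>x. f x * (u x)^2 \<partial>cubeM)"
  unfolding swap[symmetric] by (simp only: integral_complex_of_real)
 then have "(\<integral>k. v k \<bullet> conv (fcoef f) v k \<partial>cntM) = (\<integral>x. f x * (u x)^2 \<partial>cubeM)"
  unfolding inner by (subst integral_Re[OF int]) simp
 moreover have "0 \<le> (\<integral>x. f x * (u x)^2 \<partial>cubeM)"
  by (intro Bochner_Integration.integral_nonneg mult_nonneg_nonneg f(3)) auto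
 ultimately show "0 \<le> (\<integral>k. v k \<bullet> conv (fcoef f) v k \<partial>cntM)" by simp
qed

text \<open>Below \<open>N\<close> the first term dominates. Above \<open>N\<close> the factor
  \<open>x powr (s - p)\<close> is at most \<open>N powr (s - p)\<close>, its exponent being at most
  0.\<close>

lemma interp_pointwise:
 assumes "0 < x" "0 < N" "0 \<le> s" "s \<le> p"
 shows "(x::real) powr s \<le> N powr s + N powr (s - p) * x powr p"
proof (cases "x \<le> N")
 case True
 then have "x powr s \<le> N powr s" using assms by (intro powr_mono2) auto
 then show ?thesis by (simp add: add_increasing2)
next
 case False
 have "x powr s = x powr (s - p) * x powr p" by (simp add: powr_add[symmetric])
 also have "\<dots> \<le> N powr (s - p) * x powr p"
  using False assms by (intro mult_right_mono powr_mono2') auto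
 finally show ?thesis by (simp add: add_increasing)
qed

lemma sE_interp:
 assumes "0 < N" "0 \<le> s" "s \<le> p"
 shows "sE s a \<le> ennreal (N powr s) * sE 0 a + ennreal (N powr (s - p)) * sE p a"
proof -
 have "sE s a \<le> (\<integral>\<^sup>+k. ennreal (N powr s) * ennreal ((1 + ksq k) powr 0 * (cmod (a k))^2) + ennreal (N powr (s - p)) * ennreal ((1 + ksq k) powr p * (cmod (a k))^2) \<partial>cntM)"
  unfolding sE_def
 proof (rule nn_integral_mono)
  fix k :: "int^'a"
  have "(1 + ksq k) powr s * (cmod (a k))^2 \<le> (N powr s + N powr (s - p) * (1 + ksq k) powr p) * (cmod (a k))^2"
   using assms by (intro mult_right_mono interp_pointwise) auto
  also have "\<dots> = N powr s * ((1 + ksq k) powr 0 * (cmod (a k))^2) + N powr (s - p) * ((1 + ksq k) powr p * (cmod (a k))^2)"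
   by (simp add: algebra_simps)
  finally have "ennreal ((1 + ksq k) powr s * (cmod (a k))^2) \<le> ennreal \<dots>" by (rule ennreal_leI)
  then show "ennreal ((1 + ksq k) powr s * (cmod (a k))^2) \<le> ennreal (N powr s) * ennreal ((1 + ksq k) powr 0 * (cmod (a k))^2) + ennreal (N powr (s - p)) * ennreal ((1 + ksq k) powr p * (cmod (a k))^2)"
   by (simp add: ennreal_mult)
 qed
 also have "\<dots> = ennreal (N powr s) * sE 0 a + ennreal (N powr (s - p)) * sE p a"
  unfolding sE_def by (simp add: nn_integral_add nn_integral_cmult)
 finally show ?thesis .
qed

lemma sE_measurable:
 assumes [measurable]: "\<And>k. a k \<in> bmeas"
 shows "(\<lambda>t. sE s (\<lambda>k. a k t)) \<in> bmeas"
 unfolding sE_def by (rule borel_measurable_count_nn_integral) measurable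

lemma tE_interp:
 assumes "0 < N" "0 \<le> s" "s \<le> p" and [measurable]: "\<And>k. a k \<in> bmeas"
 shows "tE T s a \<le> ennreal (N powr s) * tE T 0 a + ennreal (N powr (s - p)) * tE T p a"
proof -
 note [measurable] = sE_measurable[OF assms(4)]
 have "tE T s a \<le> (\<integral>\<^sup>+t. ennreal (N powr s) * sE 0 (\<lambda>k. a k t) + ennreal (N powr (s - p)) * sE p (\<lambda>k. a k t) \<partial>timeM T)"
  unfolding tE_def by (intro nn_integral_mono sE_interp assms)
 also have "\<dots> = ennreal (N powr s) * tE T 0 a + ennreal (N powr (s - p)) * tE T p a"
  unfolding tE_def by (subst nn_integral_add) (auto simp: nn_integral_cmult)
 finally show ?thesis .
qed

text \<open>The \<open>j\<close>-th time derivative that the system prescribes for its solution \<open>c\<close>.\<close>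

primrec tder :: "real \<Rightarrow> (int^'d \<Rightarrow> complex) \<Rightarrow> (int^'d \<Rightarrow> real \<Rightarrow> complex) \<Rightarrow> nat \<Rightarrow> int^'d \<Rightarrow> real \<Rightarrow> complex" where
 "tder \<theta> F c 0 = c"
| "tder \<theta> F c (Suc j) = (\<lambda>k t. - of_real (symb \<theta> k) * tder \<theta> F c j k t - conv F (\<lambda>l. tder \<theta> F c j l t) k)"

lemma conv_time_measurable:
 assumes [measurable]: "\<And>l. v l \<in> bmeas"
 shows "(\<lambda>t. conv F (\<lambda>l. v l t) k) \<in> bmeas"
 unfolding conv_def by (rule borel_measurable_count_integral) measurable

lemma tder_measurable:
 assumes "\<And>k. c k \<in> bmeas"
 shows "tder \<theta> F c j k \<in> bmeas"
proof (induction j arbitrary: k)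
 case (Suc j)
 note [measurable] = Suc conv_time_measurable[OF Suc]
 show ?case by simp
qed (use assms in simp)

lemma tder_herm:
 assumes "herm F" "\<And>t. herm (\<lambda>k. c k t)"
 shows "herm (\<lambda>k. tder \<theta> F c j k t)"
proof (induction j)
 case (Suc j)
 have "conv F (\<lambda>l. tder \<theta> F c j l t) (- k) = cnj (conv F (\<lambda>l. tder \<theta> F c j l t) k)" for k
  using herm_conv[OF assms(1) Suc] by (simp add: herm_def)
 then show ?case using Suc by (simp add: herm_def symb_minus)
qed (use assms in simp)

lemma sE_symb_le: "sE s (\<lambda>k. of_real (symb \<theta> k) * a k) \<le> ennreal ((2 * pi^2 * \<theta>)^2) * sE (s + 2) a"
proof -
 have "sE s (\<lambda>k. of_real (symb \<theta> k) * a k) \<le> (\<integral>\<^sup>+k. ennreal ((2 * pi^2 * \<theta>)^2) * ennreal ((1 + ksq k) powr (s + 2) * (cmod (a k))^2) \<partial>cntM)"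
  unfolding sE_def
 proof (rule nn_integral_mono)
  fix k :: "int^'a"
  have "(ksq k)^2 \<le> (1 + ksq k)^2" by (intro power_mono) auto
  also have "\<dots> = (1 + ksq k) powr 2" by simp
  finally have "(1 + ksq k) powr s * (ksq k)^2 \<le> (1 + ksq k) powr s * (1 + ksq k) powr 2" by (intro mult_left_mono) auto
  then have "(1 + ksq k) powr s * (ksq k)^2 \<le> (1 + ksq k) powr (s + 2)" by (simp only: powr_add)
  then have "((2 * pi^2 * \<theta>)^2 * (cmod (a k))^2) * ((1 + ksq k) powr s * (ksq k)^2) \<le> ((2 * pi^2 * \<theta>)^2 * (cmod (a k))^2) * (1 + ksq k) powr (s + 2)"
   by (intro mult_left_mono) auto
  moreover have "(cmod (of_real (symb \<theta> k) * a k))^2 = (2 * pi^2 * \<theta>)^2 * (ksq k)^2 * (cmod (a k))^2"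
   unfolding norm_mult norm_of_real power_mult_distrib power2_abs by (simp add: symb_def power_mult_distrib)
  ultimately have "(1 + ksq k) powr s * (cmod (of_real (symb \<theta> k) * a k))^2 \<le> (2 * pi^2 * \<theta>)^2 * ((1 + ksq k) powr (s + 2) * (cmod (a k))^2)"
   by (simp only: ac_simps)
  then show "ennreal ((1 + ksq k) powr s * (cmod (of_real (symb \<theta> k) * a k))^2) \<le> ennreal ((2 * pi^2 * \<theta>)^2) * ennreal ((1 + ksq k) powr (s + 2) * (cmod (a k))^2)"
   by (subst ennreal_mult[symmetric]) (auto intro: ennreal_leI)
 qed
 then show ?thesis by (simp add: sE_def nn_integral_cmult)
qed

lemma tder_sE_step:
 "sE s (\<lambda>k. tder \<theta> F c (Suc j) k t) \<le> 2 * (ennreal ((2 * pi^2 * \<theta>)^2) * sE (s + 2) (\<lambda>k. tder \<theta> F c j k t)) + 2 * sE s (conv F (\<lambda>l. tder \<theta> F c j l t))"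
proof -
 have "sE s (\<lambda>k. tder \<theta> F c (Suc j) k t) = sE s (\<lambda>k. of_real (symb \<theta> k) * tder \<theta> F c j k t + conv F (\<lambda>l. tder \<theta> F c j l t) k)"
 proof (rule sE_cong)
  fix k
  have "tder \<theta> F c (Suc j) k t = - (of_real (symb \<theta> k) * tder \<theta> F c j k t + conv F (\<lambda>l. tder \<theta> F c j l t) k)" by simp
  then show "cmod (tder \<theta> F c (Suc j) k t) = cmod (of_real (symb \<theta> k) * tder \<theta> F c j k t + conv F (\<lambda>l. tder \<theta> F c j l t) k)"
   by (simp only: norm_minus_cancel)
 qed
 also have "\<dots> \<le> 2 * sE s (\<lambda>k. of_real (symb \<theta> k) * tder \<theta> F c j k t) + 2 * sE s (conv F (\<lambda>l. tder \<theta> F c j l t))"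
  by (rule sE_add_le)
 also have "\<dots> \<le> 2 * (ennreal ((2 * pi^2 * \<theta>)^2) * sE (s + 2) (\<lambda>k. tder \<theta> F c j k t)) + 2 * sE s (conv F (\<lambda>l. tder \<theta> F c j l t))"
  by (intro add_right_mono mult_left_mono sE_symb_le) auto
 finally show ?thesis .
qed

lemma nn_integral_timeM_of_real:
 fixes y :: "real \<Rightarrow> complex"
 assumes y: "continuous_on UNIV y" and A: "A \<ge> 0"
 shows "(\<integral>\<^sup>+t. ennreal (A * (cmod (y t))^2) \<partial>timeM T) = ennreal (A * (\<integral>t. (cmod (y t))^2 \<partial>timeM T))"
proof -
 have i: "integrable (timeM T) (\<lambda>t. A * (cmod (y t))^2)"
  by (intro integrable_timeM_cont continuous_intros y)
 have "(\<integral>\<^sup>+t. ennreal (A * (cmod (y t))^2) \<partial>timeM T) = ennreal (\<integral>t. A * (cmod (y t))^2 \<partial>timeM T)"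
  by (rule nn_integral_eq_integral[OF i]) (use A in auto)
 then show ?thesis by simp
qed

text \<open>\<open>mode_energy\<close> with weight \<open>(1 + ksq k) powr s\<close>, summed over
  modes. The initial datum is multiplied by one factor of the symbol only, hence its order
  \<open>s + 1\<close>; the first term on the right covers low frequencies, where the symbol
  degenerates.\<close>

lemma max_regularity:
 fixes c g :: "int^'d \<Rightarrow> real \<Rightarrow> complex"
 assumes T: "T > 0" and \<theta>: "\<theta> > 0"
  and c: "\<And>k. continuous_on UNIV (c k)" and g: "\<And>k. continuous_on UNIV (g k)"
  and der: "\<And>k t. t \<in> {0..T} \<Longrightarrow> (c k has_vector_derivative (- of_real (symb \<theta> k) * c k t - g k t)) (at t within {0..T})"
 shows "tE T (s + 2) c \<le> 2 * tE T s c + ennreal (2 / (2 * pi^2 * \<theta>)) * sE (s + 1) (\<lambda>k. c k 0)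
      + ennreal (2 / (2 * pi^2 * \<theta>)^2) * tE T s g"
proof -
 define \<kappa> where "\<kappa> = 2 * pi^2 * \<theta>"
 have \<kappa>: "\<kappa> > 0" using \<theta> by (simp add: \<kappa>_def)
 have cm: "c k \<in> bmeas" and gm: "g k \<in> bmeas" for k
  using c g borel_measurable_continuous_onI by blast+
 have "tE T (s + 2) c \<le> (\<integral>\<^sup>+k. 2 * (\<integral>\<^sup>+t. ennreal ((1 + ksq k) powr s * (cmod (c k t))^2) \<partial>timeM T)
   + ennreal (2 / \<kappa>) * ennreal ((1 + ksq k) powr (s + 1) * (cmod (c k 0))^2)
   + ennreal (2 / \<kappa>^2) * (\<integral>\<^sup>+t. ennreal ((1 + ksq k) powr s * (cmod (g k t))^2) \<partial>timeM T) \<partial>cntM)"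
  unfolding tE_eq_count[OF cm]
 proof (rule nn_integral_mono)
  fix k :: "int^'d"
  define x where "x = ksq k"
  define X where "X = (1 + x) powr s"
  define I where "I = (\<integral>t. (cmod (c k t))^2 \<partial>timeM T)"
  define G where "G = (\<integral>t. (cmod (g k t))^2 \<partial>timeM T)"
  define a where "a = (cmod (c k 0))^2"
  have x: "x \<ge> 0" "1 + x > 0" by (auto simp: x_def)
  have nn: "X \<ge> 0" "I \<ge> 0" "G \<ge> 0" "a \<ge> 0" by (auto simp: X_def I_def G_def a_def)
  have sx: "symb \<theta> k = \<kappa> * x" by (simp add: symb_def \<kappa>_def x_def)
  have "(\<kappa> * x)^2 * I \<le> (\<kappa> * x) * a + G"
   using mode_energy(2)[OF T c[of k] g[of k] symb_nonneg[OF less_imp_le[OF \<theta>], of k] der[of _ k]] unfolding sx I_def G_def a_def by simp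
  also have "\<dots> \<le> (\<kappa> * (1 + x)) * a + G" using \<kappa> nn by (intro add_right_mono mult_right_mono) auto
  finally have e: "\<kappa>^2 * (x^2 * I) \<le> \<kappa> * ((1 + x) * a) + G" by (simp add: power_mult_distrib mult.assoc)
  have "x^2 * I \<le> (\<kappa> * ((1 + x) * a) + G) / \<kappa>^2"
   using e \<kappa> by (simp add: le_divide_eq mult.commute)
  also have "\<dots> = (1 + x) * a / \<kappa> + G / \<kappa>^2" using \<kappa> by (simp add: add_divide_distrib power2_eq_square)
  finally have e2: "x^2 * I \<le> (1 + x) * a / \<kappa> + G / \<kappa>^2" .
  \<comment> \<open>The two orders gained are measured by \<open>1 + x\<close>, while the symbol
    controls only \<open>x\<close>.\<close>
  have "(1 + x)^2 \<le> 2 + 2 * x^2" using sum_squares_ge_zero[of "x - 1" 0] by (simp add: power2_eq_square algebra_simps)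
  then have "(1 + x)^2 * I \<le> (2 + 2 * x^2) * I" using nn by (intro mult_right_mono)
  also have "\<dots> = 2 * I + 2 * (x^2 * I)" by (simp add: algebra_simps)
  also have "\<dots> \<le> 2 * I + 2 * ((1 + x) * a / \<kappa> + G / \<kappa>^2)" using e2 by simp
  finally have "X * ((1 + x)^2 * I) \<le> X * (2 * I + 2 * ((1 + x) * a / \<kappa> + G / \<kappa>^2))" using nn by (intro mult_left_mono)
  moreover have "(1 + x) powr (s + 2) * I = X * ((1 + x)^2 * I)"
   using x by (simp add: X_def powr_add)
  moreover have "X * (1 + x) = (1 + x) powr (s + 1)" using x by (simp add: X_def powr_add)
  moreover have "X * (2 * I + 2 * ((1 + x) * a / \<kappa> + G / \<kappa>^2)) = 2 * (X * I) + 2 / \<kappa> * ((X * (1 + x)) * a) + 2 / \<kappa>^2 * (X * G)"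
   by (simp add: algebra_simps add_divide_distrib)
  ultimately have main: "(1 + x) powr (s + 2) * I \<le> 2 * (X * I) + 2 / \<kappa> * ((1 + x) powr (s + 1) * a) + 2 / \<kappa>^2 * (X * G)"
   by (simp only:)
  have "(\<integral>\<^sup>+t. ennreal ((1 + ksq k) powr (s + 2) * (cmod (c k t))^2) \<partial>timeM T) = ennreal ((1 + x) powr (s + 2) * I)"
   unfolding I_def x_def by (rule nn_integral_timeM_of_real[OF c]) simp
  also have "\<dots> \<le> ennreal (2 * (X * I) + 2 / \<kappa> * ((1 + x) powr (s + 1) * a) + 2 / \<kappa>^2 * (X * G))"
   by (rule ennreal_leI[OF main])
  also have "\<dots> = 2 * ennreal (X * I) + ennreal (2 / \<kappa>) * ennreal ((1 + x) powr (s + 1) * a) + ennreal (2 / \<kappa>^2) * ennreal (X * G)"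
  proof -
   have p: "0 \<le> 2 * (X * I)" "0 \<le> 2 / \<kappa> * ((1 + x) powr (s + 1) * a)" "0 \<le> 2 / \<kappa>^2 * (X * G)"
    using nn \<kappa> by auto
   have "ennreal (2 * (X * I)) = 2 * ennreal (X * I)" using nn by (subst ennreal_mult) auto
   moreover have "ennreal (2 / \<kappa> * ((1 + x) powr (s + 1) * a)) = ennreal (2 / \<kappa>) * ennreal ((1 + x) powr (s + 1) * a)"
    using nn \<kappa> by (intro ennreal_mult) auto
   moreover have "ennreal (2 / \<kappa>^2 * (X * G)) = ennreal (2 / \<kappa>^2) * ennreal (X * G)"
    using nn \<kappa> by (intro ennreal_mult) auto
   ultimately show ?thesis using p by (simp only: ennreal_plus add_nonneg_nonneg)
  qed
  also have "ennreal (X * I) = (\<integral>\<^sup>+t. ennreal ((1 + ksq k) powr s * (cmod (c k t))^2) \<partial>timeM T)"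
   unfolding I_def X_def x_def by (rule nn_integral_timeM_of_real[OF c, symmetric]) simp
  also have "ennreal (X * G) = (\<integral>\<^sup>+t. ennreal ((1 + ksq k) powr s * (cmod (g k t))^2) \<partial>timeM T)"
   unfolding G_def X_def x_def by (rule nn_integral_timeM_of_real[OF g, symmetric]) simp
  finally show "(\<integral>\<^sup>+t. ennreal ((1 + ksq k) powr (s + 2) * (cmod (c k t))^2) \<partial>timeM T)
   \<le> 2 * (\<integral>\<^sup>+t. ennreal ((1 + ksq k) powr s * (cmod (c k t))^2) \<partial>timeM T)
    + ennreal (2 / \<kappa>) * ennreal ((1 + ksq k) powr (s + 1) * (cmod (c k 0))^2)
    + ennreal (2 / \<kappa>^2) * (\<integral>\<^sup>+t. ennreal ((1 + ksq k) powr s * (cmod (g k t))^2) \<partial>timeM T)"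
   by (simp only: x_def a_def)
 qed
 also have "\<dots> = 2 * tE T s c + ennreal (2 / \<kappa>) * sE (s + 1) (\<lambda>k. c k 0) + ennreal (2 / \<kappa>^2) * tE T s g"
  unfolding tE_eq_count[OF cm] tE_eq_count[OF gm] sE_def by (simp add: nn_integral_add nn_integral_cmult)
 finally show ?thesis by (simp add: \<kappa>_def)
qed

text \<open>When the first inequality of \<open>mode_energy\<close> is summed over all modes, the
  potential contributes minus a nonnegative time integral. The bounds \<open>R\<close> and
  \<open>R'\<close> justify exchanging the sum with that integral and leave no trace in the
  conclusion.\<close>

lemma energy_bound:
 fixes f :: "real^'d \<Rightarrow> real" and c :: "int^'d \<Rightarrow> real \<Rightarrow> complex"
 assumes \<theta>: "\<theta> \<ge> 0" and f: "integrable cubeM f" "l1 (fcoef f) < \<infinity>" "\<And>x. f x \<ge> 0"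
  and c: "\<And>k. continuous_on UNIV (c k)" and h: "\<And>t. herm (\<lambda>k. c k t)" and cl: "\<And>t. l1 (\<lambda>k. c k t) < \<infinity>"
  and g: "\<And>k. continuous_on UNIV (\<lambda>t. conv (fcoef f) (\<lambda>l. c l t) k)"
  and R: "\<And>t. sE 0 (\<lambda>k. c k t) \<le> ennreal R" "\<And>t. sE 0 (conv (fcoef f) (\<lambda>l. c l t)) \<le> ennreal R'"
  and der: "\<And>k t. t \<in> {0..T} \<Longrightarrow> (c k has_vector_derivative (- of_real (symb \<theta> k) * c k t - conv (fcoef f) (\<lambda>l. c l t) k)) (at t within {0..T})"
  and t: "t \<in> {0<..T}"
 shows "sE 0 (\<lambda>k. c k t) \<le> sE 0 (\<lambda>k. c k 0)"
proof -
 define g where "g k s = conv (fcoef f) (\<lambda>l. c l s) k" for k s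
 have gc: "continuous_on UNIV (g k)" for k using g by (simp add: g_def[abs_def])
 have [measurable]: "c k \<in> bmeas" "g k \<in> bmeas" for k
  using c gc borel_measurable_continuous_onI by blast+
 define p where "p k s = c k s \<bullet> g k s" for k s
 have pm' [measurable]: "p k \<in> bmeas" for k unfolding p_def by measurable
 \<comment> \<open>Regarded as complex because the exchange of sum and integral is stated for
   complex values.\<close>
 have pm: "(\<lambda>s. complex_of_real (p k s)) \<in> borel_measurable (timeM t)" for k by simp
 have "(\<integral>\<^sup>+k. \<integral>\<^sup>+s. ennreal (cmod (complex_of_real (p k s))) \<partial>timeM t \<partial>cntM)
   = (\<integral>\<^sup>+s. \<integral>\<^sup>+k. ennreal (cmod (complex_of_real (p k s))) \<partial>cntM \<partial>timeM t)"
  by (rule nn_integral_count_space_nn_integral[symmetric]) auto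
 also have "\<dots> \<le> (\<integral>\<^sup>+s. ennreal R + ennreal R' \<partial>timeM t)"
 proof (rule nn_integral_mono)
  fix s
  have "(\<integral>\<^sup>+k. ennreal (cmod (complex_of_real (p k s))) \<partial>cntM)
    \<le> (\<integral>\<^sup>+k. ennreal ((cmod (c k s))^2) + ennreal ((cmod (g k s))^2) \<partial>cntM)"
  proof (rule nn_integral_mono)
   fix k
   have "\<bar>p k s\<bar> \<le> cmod (c k s) * cmod (g k s)" unfolding p_def by (rule Cauchy_Schwarz_ineq2)
   also have "\<dots> \<le> (cmod (c k s))^2 + (cmod (g k s))^2"
   proof -
    have "0 \<le> (cmod (c k s) - cmod (g k s))^2" "0 \<le> cmod (c k s) * cmod (g k s)" by auto
    moreover have "(cmod (c k s) - cmod (g k s))^2 = (cmod (c k s))^2 + (cmod (g k s))^2 - 2 * (cmod (c k s) * cmod (g k s))"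
     by (simp add: power2_eq_square algebra_simps)
    ultimately show ?thesis by linarith
   qed
   finally have "ennreal \<bar>p k s\<bar> \<le> ennreal ((cmod (c k s))^2 + (cmod (g k s))^2)" by (rule ennreal_leI)
   then show "ennreal (cmod (complex_of_real (p k s))) \<le> ennreal ((cmod (c k s))^2) + ennreal ((cmod (g k s))^2)" by simp
  qed
  also have "\<dots> = sE 0 (\<lambda>k. c k s) + sE 0 (\<lambda>k. g k s)"
   unfolding sE_0_eq by (rule nn_integral_add) auto
  also have "\<dots> \<le> ennreal R + ennreal R'" unfolding g_def by (intro add_mono R)
  finally show "(\<integral>\<^sup>+k. ennreal (cmod (complex_of_real (p k s))) \<partial>cntM) \<le> ennreal R + ennreal R'" .
 qed
 also have "\<dots> < \<infinity>" using t by (simp add: emeasure_timeM ennreal_mult_less_top)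
 finally have fin: "(\<integral>\<^sup>+k. \<integral>\<^sup>+s. ennreal (cmod (complex_of_real (p k s))) \<partial>timeM t \<partial>cntM) < \<infinity>" .
 define P where "P k = (\<integral>s. p k s \<partial>timeM t)" for k
 have iP: "integrable (cntM) P"
 proof (rule integrableI_bounded)
  have "(\<integral>\<^sup>+k. ennreal (norm (P k)) \<partial>cntM) \<le> (\<integral>\<^sup>+k. \<integral>\<^sup>+s. ennreal (cmod (complex_of_real (p k s))) \<partial>timeM t \<partial>cntM)"
  proof (rule nn_integral_mono)
   fix k
   have "ennreal (cmod (\<integral>s. complex_of_real (p k s) \<partial>timeM t)) \<le> (\<integral>\<^sup>+s. ennreal (cmod (complex_of_real (p k s))) \<partial>timeM t)"
    by (rule cmod_integral_le)
   then show "ennreal (norm (P k)) \<le> (\<integral>\<^sup>+s. ennreal (cmod (complex_of_real (p k s))) \<partial>timeM t)" by (simp add: P_def)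
  qed
  then show "(\<integral>\<^sup>+k. ennreal (norm (P k)) \<partial>cntM) < \<infinity>" using fin by (rule le_less_trans)
 qed simp
 have "complex_of_real (\<integral>k. P k \<partial>cntM) = (\<integral>k. \<integral>s. complex_of_real (p k s) \<partial>timeM t \<partial>cntM)"
  by (simp add: P_def flip: integral_complex_of_real)
 also have "\<dots> = (\<integral>s. \<integral>k. complex_of_real (p k s) \<partial>cntM \<partial>timeM t)"
  by (rule integral_count_swap[OF sigma_finite_timeM pm fin, symmetric])
 also have "\<dots> = complex_of_real (\<integral>s. \<integral>k. p k s \<partial>cntM \<partial>timeM t)" by simp
 finally have "(\<integral>k. P k \<partial>cntM) = (\<integral>s. \<integral>k. p k s \<partial>cntM \<partial>timeM t)" by (simp only: of_real_eq_iff)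
 also have "\<dots> \<ge> 0"
  unfolding p_def g_def by (intro Bochner_Integration.integral_nonneg conv_pairing_nonneg(1)[OF f h cl])
 finally have P0: "0 \<le> (\<integral>k. P k \<partial>cntM)" .
 have ic: "integrable (cntM) (\<lambda>k. (cmod (c k s))^2)" for s
  using le_less_trans[OF R(1)[of s, unfolded sE_0_eq]] by (intro integrableI_bounded) auto
 have sEc: "sE 0 (\<lambda>k. c k s) = ennreal (\<integral>k. (cmod (c k s))^2 \<partial>cntM)" for s
  unfolding sE_0_eq by (rule nn_integral_eq_integral[OF ic]) auto
 have "(\<integral>k. (cmod (c k t))^2 \<partial>cntM) \<le> (\<integral>k. (cmod (c k 0))^2 - 2 * P k \<partial>cntM)"
 proof (rule integral_mono[OF ic])
  show "integrable (cntM) (\<lambda>k. (cmod (c k 0))^2 - 2 * P k)" using ic[of 0] iP by auto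
  fix k
  show "(cmod (c k t))^2 \<le> (cmod (c k 0))^2 - 2 * P k"
   unfolding P_def p_def
  proof (rule mode_energy(1)[OF _ c gc symb_nonneg[OF \<theta>]])
   show "t > 0" using t by simp
   fix s assume "s \<in> {0..t}"
   then show "(c k has_vector_derivative - complex_of_real (symb \<theta> k) * c k s - g k s) (at s within {0..t})"
    unfolding g_def using t by (intro has_vector_derivative_within_subset[OF der]) auto
  qed
 qed
 also have "\<dots> = (\<integral>k. (cmod (c k 0))^2 \<partial>cntM) - 2 * (\<integral>k. P k \<partial>cntM)"
  using ic[of 0] iP by simp
 also have "\<dots> \<le> (\<integral>k. (cmod (c k 0))^2 \<partial>cntM)" using P0 by simp
 finally show ?thesis unfolding sEc by (rule ennreal_leI)
qed

lemma wder_smooth: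
 fixes y :: "real \<Rightarrow> complex"
 assumes T: "T > 0" and y: "continuous_on UNIV y" and y': "continuous_on UNIV y'"
  and der: "\<And>t. t \<in> {0..T} \<Longrightarrow> (y has_vector_derivative y' t) (at t within {0..T})"
 shows "wder T y y'"
 unfolding wder_def
proof (intro allI impI)
 fix \<eta> assume \<eta>: "test_fun T \<eta>"
 have c\<eta>: "continuous_on S \<eta>" "continuous_on S (deriv \<eta>)" for S
  using test_fun_continuous[OF \<eta>] test_fun_continuous[OF test_fun_deriv[OF \<eta>]] by blast+
 have cont: "continuous_on UNIV (\<lambda>t. y t * of_real (deriv \<eta> t) + y' t * of_real (\<eta> t))"
  by (intro continuous_intros y y' c\<eta>)
 have "(\<integral>t. y t * of_real (deriv \<eta> t) + y' t * of_real (\<eta> t) \<partial>timeM T) = y T * of_real (\<eta> T) - y 0 * of_real (\<eta> 0)"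
 proof (rule integral_timeM_FTC[OF T borel_measurable_continuous_onI[OF cont] _ continuous_on_subset[OF cont]])
  fix t assume t: "0 \<le> t" "t \<le> T"
  have "(\<eta> has_real_derivative deriv \<eta> t) (at t within {0..T})"
   by (rule has_field_derivative_at_within[OF test_fun_has_derivative[OF \<eta>]])
  from has_vector_derivative_mult[OF der has_vector_derivative_of_real[OF this]] t
  show "((\<lambda>t. y t * of_real (\<eta> t)) has_vector_derivative (y t * of_real (deriv \<eta> t) + y' t * of_real (\<eta> t))) (at t within {0..T})" by simp
 qed simp
 then have "(\<integral>t. y t * of_real (deriv \<eta> t) \<partial>timeM T) + (\<integral>t. y' t * of_real (\<eta> t) \<partial>timeM T) = 0"
  using test_fun_eq_0[OF \<eta>]
  by (subst (asm) Bochner_Integration.integral_add) (auto intro!: integrable_timeM_cont continuous_intros y y' c\<eta>)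
 then show "(\<integral>t. y t * of_real (deriv \<eta> t) \<partial>timeM T) = - (\<integral>t. y' t * of_real (\<eta> t) \<partial>timeM T)"
  by (simp add: add_eq_0_iff2)
qed

text \<open>Lets pairing with a test function, and with it a weak derivative, pass through the
  infinite lattice sum.\<close>

lemma conv_test_swap:
 fixes v :: "int^'d \<Rightarrow> real \<Rightarrow> complex"
 assumes F: "l1 F < \<infinity>" and vm [measurable]: "\<And>k. v k \<in> bmeas" and fin: "tE T 0 v < \<infinity>"
  and \<eta>: "test_fun T \<eta>"
 shows "(\<integral>t. conv F (\<lambda>l. v l t) k * of_real (\<eta> t) \<partial>timeM T)
    = (\<integral>l. F (k - l) * (\<integral>t. v l t * of_real (\<eta> t) \<partial>timeM T) \<partial>cntM)"
proof -
 obtain B where B: "B \<ge> 0" "\<And>t. \<bar>\<eta> t\<bar> \<le> B" using test_fun_bounded[OF \<eta>] by blast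
 note [measurable] = test_fun_measurable[OF \<eta>]
 have "(\<integral>t. conv F (\<lambda>l. v l t) k * of_real (\<eta> t) \<partial>timeM T)
   = (\<integral>t. \<integral>l. F (k - l) * v l t * of_real (\<eta> t) \<partial>cntM \<partial>timeM T)"
  by (simp add: conv_def)
 also have "\<dots> = (\<integral>l. \<integral>t. F (k - l) * v l t * of_real (\<eta> t) \<partial>timeM T \<partial>cntM)"
 proof (rule integral_count_swap[OF sigma_finite_timeM])
  define D where "D = emeasure (timeM T) UNIV + tE T 0 v"
  have Dfin: "D < \<infinity>"
   using fin finite_measure.emeasure_finite[OF finite_measure_timeM, of T UNIV] by (simp add: D_def less_top)
  have v1: "(\<integral>\<^sup>+t. ennreal (cmod (v l t)) \<partial>timeM T) \<le> D" for l
  proof -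
   have "(\<integral>\<^sup>+t. ennreal (cmod (v l t)) \<partial>timeM T) \<le> (\<integral>\<^sup>+t. 1 + ennreal ((cmod (v l t))^2) \<partial>timeM T)"
   proof (rule nn_integral_mono)
    fix t
    have "0 \<le> (cmod (v l t) - 1)^2" by simp
    then have "2 * cmod (v l t) \<le> 1 + (cmod (v l t))^2" by (simp add: power2_eq_square algebra_simps)
    then have "cmod (v l t) \<le> 1 + (cmod (v l t))^2" using norm_ge_zero[of "v l t"] by linarith
    then have "ennreal (cmod (v l t)) \<le> ennreal (1 + (cmod (v l t))^2)" by (rule ennreal_leI)
    then show "ennreal (cmod (v l t)) \<le> 1 + ennreal ((cmod (v l t))^2)" by simp
   qed
   also have "\<dots> = emeasure (timeM T) UNIV + (\<integral>\<^sup>+t. ennreal ((cmod (v l t))^2) \<partial>timeM T)"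
    by (subst nn_integral_add) auto
   also have "\<dots> \<le> D" unfolding D_def by (intro add_left_mono tE_component) simp
   finally show ?thesis .
  qed
  have "(\<integral>\<^sup>+l. \<integral>\<^sup>+t. ennreal (cmod (F (k - l) * v l t * of_real (\<eta> t))) \<partial>timeM T \<partial>cntM)
    \<le> (\<integral>\<^sup>+l. ennreal (cmod (F (k - l))) * (ennreal B * D) \<partial>cntM)"
  proof (rule nn_integral_mono)
   fix l
   have "(\<integral>\<^sup>+t. ennreal (cmod (F (k - l) * v l t * of_real (\<eta> t))) \<partial>timeM T)
     \<le> (\<integral>\<^sup>+t. ennreal (cmod (F (k - l)) * B) * ennreal (cmod (v l t)) \<partial>timeM T)"
   proof (rule nn_integral_mono)
    fix t
    have "cmod (F (k - l)) * cmod (v l t) * \<bar>\<eta> t\<bar> \<le> cmod (F (k - l)) * cmod (v l t) * B" by (intro mult_left_mono B) auto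
    then have "ennreal (cmod (F (k - l) * v l t * of_real (\<eta> t))) \<le> ennreal (cmod (F (k - l)) * B * cmod (v l t))"
     by (intro ennreal_leI) (simp add: norm_mult ac_simps)
    also have "\<dots> = ennreal (cmod (F (k - l)) * B) * ennreal (cmod (v l t))" using B by (intro ennreal_mult) auto
    finally show "ennreal (cmod (F (k - l) * v l t * of_real (\<eta> t))) \<le> \<dots>" .
   qed
   also have "\<dots> = ennreal (cmod (F (k - l)) * B) * (\<integral>\<^sup>+t. ennreal (cmod (v l t)) \<partial>timeM T)"
    by (rule nn_integral_cmult) simp
   also have "\<dots> \<le> ennreal (cmod (F (k - l)) * B) * D" by (intro mult_left_mono v1) auto
   also have "\<dots> = ennreal (cmod (F (k - l))) * (ennreal B * D)"
    using B by (simp add: ennreal_mult mult.assoc)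
   finally show "(\<integral>\<^sup>+t. ennreal (cmod (F (k - l) * v l t * of_real (\<eta> t))) \<partial>timeM T) \<le> \<dots>" .
  qed
  also have "\<dots> = l1 F * (ennreal B * D)"
   unfolding l1_def by (subst nn_integral_multc) (auto simp: nn_integral_count_minus_left[of "\<lambda>l. ennreal (cmod (F l))"])
  also have "\<dots> < \<infinity>" using F Dfin by (simp add: ennreal_mult_less_top)
  finally show "(\<integral>\<^sup>+l. \<integral>\<^sup>+t. ennreal (cmod (F (k - l) * v l t * of_real (\<eta> t))) \<partial>timeM T \<partial>cntM) < \<infinity>" .
 qed simp
 also have "\<dots> = (\<integral>l. F (k - l) * (\<integral>t. v l t * of_real (\<eta> t) \<partial>timeM T) \<partial>cntM)"
  by (simp add: mult.assoc)
 finally show ?thesis .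
qed

lemma conv_timeM_integrable:
 fixes v :: "int^'d \<Rightarrow> real \<Rightarrow> complex"
 assumes K: "\<And>v. sE 0 (conv F v) \<le> ennreal K * sE 0 v" and vm: "\<And>k. v k \<in> bmeas" and fin: "tE T 0 v < \<infinity>"
 shows "tE T 0 (\<lambda>k t. conv F (\<lambda>l. v l t) k) \<le> ennreal K * tE T 0 v"
  and "integrable (timeM T) (\<lambda>t. conv F (\<lambda>l. v l t) k)"
proof -
 show *: "tE T 0 (\<lambda>k t. conv F (\<lambda>l. v l t) k) \<le> ennreal K * tE T 0 v"
  unfolding tE_def using sE_measurable[OF vm, of 0]
  by (subst nn_integral_cmult[symmetric]) (auto intro!: nn_integral_mono K)
 show "integrable (timeM T) (\<lambda>t. conv F (\<lambda>l. v l t) k)"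
  by (rule tE_integrable[OF conv_time_measurable[OF vm] le_less_trans[OF *]]) (use fin in \<open>simp add: ennreal_mult_less_top\<close>)
qed

text \<open>The first stage is assumed. From then on the recursion is linear, and its symbol and
  convolution commute with pairing against test functions, so the weak derivative of one stage gives
  that of the next without any continuity in time.\<close>

lemma tder_wder:
 fixes c :: "int^'d \<Rightarrow> real \<Rightarrow> complex"
 assumes F: "l1 F < \<infinity>" and K: "\<And>v. sE 0 (conv F v) \<le> ennreal K * sE 0 v"
  and cm: "\<And>k. c k \<in> bmeas"
  and base: "\<And>k. wder T (c k) (tder \<theta> F c 1 k)"
  and fin: "\<And>j. j \<le> m \<Longrightarrow> tE T 0 (tder \<theta> F c j) < \<infinity>"
 shows "j \<le> m \<Longrightarrow> wder T (tder \<theta> F c j k) (tder \<theta> F c (Suc j) k)"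
proof (induction j arbitrary: k)
 case 0
 then show ?case using base by simp
next
 case (Suc j)
 define W where "W = tder \<theta> F c j"
 define V where "V = tder \<theta> F c (Suc j)"
 have Wm: "W k \<in> bmeas" and Vm: "V k \<in> bmeas" for k
  unfolding W_def V_def by (rule tder_measurable[OF cm])+
 have Wf: "tE T 0 W < \<infinity>" and Vf: "tE T 0 V < \<infinity>" using fin[of j] fin[of "Suc j"] Suc.prems
  by (simp_all add: W_def V_def del: tder.simps)
 have IH: "wder T (W k) (V k)" for k using Suc.IH Suc.prems by (simp add: W_def V_def)
 have iW: "integrable (timeM T) (W k)" and iV: "integrable (timeM T) (V k)" for k
  using tE_integrable[OF Wm Wf] tE_integrable[OF Vm Vf] by auto
 have icW: "integrable (timeM T) (\<lambda>t. conv F (\<lambda>l. W l t) k)" and icV: "integrable (timeM T) (\<lambda>t. conv F (\<lambda>l. V l t) k)" for k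
  using conv_timeM_integrable(2)[OF K Wm Wf] conv_timeM_integrable(2)[OF K Vm Vf] by auto
 have V_eq: "V = (\<lambda>k t. - of_real (symb \<theta> k) * W k t - conv F (\<lambda>l. W l t) k)" by (simp add: V_def W_def)
 show ?case
  unfolding wder_def
 proof (intro allI impI)
  fix \<eta> assume \<eta>: "test_fun T \<eta>"
  note d\<eta> = test_fun_deriv[OF \<eta>]
  have IH': "(\<integral>t. W k t * of_real (deriv \<eta> t) \<partial>timeM T) = - (\<integral>t. V k t * of_real (\<eta> t) \<partial>timeM T)" for k
   using IH \<eta> by (simp add: wder_def)
  have split: "(\<integral>t. (- of_real (symb \<theta> k) * X k t - conv F (\<lambda>l. X l t) k) * of_real (\<phi> t) \<partial>timeM T)
    = - of_real (symb \<theta> k) * (\<integral>t. X k t * of_real (\<phi> t) \<partial>timeM T) - (\<integral>t. conv F (\<lambda>l. X l t) k * of_real (\<phi> t) \<partial>timeM T)"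
   if iX: "integrable (timeM T) (X k)" and icX: "integrable (timeM T) (\<lambda>t. conv F (\<lambda>l. X l t) k)" and \<phi>: "test_fun T \<phi>" for X \<phi>
  proof -
   have "(\<integral>t. (- of_real (symb \<theta> k) * X k t - conv F (\<lambda>l. X l t) k) * of_real (\<phi> t) \<partial>timeM T)
    = (\<integral>t. - of_real (symb \<theta> k) * (X k t * of_real (\<phi> t)) - conv F (\<lambda>l. X l t) k * of_real (\<phi> t) \<partial>timeM T)"
    by (intro Bochner_Integration.integral_cong) (auto simp: algebra_simps)
   also have "\<dots> = (\<integral>t. - of_real (symb \<theta> k) * (X k t * of_real (\<phi> t)) \<partial>timeM T) - (\<integral>t. conv F (\<lambda>l. X l t) k * of_real (\<phi> t) \<partial>timeM T)"
    by (intro Bochner_Integration.integral_diff integrable_mult_right integrable_timeM_test[OF iX \<phi>] integrable_timeM_test[OF icX \<phi>])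
   finally show ?thesis by (simp only: integral_mult_right_zero)
  qed
  have "(\<integral>t. V k t * of_real (deriv \<eta> t) \<partial>timeM T)
    = - of_real (symb \<theta> k) * (\<integral>t. W k t * of_real (deriv \<eta> t) \<partial>timeM T) - (\<integral>l. F (k - l) * (\<integral>t. W l t * of_real (deriv \<eta> t) \<partial>timeM T) \<partial>cntM)"
   unfolding V_eq split[OF iW icW d\<eta>] conv_test_swap[OF F Wm Wf d\<eta>] ..
  also have "\<dots> = - (- of_real (symb \<theta> k) * (\<integral>t. V k t * of_real (\<eta> t) \<partial>timeM T) - (\<integral>l. F (k - l) * (\<integral>t. V l t * of_real (\<eta> t) \<partial>timeM T) \<partial>cntM))"
   unfolding IH' by (simp add: algebra_simps)
  also have "\<dots> = - (\<integral>t. tder \<theta> F c (Suc (Suc j)) k t * of_real (\<eta> t) \<partial>timeM T)"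
   unfolding conv_test_swap[OF F Vm Vf \<eta>, symmetric] split[OF iV icV \<eta>, symmetric] by (simp add: V_def)
  finally show "(\<integral>t. tder \<theta> F c (Suc j) k t * of_real (deriv \<eta> t) \<partial>timeM T) = - (\<integral>t. tder \<theta> F c (Suc (Suc j)) k t * of_real (\<eta> t) \<partial>timeM T)"
   by (simp only: V_def)
 qed
qed

subsection \<open>Fractional regularity in time\<close>

lemma nn_integral_timeM_le:
 assumes "f \<in> bmeas"
 shows "(\<integral>\<^sup>+t. f t \<partial>timeM T) \<le> (\<integral>\<^sup>+t. f t \<partial>lborel)"
 unfolding nn_integral_timeM[OF assms] by (intro nn_integral_mono) (auto simp: indicator_def)

lemma nn_integral_lborel_reflect:
 assumes [measurable]: "f \<in> bmeas"
 shows "(\<integral>\<^sup>+s. f (t - s) \<partial>lborel) = (\<integral>\<^sup>+s. f s \<partial>(lborel :: real measure))"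
 using nn_integral_real_affine[of f "-1" t] by simp

lemma nn_integral_even_le:
 assumes [measurable]: "f \<in> bmeas" and even: "\<And>x. f (- x) = f (x::real)"
 shows "(\<integral>\<^sup>+x. f x \<partial>lborel) \<le> 2 * (\<integral>\<^sup>+x. indicator {0..} x * f x \<partial>lborel)"
proof -
 have "(\<integral>\<^sup>+x. f x \<partial>lborel) \<le> (\<integral>\<^sup>+x. indicator {0..} x * f x + indicator {0..} (0 - x) * f (0 - x) \<partial>lborel)"
  by (intro nn_integral_mono) (auto simp: indicator_def even)
 also have "\<dots> = (\<integral>\<^sup>+x. indicator {0..} x * f x \<partial>lborel) + (\<integral>\<^sup>+x. indicator {0..} (0 - x) * f (0 - x) \<partial>lborel)"
  by (rule nn_integral_add) measurable
 also have "(\<integral>\<^sup>+x. indicator {0..} (0 - x) * f (0 - x) \<partial>lborel) = (\<integral>\<^sup>+x. indicator {0..} x * f x \<partial>lborel)"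
  by (rule nn_integral_lborel_reflect) measurable
 finally show ?thesis by (simp add: mult_2)
qed

text \<open>On the diagonal the value is 0, by division by zero, just as in
  \<open>slob_energy\<close>.\<close>

definition sker :: "real \<Rightarrow> real \<Rightarrow> real" where
 "sker \<sigma> \<tau> = 1 / \<bar>\<tau>\<bar> powr (1 + 2 * \<sigma>)"

lemma sker_measurable [measurable]: "sker \<sigma> \<in> bmeas"
 unfolding sker_def[abs_def] by measurable

lemma sker_far:
 assumes "\<sigma> > 0" "a > 0"
 shows "(\<integral>\<^sup>+\<tau>. ennreal (sker \<sigma> \<tau>) * indicator {\<tau>. \<bar>\<tau>\<bar> \<ge> a} \<tau> \<partial>lborel) \<le> ennreal (a powr (- 2 * \<sigma>) / \<sigma>)"
proof -
 have "(\<integral>\<^sup>+\<tau>. ennreal (sker \<sigma> \<tau>) * indicator {\<tau>. \<bar>\<tau>\<bar> \<ge> a} \<tau> \<partial>lborel)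
   \<le> 2 * (\<integral>\<^sup>+\<tau>. indicator {0..} \<tau> * (ennreal (sker \<sigma> \<tau>) * indicator {\<tau>. \<bar>\<tau>\<bar> \<ge> a} \<tau>) \<partial>lborel)"
  by (rule nn_integral_even_le) (measurable, auto simp: sker_def indicator_def)
 also have "(\<integral>\<^sup>+\<tau>. indicator {0..} \<tau> * (ennreal (sker \<sigma> \<tau>) * indicator {\<tau>. \<bar>\<tau>\<bar> \<ge> a} \<tau>) \<partial>lborel)
   = (\<integral>\<^sup>+\<tau>. indicator {a..} \<tau> * ennreal (\<tau> powr (- (1 + 2 * \<sigma>))) \<partial>lborel)"
 proof (rule nn_integral_cong)
  fix \<tau> :: real
  have "sker \<sigma> \<tau> = \<tau> powr (- (1 + 2 * \<sigma>))" if "\<tau> \<ge> a"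
   unfolding powr_minus_divide using that assms by (simp add: sker_def)
  then show "indicator {0..} \<tau> * (ennreal (sker \<sigma> \<tau>) * indicator {\<tau>. \<bar>\<tau>\<bar> \<ge> a} \<tau>) = indicator {a..} \<tau> * ennreal (\<tau> powr (- (1 + 2 * \<sigma>)))"
   using assms by (cases "\<tau> \<ge> a") (simp_all add: indicator_def)
 qed
 also have "\<dots> = ennreal (- (a powr (- (1 + 2 * \<sigma>) + 1)) / (- (1 + 2 * \<sigma>) + 1))"
 proof -
  have "(\<integral>\<^sup>+\<tau>. indicator {a..} \<tau> * ennreal (\<tau> powr (- (1 + 2 * \<sigma>))) \<partial>lborel) = (\<integral>\<^sup>+\<tau>. ennreal (indicator {a..} \<tau> * \<tau> powr (- (1 + 2 * \<sigma>))) \<partial>lborel)"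
   by (intro nn_integral_cong) (auto simp: indicator_def)
  also have "\<dots> = ennreal (- (a powr (- (1 + 2 * \<sigma>) + 1)) / (- (1 + 2 * \<sigma>) + 1))"
   by (rule nn_integral_has_integral_lebesgue[OF _ has_integral_powr_to_inf]) (use assms in auto)
  finally show ?thesis .
 qed
 also have "2 * ennreal (- (a powr (- (1 + 2 * \<sigma>) + 1)) / (- (1 + 2 * \<sigma>) + 1)) = ennreal (a powr (- 2 * \<sigma>) / \<sigma>)"
 proof -
  have "ennreal (a powr (- 2 * \<sigma>) / \<sigma>) = ennreal (2 * (- (a powr (- (1 + 2 * \<sigma>) + 1)) / (- (1 + 2 * \<sigma>) + 1)))"
   using assms by (intro arg_cong[where f = ennreal]) (simp add: field_simps)
  also have "\<dots> = 2 * ennreal (- (a powr (- (1 + 2 * \<sigma>) + 1)) / (- (1 + 2 * \<sigma>) + 1))"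
   using assms by (subst ennreal_mult) auto
  finally show ?thesis by simp
 qed
 finally show ?thesis .
qed

text \<open>The two factors \<open>\<bar>\<tau>\<bar>\<close> are those gained from increments of a
  primitive: one by Cauchy-Schwarz, one by Fubini as the length of a set of times. They make the
  singularity integrable because \<open>\<sigma> < 1\<close>.\<close>

lemma sker_near:
 assumes "\<sigma> > 0" "\<sigma> < 1" "a > 0"
 shows "(\<integral>\<^sup>+\<tau>. ennreal (sker \<sigma> \<tau> * \<bar>\<tau>\<bar> * \<bar>\<tau>\<bar>) * indicator {\<tau>. \<bar>\<tau>\<bar> < a} \<tau> \<partial>lborel) \<le> ennreal (a powr (2 - 2 * \<sigma>) / (1 - \<sigma>))"
proof -
 have "(\<integral>\<^sup>+\<tau>. ennreal (sker \<sigma> \<tau> * \<bar>\<tau>\<bar> * \<bar>\<tau>\<bar>) * indicator {\<tau>. \<bar>\<tau>\<bar> < a} \<tau> \<partial>lborel)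
   \<le> 2 * (\<integral>\<^sup>+\<tau>. indicator {0..} \<tau> * (ennreal (sker \<sigma> \<tau> * \<bar>\<tau>\<bar> * \<bar>\<tau>\<bar>) * indicator {\<tau>. \<bar>\<tau>\<bar> < a} \<tau>) \<partial>lborel)"
  by (rule nn_integral_even_le) (measurable, auto simp: sker_def indicator_def)
 also have "(\<integral>\<^sup>+\<tau>. indicator {0..} \<tau> * (ennreal (sker \<sigma> \<tau> * \<bar>\<tau>\<bar> * \<bar>\<tau>\<bar>) * indicator {\<tau>. \<bar>\<tau>\<bar> < a} \<tau>) \<partial>lborel)
   \<le> (\<integral>\<^sup>+\<tau>. indicator {0..a} \<tau> * ennreal (\<tau> powr (1 - 2 * \<sigma>)) \<partial>lborel)"
 proof (intro nn_integral_mono)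
  fix \<tau> :: real
  have "sker \<sigma> \<tau> * \<bar>\<tau>\<bar> * \<bar>\<tau>\<bar> = \<tau> powr (1 - 2 * \<sigma>)" if "\<tau> > 0"
  proof -
   have "\<tau> powr (1 - 2 * \<sigma>) = \<tau> powr (2 - (1 + 2 * \<sigma>))" by simp
   also have "\<dots> = \<tau> powr 2 / \<tau> powr (1 + 2 * \<sigma>)" by (rule powr_diff)
   finally show ?thesis using that by (simp add: sker_def power2_eq_square)
  qed
  then show "indicator {0..} \<tau> * (ennreal (sker \<sigma> \<tau> * \<bar>\<tau>\<bar> * \<bar>\<tau>\<bar>) * indicator {\<tau>. \<bar>\<tau>\<bar> < a} \<tau>) \<le> indicator {0..a} \<tau> * ennreal (\<tau> powr (1 - 2 * \<sigma>))"
   by (cases "\<tau> > 0") (auto simp: indicator_def sker_def)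
 qed
 also have "\<dots> = ennreal (a powr (1 - 2 * \<sigma> + 1) / (1 - 2 * \<sigma> + 1))"
 proof -
  have "(\<integral>\<^sup>+\<tau>. indicator {0..a} \<tau> * ennreal (\<tau> powr (1 - 2 * \<sigma>)) \<partial>lborel) = (\<integral>\<^sup>+\<tau>. ennreal (indicator {0..a} \<tau> * \<tau> powr (1 - 2 * \<sigma>)) \<partial>lborel)"
   by (intro nn_integral_cong) (auto simp: indicator_def)
  also have "\<dots> = ennreal (a powr (1 - 2 * \<sigma> + 1) / (1 - 2 * \<sigma> + 1))"
   by (rule nn_integral_has_integral_lebesgue[OF _ has_integral_powr_from_0]) (use assms in auto)
  finally show ?thesis .
 qed
 also have "2 * ennreal (a powr (1 - 2 * \<sigma> + 1) / (1 - 2 * \<sigma> + 1)) = ennreal (a powr (2 - 2 * \<sigma>) / (1 - \<sigma>))"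
 proof -
  have "ennreal (a powr (2 - 2 * \<sigma>) / (1 - \<sigma>)) = ennreal (2 * (a powr (1 - 2 * \<sigma> + 1) / (1 - 2 * \<sigma> + 1)))"
   using assms by (intro arg_cong[where f = ennreal]) (simp add: field_simps)
  also have "\<dots> = 2 * ennreal (a powr (1 - 2 * \<sigma> + 1) / (1 - 2 * \<sigma> + 1))"
   using assms by (subst ennreal_mult) auto
  finally show ?thesis by simp
 qed
 finally show ?thesis by (simp add: mult_left_mono)
qed

text \<open>Cauchy-Schwarz on the segment between \<open>s\<close> and \<open>t\<close>. The right
  side is kept local to that segment so that Fubini can later gain a second factor of its
  length.\<close>

lemma primitive_diff_sq_le:
 fixes h :: "real \<Rightarrow> complex"
 assumes h: "integrable (timeM T) h"
  and D: "\<And>t. D t = K + (\<integral>s. indicator {..<t} s *\<^sub>R h s \<partial>timeM T)"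
 shows "ennreal ((cmod (D t - D s))^2) \<le> ennreal \<bar>t - s\<bar> * (\<integral>\<^sup>+r. ennreal ((cmod (h r))^2) * indicator {min t s..max t s} r \<partial>timeM T)"
proof -
 have *: "ennreal ((cmod (D t - D s))^2) \<le> ennreal \<bar>t - s\<bar> * (\<integral>\<^sup>+r. ennreal ((cmod (h r))^2) * indicator {min t s..max t s} r \<partial>timeM T)"
  if st: "s \<le> t" for t s
 proof -
  have hm [measurable]: "h \<in> bmeas" using borel_measurable_integrable[OF h] by simp
  have i: "integrable (timeM T) (\<lambda>r. indicator {..<t} r *\<^sub>R h r)" for t
   by (rule integrable_mult_indicator[OF _ h]) simp
  have "D t - D s = (\<integral>r. indicator {..<t} r *\<^sub>R h r - indicator {..<s} r *\<^sub>R h r \<partial>timeM T)"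
   unfolding D using i[of t] i[of s] by simp
  also have "\<dots> = (\<integral>r. indicator {s..<t} r *\<^sub>R h r \<partial>timeM T)"
   by (intro Bochner_Integration.integral_cong) (use st in \<open>auto simp: indicator_def\<close>)
  finally have "ennreal (cmod (D t - D s)) \<le> (\<integral>\<^sup>+r. ennreal (cmod (indicator {s..<t} r *\<^sub>R h r)) \<partial>timeM T)"
   by (simp only: cmod_integral_le)
  also have "\<dots> \<le> (\<integral>\<^sup>+r. indicator {s..t} r * ennreal (cmod (h r) * indicator {s..t} r) \<partial>timeM T)"
   by (intro nn_integral_mono) (auto simp: indicator_def)
  finally have "(ennreal (cmod (D t - D s)))^2 \<le> (\<integral>\<^sup>+r. indicator {s..t} r * ennreal (cmod (h r) * indicator {s..t} r) \<partial>timeM T)^2"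
   by (rule power_mono) simp
  also have "\<dots> \<le> (\<integral>\<^sup>+r. (indicator {s..t} r)^2 \<partial>timeM T) * (\<integral>\<^sup>+r. (ennreal (cmod (h r) * indicator {s..t} r))^2 \<partial>timeM T)"
   by (rule Cauchy_Schwarz_nn_integral) simp_all
  also have "(\<integral>\<^sup>+r. (indicator {s..t} r)^2 \<partial>timeM T) \<le> ennreal \<bar>t - s\<bar>"
  proof -
   have "(\<integral>\<^sup>+r. (indicator {s..t} r)^2 \<partial>timeM T) \<le> (\<integral>\<^sup>+r. (indicator {s..t} r)^2 \<partial>lborel)" by (rule nn_integral_timeM_le) simp
   also have "\<dots> = (\<integral>\<^sup>+r. indicator {s..t} r \<partial>lborel)" by (intro nn_integral_cong) (auto simp: indicator_def)
   finally show ?thesis using st by simp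
  qed
  also have "(\<integral>\<^sup>+r. (ennreal (cmod (h r) * indicator {s..t} r))^2 \<partial>timeM T) = (\<integral>\<^sup>+r. ennreal ((cmod (h r))^2) * indicator {min t s..max t s} r \<partial>timeM T)"
   by (intro nn_integral_cong) (use st in \<open>auto simp: indicator_def ennreal_power\<close>)
  finally show ?thesis by (simp add: ennreal_power mult_right_mono)
 qed
 show ?thesis
 proof (cases "s \<le> t")
  case False
  then show ?thesis using *[of t s] by (simp add: norm_minus_commute abs_minus_commute min.commute max.commute)
 qed (rule *)
qed

text \<open>Pairs of times at distance at least \<open>1 / N\<close> are handled by the size of
  \<open>g\<close>, closer ones by the size of its derivative \<open>h\<close>. The parameter is
  free here and is tuned to the frequency afterwards.\<close>

lemma slob_mode:
 fixes g h :: "real \<Rightarrow> complex"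
 assumes T: "T > 0" and \<sigma>: "0 < \<sigma>" "\<sigma> < 1" and N: "N > 0"
  and gm [measurable]: "g \<in> bmeas" and g: "integrable (timeM T) g" and h: "integrable (timeM T) h" and w: "wder T g h"
 shows "(\<integral>\<^sup>+t. \<integral>\<^sup>+s. ennreal ((cmod (g t - g s))^2) * ennreal (sker \<sigma> (t - s)) \<partial>timeM T \<partial>timeM T)
  \<le> ennreal (4 / \<sigma> * N powr (2 * \<sigma>)) * (\<integral>\<^sup>+t. ennreal ((cmod (g t))^2) \<partial>timeM T)
   + ennreal (1 / (1 - \<sigma>) * N powr (2 * \<sigma> - 2)) * (\<integral>\<^sup>+t. ennreal ((cmod (h t))^2) \<partial>timeM T)"
proof -
 have hm [measurable]: "h \<in> bmeas" using borel_measurable_integrable[OF h] by simp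
 obtain K where K: "AE t in timeM T. g t = K + (\<integral>s. indicator {..<t} s *\<^sub>R h s \<partial>timeM T)"
  using wder_imp_primitive[OF T g h w] by blast
 define D where "D t = K + (\<integral>s. indicator {..<t} s *\<^sub>R h s \<partial>timeM T)" for t
 define a where "a = 1 / N"
 have a: "a > 0" using N by (simp add: a_def)
 define k where "k \<tau> = ennreal (sker \<sigma> \<tau>)" for \<tau>
 have [measurable]: "k \<in> bmeas" unfolding k_def by measurable
 define Far Near where "Far = {\<tau>::real. \<bar>\<tau>\<bar> \<ge> a}" and "Near = {\<tau>::real. \<bar>\<tau>\<bar> < a}"
 have [measurable]: "Far \<in> sets borel" "Near \<in> sets borel" unfolding Far_def Near_def by measurable
 define G where "G t = ennreal ((cmod (g t))^2)" for t
 define H where "H t = ennreal ((cmod (h t))^2)" for t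
 have [measurable]: "G \<in> bmeas" "H \<in> bmeas" unfolding G_def H_def by measurable
 define btw where "btw t s r = (indicator {min t s..max t s} r :: ennreal)" for t s r :: real
 have btw: "btw t s r = (if min t s \<le> r \<and> r \<le> max t s then 1 else 0)" for t s r by (simp add: btw_def indicator_def)
 interpret tt: pair_sigma_finite "timeM T" "timeM T" by (intro pair_sigma_finite.intro sigma_finite_timeM)
 \<comment> \<open>Each pair of times is charged to one of the two regimes. The bounds carry
   indicators, so that their sum holds for almost every pair and can be integrated termwise.\<close>
 have pt: "AE t in timeM T. AE s in timeM T. ennreal ((cmod (g t - g s))^2) * k (t - s)
   \<le> (2 * G t) * (k (t - s) * indicator Far (t - s)) + (2 * G s) * (k (t - s) * indicator Far (t - s))
    + (\<integral>\<^sup>+r. H r * (k (t - s) * ennreal \<bar>t - s\<bar> * indicator Near (t - s) * btw t s r) \<partial>timeM T)"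
  using K
 proof eventually_elim
  case (elim t)
  note t = this
  show ?case using K
  proof eventually_elim
   case (elim s)
   show ?case
   proof (cases "t - s \<in> Far")
    case True
    have "ennreal ((cmod (g t - g s))^2) \<le> ennreal (2 * (cmod (g t))^2 + 2 * (cmod (g s))^2)"
     using cmod_add_sq_le[of "g t" "- g s"] by (intro ennreal_leI) simp
    also have "\<dots> = 2 * G t + 2 * G s" by (simp add: G_def ennreal_mult)
    finally have "ennreal ((cmod (g t - g s))^2) * k (t - s) \<le> (2 * G t + 2 * G s) * k (t - s)" by (rule mult_right_mono) simp
    also have "\<dots> \<le> (2 * G t) * (k (t - s) * indicator Far (t - s)) + (2 * G s) * (k (t - s) * indicator Far (t - s))"
     using True by (simp add: distrib_right)
    finally show ?thesis by (rule order_trans) simp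
   next
    case False
    then have near: "t - s \<in> Near" by (auto simp: Far_def Near_def)
    have "ennreal ((cmod (g t - g s))^2) = ennreal ((cmod (D t - D s))^2)" using t elim by (simp add: D_def)
    also have "\<dots> \<le> ennreal \<bar>t - s\<bar> * (\<integral>\<^sup>+r. H r * btw t s r \<partial>timeM T)"
     unfolding H_def btw_def by (rule primitive_diff_sq_le[OF h D_def])
    finally have "ennreal ((cmod (g t - g s))^2) * k (t - s) \<le> (ennreal \<bar>t - s\<bar> * (\<integral>\<^sup>+r. H r * btw t s r \<partial>timeM T)) * k (t - s)"
     by (rule mult_right_mono) simp
    also have "\<dots> = (\<integral>\<^sup>+r. (k (t - s) * ennreal \<bar>t - s\<bar>) * (H r * btw t s r) \<partial>timeM T)"
     by (subst nn_integral_cmult) (auto simp: btw_def ac_simps)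
    also have "\<dots> = (\<integral>\<^sup>+r. H r * (k (t - s) * ennreal \<bar>t - s\<bar> * indicator Near (t - s) * btw t s r) \<partial>timeM T)"
     using near by (intro nn_integral_cong) (simp add: ac_simps)
    finally show ?thesis by (rule order_trans) simp
   qed
  qed
 qed
 define KF where "KF = (\<integral>\<^sup>+\<tau>. k \<tau> * indicator Far \<tau> \<partial>lborel)"
 define KN where "KN = (\<integral>\<^sup>+\<tau>. ennreal (sker \<sigma> \<tau> * \<bar>\<tau>\<bar> * \<bar>\<tau>\<bar>) * indicator Near \<tau> \<partial>lborel)"
 have far1: "(\<integral>\<^sup>+s. k (t - s) * indicator Far (t - s) \<partial>timeM T) \<le> KF" for t
 proof -
  have "(\<integral>\<^sup>+s. k (t - s) * indicator Far (t - s) \<partial>timeM T) \<le> (\<integral>\<^sup>+s. k (t - s) * indicator Far (t - s) \<partial>lborel)"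
   by (rule nn_integral_timeM_le) measurable
  also have "\<dots> = KF" unfolding KF_def by (rule nn_integral_lborel_reflect) measurable
  finally show ?thesis .
 qed
 have ksym: "k (t - s) * indicator Far (t - s) = k (s - t) * indicator Far (s - t)" for s t
  by (simp add: k_def sker_def Far_def abs_minus_commute indicator_def)
 have P1: "(\<integral>\<^sup>+t. \<integral>\<^sup>+s. (2 * G t) * (k (t - s) * indicator Far (t - s)) \<partial>timeM T \<partial>timeM T) \<le> 2 * KF * (\<integral>\<^sup>+t. G t \<partial>timeM T)"
 proof -
  have "(\<integral>\<^sup>+t. \<integral>\<^sup>+s. (2 * G t) * (k (t - s) * indicator Far (t - s)) \<partial>timeM T \<partial>timeM T) \<le> (\<integral>\<^sup>+t. (2 * KF) * G t \<partial>timeM T)"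
  proof (rule nn_integral_mono)
   fix t
   have "(\<integral>\<^sup>+s. (2 * G t) * (k (t - s) * indicator Far (t - s)) \<partial>timeM T) = (2 * G t) * (\<integral>\<^sup>+s. k (t - s) * indicator Far (t - s) \<partial>timeM T)"
    by (rule nn_integral_cmult) simp
   also have "\<dots> \<le> (2 * G t) * KF" by (intro mult_left_mono far1) simp
   finally show "(\<integral>\<^sup>+s. (2 * G t) * (k (t - s) * indicator Far (t - s)) \<partial>timeM T) \<le> (2 * KF) * G t" by (simp add: ac_simps)
  qed
  then show ?thesis by (simp add: nn_integral_cmult)
 qed
 have P2: "(\<integral>\<^sup>+t. \<integral>\<^sup>+s. (2 * G s) * (k (t - s) * indicator Far (t - s)) \<partial>timeM T \<partial>timeM T) \<le> 2 * KF * (\<integral>\<^sup>+t. G t \<partial>timeM T)"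
 proof -
  have "(\<integral>\<^sup>+t. \<integral>\<^sup>+s. (2 * G s) * (k (t - s) * indicator Far (t - s)) \<partial>timeM T \<partial>timeM T)
    = (\<integral>\<^sup>+s. \<integral>\<^sup>+t. (2 * G s) * (k (t - s) * indicator Far (t - s)) \<partial>timeM T \<partial>timeM T)"
   by (rule tt.Fubini') (simp add: split_beta')
  also have "\<dots> = (\<integral>\<^sup>+t. \<integral>\<^sup>+s. (2 * G t) * (k (t - s) * indicator Far (t - s)) \<partial>timeM T \<partial>timeM T)"
   by (subst ksym) simp
  finally show ?thesis using P1 by simp
 qed
 have btwm [measurable]: "(\<lambda>p. btw (X p) (Y p) (Z p)) \<in> borel_measurable M"
  if [measurable]: "X \<in> borel_measurable M" "Y \<in> borel_measurable M" "Z \<in> borel_measurable M" for X Y Z and M :: "'z measure"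
  unfolding btw by measurable
 \<comment> \<open>For a fixed point \<open>r\<close> and a fixed difference of times, the
   \<open>t\<close> for which \<open>r\<close> lies between \<open>t\<close> and its partner fill an
   interval of length \<open>\<bar>\<tau>\<bar>\<close>; this is the second such factor in
   \<open>KN\<close>.\<close>
 have near1: "(\<integral>\<^sup>+t. \<integral>\<^sup>+s. k (t - s) * ennreal \<bar>t - s\<bar> * indicator Near (t - s) * btw t s r \<partial>timeM T \<partial>timeM T) \<le> KN" for r
 proof -
  have m: "(\<lambda>s. k (t - s) * ennreal \<bar>t - s\<bar> * indicator Near (t - s) * btw t s r) \<in> bmeas" for t
   by (simp add: btw)
  have m2: "(\<lambda>t. \<integral>\<^sup>+s. k (t - s) * ennreal \<bar>t - s\<bar> * indicator Near (t - s) * btw t s r \<partial>lborel) \<in> bmeas"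
   using lborel.borel_measurable_nn_integral_fst[of "\<lambda>(t, s). k (t - s) * ennreal \<bar>t - s\<bar> * indicator Near (t - s) * btw t s r" lborel]
   by (simp add: split_beta' btw)
  have "(\<integral>\<^sup>+t. \<integral>\<^sup>+s. k (t - s) * ennreal \<bar>t - s\<bar> * indicator Near (t - s) * btw t s r \<partial>timeM T \<partial>timeM T)
    \<le> (\<integral>\<^sup>+t. \<integral>\<^sup>+s. k (t - s) * ennreal \<bar>t - s\<bar> * indicator Near (t - s) * btw t s r \<partial>lborel \<partial>timeM T)"
   by (intro nn_integral_mono nn_integral_timeM_le m)
  also have "\<dots> \<le> (\<integral>\<^sup>+t. \<integral>\<^sup>+s. k (t - s) * ennreal \<bar>t - s\<bar> * indicator Near (t - s) * btw t s r \<partial>lborel \<partial>lborel)"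
   by (rule nn_integral_timeM_le[OF m2])
  also have "\<dots> = (\<integral>\<^sup>+t. \<integral>\<^sup>+\<tau>. k \<tau> * ennreal \<bar>\<tau>\<bar> * indicator Near \<tau> * btw t (t - \<tau>) r \<partial>lborel \<partial>lborel)"
  proof (rule nn_integral_cong)
   fix t
   show "(\<integral>\<^sup>+s. k (t - s) * ennreal \<bar>t - s\<bar> * indicator Near (t - s) * btw t s r \<partial>lborel) = (\<integral>\<^sup>+\<tau>. k \<tau> * ennreal \<bar>\<tau>\<bar> * indicator Near \<tau> * btw t (t - \<tau>) r \<partial>lborel)"
    using nn_integral_lborel_reflect[of "\<lambda>\<tau>. k \<tau> * ennreal \<bar>\<tau>\<bar> * indicator Near \<tau> * btw t (t - \<tau>) r" t]
    by (simp add: btw)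
  qed
  also have "\<dots> = (\<integral>\<^sup>+\<tau>. \<integral>\<^sup>+t. k \<tau> * ennreal \<bar>\<tau>\<bar> * indicator Near \<tau> * btw t (t - \<tau>) r \<partial>lborel \<partial>lborel)"
   by (rule lborel_pair.Fubini') (simp add: split_beta' btw)
  also have "\<dots> = KN"
   unfolding KN_def
  proof (rule nn_integral_cong)
   fix \<tau> :: real
   have "(\<integral>\<^sup>+t. btw t (t - \<tau>) r \<partial>lborel) = (\<integral>\<^sup>+t. indicator {min r (r + \<tau>)..max r (r + \<tau>)} t \<partial>lborel)"
    by (intro nn_integral_cong) (auto simp: btw indicator_def)
   also have "\<dots> = ennreal \<bar>\<tau>\<bar>" by (auto simp: min_def max_def)
   finally have b: "(\<integral>\<^sup>+t. btw t (t - \<tau>) r \<partial>lborel) = ennreal \<bar>\<tau>\<bar>" .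
   have s0: "sker \<sigma> \<tau> \<ge> 0" by (simp add: sker_def)
   have "(\<integral>\<^sup>+t. k \<tau> * ennreal \<bar>\<tau>\<bar> * indicator Near \<tau> * btw t (t - \<tau>) r \<partial>lborel) = k \<tau> * ennreal \<bar>\<tau>\<bar> * indicator Near \<tau> * ennreal \<bar>\<tau>\<bar>"
    using nn_integral_cmult[of "\<lambda>t. btw t (t - \<tau>) r" lborel "k \<tau> * ennreal \<bar>\<tau>\<bar> * indicator Near \<tau>"]
    by (simp add: btw b[unfolded btw])
   also have "\<dots> = ennreal (sker \<sigma> \<tau> * \<bar>\<tau>\<bar> * \<bar>\<tau>\<bar>) * indicator Near \<tau>"
    using s0 by (simp add: k_def ennreal_mult ac_simps)
   finally show "(\<integral>\<^sup>+t. k \<tau> * ennreal \<bar>\<tau>\<bar> * indicator Near \<tau> * btw t (t - \<tau>) r \<partial>lborel) = ennreal (sker \<sigma> \<tau> * \<bar>\<tau>\<bar> * \<bar>\<tau>\<bar>) * indicator Near \<tau>" .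
  qed
  finally show ?thesis .
 qed
 define Z where "Z t s r = k (t - s) * ennreal \<bar>t - s\<bar> * indicator Near (t - s) * btw t s r" for t s r
 have Zm [measurable]: "(\<lambda>p. Z (X p) (Y p) (W p)) \<in> borel_measurable M"
  if [measurable]: "X \<in> borel_measurable M" "Y \<in> borel_measurable M" "W \<in> borel_measurable M" for X Y W and M :: "'z measure"
  unfolding Z_def btw by measurable
 \<comment> \<open>The variable \<open>r\<close> of the increment estimate is moved outermost, where
   \<open>near1\<close> bounds the remaining double integral.\<close>
 have P3: "(\<integral>\<^sup>+t. \<integral>\<^sup>+s. \<integral>\<^sup>+r. H r * Z t s r \<partial>timeM T \<partial>timeM T \<partial>timeM T) \<le> KN * (\<integral>\<^sup>+t. H t \<partial>timeM T)"
 proof -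
  have m1: "(\<lambda>(s, r). H r * Z t s r) \<in> borel_measurable (timeM T \<Otimes>\<^sub>M timeM T)" for t
   unfolding split_beta' Z_def btw by measurable
  have "(\<integral>\<^sup>+t. \<integral>\<^sup>+s. \<integral>\<^sup>+r. H r * Z t s r \<partial>timeM T \<partial>timeM T \<partial>timeM T)
    = (\<integral>\<^sup>+t. \<integral>\<^sup>+r. \<integral>\<^sup>+s. H r * Z t s r \<partial>timeM T \<partial>timeM T \<partial>timeM T)"
   by (intro nn_integral_cong tt.Fubini'[symmetric] m1)
  also have "\<dots> = (\<integral>\<^sup>+t. \<integral>\<^sup>+r. H r * (\<integral>\<^sup>+s. Z t s r \<partial>timeM T) \<partial>timeM T \<partial>timeM T)"
  proof (intro nn_integral_cong nn_integral_cmult)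
   fix t r show "(\<lambda>s. Z t s r) \<in> borel_measurable (timeM T)" unfolding Z_def btw by simp
  qed
  also have "\<dots> = (\<integral>\<^sup>+r. \<integral>\<^sup>+t. H r * (\<integral>\<^sup>+s. Z t s r \<partial>timeM T) \<partial>timeM T \<partial>timeM T)"
  proof (rule tt.Fubini'[symmetric])
   have "(\<lambda>p. (\<integral>\<^sup>+s. (\<lambda>(p, s). Z (fst p) s (snd p)) (p, s) \<partial>timeM T)) \<in> borel_measurable (timeM T \<Otimes>\<^sub>M timeM T)"
    by (rule sigma_finite_measure.borel_measurable_nn_integral_fst[OF sigma_finite_timeM])
     (unfold split_beta' Z_def btw, measurable)
   then have [measurable]: "(\<lambda>p. (\<integral>\<^sup>+s. Z (fst p) s (snd p) \<partial>timeM T)) \<in> borel_measurable (timeM T \<Otimes>\<^sub>M timeM T)" by simp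
   show "(\<lambda>(t, r). H r * (\<integral>\<^sup>+s. Z t s r \<partial>timeM T)) \<in> borel_measurable (timeM T \<Otimes>\<^sub>M timeM T)"
    unfolding split_beta' by measurable
  qed
  also have "\<dots> \<le> (\<integral>\<^sup>+r. KN * H r \<partial>timeM T)"
  proof (rule nn_integral_mono)
   fix r
   have "(\<integral>\<^sup>+t. H r * (\<integral>\<^sup>+s. Z t s r \<partial>timeM T) \<partial>timeM T) = H r * (\<integral>\<^sup>+t. \<integral>\<^sup>+s. Z t s r \<partial>timeM T \<partial>timeM T)"
   proof (rule nn_integral_cmult)
    have "(\<lambda>t. (\<integral>\<^sup>+s. (\<lambda>(t, s). Z t s r) (t, s) \<partial>timeM T)) \<in> borel_measurable (timeM T)"
     by (rule sigma_finite_measure.borel_measurable_nn_integral_fst[OF sigma_finite_timeM])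
      (unfold split_beta' Z_def btw, measurable)
    then show "(\<lambda>t. (\<integral>\<^sup>+s. Z t s r \<partial>timeM T)) \<in> borel_measurable (timeM T)" by simp
   qed
   also have "\<dots> \<le> H r * KN" unfolding Z_def by (intro mult_left_mono near1) simp
   finally show "(\<integral>\<^sup>+t. H r * (\<integral>\<^sup>+s. Z t s r \<partial>timeM T) \<partial>timeM T) \<le> KN * H r" by (simp add: mult.commute)
  qed
  also have "\<dots> = KN * (\<integral>\<^sup>+t. H t \<partial>timeM T)" by (rule nn_integral_cmult) simp
  finally show ?thesis .
 qed
 define A1 where "A1 t s = (2 * G t) * (k (t - s) * indicator Far (t - s))" for t s
 define A2 where "A2 t s = (2 * G s) * (k (t - s) * indicator Far (t - s))" for t s
 define A3 where "A3 t s = (\<integral>\<^sup>+r. H r * Z t s r \<partial>timeM T)" for t s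
 have A12 [measurable]: "(\<lambda>p. A1 (fst p) (snd p)) \<in> borel_measurable (timeM T \<Otimes>\<^sub>M timeM T)"
   "(\<lambda>p. A2 (fst p) (snd p)) \<in> borel_measurable (timeM T \<Otimes>\<^sub>M timeM T)"
  unfolding A1_def A2_def by measurable
 have A3 [measurable]: "(\<lambda>p. A3 (fst p) (snd p)) \<in> borel_measurable (timeM T \<Otimes>\<^sub>M timeM T)"
 proof -
  have "(\<lambda>p. (\<integral>\<^sup>+r. (\<lambda>(p, r). H r * Z (fst p) (snd p) r) (p, r) \<partial>timeM T)) \<in> borel_measurable (timeM T \<Otimes>\<^sub>M timeM T)"
   by (rule sigma_finite_measure.borel_measurable_nn_integral_fst[OF sigma_finite_timeM])
    (unfold split_beta' Z_def btw, measurable)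
  then show ?thesis by (simp add: A3_def)
 qed
 have Asec: "(\<lambda>s. A (t) s) \<in> borel_measurable (timeM T)"
  if "(\<lambda>p. A (fst p) (snd p)) \<in> borel_measurable (timeM T \<Otimes>\<^sub>M timeM T)" for A :: "real \<Rightarrow> real \<Rightarrow> ennreal" and t
  using measurable_Pair2[OF that, of t] by simp
 have Aint: "(\<lambda>t. \<integral>\<^sup>+s. A t s \<partial>timeM T) \<in> borel_measurable (timeM T)"
  if "(\<lambda>p. A (fst p) (snd p)) \<in> borel_measurable (timeM T \<Otimes>\<^sub>M timeM T)" for A :: "real \<Rightarrow> real \<Rightarrow> ennreal"
  using sigma_finite_measure.borel_measurable_nn_integral_fst[OF sigma_finite_timeM that] by simp
 have "(\<integral>\<^sup>+t. \<integral>\<^sup>+s. ennreal ((cmod (g t - g s))^2) * k (t - s) \<partial>timeM T \<partial>timeM T)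
   \<le> (\<integral>\<^sup>+t. \<integral>\<^sup>+s. A1 t s + A2 t s + A3 t s \<partial>timeM T \<partial>timeM T)"
 proof (rule nn_integral_mono_AE)
  show "AE t in timeM T. (\<integral>\<^sup>+s. ennreal ((cmod (g t - g s))^2) * k (t - s) \<partial>timeM T) \<le> (\<integral>\<^sup>+s. A1 t s + A2 t s + A3 t s \<partial>timeM T)"
   using pt
  proof eventually_elim
   case (elim t)
   then show ?case by (intro nn_integral_mono_AE) (simp add: A1_def A2_def A3_def Z_def)
  qed
 qed
 also have "\<dots> = (\<integral>\<^sup>+t. (\<integral>\<^sup>+s. A1 t s \<partial>timeM T) + (\<integral>\<^sup>+s. A2 t s \<partial>timeM T) + (\<integral>\<^sup>+s. A3 t s \<partial>timeM T) \<partial>timeM T)"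
  by (intro nn_integral_cong) (use Asec[OF A12(1)] Asec[OF A12(2)] Asec[OF A3] in \<open>simp add: nn_integral_add\<close>)
 also have "\<dots> = (\<integral>\<^sup>+t. \<integral>\<^sup>+s. A1 t s \<partial>timeM T \<partial>timeM T) + (\<integral>\<^sup>+t. \<integral>\<^sup>+s. A2 t s \<partial>timeM T \<partial>timeM T) + (\<integral>\<^sup>+t. \<integral>\<^sup>+s. A3 t s \<partial>timeM T \<partial>timeM T)"
  using Aint[OF A12(1)] Aint[OF A12(2)] Aint[OF A3] by (simp add: nn_integral_add)
 also have "\<dots> \<le> 2 * KF * (\<integral>\<^sup>+t. G t \<partial>timeM T) + 2 * KF * (\<integral>\<^sup>+t. G t \<partial>timeM T) + KN * (\<integral>\<^sup>+t. H t \<partial>timeM T)"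
  using P1 P2 P3 unfolding A1_def A2_def A3_def by (intro add_mono)
 also have "\<dots> = (4 * KF) * (\<integral>\<^sup>+t. G t \<partial>timeM T) + KN * (\<integral>\<^sup>+t. H t \<partial>timeM T)"
  by (simp add: distrib_right[symmetric])
 also have "\<dots> \<le> ennreal (4 / \<sigma> * N powr (2 * \<sigma>)) * (\<integral>\<^sup>+t. G t \<partial>timeM T) + ennreal (1 / (1 - \<sigma>) * N powr (2 * \<sigma> - 2)) * (\<integral>\<^sup>+t. H t \<partial>timeM T)"
 proof (intro add_mono mult_right_mono)
  have aN: "a powr x = N powr (- x)" for x using N by (simp add: a_def powr_divide powr_minus_divide)
  have "4 * KF \<le> 4 * ennreal (a powr (- 2 * \<sigma>) / \<sigma>)"
   unfolding KF_def k_def Far_def by (intro mult_left_mono sker_far \<sigma> a) simp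
  also have "\<dots> = ennreal (4 / \<sigma> * N powr (2 * \<sigma>))"
  proof -
   have "4 * ennreal (a powr (- 2 * \<sigma>) / \<sigma>) = ennreal (4 * (a powr (- 2 * \<sigma>) / \<sigma>))" using \<sigma> by (subst ennreal_mult) auto
   then show ?thesis by (simp add: aN)
  qed
  finally show "4 * KF \<le> ennreal (4 / \<sigma> * N powr (2 * \<sigma>))" .
  have "KN \<le> ennreal (a powr (2 - 2 * \<sigma>) / (1 - \<sigma>))" unfolding KN_def Near_def by (rule sker_near[OF \<sigma> a])
  then show "KN \<le> ennreal (1 / (1 - \<sigma>) * N powr (2 * \<sigma> - 2))" by (simp add: aN)
 qed auto
 finally show ?thesis by (simp only: k_def G_def H_def)
qed

lemma cmod_diff_sq_le: "(cmod (a - b))^2 \<le> 2 * (cmod a)^2 + 2 * (cmod b)^2"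
 using cmod_add_sq_le[of a "- b"] by simp

lemma l2_diff:
 assumes "l2 g" "l2 h"
 shows "l2 (\<lambda>x. g x - h x)"
proof -
 have [measurable]: "g \<in> bmeas" "h \<in> bmeas" using assms by (auto simp: l2_def)
 have "(\<integral>\<^sup>+x. ennreal ((g x - h x)^2) \<partial>cubeM) \<le> (\<integral>\<^sup>+x. 2 * ennreal ((g x)^2) + 2 * ennreal ((h x)^2) \<partial>cubeM)"
 proof (rule nn_integral_mono)
  fix x
  have "(g x - h x)^2 \<le> 2 * (g x)^2 + 2 * (h x)^2"
   using sum_squares_ge_zero[of "g x + h x" 0] by (simp add: power2_eq_square algebra_simps)
  then have "ennreal ((g x - h x)^2) \<le> ennreal (2 * (g x)^2 + 2 * (h x)^2)" by (rule ennreal_leI)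
  also have "\<dots> = 2 * ennreal ((g x)^2) + 2 * ennreal ((h x)^2)" by (simp add: ennreal_mult)
  finally show "ennreal ((g x - h x)^2) \<le> \<dots>" .
 qed
 also have "\<dots> = 2 * (\<integral>\<^sup>+x. ennreal ((g x)^2) \<partial>cubeM) + 2 * (\<integral>\<^sup>+x. ennreal ((h x)^2) \<partial>cubeM)"
  by (simp add: nn_integral_add nn_integral_cmult)
 also have "\<dots> < \<infinity>" using assms by (simp add: l2_def ennreal_mult_less_top)
 finally show ?thesis by (simp add: l2_def)
qed

text \<open>Parseval applied to the difference of two time slices, legitimate for almost every pair
  of times.\<close>

lemma slob_energy_eq:
 fixes w :: "real^'d \<Rightarrow> real \<Rightarrow> real"
 assumes w: "L2Q T w" and a: "AE t in timeM T. \<forall>k. fcoef (\<lambda>x. w x t) k = a k t"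
 shows "slob_energy T \<sigma> w = (\<integral>\<^sup>+t. \<integral>\<^sup>+s. sE 0 (\<lambda>k. a k t - a k s) * ennreal (sker \<sigma> (t - s)) \<partial>timeM T \<partial>timeM T)"
proof -
 have wm [measurable]: "case_prod w \<in> bmeas2" using w by (simp add: L2Q_iff)
 define J where "J q = (\<integral>\<^sup>+x. indicator tcube x * ennreal ((w x (fst q) - w x (snd q))^2) \<partial>lborel)" for q
 have "(\<lambda>q. \<integral>\<^sup>+x. (\<lambda>(q, x). indicator tcube x * ennreal ((w x (fst q) - w x (snd q))^2)) (q, x) \<partial>lborel) \<in> bmeas2"
  by (rule lborel.borel_measurable_nn_integral_fst) measurable
 then have Jm [measurable]: "J \<in> bmeas2" by (simp add: J_def[abs_def])
 have "density lborel (indicator ({0<..<T} \<times> {0<..<T})) = (timeM T \<Otimes>\<^sub>M timeM T)"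
 proof -
  have "timeM T \<Otimes>\<^sub>M timeM T = density (lborel \<Otimes>\<^sub>M lborel) (\<lambda>(x, y). indicator {0<..<T} x * indicator {0<..<T} y)"
   unfolding timeM_def
   by (rule pair_measure_density) (auto intro: lborel.sigma_finite_measure_axioms sigma_finite_timeM[unfolded timeM_def])
  also have "(\<lambda>(x::real, y::real). indicator {0<..<T} x * indicator {0<..<T} y :: ennreal) = indicator ({0<..<T} \<times> {0<..<T})"
   by (auto simp: fun_eq_iff split: split_indicator)
  finally show ?thesis by (simp add: lborel_prod)
 qed
 note dens = this
 have Km: "(\<lambda>q. J q * ennreal (sker \<sigma> (fst q - snd q))) \<in> bmeas2" by measurable
 have Km': "(\<lambda>q. J q * ennreal (sker \<sigma> (fst q - snd q))) \<in> borel_measurable (lborel :: (real \<times> real) measure)"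
  using Km by (simp add: borel_prod)
 have "slob_energy T \<sigma> w = (\<integral>\<^sup>+q. indicator ({0<..<T} \<times> {0<..<T}) q * (J q * ennreal (sker \<sigma> (fst q - snd q))) \<partial>lborel)"
  unfolding slob_energy_def J_def sker_def by (simp add: mult.assoc)
 also have "\<dots> = (\<integral>\<^sup>+q. J q * ennreal (sker \<sigma> (fst q - snd q)) \<partial>(density lborel (indicator ({0<..<T} \<times> {0<..<T}))))"
 proof (rule nn_integral_density[symmetric])
  have "{0<..<T} \<times> {0<..<T} \<in> sets (borel \<Otimes>\<^sub>M borel)" by measurable
  then have "{0<..<T} \<times> {0<..<T} \<in> sets (borel :: (real \<times> real) measure)" by (simp only: borel_prod)
  then show "indicator ({0<..<T} \<times> {0<..<T}) \<in> borel_measurable (lborel :: (real \<times> real) measure)" by simp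
 qed (rule Km')
 also have "\<dots> = (\<integral>\<^sup>+t. \<integral>\<^sup>+s. J (t, s) * ennreal (sker \<sigma> (t - s)) \<partial>timeM T \<partial>timeM T)"
  unfolding dens
  using sigma_finite_measure.nn_integral_fst[OF sigma_finite_timeM, of "\<lambda>q. J q * ennreal (sker \<sigma> (fst q - snd q))" "timeM T" T] Km
  by simp
 also have "\<dots> = (\<integral>\<^sup>+t. \<integral>\<^sup>+s. sE 0 (\<lambda>k. a k t - a k s) * ennreal (sker \<sigma> (t - s)) \<partial>timeM T \<partial>timeM T)"
 proof (rule nn_integral_cong_AE)
  note good = AE_conjI[OF a L2Q_slice[OF w]]
  show "AE t in timeM T. (\<integral>\<^sup>+s. J (t, s) * ennreal (sker \<sigma> (t - s)) \<partial>timeM T) = (\<integral>\<^sup>+s. sE 0 (\<lambda>k. a k t - a k s) * ennreal (sker \<sigma> (t - s)) \<partial>timeM T)"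
   using good
  proof eventually_elim
   case t: (elim t)
   show ?case
   proof (rule nn_integral_cong_AE)
    show "AE s in timeM T. J (t, s) * ennreal (sker \<sigma> (t - s)) = sE 0 (\<lambda>k. a k t - a k s) * ennreal (sker \<sigma> (t - s))"
     using good
    proof eventually_elim
     case s: (elim s)
     have l: "l2 (\<lambda>x. w x t - w x s)" using t s by (intro l2_diff) auto
     have "J (t, s) = (\<integral>\<^sup>+x. ennreal ((w x t - w x s)^2) \<partial>cubeM)"
      unfolding J_def by (subst nn_integral_cubeM) (use l in \<open>auto simp: l2_def\<close>)
     also have "\<dots> = sE 0 (fcoef (\<lambda>x. w x t - w x s))" by (rule parseval[OF l])
     also have "fcoef (\<lambda>x. w x t - w x s) = (\<lambda>k. a k t - a k s)"
      using t s by (auto simp: fcoef_diff l2_integrable)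
     finally show ?case by simp
    qed
   qed
  qed
 qed
 finally show ?thesis .
qed

text \<open>\<open>slob_mode\<close> is applied to mode \<open>k\<close> with
  \<open>N = 1 + ksq k + M\<close>. The frequency part lets the second term absorb the square of the
  symbol, as \<open>N powr (2 * \<sigma> - 2) * x^2 \<le> x powr (2 * \<sigma>)\<close> for
  \<open>x = 1 + ksq k\<close>. The part \<open>M\<close> gives the forcing \<open>b\<close> the
  factor \<open>M powr (2 * \<sigma> - 2)\<close>, which offsets the size of the potential.\<close>

lemma slob_total:
 fixes a b :: "int^'d \<Rightarrow> real \<Rightarrow> complex"
 assumes T: "T > 0" and \<theta>: "\<theta> \<ge> 0" and \<sigma>: "0 < \<sigma>" "\<sigma> < 1" and M: "M \<ge> 1"
  and am: "\<And>k. a k \<in> bmeas" and bm: "\<And>k. b k \<in> bmeas"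
  and af: "tE T 0 a < \<infinity>" and bf: "tE T 0 b < \<infinity>"
  and wd: "\<And>k. wder T (a k) (\<lambda>t. - of_real (symb \<theta> k) * a k t - b k t)"
 shows "(\<integral>\<^sup>+t. \<integral>\<^sup>+s. sE 0 (\<lambda>k. a k t - a k s) * ennreal (sker \<sigma> (t - s)) \<partial>timeM T \<partial>timeM T)
  \<le> ennreal (16 / \<sigma> + 2 * (2 * pi^2 * \<theta>)^2 / (1 - \<sigma>)) * tE T (2 * \<sigma>) a
   + ennreal (16 / \<sigma> * M powr (2 * \<sigma>)) * tE T 0 a
   + ennreal (2 / (1 - \<sigma>) * M powr (2 * \<sigma> - 2)) * tE T 0 b"
proof -
 define \<kappa> where "\<kappa> = 2 * pi^2 * \<theta>"
 let ?A1 = "16 / \<sigma> + 2 * \<kappa>^2 / (1 - \<sigma>)" and ?A2 = "16 / \<sigma> * M powr (2 * \<sigma>)" and ?A3 = "2 / (1 - \<sigma>) * M powr (2 * \<sigma> - 2)"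
 note [measurable] = am bm
 define A where "A k = (\<integral>\<^sup>+t. ennreal ((cmod (a k t))^2) \<partial>timeM T)" for k
 define B where "B k = (\<integral>\<^sup>+t. ennreal ((cmod (b k t))^2) \<partial>timeM T)" for k
 have ia: "integrable (timeM T) (a k)" and ib: "integrable (timeM T) (b k)" for k
  using tE_integrable[OF am af] tE_integrable[OF bm bf] by auto
 define X where "X k t s = ennreal ((cmod (a k t - a k s))^2) * ennreal (sker \<sigma> (t - s))" for k t s
 have Xm [measurable]: "(\<lambda>p. X k (fst p) (snd p)) \<in> borel_measurable (timeM T \<Otimes>\<^sub>M timeM T)" for k
  unfolding X_def by measurable
 have "(\<integral>\<^sup>+t. \<integral>\<^sup>+s. sE 0 (\<lambda>k. a k t - a k s) * ennreal (sker \<sigma> (t - s)) \<partial>timeM T \<partial>timeM T)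
   = (\<integral>\<^sup>+t. \<integral>\<^sup>+s. \<integral>\<^sup>+k. X k t s \<partial>cntM \<partial>timeM T \<partial>timeM T)"
  unfolding X_def sE_0_eq by (simp add: nn_integral_multc)
 also have "\<dots> = (\<integral>\<^sup>+t. \<integral>\<^sup>+k. \<integral>\<^sup>+s. X k t s \<partial>timeM T \<partial>cntM \<partial>timeM T)"
  by (intro nn_integral_cong nn_integral_count_space_nn_integral) (auto simp: X_def)
 also have "\<dots> = (\<integral>\<^sup>+k. \<integral>\<^sup>+t. \<integral>\<^sup>+s. X k t s \<partial>timeM T \<partial>timeM T \<partial>cntM)"
 proof (rule nn_integral_count_space_nn_integral)
  fix k
  show "(\<lambda>t. \<integral>\<^sup>+s. X k t s \<partial>timeM T) \<in> borel_measurable (timeM T)"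
   using sigma_finite_measure.borel_measurable_nn_integral_fst[OF sigma_finite_timeM Xm] by simp
 qed simp
 also have "\<dots> \<le> (\<integral>\<^sup>+k. ennreal ?A1 * (ennreal ((1 + ksq k) powr (2 * \<sigma>)) * A k)
   + ennreal ?A2 * A k + ennreal ?A3 * B k \<partial>cntM)"
 proof (rule nn_integral_mono)
  fix k :: "int^'d"
  define x where "x = 1 + ksq k"
  have x: "x \<ge> 1" by (simp add: x_def)
  define N where "N = x + M"
  let ?Ns = "1 / (1 - \<sigma>) * N powr (2 * \<sigma> - 2)"
  have N: "N > 0" "N \<ge> x" "N \<ge> M" using x M by (auto simp: N_def)
  define h where "h t = - of_real (symb \<theta> k) * a k t - b k t" for t
  have ih: "integrable (timeM T) h" unfolding h_def by (intro Bochner_Integration.integrable_diff integrable_mult_right ia ib)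
  have "h = (\<lambda>t. - of_real (symb \<theta> k) * a k t - b k t)" by (rule ext) (rule h_def)
  then have wdh: "wder T (a k) h" using wd[of k] by (simp only:)
  have hm [measurable]: "h \<in> bmeas" using borel_measurable_integrable[OF ih] by simp
  have "(\<integral>\<^sup>+t. \<integral>\<^sup>+s. X k t s \<partial>timeM T \<partial>timeM T) \<le> ennreal (4 / \<sigma> * N powr (2 * \<sigma>)) * A k
    + ennreal (?Ns) * (\<integral>\<^sup>+t. ennreal ((cmod (h t))^2) \<partial>timeM T)"
   unfolding X_def A_def by (rule slob_mode[OF T \<sigma> N(1) am ia ih wdh])
  also have "\<dots> \<le> ennreal (4 / \<sigma> * N powr (2 * \<sigma>)) * A k
    + ennreal (?Ns) * (ennreal (2 * \<kappa>^2 * x^2) * A k + 2 * B k)"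
  proof (intro add_left_mono mult_left_mono)
  show "(\<integral>\<^sup>+t. ennreal ((cmod (h t))^2) \<partial>timeM T) \<le> ennreal (2 * \<kappa>^2 * x^2) * A k + 2 * B k"
  proof -
   have "(\<integral>\<^sup>+t. ennreal ((cmod (h t))^2) \<partial>timeM T) \<le> (\<integral>\<^sup>+t. ennreal (2 * \<kappa>^2 * x^2) * ennreal ((cmod (a k t))^2) + 2 * ennreal ((cmod (b k t))^2) \<partial>timeM T)"
   proof (rule nn_integral_mono)
    fix t
    have sx: "0 \<le> symb \<theta> k" "symb \<theta> k \<le> \<kappa> * x"
     using \<theta> by (auto simp: symb_def \<kappa>_def x_def intro!: mult_left_mono)
    have "(cmod (h t))^2 \<le> 2 * (cmod (- of_real (symb \<theta> k) * a k t))^2 + 2 * (cmod (b k t))^2"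
     unfolding h_def by (rule cmod_diff_sq_le)
    also have "(cmod (- of_real (symb \<theta> k) * a k t))^2 = (symb \<theta> k)^2 * (cmod (a k t))^2"
     by (simp add: norm_mult power_mult_distrib)
    also have "(symb \<theta> k)^2 * (cmod (a k t))^2 \<le> (\<kappa> * x)^2 * (cmod (a k t))^2"
     by (intro mult_right_mono power_mono sx) auto
    finally have "(cmod (h t))^2 \<le> (2 * \<kappa>^2 * x^2) * (cmod (a k t))^2 + 2 * (cmod (b k t))^2"
     by (simp add: power_mult_distrib mult.assoc)
    then have "ennreal ((cmod (h t))^2) \<le> ennreal ((2 * \<kappa>^2 * x^2) * (cmod (a k t))^2 + 2 * (cmod (b k t))^2)" by (rule ennreal_leI)
    also have "\<dots> = ennreal ((2 * \<kappa>^2 * x^2) * (cmod (a k t))^2) + ennreal (2 * (cmod (b k t))^2)" by (rule ennreal_plus) auto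
    also have "\<dots> = ennreal (2 * \<kappa>^2 * x^2) * ennreal ((cmod (a k t))^2) + 2 * ennreal ((cmod (b k t))^2)"
     by (intro arg_cong2[where f = plus]) (subst ennreal_mult; simp)+
    finally show "ennreal ((cmod (h t))^2) \<le> \<dots>" .
   qed
   also have "\<dots> = ennreal (2 * \<kappa>^2 * x^2) * A k + 2 * B k"
    unfolding A_def B_def by (simp add: nn_integral_add nn_integral_cmult)
   finally show ?thesis .
  qed
  qed simp
  also have "ennreal (4 / \<sigma> * N powr (2 * \<sigma>)) * A k + ennreal (?Ns) * (ennreal (2 * \<kappa>^2 * x^2) * A k + 2 * B k)
    = (ennreal (4 / \<sigma> * N powr (2 * \<sigma>)) + ennreal (?Ns * (2 * \<kappa>^2 * x^2))) * A k
    + ennreal (2 / (1 - \<sigma>) * N powr (2 * \<sigma> - 2)) * B k"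
  proof -
   have "ennreal (?Ns * (2 * \<kappa>^2 * x^2)) = ennreal (?Ns) * ennreal (2 * \<kappa>^2 * x^2)"
    using \<sigma> by (intro ennreal_mult) auto
   moreover have "ennreal (2 / (1 - \<sigma>) * N powr (2 * \<sigma> - 2)) = 2 * ennreal (?Ns)"
   proof -
    have "ennreal (2 / (1 - \<sigma>) * N powr (2 * \<sigma> - 2)) = ennreal (2 * (?Ns))" by simp
    then show ?thesis using \<sigma> by (subst (asm) ennreal_mult) auto
   qed
   ultimately show ?thesis by (simp add: distrib_left distrib_right ac_simps)
  qed
  also have "\<dots> \<le> (ennreal ?A1 * ennreal (x powr (2 * \<sigma>)) + ennreal ?A2) * A k
    + ennreal ?A3 * B k"
  proof (rule add_mono[OF mult_right_mono mult_right_mono])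
   have xp: "x powr (2 * \<sigma>) > 0" "M powr (2 * \<sigma>) > 0" using x M by auto
   \<comment> \<open>\<open>N\<close> is at most twice the larger of its two summands, and
     \<open>2 powr (2 * \<sigma>) \<le> 4\<close>.\<close>
   have "N powr (2 * \<sigma>) \<le> 4 * (x powr (2 * \<sigma>) + M powr (2 * \<sigma>))"
   proof -
    have "N powr (2 * \<sigma>) \<le> (2 * max x M) powr (2 * \<sigma>)" using x M \<sigma> by (intro powr_mono2) (auto simp: N_def)
    also have "\<dots> = 2 powr (2 * \<sigma>) * (max x M) powr (2 * \<sigma>)" using x M by (simp add: powr_mult)
    also have "\<dots> \<le> 4 * (x powr (2 * \<sigma>) + M powr (2 * \<sigma>))"
    proof (rule mult_mono)
     have "2 powr (2 * \<sigma>) \<le> 2 powr (2::real)" using \<sigma> by (intro powr_mono) auto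
     then show "2 powr (2 * \<sigma>) \<le> 4" by simp
     show "(max x M) powr (2 * \<sigma>) \<le> x powr (2 * \<sigma>) + M powr (2 * \<sigma>)" using xp by (auto simp: max_def)
    qed auto
    finally show ?thesis .
   qed
   then have "4 / \<sigma> * N powr (2 * \<sigma>) \<le> 4 / \<sigma> * (4 * (x powr (2 * \<sigma>) + M powr (2 * \<sigma>)))" using \<sigma> by (intro mult_left_mono) auto
   also have "\<dots> = 16 / \<sigma> * x powr (2 * \<sigma>) + 16 / \<sigma> * M powr (2 * \<sigma>)" by (simp add: distrib_left)
   finally have e1: "4 / \<sigma> * N powr (2 * \<sigma>) \<le> 16 / \<sigma> * x powr (2 * \<sigma>) + 16 / \<sigma> * M powr (2 * \<sigma>)" .
   have "N powr (2 * \<sigma> - 2) * x^2 \<le> x powr (2 * \<sigma> - 2) * x^2" using N x \<sigma> by (intro mult_right_mono powr_mono2') auto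
   also have "\<dots> = x powr (2 * \<sigma> - 2) * x powr 2" using x by simp
   also have "\<dots> = x powr (2 * \<sigma>)" by (simp add: powr_add[symmetric] del: powr_numeral)
   finally have e3: "N powr (2 * \<sigma> - 2) * x^2 \<le> x powr (2 * \<sigma>)" .
   have "?Ns * (2 * \<kappa>^2 * x^2) = (2 * \<kappa>^2 / (1 - \<sigma>)) * (N powr (2 * \<sigma> - 2) * x^2)" by simp
   also have "\<dots> \<le> (2 * \<kappa>^2 / (1 - \<sigma>)) * x powr (2 * \<sigma>)" using \<sigma> by (intro mult_left_mono e3) auto
   finally have e2: "?Ns * (2 * \<kappa>^2 * x^2) \<le> (2 * \<kappa>^2 / (1 - \<sigma>)) * x powr (2 * \<sigma>)" .
   have "ennreal (4 / \<sigma> * N powr (2 * \<sigma>)) + ennreal (?Ns * (2 * \<kappa>^2 * x^2))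
     = ennreal (4 / \<sigma> * N powr (2 * \<sigma>) + ?Ns * (2 * \<kappa>^2 * x^2))"
    using \<sigma> by (intro ennreal_plus[symmetric]) auto
   also have "\<dots> \<le> ennreal (?A1 * x powr (2 * \<sigma>) + 16 / \<sigma> * M powr (2 * \<sigma>))"
    using e1 e2 by (intro ennreal_leI) (simp add: distrib_right)
   also have "\<dots> = ennreal (?A1 * x powr (2 * \<sigma>)) + ennreal ?A2"
    using \<sigma> by (intro ennreal_plus) auto
   also have "ennreal (?A1 * x powr (2 * \<sigma>)) = ennreal ?A1 * ennreal (x powr (2 * \<sigma>))"
    using \<sigma> by (intro ennreal_mult) auto
   finally show "ennreal (4 / \<sigma> * N powr (2 * \<sigma>)) + ennreal (?Ns * (2 * \<kappa>^2 * x^2))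
    \<le> ennreal ?A1 * ennreal (x powr (2 * \<sigma>)) + ennreal ?A2" .
   show "ennreal (2 / (1 - \<sigma>) * N powr (2 * \<sigma> - 2)) \<le> ennreal ?A3"
    using \<sigma> N M by (intro ennreal_leI mult_left_mono powr_mono2') auto
  qed auto
  finally show "(\<integral>\<^sup>+t. \<integral>\<^sup>+s. X k t s \<partial>timeM T \<partial>timeM T) \<le> ennreal ?A1 * (ennreal ((1 + ksq k) powr (2 * \<sigma>)) * A k)
   + ennreal ?A2 * A k + ennreal ?A3 * B k"
   by (simp add: x_def distrib_right mult.assoc)
 qed
 also have "\<dots> = ennreal ?A1 * tE T (2 * \<sigma>) a + ennreal ?A2 * tE T 0 a
   + ennreal ?A3 * tE T 0 b"
 proof -
  have "tE T (2 * \<sigma>) a = (\<integral>\<^sup>+k. ennreal ((1 + ksq k) powr (2 * \<sigma>)) * A k \<partial>cntM)"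
   unfolding tE_eq_count[OF am] A_def
   by (intro nn_integral_cong) (simp add: ennreal_mult nn_integral_cmult)
  moreover have "tE T 0 a = (\<integral>\<^sup>+k. A k \<partial>cntM)" "tE T 0 b = (\<integral>\<^sup>+k. B k \<partial>cntM)"
   unfolding tE_eq_count[OF am] tE_eq_count[OF bm] A_def B_def by simp_all
  ultimately show ?thesis by (simp add: nn_integral_add nn_integral_cmult)
 qed
 finally show ?thesis by (simp add: \<kappa>_def)
qed

text \<open>Multiply by \<open>exp (- (2 * M) * t)\<close> and integrate: after an exchange of
  integrals the right side is at most half of the left. The total is finite, so it is 0. An
  inequality at almost every time is enough for this form.\<close>

lemma gronwall_zero:
 fixes \<phi> :: "real \<Rightarrow> ennreal"
 assumes [measurable]: "\<phi> \<in> bmeas" and M: "M > 0" and fin: "(\<integral>\<^sup>+t. \<phi> t \<partial>timeM T) < \<infinity>"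
  and le: "AE t in timeM T. \<phi> t \<le> ennreal M * (\<integral>\<^sup>+s. \<phi> s * indicator {..<t} s \<partial>timeM T)"
 shows "AE t in timeM T. \<phi> t = 0"
proof -
 interpret tt: pair_sigma_finite "timeM T" "timeM T" by (intro pair_sigma_finite.intro sigma_finite_timeM)
 define e where "e t = ennreal (exp (- (2 * M) * t))" for t
 have [measurable]: "e \<in> bmeas" unfolding e_def by measurable
 define \<Psi> where "\<Psi> = (\<integral>\<^sup>+t. e t * \<phi> t \<partial>timeM T)"
 have ind: "indicator {..<t} s = (if s < t then 1 else 0 :: ennreal)" for s t :: real by (simp add: indicator_def)
 have \<Psi>fin: "\<Psi> < \<infinity>"
 proof -
  have "\<Psi> \<le> (\<integral>\<^sup>+t. \<phi> t \<partial>timeM T)"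
   unfolding \<Psi>_def
  proof (rule nn_integral_mono_AE)
   show "AE t in timeM T. e t * \<phi> t \<le> \<phi> t"
    using AE_timeM_Ioo[of T]
   proof eventually_elim
    case (elim t)
    then have "e t \<le> 1" using M by (simp add: e_def)
    then show ?case using mult_right_mono[of "e t" 1 "\<phi> t"] by simp
   qed
  qed
  then show ?thesis using fin by (rule le_less_trans)
 qed
 have inner: "(\<integral>\<^sup>+t. e t * (ennreal M * indicator {..<t} s) \<partial>timeM T) \<le> ennreal (1/2) * e s" for s
 proof -
  have "(\<integral>\<^sup>+t. e t * (ennreal M * indicator {..<t} s) \<partial>timeM T) \<le> (\<integral>\<^sup>+t. e t * (ennreal M * indicator {..<t} s) \<partial>lborel)"
   by (rule nn_integral_timeM_le) (simp add: ind)
  also have "\<dots> \<le> (\<integral>\<^sup>+t. ennreal (M * exp (- (2 * M) * t)) * indicator {s..} t \<partial>lborel)"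
   using M by (intro nn_integral_mono) (auto simp: e_def indicator_def mult.commute simp flip: ennreal_mult)
  also have "\<dots> = ennreal (0 - (- exp (- (2 * M) * s) / 2))"
  proof (rule nn_integral_FTC_atLeast)
   show "((\<lambda>t. - exp (- (2 * M) * t) / 2) has_real_derivative M * exp (- (2 * M) * x)) (at x)" for x
    by (auto intro!: derivative_eq_intros)
   have "((\<lambda>t. exp (- (2 * M) * t)) \<longlongrightarrow> 0) at_top"
    using M by (intro filterlim_compose[OF exp_at_bot] filterlim_tendsto_neg_mult_at_bot[OF tendsto_const _ filterlim_ident]) auto
   then have "((\<lambda>t. - exp (- (2 * M) * t) / 2) \<longlongrightarrow> - 0 / 2) at_top" by (intro tendsto_intros) auto
   then show "((\<lambda>t. - exp (- (2 * M) * t) / 2) \<longlongrightarrow> 0) at_top" by simp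
  qed (use M in auto)
  also have "\<dots> = ennreal (1/2) * e s" unfolding e_def by (subst ennreal_mult[symmetric]) (simp_all add: field_simps)
  finally show ?thesis .
 qed
 have "\<Psi> \<le> (\<integral>\<^sup>+t. \<integral>\<^sup>+s. \<phi> s * (e t * (ennreal M * indicator {..<t} s)) \<partial>timeM T \<partial>timeM T)"
  unfolding \<Psi>_def
 proof (rule nn_integral_mono_AE)
  show "AE t in timeM T. e t * \<phi> t \<le> (\<integral>\<^sup>+s. \<phi> s * (e t * (ennreal M * indicator {..<t} s)) \<partial>timeM T)"
   using le
  proof eventually_elim
   case (elim t)
   have "e t * \<phi> t \<le> (e t * ennreal M) * (\<integral>\<^sup>+s. \<phi> s * indicator {..<t} s \<partial>timeM T)"
    using mult_left_mono[OF elim, of "e t"] by (simp add: mult.assoc)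
   also have "\<dots> = (\<integral>\<^sup>+s. (e t * ennreal M) * (\<phi> s * indicator {..<t} s) \<partial>timeM T)"
    by (rule nn_integral_cmult[symmetric]) simp
   finally show ?case by (simp add: ac_simps)
  qed
 qed
 also have "\<dots> = (\<integral>\<^sup>+s. \<integral>\<^sup>+t. \<phi> s * (e t * (ennreal M * indicator {..<t} s)) \<partial>timeM T \<partial>timeM T)"
  by (rule tt.Fubini') (simp add: split_beta' ind)
 also have "\<dots> \<le> (\<integral>\<^sup>+s. ennreal (1/2) * (e s * \<phi> s) \<partial>timeM T)"
 proof (rule nn_integral_mono)
  fix s
  have "(\<integral>\<^sup>+t. \<phi> s * (e t * (ennreal M * indicator {..<t} s)) \<partial>timeM T) = \<phi> s * (\<integral>\<^sup>+t. e t * (ennreal M * indicator {..<t} s) \<partial>timeM T)"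
   by (rule nn_integral_cmult) (simp add: ind)
  also have "\<dots> \<le> \<phi> s * (ennreal (1/2) * e s)" by (intro mult_left_mono inner) simp
  finally show "(\<integral>\<^sup>+t. \<phi> s * (e t * (ennreal M * indicator {..<t} s)) \<partial>timeM T) \<le> ennreal (1/2) * (e s * \<phi> s)" by (simp add: ac_simps)
 qed
 also have "\<dots> = ennreal (1/2) * \<Psi>" unfolding \<Psi>_def by (rule nn_integral_cmult) simp
 finally have half: "\<Psi> \<le> ennreal (1/2) * \<Psi>" .
 obtain p where p: "\<Psi> = ennreal p" "p \<ge> 0" using \<Psi>fin by (cases \<Psi>) auto
 have "ennreal p \<le> ennreal (1/2 * p)" using half p(2) unfolding p(1) by (subst ennreal_mult) simp_all
 then have "p \<le> 1/2 * p" using p(2) by (subst (asm) ennreal_le_iff) simp_all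
 then have "\<Psi> = 0" using p by simp
 then have "AE t in timeM T. e t * \<phi> t = 0" unfolding \<Psi>_def by (subst (asm) nn_integral_0_iff_AE) auto
 then show ?thesis by eventually_elim (auto simp: e_def)
qed

subsection \<open>Uniqueness\<close>

abbreviation tcoef :: "(real^'d \<Rightarrow> real \<Rightarrow> real) \<Rightarrow> int^'d \<Rightarrow> real \<Rightarrow> complex" where
 "tcoef u \<equiv> (\<lambda>k t. fcoef (\<lambda>x. u x t) k)"

lemma fcoef_cmult: "fcoef (\<lambda>x. c * g x) k = of_real c * fcoef g k"
proof -
 have "fcoef (\<lambda>x. c * g x) k = (\<integral>x. of_real c * (indicator tcube x * (complex_of_real (g x) * cis (-2*pi*kdot k x))) \<partial>lborel)"
  unfolding fcoef_def by (intro Bochner_Integration.integral_cong) (auto simp: mult_ac)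
 then show ?thesis unfolding fcoef_def by simp
qed

lemma in_Hs_l2: "in_Hs s g \<Longrightarrow> l2 g"
 unfolding in_Hs_def l2_iff_weak[symmetric] by blast

lemma integrable_timeM_exp:
 fixes g :: "real \<Rightarrow> complex"
 assumes g: "integrable (timeM T) g"
 shows "integrable (timeM T) (\<lambda>t. of_real (exp (c * t)) * g t)"
proof -
 have [measurable]: "g \<in> bmeas" using borel_measurable_integrable[OF g] by simp
 \<comment> \<open>The exponential may be unbounded on the line; clamping the time changes nothing
   almost everywhere and makes the multiplier bounded.\<close>
 have "integrable (timeM T) (\<lambda>t. g t * of_real (exp (c * min (max t 0) T)))"
 proof (rule integrable_timeM_bounded[OF g])
  fix t
  have "\<bar>min (max t 0) T\<bar> \<le> \<bar>T\<bar>" by auto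
  then have "\<bar>c\<bar> * \<bar>min (max t 0) T\<bar> \<le> \<bar>c\<bar> * \<bar>T\<bar>" by (intro mult_left_mono) auto
  then have "c * min (max t 0) T \<le> \<bar>c\<bar> * \<bar>T\<bar>" by (simp add: abs_mult[symmetric])
  then show "norm (complex_of_real (exp (c * min (max t 0) T))) \<le> exp (\<bar>c\<bar> * \<bar>T\<bar>)" by simp
 qed measurable
 moreover have "AE t in timeM T. g t * of_real (exp (c * min (max t 0) T)) = of_real (exp (c * t)) * g t"
  using AE_timeM_Ioo[of T] by eventually_elim (auto simp: min_def max_def)
 ultimately show ?thesis by (subst integrable_cong_AE[symmetric]) auto
qed

lemma wder_diff:
 assumes "integrable (timeM T) g" "integrable (timeM T) g'" "integrable (timeM T) h" "integrable (timeM T) h'"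
  and "wder T g h" "wder T g' h'"
 shows "wder T (\<lambda>t. g t - g' t) (\<lambda>t. h t - h' t)"
 unfolding wder_def
proof (intro allI impI)
 fix \<eta> assume \<eta>: "test_fun T \<eta>"
 note i = integrable_timeM_test[OF _ \<eta>] integrable_timeM_test[OF _ test_fun_deriv[OF \<eta>]]
 show "(\<integral>t. (g t - g' t) * of_real (deriv \<eta> t) \<partial>timeM T) = - (\<integral>t. (h t - h' t) * of_real (\<eta> t) \<partial>timeM T)"
  using assms(5,6) \<eta> by (simp add: left_diff_distrib Bochner_Integration.integral_diff i assms(1-4) wder_def)
qed

text \<open>Extracts an actual time, arbitrarily close to 0, from a property known almost
  everywhere; the initial trace is evaluated at such a time.\<close>

lemma AE_timeM_ex:
 assumes "T > 0" "\<delta> > 0" and P: "AE t in timeM T. P t"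
 shows "\<exists>t. 0 < t \<and> t < \<delta> \<and> t < T \<and> P t"
proof (rule ccontr)
 assume n: "\<not> ?thesis"
 have "AE t in lborel. t \<notin> {0<..<min \<delta> T}"
  using P unfolding AE_timeM by eventually_elim (use n in auto)
 then have "{0<..<min \<delta> T} \<in> null_sets lborel" by (subst AE_iff_null_sets) auto
 then show False using assms(1,2) by (simp add: null_sets_def)
qed

lemma tcoef_facts:
 assumes u: "L2Q T u"
 shows "tcoef u k \<in> bmeas" "tE T 0 (tcoef u) < \<infinity>" "integrable (timeM T) (tcoef u k)"
proof -
 show m: "tcoef u k \<in> bmeas" for k using u by (intro fcoef_time_measurable) (simp add: L2Q_iff)
 show f: "tE T 0 (tcoef u) < \<infinity>" using tE_fcoef_le[OF u] u by (auto simp: L2Q_iff intro: le_less_trans)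
 show "integrable (timeM T) (tcoef u k)" by (rule tE_integrable[OF m f])
qed

text \<open>Coefficients are taken at those times where the equation holds almost everywhere in
  space and all slices are square integrable, so that \<open>fcoef_mult\<close> turns the potential
  into a convolution.\<close>

lemma strong_sol_coef_equation:
 fixes u :: "real^'d \<Rightarrow> real \<Rightarrow> real"
 assumes f: "f \<in> bmeas" "integrable cubeM f" "l1 (fcoef f) < \<infinity>"
  and u: "L2Q T u" and L: "L2Q T L" and D: "L2Q T D"
  and eq: "AE p in lborel. p \<in> Qset T \<longrightarrow> \<theta>/2 * L (fst p) (snd p) - D (fst p) (snd p) - f (fst p) * u (fst p) (snd p) = 0"
 shows "AE t in timeM T. \<forall>k. of_real (\<theta>/2) * tcoef L k t - tcoef D k t = conv (fcoef f) (\<lambda>l. tcoef u l t) k"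
proof -
 have [measurable]: "case_prod u \<in> bmeas2" "case_prod L \<in> bmeas2"
  "case_prod D \<in> bmeas2" "f \<in> bmeas"
  using u L D f by (auto simp: L2Q_iff)
 have "Measurable.pred (borel \<Otimes>\<^sub>M borel) (\<lambda>p. \<theta>/2 * case_prod L p - case_prod D p - f (fst p) * case_prod u p = 0)" by measurable
 from AE_Q_iff[OF this, of T] eq have "AE t in timeM T. AE x in cubeM. \<theta>/2 * L x t - D x t - f x * u x t = 0"
  by (simp add: split_beta')
 then show ?thesis using L2Q_slice[OF u] L2Q_slice[OF L] L2Q_slice[OF D]
 proof eventually_elim
  case (elim t)
  then have i: "integrable cubeM (\<lambda>x. u x t)" "integrable cubeM (\<lambda>x. \<theta>/2 * L x t)" "integrable cubeM (\<lambda>x. D x t)"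
   using l2_integrable integrable_mult_right[OF l2_integrable[OF elim(3)], of "\<theta>/2"] by auto
  have [measurable]: "(\<lambda>x. u x t) \<in> bmeas" "(\<lambda>x. L x t) \<in> bmeas" "(\<lambda>x. D x t) \<in> bmeas"
   using elim by (auto simp: l2_def)
  show ?case
  proof
   fix k
   have "fcoef (\<lambda>x. \<theta>/2 * L x t - D x t) k = fcoef (\<lambda>x. f x * u x t) k"
    by (rule fcoef_cong_AE) (use elim(1) in auto)
   then show "of_real (\<theta>/2) * tcoef L k t - tcoef D k t = conv (fcoef f) (\<lambda>l. tcoef u l t) k"
    by (simp only: fcoef_diff[OF i(2,3)] fcoef_cmult fcoef_mult[OF f(2,3) i(1)])
  qed
 qed
qed

text \<open>The integrating factor removes the unbounded symbol; only the bounded convolution remains.\<close>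

lemma strong_sol_wder:
 fixes u :: "real^'d \<Rightarrow> real \<Rightarrow> real"
 assumes f: "f \<in> bmeas" "integrable cubeM f" "l1 (fcoef f) < \<infinity>"
  and K: "\<And>v. sE 0 (conv (fcoef f) v) \<le> ennreal K * sE 0 v"
  and s: "strong_sol \<theta> T f u0 u"
 shows "wder T (\<lambda>t. of_real (exp (symb \<theta> k * t)) * tcoef u k t)
   (\<lambda>t. of_real (exp (symb \<theta> k * t)) * - conv (fcoef f) (\<lambda>l. tcoef u l t) k)"
 unfolding wder_def
proof (intro allI impI)
 fix \<psi> assume \<psi>: "test_fun T \<psi>"
 let ?n = "symb \<theta> k" and ?F = "\<lambda>t. conv (fcoef f) (\<lambda>l. tcoef u l t) k"
 from s obtain L D where u: "L2Q T u" and L: "L2Q T L" and D: "L2Q T D"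
  and wl: "weak_lap T u L" and wd: "weak_dt T 1 u D"
  and eq: "AE p in lborel. p \<in> Qset T \<longrightarrow> \<theta>/2 * L (fst p) (snd p) - D (fst p) (snd p) - f (fst p) * u (fst p) (snd p) = 0"
  unfolding strong_sol_def by blast
 note ce = strong_sol_coef_equation[OF f u L D eq]
 note fu = tcoef_facts[OF u] and fL = tcoef_facts[OF L] and fD = tcoef_facts[OF D]
 have iF: "integrable (timeM T) ?F" by (rule conv_timeM_integrable(2)[OF K fu(1,2)])
 \<comment> \<open>The equation is tested with this product: the extra term
   \<open>symb \<theta> k * \<eta> t\<close> in its derivative is cancelled by the
   Laplacian.\<close>
 define \<eta> where "\<eta> t = exp (?n * t) * \<psi> t" for t
 have \<eta>: "test_fun T \<eta>" unfolding \<eta>_def by (rule test_fun_mult_exp[OF \<psi>])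
 define \<psi>' where "\<psi>' t = exp (?n * t) * deriv \<psi> t" for t
 have \<psi>': "test_fun T \<psi>'" unfolding \<psi>'_def by (rule test_fun_mult_exp[OF test_fun_deriv[OF \<psi>]])
 have d: "deriv \<eta> t = ?n * \<eta> t + \<psi>' t" for t
  unfolding \<eta>_def \<psi>'_def by (rule DERIV_imp_deriv) (auto intro!: derivative_eq_intros test_fun_has_derivative[OF \<psi>] simp: algebra_simps)
 note it = integrable_timeM_test[OF _ \<eta>] integrable_timeM_test[OF _ \<psi>']
 define I where "I = (\<integral>t. tcoef u k t * of_real (\<eta> t) \<partial>timeM T)"
 have 1: "(\<integral>t. tcoef L k t * of_real (\<eta> t) \<partial>timeM T) = of_real (-(4 * pi^2 * ksq k)) * I"
  using wl \<eta> unfolding weak_lap_iff[OF u L] I_def by simp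
 have 2: "(\<integral>t. tcoef u k t * of_real (deriv \<eta> t) \<partial>timeM T) = - (\<integral>t. tcoef D k t * of_real (\<eta> t) \<partial>timeM T)"
  using weak_dt_coef[OF u D wd \<eta>, of k] by simp
 have 3: "(\<integral>t. tcoef u k t * of_real (deriv \<eta> t) \<partial>timeM T) = of_real ?n * I + (\<integral>t. tcoef u k t * of_real (\<psi>' t) \<partial>timeM T)"
 proof -
  have "(\<integral>t. tcoef u k t * of_real (deriv \<eta> t) \<partial>timeM T) = (\<integral>t. of_real ?n * (tcoef u k t * of_real (\<eta> t)) + tcoef u k t * of_real (\<psi>' t) \<partial>timeM T)"
   by (intro Bochner_Integration.integral_cong) (auto simp: d algebra_simps)
  then show ?thesis unfolding I_def by (simp add: Bochner_Integration.integral_add it fu)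
 qed
 have 4: "(\<integral>t. ?F t * of_real (\<eta> t) \<partial>timeM T) = of_real (\<theta>/2) * (\<integral>t. tcoef L k t * of_real (\<eta> t) \<partial>timeM T) - (\<integral>t. tcoef D k t * of_real (\<eta> t) \<partial>timeM T)"
 proof -
  have "(\<integral>t. ?F t * of_real (\<eta> t) \<partial>timeM T) = (\<integral>t. of_real (\<theta>/2) * (tcoef L k t * of_real (\<eta> t)) - tcoef D k t * of_real (\<eta> t) \<partial>timeM T)"
  proof (rule integral_cong_AE)
   show "AE t in timeM T. ?F t * of_real (\<eta> t) = of_real (\<theta>/2) * (tcoef L k t * of_real (\<eta> t)) - tcoef D k t * of_real (\<eta> t)"
    using ce
   proof eventually_elim
    case (elim t)
    then show ?case by (metis left_diff_distrib mult.assoc)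
   qed
  qed (intro borel_measurable_integrable Bochner_Integration.integrable_diff integrable_mult_right it iF fL fD)+
  then show ?thesis by (simp add: Bochner_Integration.integral_diff it fL fD)
 qed
 have sy: "complex_of_real (\<theta>/2) * of_real (-(4 * pi^2 * ksq k)) = - of_real ?n"
  by (simp add: symb_def)
 have "(\<integral>t. tcoef u k t * of_real (\<psi>' t) \<partial>timeM T) = (\<integral>t. ?F t * of_real (\<eta> t) \<partial>timeM T)"
 proof -
  have "(\<integral>t. ?F t * of_real (\<eta> t) \<partial>timeM T) = - of_real ?n * I - (\<integral>t. tcoef D k t * of_real (\<eta> t) \<partial>timeM T)"
   unfolding 4 1 mult.assoc[symmetric] sy ..
  also have "\<dots> = - of_real ?n * I + (\<integral>t. tcoef u k t * of_real (deriv \<eta> t) \<partial>timeM T)" unfolding 2 by simp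
  finally show ?thesis unfolding 3 by simp
 qed
 moreover have "(\<integral>t. of_real (exp (?n * t)) * tcoef u k t * of_real (deriv \<psi> t) \<partial>timeM T) = (\<integral>t. tcoef u k t * of_real (\<psi>' t) \<partial>timeM T)"
  by (intro Bochner_Integration.integral_cong) (auto simp: \<psi>'_def)
 moreover have "(\<integral>t. of_real (exp (?n * t)) * - ?F t * of_real (\<psi> t) \<partial>timeM T) = (\<integral>t. - (?F t * of_real (\<eta> t)) \<partial>timeM T)"
  by (intro Bochner_Integration.integral_cong) (auto simp: \<eta>_def)
 ultimately show "(\<integral>t. of_real (exp (?n * t)) * tcoef u k t * of_real (deriv \<psi> t) \<partial>timeM T)
   = - (\<integral>t. of_real (exp (?n * t)) * - ?F t * of_real (\<psi> t) \<partial>timeM T)" by simp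
qed

text \<open>Bessel turns the initial condition in L2 into one for each single coefficient, which is
  what fixing a constant of integration requires.\<close>

lemma strong_sol_trace:
 fixes u :: "real^'d \<Rightarrow> real \<Rightarrow> real"
 assumes u0: "l2 u0" and s: "strong_sol \<theta> T f u0 u" and e: "e > 0"
 shows "\<exists>\<delta>>0. AE t in timeM T. t < \<delta> \<longrightarrow> (cmod (tcoef u k t - fcoef u0 k))^2 \<le> e"
proof -
 from s have u: "L2Q T u" by (simp add: strong_sol_def)
 from s e obtain \<delta> where \<delta>: "\<delta> > 0" "AE t in lborel. 0 < t \<and> t < \<delta> \<and> t < T \<longrightarrow>
    (\<integral>\<^sup>+ x. indicator tcube x * ennreal ((u x t - u0 x)^2) \<partial>lborel) < ennreal e"
  unfolding strong_sol_def by blast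
 have "AE t in timeM T. t < \<delta> \<longrightarrow> (\<integral>\<^sup>+ x. indicator tcube x * ennreal ((u x t - u0 x)^2) \<partial>lborel) < ennreal e"
  using \<delta>(2) unfolding AE_timeM by eventually_elim auto
 then have "AE t in timeM T. t < \<delta> \<longrightarrow> (cmod (tcoef u k t - fcoef u0 k))^2 \<le> e"
  using L2Q_slice[OF u]
 proof eventually_elim
  case (elim t)
  show ?case
  proof
   assume "t < \<delta>"
   have l: "l2 (\<lambda>x. u x t - u0 x)" by (rule l2_diff[OF elim(2) u0])
   then have [measurable]: "(\<lambda>x. u x t - u0 x) \<in> bmeas" by (simp add: l2_def)
   have "ennreal ((1 + ksq k) powr 0 * (cmod (fcoef (\<lambda>x. u x t - u0 x) k))^2) \<le> sE 0 (fcoef (\<lambda>x. u x t - u0 x))" by (rule sE_point_le)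
   also have "\<dots> \<le> (\<integral>\<^sup>+x. ennreal ((u x t - u0 x)^2) \<partial>cubeM)" by (rule bessel[OF l])
   also have "\<dots> = (\<integral>\<^sup>+ x. indicator tcube x * ennreal ((u x t - u0 x)^2) \<partial>lborel)" by (rule nn_integral_cubeM) measurable
   also have "\<dots> \<le> ennreal e" using elim(1) \<open>t < \<delta>\<close> by simp
   finally have "(cmod (fcoef (\<lambda>x. u x t - u0 x) k))^2 \<le> e" using e by (simp add: powr_zero_eq_one)
   then show "(cmod (tcoef u k t - fcoef u0 k))^2 \<le> e"
    by (simp add: fcoef_diff[OF l2_integrable[OF elim(2)] l2_integrable[OF u0]])
  qed
 qed
 then show ?thesis using \<delta>(1) by blast
qed

text \<open>Each mode of the difference \<open>z\<close>, times its integrating factor, is a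
  primitive whose constant of integration is 0 by the two traces. Only earlier times enter its value
  at \<open>t\<close>, so the integrating factors cost nothing and the bound is uniform over modes;
  summation yields the hypothesis of \<open>gronwall_zero\<close>.\<close>

lemma strong_sol_unique:
 fixes f :: "real^'d \<Rightarrow> real" and u v :: "real^'d \<Rightarrow> real \<Rightarrow> real"
 assumes T: "T > 0" and f: "f \<in> bmeas" "integrable cubeM f" "l1 (fcoef f) < \<infinity>"
  and \<theta>: "\<theta> \<ge> 0" and K: "\<And>v. sE 0 (conv (fcoef f) v) \<le> ennreal K * sE 0 v" "K > 0" and u0: "l2 u0"
  and u: "strong_sol \<theta> T f u0 u" and v: "strong_sol \<theta> T f u0 v"
 shows "AE p in lborel. p \<in> Qset T \<longrightarrow> case_prod v p = case_prod u p"
proof -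
 have uL: "L2Q T u" and vL: "L2Q T v" using u v by (auto simp: strong_sol_def)
 note fu = tcoef_facts[OF uL] and fv = tcoef_facts[OF vL]
 note [measurable] = fu(1) fv(1)
 define z where "z k t = tcoef u k t - tcoef v k t" for k t
 have zm [measurable]: "z k \<in> bmeas" for k unfolding z_def by measurable
 have zfin: "tE T 0 z < \<infinity>"
 proof -
  have [measurable]: "(\<lambda>t. sE 0 (\<lambda>k. tcoef u k t)) \<in> bmeas" "(\<lambda>t. sE 0 (\<lambda>k. tcoef v k t)) \<in> bmeas"
   by (rule sE_measurable[OF fu(1)], rule sE_measurable[OF fv(1)])
  have "tE T 0 z \<le> (\<integral>\<^sup>+t. 2 * sE 0 (\<lambda>k. tcoef u k t) + 2 * sE 0 (\<lambda>k. - tcoef v k t) \<partial>timeM T)"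
   unfolding tE_def z_def diff_conv_add_uminus by (intro nn_integral_mono sE_add_le)
  also have "(\<lambda>t. sE 0 (\<lambda>k. - tcoef v k t)) = (\<lambda>t. sE 0 (\<lambda>k. tcoef v k t))" by (intro ext sE_cong) simp
  also have "(\<integral>\<^sup>+t. 2 * sE 0 (\<lambda>k. tcoef u k t) + 2 * sE 0 (\<lambda>k. tcoef v k t) \<partial>timeM T) = 2 * tE T 0 (tcoef u) + 2 * tE T 0 (tcoef v)"
   unfolding tE_def by (simp add: nn_integral_add nn_integral_cmult)
  also have "\<dots> < \<infinity>" using fu(2) fv(2) by (simp add: ennreal_mult_less_top)
  finally show ?thesis .
 qed
 let ?F = "fcoef f"
 let ?c = "\<lambda>s k. conv ?F (\<lambda>l. z l s) k"
 let ?I = "\<lambda>t k. \<integral>\<^sup>+s. ennreal ((cmod (?c s k))^2) * indicator {..<t} s \<partial>timeM T"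
 \<comment> \<open>Additivity of \<open>conv\<close> requires absolute convergence of both series,
   which square integrability of the slices provides at almost every time.\<close>
 have lin: "AE t in timeM T. \<forall>k. conv ?F (\<lambda>l. tcoef u l t) k - conv ?F (\<lambda>l. tcoef v l t) k = ?c t k"
  using L2Q_slice[OF uL] L2Q_slice[OF vL]
 proof eventually_elim
  case (elim t)
  have bd: "\<exists>B. \<forall>k. cmod (fcoef g k) \<le> B" if g: "l2 g" for g :: "real^'d \<Rightarrow> real"
  proof -
   have "sE 0 (fcoef g) < \<infinity>" using bessel[OF g] g unfolding l2_def by (auto intro: le_less_trans)
   then obtain R where R: "sE 0 (fcoef g) = ennreal R" "R \<ge> 0" by (cases "sE 0 (fcoef g)") auto
   then show ?thesis using cmod_le_sE_0[of "fcoef g" "sqrt R"] by auto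
  qed
  obtain B B' where "\<And>l. cmod (tcoef u l t) \<le> B" "\<And>l. cmod (tcoef v l t) \<le> B'" using bd[OF elim(1)] bd[OF elim(2)] by auto
  then have "integrable (cntM) (\<lambda>l. ?F (k - l) * tcoef u l t)" "integrable (cntM) (\<lambda>l. ?F (k - l) * tcoef v l t)" for k
   by (auto intro: conv_integrable[OF f(3)])
  then show ?case unfolding conv_def z_def right_diff_distrib
   by (intro allI Bochner_Integration.integral_diff[symmetric])
 qed
 have mode: "AE t in timeM T. ennreal ((cmod (z k t))^2) \<le> ennreal T * ?I t k" for k
 proof -
  let ?n = "symb \<theta> k"
  have n0: "?n \<ge> 0" by (rule symb_nonneg[OF \<theta>])
  define E where "E t = complex_of_real (exp (?n * t))" for t
  define h where "h t = E t * - conv ?F (\<lambda>l. tcoef u l t) k - E t * - conv ?F (\<lambda>l. tcoef v l t) k" for t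
  have ig: "integrable (timeM T) (\<lambda>t. E t * tcoef u k t)" "integrable (timeM T) (\<lambda>t. E t * tcoef v k t)"
   unfolding E_def by (intro integrable_timeM_exp fu fv)+
  have ih: "integrable (timeM T) (\<lambda>t. E t * - conv ?F (\<lambda>l. tcoef u l t) k)" "integrable (timeM T) (\<lambda>t. E t * - conv ?F (\<lambda>l. tcoef v l t) k)"
   unfolding E_def by (intro integrable_timeM_exp Bochner_Integration.integrable_minus conv_timeM_integrable(2)[OF K(1)] fu fv)+
  have hi: "integrable (timeM T) h" unfolding h_def by (rule Bochner_Integration.integrable_diff[OF ih])
  have zi: "integrable (timeM T) (\<lambda>t. E t * z k t)" unfolding z_def right_diff_distrib by (rule Bochner_Integration.integrable_diff[OF ig])
  have "wder T (\<lambda>t. E t * tcoef u k t - E t * tcoef v k t) (\<lambda>t. E t * - conv ?F (\<lambda>l. tcoef u l t) k - E t * - conv ?F (\<lambda>l. tcoef v l t) k)"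
   by (rule wder_diff[OF ig ih strong_sol_wder[OF f K(1) u, of k, folded E_def] strong_sol_wder[OF f K(1) v, of k, folded E_def]])
  then have w: "wder T (\<lambda>t. E t * z k t) h" by (simp add: z_def right_diff_distrib h_def[abs_def])
  obtain C where C: "AE t in timeM T. E t * z k t = C + (\<integral>s. indicator {..<t} s *\<^sub>R h s \<partial>timeM T)"
   using wder_imp_primitive[OF T zi hi w] by blast
  define D where "D t = C + (\<integral>s. indicator {..<t} s *\<^sub>R h s \<partial>timeM T)" for t
  have D0: "D 0 = C"
  proof -
   have "(\<integral>s. indicator {..<0} s *\<^sub>R h s \<partial>timeM T) = 0"
    by (rule integral_eq_zero_AE) (use AE_timeM_Ioo[of T] in \<open>eventually_elim, auto\<close>)
   then show ?thesis by (simp add: D_def)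
  qed
  have hE: "AE s in timeM T. h s = - (E s * ?c s k)"
   using lin
  proof eventually_elim
   case (elim s)
   have "h s = - (E s * (conv ?F (\<lambda>l. tcoef u l s) k - conv ?F (\<lambda>l. tcoef v l s) k))" by (simp add: h_def algebra_simps)
   then show ?case using elim by simp
  qed
  have hm [measurable]: "h \<in> bmeas" using borel_measurable_integrable[OF hi] by simp
  have [measurable]: "(\<lambda>t. ?c t k) \<in> bmeas" by (rule conv_time_measurable[OF zm])
  \<comment> \<open>The first bound keeps the exponential at time \<open>t\<close> and feeds the
    Gronwall argument; the second is crude but tends to 0 with \<open>t\<close>, which identifies
    \<open>C\<close>.\<close>
  have D2: "ennreal ((cmod (D t - C))^2) \<le> ennreal T * ennreal (exp (2 * ?n * t)) * ?I t k"
   and D3: "ennreal ((cmod (D t - C))^2) \<le> ennreal t * ennreal (exp (2 * ?n * T)) * (ennreal K * tE T 0 z)"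
   if t: "0 < t" "t < T" for t
  proof -
   have 1: "ennreal ((cmod (D t - C))^2) \<le> ennreal \<bar>t - 0\<bar> * (\<integral>\<^sup>+r. ennreal ((cmod (h r))^2) * indicator {min t 0..max t 0} r \<partial>timeM T)"
    using primitive_diff_sq_le[OF hi D_def, of t 0] unfolding D0 .
   \<comment> \<open>The closed segment from 0 to \<open>t\<close> exceeds the half-line before
     \<open>t\<close> by the single point \<open>t\<close>.\<close>
   have nt: "AE s in timeM T. s \<noteq> t" unfolding AE_timeM using AE_lborel_singleton[of t] by eventually_elim auto
   have "(\<integral>\<^sup>+r. ennreal ((cmod (h r))^2) * indicator {min t 0..max t 0} r \<partial>timeM T)
     \<le> (\<integral>\<^sup>+s. ennreal (exp (2 * ?n * t)) * (ennreal ((cmod (?c s k))^2) * indicator {..<t} s) \<partial>timeM T)"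
   proof (rule nn_integral_mono_AE)
    show "AE r in timeM T. ennreal ((cmod (h r))^2) * indicator {min t 0..max t 0} r
      \<le> ennreal (exp (2 * ?n * t)) * (ennreal ((cmod (?c r k))^2) * indicator {..<t} r)"
     using hE nt
    proof eventually_elim
     case (elim r)
     show ?case
     proof (cases "r < t")
      case True
      have "(cmod (h r))^2 = exp (2 * ?n * r) * (cmod (?c r k))^2"
       unfolding elim(1) by (simp add: E_def norm_mult power_mult_distrib exp_double[symmetric] mult.assoc)
      also have "\<dots> \<le> exp (2 * ?n * t) * (cmod (?c r k))^2"
       using True n0 by (intro mult_right_mono) (auto intro: mult_left_mono)
      finally have "ennreal ((cmod (h r))^2) \<le> ennreal (exp (2 * ?n * t)) * ennreal ((cmod (?c r k))^2)"
       by (subst ennreal_mult[symmetric]) (auto intro: ennreal_leI)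
      then show ?thesis using True by (auto simp: indicator_def)
     qed (use elim(2) t in \<open>auto simp: indicator_def\<close>)
    qed
   qed
   also have "\<dots> = ennreal (exp (2 * ?n * t)) * ?I t k"
    by (rule nn_integral_cmult) simp
   finally have 2: "(\<integral>\<^sup>+r. ennreal ((cmod (h r))^2) * indicator {min t 0..max t 0} r \<partial>timeM T)
     \<le> ennreal (exp (2 * ?n * t)) * ?I t k" .
   have 3: "ennreal ((cmod (D t - C))^2) \<le> ennreal t * (ennreal (exp (2 * ?n * t)) * ?I t k)"
    using order_trans[OF 1 mult_left_mono[OF 2, of "ennreal \<bar>t - 0\<bar>"]] t by simp
   show "ennreal ((cmod (D t - C))^2) \<le> ennreal T * ennreal (exp (2 * ?n * t)) * ?I t k"
   proof -
    have "ennreal t * Y \<le> ennreal T * Y" for Y using t by (intro mult_right_mono ennreal_leI) auto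
    from order_trans[OF 3 this] show ?thesis by (simp only: mult.assoc)
   qed
   have "?I t k \<le> (\<integral>\<^sup>+s. ennreal ((cmod (?c s k))^2) \<partial>timeM T)"
    by (intro nn_integral_mono) (auto simp: indicator_def)
   also have "\<dots> \<le> tE T 0 (\<lambda>k t. ?c t k)"
    by (rule tE_component) (rule conv_time_measurable[OF zm])
   also have "\<dots> \<le> ennreal K * tE T 0 z" by (rule conv_timeM_integrable(1)[OF K(1) zm zfin])
   finally have 4: "?I t k \<le> ennreal K * tE T 0 z" .
   show "ennreal ((cmod (D t - C))^2) \<le> ennreal t * ennreal (exp (2 * ?n * T)) * (ennreal K * tE T 0 z)"
   proof -
    have "ennreal (exp (2 * ?n * t)) \<le> ennreal (exp (2 * ?n * T))" using n0 t by (intro ennreal_leI) (auto intro: mult_left_mono)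
    from order_trans[OF 3 mult_left_mono[OF mult_mono[OF this 4]]] show ?thesis by (simp add: mult.assoc)
   qed
  qed
  have C0: "C = 0"
  proof (rule ccontr)
   assume "C \<noteq> 0"
   define c where "c = (cmod C)^2"
   have c: "c > 0" using \<open>C \<noteq> 0\<close> by (simp add: c_def)
   obtain Z where Z: "tE T 0 z = ennreal Z" "Z \<ge> 0" using zfin by (cases "tE T 0 z") auto
   define X where "X = exp (2 * ?n * T)"
   have X: "X > 0" by (simp add: X_def)
   \<comment> \<open>Together with \<open>d3\<close> this gives
     \<open>(cmod (D t))^2 \<le> c / 4\<close> and \<open>(cmod (D t - C))^2 \<le> c / 8\<close> at
     a suitable time, hence the contradiction \<open>c \<le> 3 * c / 4\<close>.\<close>
   define e where "e = c / (16 * X)"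
   have e: "e > 0" using c X by (simp add: e_def)
   obtain d1 where d1: "d1 > 0" "AE t in timeM T. t < d1 \<longrightarrow> (cmod (tcoef u k t - fcoef u0 k))^2 \<le> e" using strong_sol_trace[OF u0 u e] by blast
   obtain d2 where d2: "d2 > 0" "AE t in timeM T. t < d2 \<longrightarrow> (cmod (tcoef v k t - fcoef u0 k))^2 \<le> e" using strong_sol_trace[OF u0 v e] by blast
   define d3 where "d3 = c / (8 * X * (K * Z + 1))"
   have KZ: "K * Z + 1 > 0" using K(2) Z(2) by (simp add: add_nonneg_pos)
   have d3: "d3 > 0" using c X KZ by (simp add: d3_def)
   have "AE t in timeM T. (t < d1 \<longrightarrow> (cmod (tcoef u k t - fcoef u0 k))^2 \<le> e) \<and> (t < d2 \<longrightarrow> (cmod (tcoef v k t - fcoef u0 k))^2 \<le> e) \<and> E t * z k t = D t"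
    using d1(2) d2(2) C unfolding D_def by eventually_elim auto
   from AE_timeM_ex[OF T _ this, of "min d1 (min d2 d3)"] d1(1) d2(1) d3
   obtain t where t: "0 < t" "t < T" "t < d3" "(cmod (tcoef u k t - fcoef u0 k))^2 \<le> e" "(cmod (tcoef v k t - fcoef u0 k))^2 \<le> e" "E t * z k t = D t" by auto
   have "ennreal ((cmod (D t - C))^2) \<le> ennreal (t * X * (K * Z))"
    using D3[OF t(1,2)] t(1) X K(2) Z unfolding Z(1) X_def[symmetric] by (simp add: ennreal_mult)
   then have a1: "(cmod (D t - C))^2 \<le> t * X * (K * Z)" using t(1) X K(2) Z(2) by (subst (asm) ennreal_le_iff) auto
   also have "\<dots> \<le> d3 * X * (K * Z + 1)" using t X K(2) Z(2) d3 by (intro mult_mono) auto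
   also have "\<dots> = c / 8"
   proof -
    have "c / (8 * X * W) * X * W = c / 8" if "W > 0" for W using that X by (simp add: field_simps)
    from this[OF KZ] show ?thesis unfolding d3_def .
   qed
   finally have a1: "(cmod (D t - C))^2 \<le> c / 8" .
   have "z k t = (tcoef u k t - fcoef u0 k) - (tcoef v k t - fcoef u0 k)" by (simp add: z_def)
   then have "(cmod (z k t))^2 \<le> 4 * e" using cmod_diff_sq_le[of "tcoef u k t - fcoef u0 k" "tcoef v k t - fcoef u0 k"] t(4,5) by simp
   moreover have "(cmod (E t))^2 \<le> X"
    using t n0 by (auto simp: E_def X_def exp_double[symmetric] mult.assoc intro!: mult_left_mono)
   ultimately have "(cmod (E t))^2 * (cmod (z k t))^2 \<le> X * (4 * e)" using X by (intro mult_mono) auto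
   then have a2: "(cmod (D t))^2 \<le> c / 4" unfolding t(6)[symmetric] norm_mult power_mult_distrib using X by (simp add: e_def)
   have "c \<le> 2 * (cmod (D t))^2 + 2 * (cmod (D t - C))^2"
    using cmod_diff_sq_le[of "D t" "D t - C"] by (simp add: c_def)
   then show False using a1 a2 c by simp
  qed
  show ?thesis
   using C AE_timeM_Ioo[of T]
  proof eventually_elim
   case (elim t)
   have "E t * z k t = D t - C" using elim(1) C0 by (simp add: D_def)
   then have "(cmod (D t - C))^2 = exp (2 * ?n * t) * (cmod (z k t))^2"
    by (simp add: E_def norm_mult power_mult_distrib exp_double[symmetric] mult.assoc flip: \<open>E t * z k t = D t - C\<close>)
   then have "ennreal (exp (2 * ?n * t)) * ennreal ((cmod (z k t))^2) \<le> ennreal (exp (2 * ?n * t)) * (ennreal T * ?I t k)"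
    using D2[of t] elim(2) by (simp add: ennreal_mult ac_simps)
   then have "ennreal (exp (- (2 * ?n * t))) * (ennreal (exp (2 * ?n * t)) * ennreal ((cmod (z k t))^2)) \<le> ennreal (exp (- (2 * ?n * t))) * (ennreal (exp (2 * ?n * t)) * (ennreal T * ?I t k))"
    by (rule mult_left_mono) simp
   moreover have "ennreal (exp (- (2 * ?n * t))) * ennreal (exp (2 * ?n * t)) = 1"
    by (subst ennreal_mult[symmetric]) (simp_all add: exp_minus field_simps)
   ultimately show ?case by (simp only: mult.assoc[symmetric] mult_1)
  qed
 qed
 have "AE t in timeM T. \<forall>k. ennreal ((cmod (z k t))^2) \<le> ennreal T * ?I t k"
  unfolding AE_all_countable using mode by blast
 then have "AE t in timeM T. sE 0 (\<lambda>k. z k t) \<le> ennreal (T * K) * (\<integral>\<^sup>+s. sE 0 (\<lambda>k. z k s) * indicator {..<t} s \<partial>timeM T)"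
 proof eventually_elim
  case (elim t)
  have [measurable]: "(\<lambda>t. ?c t k) \<in> bmeas" for k by (rule conv_time_measurable[OF zm])
  have [measurable]: "(\<lambda>t. sE 0 (\<lambda>k. z k t)) \<in> bmeas" by (rule sE_measurable[OF zm])
  have "sE 0 (\<lambda>k. z k t) \<le> (\<integral>\<^sup>+k. ennreal T * ?I t k \<partial>cntM)"
   unfolding sE_0_eq by (intro nn_integral_mono) (use elim in auto)
  also have "\<dots> = ennreal T * (\<integral>\<^sup>+k. ?I t k \<partial>cntM)"
   by (rule nn_integral_cmult) simp
  also have "(\<integral>\<^sup>+k. ?I t k \<partial>cntM)
    = (\<integral>\<^sup>+s. (\<integral>\<^sup>+k. ennreal ((cmod (?c s k))^2) * indicator {..<t} s \<partial>cntM) \<partial>timeM T)"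
   by (rule nn_integral_count_space_nn_integral[symmetric]) auto
  also have "\<dots> = (\<integral>\<^sup>+s. sE 0 (conv ?F (\<lambda>l. z l s)) * indicator {..<t} s \<partial>timeM T)"
   unfolding sE_0_eq by (simp add: nn_integral_multc)
  also have "ennreal T * \<dots> \<le> ennreal T * (\<integral>\<^sup>+s. ennreal K * (sE 0 (\<lambda>k. z k s) * indicator {..<t} s) \<partial>timeM T)"
   unfolding mult.assoc[symmetric] by (intro mult_left_mono nn_integral_mono mult_right_mono K(1)) auto
  also have "\<dots> = ennreal (T * K) * (\<integral>\<^sup>+s. sE 0 (\<lambda>k. z k s) * indicator {..<t} s \<partial>timeM T)"
   using T K(2) by (subst nn_integral_cmult) (auto simp: ennreal_mult mult.assoc)
  finally show ?case .
 qed
 from gronwall_zero[OF sE_measurable[OF zm] _ zfin[unfolded tE_def] this] have "AE t in timeM T. sE 0 (\<lambda>k. z k t) = 0"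
  using T K(2) by simp
 then have "AE t in timeM T. AE x in cubeM. case_prod v (x, t) = case_prod u (x, t)"
  using L2Q_slice[OF uL] L2Q_slice[OF vL]
 proof eventually_elim
  case (elim t)
  have "cmod (z k t) \<le> 0" for k by (rule cmod_le_sE_0) (use elim(1) in auto)
  then have "fcoef (\<lambda>x. v x t) k = fcoef (\<lambda>x. u x t) k" for k by (simp add: z_def)
  then show ?case using AE_eq_of_fcoef_eq[OF l2_integrable[OF elim(3)] l2_integrable[OF elim(2)]] by simp
 qed
 moreover have "Measurable.pred (borel \<Otimes>\<^sub>M borel) (\<lambda>p. case_prod v p = case_prod u p)"
 proof -
  have [measurable]: "case_prod u \<in> bmeas2" "case_prod v \<in> bmeas2"
   using uL vL by (auto simp: L2Q_iff)
  show ?thesis by measurable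
 qed
 ultimately show ?thesis using AE_Q_iff[of "\<lambda>p. case_prod v p = case_prod u p" T] by simp
qed

subsection \<open>A priori estimates\<close>

lemma tE_conv_le:
 assumes K: "\<And>v. sE s (conv F v) \<le> ennreal K * sE s v" and vm: "\<And>k. v k \<in> bmeas"
 shows "tE T s (\<lambda>k t. conv F (\<lambda>l. v l t) k) \<le> ennreal K * tE T s v"
proof -
 have "tE T s (\<lambda>k t. conv F (\<lambda>l. v l t) k) \<le> (\<integral>\<^sup>+t. ennreal K * sE s (\<lambda>k. v k t) \<partial>timeM T)"
  unfolding tE_def by (intro nn_integral_mono K)
 also have "\<dots> = ennreal K * tE T s v" unfolding tE_def using sE_measurable[OF vm] by (intro nn_integral_cmult) simp
 finally show ?thesis .
qed

text \<open>The constant is fixed before \<open>f\<close>, \<open>c\<close>, \<open>M\<close> and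
  \<open>R\<close>, which explains the quantifiers in the conclusion. The crude bound
  \<open>R\<close> only makes the norms of orders \<open>\<beta>\<close> and
  \<open>\<beta> + 2\<close> finite, so that the absorption is an inequality between reals.\<close>

lemma coef_apriori:
 fixes a0 :: "int^'d \<Rightarrow> complex"
 assumes T: "T > 0" and \<theta>: "\<theta> > 0" and \<beta>: "\<beta> > real CARD('d) / 2" and Kc: "Kc \<ge> 0"
  and a0: "sE (\<beta> + 1) a0 < \<infinity>"
 obtains C0 where "C0 \<ge> 0" "\<And>f c M R s. \<lbrakk>integrable cubeM f; l1 (fcoef f) < \<infinity>; \<And>x. f x \<ge> 0; M \<ge> 1;
   \<And>s v. 0 \<le> s \<Longrightarrow> s \<le> \<beta> \<Longrightarrow> sE s (conv (fcoef f) v) \<le> ennreal (Kc * M^2) * sE s v;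
   \<And>k. continuous_on UNIV (c k); \<And>t. herm (\<lambda>k. c k t); \<And>t. sE \<beta> (\<lambda>k. c k t) \<le> ennreal R; R \<ge> 0; \<And>k. c k 0 = a0 k;
   \<And>k. continuous_on UNIV (\<lambda>t. conv (fcoef f) (\<lambda>l. c l t) k);
   \<And>k t. t \<in> {0..T} \<Longrightarrow> (c k has_vector_derivative
    (- of_real (symb \<theta> k) * c k t - conv (fcoef f) (\<lambda>l. c l t) k)) (at t within {0..T});
   0 \<le> s; s \<le> \<beta> + 2\<rbrakk> \<Longrightarrow> tE T s c \<le> ennreal (C0 * M powr s)"
proof -
 have \<beta>0: "\<beta> > 0" using \<beta> by (smt (verit) divide_nonneg_nonneg of_nat_0_le_iff)
 have "sE 0 a0 < \<infinity>" using sE_mono_exp[of 0 "\<beta> + 1" a0] \<beta>0 a0 by (auto intro: le_less_trans)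
 then obtain e0 where e0: "sE 0 a0 = ennreal e0" "e0 \<ge> 0" by (cases "sE 0 a0") auto
 obtain a1 where a1: "sE (\<beta> + 1) a0 = ennreal a1" "a1 \<ge> 0" using a0 by (cases "sE (\<beta> + 1) a0") auto
 define \<kappa> where "\<kappa> = 2 * pi^2 * \<theta>"
 have \<kappa>: "\<kappa> > 0" using \<theta> by (simp add: \<kappa>_def)
 define c1 c2 where "c1 = 2 / \<kappa>" and "c2 = 2 / \<kappa>^2"
 have c12: "c1 > 0" "c2 > 0" using \<kappa> by (auto simp: c1_def c2_def)
 \<comment> \<open>Collects the coefficients of the norm of order \<open>\<beta>\<close>: 2 from the
   low frequencies and \<open>c2 * Kc\<close> from the potential, both put in front of
   \<open>M^2\<close> with the help of \<open>M \<ge> 1\<close>.\<close>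
 define D where "D = 2 + c2 * Kc"
 have D: "D \<ge> 2" using c12 Kc by (simp add: D_def)
 \<comment> \<open>With \<open>N = n0 * M\<close> the interpolation constant satisfies \<open>D * M^2 * N powr -2 = 1/2\<close>, so that the top order term is absorbed.\<close>
 define n0 where "n0 = sqrt (2 * D)"
 have n0: "n0 > 0" "n0^2 = 2 * D" using D by (auto simp: n0_def)
 \<comment> \<open>The contributions of the energy bound and of the initial datum, doubled because
   half of the top norm has been absorbed.\<close>
 define C1 where "C1 = 2 * D * n0 powr \<beta> * (T * e0) + 2 * c1 * a1"
 have C1: "C1 \<ge> 0" using D n0 T e0 c12 a1 by (simp add: C1_def)
 show thesis
 proof (rule that[of "T * e0 + C1"])
  show "T * e0 + C1 \<ge> 0" using T e0 C1 by simp
  fix f :: "real^'d \<Rightarrow> real" and c :: "int^'d \<Rightarrow> real \<Rightarrow> complex" and M R s :: real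
  assume f: "integrable cubeM f" "l1 (fcoef f) < \<infinity>" "\<And>x. f x \<ge> 0" and M: "M \<ge> 1"
   and K: "\<And>s v. 0 \<le> s \<Longrightarrow> s \<le> \<beta> \<Longrightarrow> sE s (conv (fcoef f) v) \<le> ennreal (Kc * M^2) * sE s v"
   and c: "\<And>k. continuous_on UNIV (c k)" "\<And>t. herm (\<lambda>k. c k t)"
   and R: "\<And>t. sE \<beta> (\<lambda>k. c k t) \<le> ennreal R" "R \<ge> 0" and c0: "\<And>k. c k 0 = a0 k"
   and g: "\<And>k. continuous_on UNIV (\<lambda>t. conv (fcoef f) (\<lambda>l. c l t) k)"
   and der: "\<And>k t. t \<in> {0..T} \<Longrightarrow> (c k has_vector_derivative
    (- of_real (symb \<theta> k) * c k t - conv (fcoef f) (\<lambda>l. c l t) k)) (at t within {0..T})"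
   and s: "0 \<le> s" "s \<le> \<beta> + 2"
  have cm: "c k \<in> bmeas" for k by (rule borel_measurable_continuous_onI[OF c(1)])
  have R0: "sE 0 (\<lambda>k. c k t) \<le> ennreal R" for t using sE_mono_exp[of 0 \<beta> "\<lambda>k. c k t"] \<beta>0 R(1)[of t] by (auto intro: order_trans)
  have R0': "sE 0 (conv (fcoef f) (\<lambda>l. c l t)) \<le> ennreal (Kc * M^2 * R)" for t
   using order_trans[OF K[of 0 "\<lambda>l. c l t"] mult_left_mono[OF R0]] \<beta>0 Kc R(2) by (simp add: ennreal_mult)
  have cl: "l1 (\<lambda>k. c k t) < \<infinity>" for t by (rule l1_finite[OF \<beta>]) (rule le_less_trans[OF R(1)], simp)
  have X0: "tE T 0 c \<le> ennreal (T * e0)"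
  proof -
   have "tE T 0 c \<le> (\<integral>\<^sup>+t. sE 0 a0 \<partial>timeM T)"
    unfolding tE_def
   proof (rule nn_integral_mono_AE)
    show "AE t in timeM T. sE 0 (\<lambda>k. c k t) \<le> sE 0 a0"
     using AE_timeM_Ioo[of T]
    proof eventually_elim
     case (elim t)
     then show ?case using energy_bound[OF less_imp_le[OF \<theta>] f c cl g R0 R0' der, of t] by (simp add: c0)
    qed
   qed
   also have "\<dots> = ennreal (T * e0)" using T e0 by (simp add: emeasure_timeM ennreal_mult mult.commute)
   finally show ?thesis .
  qed
  have "tE T \<beta> c \<le> (\<integral>\<^sup>+t. ennreal R \<partial>timeM T)" unfolding tE_def by (intro nn_integral_mono R(1))
  also have "\<dots> < \<infinity>" using T by (simp add: emeasure_timeM ennreal_mult_less_top)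
  finally obtain x where x: "tE T \<beta> c = ennreal x" "x \<ge> 0" by (cases "tE T \<beta> c") auto
  have "tE T (\<beta> + 2) c \<le> 2 * tE T \<beta> c + ennreal c1 * sE (\<beta> + 1) (\<lambda>k. c k 0) + ennreal c2 * tE T \<beta> (\<lambda>k t. conv (fcoef f) (\<lambda>l. c l t) k)"
   unfolding c1_def c2_def \<kappa>_def by (rule max_regularity[OF T \<theta> c(1) g der])
  also have "\<dots> \<le> 2 * tE T \<beta> c + ennreal c1 * sE (\<beta> + 1) a0 + ennreal c2 * (ennreal (Kc * M^2) * tE T \<beta> c)"
   using \<beta>0 by (intro add_mono mult_left_mono tE_conv_le[OF K cm]) (auto simp: c0)
  also have "\<dots> = ennreal (2 * x + c1 * a1 + c2 * (Kc * M^2 * x))"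
   using x a1 c12 Kc by (simp add: x(1) a1(1) ennreal_mult ennreal_plus[symmetric] del: ennreal_plus) (simp add: ennreal_plus ennreal_mult)
  finally have Y: "tE T (\<beta> + 2) c \<le> ennreal (2 * x + c1 * a1 + c2 * (Kc * M^2 * x))" .
  then have "tE T (\<beta> + 2) c < \<infinity>" by (rule le_less_trans) simp
  then obtain y where y: "tE T (\<beta> + 2) c = ennreal y" "y \<ge> 0" by (cases "tE T (\<beta> + 2) c") auto
  have y1: "y \<le> 2 * x + c1 * a1 + c2 * (Kc * M^2 * x)"
   using Y x a1 c12 Kc unfolding y(1) by (subst (asm) ennreal_le_iff) auto
  have "2 * x \<le> 2 * M^2 * x" using M x by (simp add: mult_right_mono power_mono)
  then have y2: "y \<le> D * M^2 * x + c1 * a1" using y1 by (simp add: D_def algebra_simps)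
  define N where "N = n0 * M"
  have N: "N > 0" using n0 M by (simp add: N_def)
  have interp: "tE T s' c \<le> ennreal (N' powr s' * (T * e0) + N' powr (s' - (\<beta> + 2)) * y)" if "N' > 0" "0 \<le> s'" "s' \<le> \<beta> + 2" for N' s'
  proof -
   have "tE T s' c \<le> ennreal (N' powr s') * tE T 0 c + ennreal (N' powr (s' - (\<beta> + 2))) * tE T (\<beta> + 2) c"
    by (rule tE_interp[OF that cm])
   also have "\<dots> \<le> ennreal (N' powr s') * ennreal (T * e0) + ennreal (N' powr (s' - (\<beta> + 2))) * ennreal y"
    unfolding y(1) by (intro add_mono mult_left_mono X0) auto
   also have "\<dots> = ennreal (N' powr s' * (T * e0) + N' powr (s' - (\<beta> + 2)) * y)"
    using T e0 y by (simp add: ennreal_mult ennreal_plus)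
   finally show ?thesis .
  qed
  have x1: "x \<le> N powr \<beta> * (T * e0) + N powr (- 2) * y"
  proof -
   have b: "\<beta> \<le> \<beta> + 2" "\<beta> - (\<beta> + 2) = - 2" by simp_all
   show ?thesis using interp[OF N less_imp_le[OF \<beta>0] b(1), unfolded b(2) x(1)] T e0(2) y(2)
    by (subst (asm) ennreal_le_iff) auto
  qed
  have "N^2 = 2 * D * M^2" by (simp only: N_def power_mult_distrib n0(2))
  then have Nm: "N powr (- 2) = 1 / (2 * (D * M^2))" using N by (simp add: powr_minus_divide mult.assoc)
  have "D * M^2 > 0" using D M by simp
  then have "D * M^2 * (A + 1 / (2 * (D * M^2)) * y) = D * M^2 * A + y / 2" for A using D M by (auto simp: distrib_left)
  moreover have "D * M^2 * x \<le> D * M^2 * (N powr \<beta> * (T * e0) + N powr (- 2) * y)" using x1 \<open>D * M^2 > 0\<close> by (intro mult_left_mono) auto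
  ultimately have "D * M^2 * x \<le> D * M^2 * (N powr \<beta> * (T * e0)) + y / 2" unfolding Nm by metis
  then have y4: "y \<le> 2 * (D * M^2 * (N powr \<beta> * (T * e0))) + 2 * c1 * a1" using y2 by linarith
  have "M powr (\<beta> + 2) = M powr \<beta> * M^2" using M by (simp add: powr_add)
  moreover have "N powr \<beta> = n0 powr \<beta> * M powr \<beta>" using n0(1) M by (simp add: N_def powr_mult)
  ultimately have "2 * (D * M^2 * (N powr \<beta> * (T * e0))) = 2 * D * n0 powr \<beta> * (T * e0) * M powr (\<beta> + 2)" by (simp only: ac_simps)
  moreover have "2 * c1 * a1 * 1 \<le> 2 * c1 * a1 * M powr (\<beta> + 2)"
   using M \<beta>0 c12 a1 by (intro mult_left_mono ge_one_powr_ge_zero) auto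
  ultimately have y3: "y \<le> C1 * M powr (\<beta> + 2)" using y4 unfolding C1_def distrib_right by linarith
  \<comment> \<open>A second interpolation, now at the parameter \<open>M\<close> itself, carries
    the bound from order \<open>\<beta> + 2\<close> to all lower orders with the matching power of
    \<open>M\<close>.\<close>
  have "M powr (s - (\<beta> + 2)) * y \<le> M powr (s - (\<beta> + 2)) * (C1 * M powr (\<beta> + 2))" by (intro mult_left_mono y3) auto
  also have "\<dots> = C1 * M powr s" using M by (simp add: powr_diff)
  finally have "M powr s * (T * e0) + M powr (s - (\<beta> + 2)) * y \<le> (T * e0 + C1) * M powr s" by (simp add: algebra_simps)
  then show "tE T s c \<le> ennreal ((T * e0 + C1) * M powr s)"
   using interp[of M s] M s by (auto intro: order_trans ennreal_leI)
 qed
qed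

text \<open>One application of the recursion costs two orders through the symbol or the factor
  \<open>M^2\<close> through the convolution. At the scale of \<open>base\<close> the two prices
  agree, so orders and time derivatives are counted jointly as \<open>s + 2 * j\<close>.\<close>

lemma tder_apriori:
 assumes K: "\<And>s v. 0 \<le> s \<Longrightarrow> s \<le> \<beta> \<Longrightarrow> sE s (conv F v) \<le> ennreal (Kc * M^2) * sE s v" and Kc: "Kc \<ge> 0" and M: "M \<ge> 1"
  and cm: "\<And>k. c k \<in> bmeas" and C0: "C0 \<ge> 0"
  and base: "\<And>s. 0 \<le> s \<Longrightarrow> s \<le> \<beta> + 2 \<Longrightarrow> tE T s c \<le> ennreal (C0 * M powr s)"
  and G: "G = 2 * (2 * pi^2 * \<theta>)^2 + 2 * Kc"
 shows "0 \<le> s \<Longrightarrow> s + 2 * real j \<le> \<beta> + 2 \<Longrightarrow> tE T s (tder \<theta> F c j) \<le> ennreal (C0 * G^j * M powr (s + 2 * real j))"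
proof (induction j arbitrary: s)
 case 0
 then show ?case using base[of s] by simp
next
 case (Suc j)
 note tm [measurable] = tder_measurable[OF cm]
 let ?X = "C0 * G^j * M powr (s + 2 + 2 * real j)" and ?X' = "C0 * G^j * M powr (s + 2 * real j)" and ?k = "(2 * pi^2 * \<theta>)^2"
 have G0: "G \<ge> 0" using Kc by (simp add: G)
 have m: "(\<lambda>t. sE r (\<lambda>k. tder \<theta> F c j k t)) \<in> bmeas" for r by (rule sE_measurable[OF tm])
 have m': "(\<lambda>t. sE r (conv F (\<lambda>l. tder \<theta> F c j l t))) \<in> bmeas" for r
  using sE_measurable[of "\<lambda>k t. conv F (\<lambda>l. tder \<theta> F c j l t) k", OF conv_time_measurable[OF tm]] by simp
 have "tE T s (tder \<theta> F c (Suc j)) \<le> (\<integral>\<^sup>+t. 2 * (ennreal ?k * sE (s + 2) (\<lambda>k. tder \<theta> F c j k t)) + 2 * sE s (conv F (\<lambda>l. tder \<theta> F c j l t)) \<partial>timeM T)"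
  unfolding tE_def by (intro nn_integral_mono tder_sE_step)
 also have "\<dots> = 2 * (ennreal ?k * tE T (s + 2) (tder \<theta> F c j)) + 2 * tE T s (\<lambda>k t. conv F (\<lambda>l. tder \<theta> F c j l t) k)"
  unfolding tE_def using m m' by (simp add: nn_integral_add nn_integral_cmult)
 also have "\<dots> \<le> 2 * (ennreal ?k * ennreal ?X) + 2 * (ennreal (Kc * M^2) * ennreal ?X')"
 proof (intro add_mono mult_left_mono)
  show "tE T (s + 2) (tder \<theta> F c j) \<le> ennreal ?X" using Suc.IH[of "s + 2"] Suc.prems by (simp add: algebra_simps)
  have "tE T s (\<lambda>k t. conv F (\<lambda>l. tder \<theta> F c j l t) k) \<le> ennreal (Kc * M^2) * tE T s (tder \<theta> F c j)"
   using Suc.prems by (intro tE_conv_le K tm) auto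
  also have "\<dots> \<le> ennreal (Kc * M^2) * ennreal ?X'" using Suc.IH[of s] Suc.prems by (intro mult_left_mono) (auto simp: algebra_simps)
  finally show "tE T s (\<lambda>k t. conv F (\<lambda>l. tder \<theta> F c j l t) k) \<le> ennreal (Kc * M^2) * ennreal ?X'" .
 qed auto
 also have "\<dots> = ennreal (2 * (?k * ?X) + 2 * (Kc * M^2 * ?X'))"
  using C0 G0 Kc by (simp add: ennreal_mult ennreal_plus)
 also have "2 * (?k * ?X) + 2 * (Kc * M^2 * ?X') = C0 * G^Suc j * M powr (s + 2 * real (Suc j))"
  using M by (simp add: G powr_add algebra_simps)
 finally show ?case .
qed

subsection \<open>Existence\<close>

text \<open>Provides the initial trace: summed over modes, the squared distance from the datum is at
  most \<open>t\<close> times the energy of the first time derivative.\<close>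

lemma vderiv_increment_sq_le:
 fixes y :: "real \<Rightarrow> complex"
 assumes y': "continuous_on UNIV y'" and t: "0 < t" "t < T"
  and der: "\<And>t. t \<in> {0..T} \<Longrightarrow> (y has_vector_derivative y' t) (at t within {0..T})"
 shows "esq (y t - y 0) \<le> ennreal t * (\<integral>\<^sup>+s. esq (y' s) \<partial>timeM T)"
proof -
 have [measurable]: "y' \<in> bmeas" by (rule borel_measurable_continuous_onI[OF y'])
 define D where "D t = 0 + (\<integral>s. indicator {..<t} s *\<^sub>R y' s \<partial>timeM T)" for t
 have "(\<integral>s. indicator {..<0} s *\<^sub>R y' s \<partial>timeM T) = 0"
  by (rule integral_eq_zero_AE) (use AE_timeM_Ioo[of T] in \<open>eventually_elim, auto\<close>)
 then have D0: "D 0 = 0" by (simp add: D_def)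
 have "(\<integral>s. indicator {..<t} s *\<^sub>R y' s \<partial>timeM T) = (\<integral>s. indicator {0<..<t} s *\<^sub>R y' s \<partial>timeM T)"
  by (rule integral_cong_AE) (use AE_timeM_Ioo[of T] in \<open>measurable, eventually_elim, auto simp: indicator_def\<close>)
 also have "\<dots> = y t - y 0"
 proof (rule integral_timeM_interval_FTC)
  fix s assume "0 \<le> s" "s \<le> t"
  then show "(y has_vector_derivative y' s) (at s within {0..t})"
   using t by (intro has_vector_derivative_within_subset[OF der]) auto
 qed (use t y' in \<open>auto intro: continuous_on_subset\<close>)
 finally have Dt: "D t = y t - y 0" by (simp add: D_def)
 have "esq (D t - D 0) \<le> ennreal \<bar>t - 0\<bar> * (\<integral>\<^sup>+r. esq (y' r) * indicator {min t 0..max t 0} r \<partial>timeM T)"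
  by (rule primitive_diff_sq_le[OF integrable_timeM_cont[OF y'] D_def])
 also have "\<dots> \<le> ennreal \<bar>t - 0\<bar> * (\<integral>\<^sup>+s. esq (y' s) \<partial>timeM T)"
  by (intro mult_left_mono nn_integral_mono) (auto simp: indicator_def)
 finally show ?thesis using t by (simp add: D0 Dt)
qed

text \<open>The function is the pointwise sum of its series, but its time derivatives and its
  Laplacian have coefficients known only to be square summable, so these come from Riesz-Fischer.
  The equation is checked on coefficients and holds almost everywhere by completeness.\<close>

lemma synth_strong_solution:
 fixes f u0 :: "real^'d \<Rightarrow> real" and c :: "int^'d \<Rightarrow> real \<Rightarrow> complex"
 defines "F \<equiv> fcoef f" and "u \<equiv> (\<lambda>x t. synth (\<lambda>k. c k t) x)"
 assumes T: "T > 0" and \<theta>: "\<theta> > 0" and f: "l2 f" "l1 F < \<infinity>" and u0: "l2 u0"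
  and K: "\<And>v. sE 0 (conv F v) \<le> ennreal K * sE 0 v"
  and c: "\<And>k. continuous_on UNIV (c k)" "\<And>t. herm (\<lambda>k. c k t)" "\<And>t. l1 (\<lambda>k. c k t) < \<infinity>" "\<And>k t. cmod (c k t) \<le> B"
  and c0: "\<And>k. c k 0 = fcoef u0 k"
  and der: "\<And>k t. t \<in> {0..T} \<Longrightarrow> (c k has_vector_derivative
    (- of_real (symb \<theta> k) * c k t - conv F (\<lambda>l. c l t) k)) (at t within {0..T})"
  and m: "m \<ge> 1" and fin: "\<And>j. j \<le> m \<Longrightarrow> tE T 0 (tder \<theta> F c j) < \<infinity>" and fin2: "tE T 2 c < \<infinity>"
 shows "strong_sol \<theta> T f u0 u" "\<And>k t. fcoef (\<lambda>x. u x t) k = c k t" "\<And>t. l2 (\<lambda>x. u x t)"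
  and "\<And>j k. j \<le> m \<Longrightarrow> wder T (tder \<theta> F c j k) (tder \<theta> F c (Suc j) k)"
  and "\<exists>w. w 0 = u \<and> (\<forall>j\<le>m. L2Q T (w j) \<and> weak_dt T j u (w j) \<and> L2Q_energy T (w j) \<le> tE T 0 (tder \<theta> F c j)
     \<and> (AE t in timeM T. \<forall>k. fcoef (\<lambda>x. w j x t) k = tder \<theta> F c j k t))"
proof -
 have cm [measurable]: "c k \<in> bmeas" for k by (rule borel_measurable_continuous_onI[OF c(1)])
 note tm [measurable] = tder_measurable[of c, OF cm]
 have Fh: "herm F" unfolding F_def using f(1) by (intro herm_fcoef) (simp add: l2_def)
 have um [measurable]: "case_prod u \<in> bmeas2"
 proof -
  have "(\<lambda>p. \<integral>k. c k (snd p) * chr k (fst p) \<partial>cntM) \<in> borel_measurable (borel \<Otimes>\<^sub>M (borel :: real measure))"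
   by (rule borel_measurable_count_integral) measurable
  then show ?thesis unfolding u_def synth_def split_beta' by measurable
 qed
 show uc: "fcoef (\<lambda>x. u x t) k = c k t" for k t unfolding u_def by (rule fcoef_synth[OF c(2,3)])
 show ul: "l2 (\<lambda>x. u x t)" for t unfolding u_def by (rule l2_synth[OF c(3)])
 have uE: "L2Q_energy T u = tE T 0 c"
  unfolding L2Q_energy_eq(2)[OF um] tE_def by (intro nn_integral_cong) (simp add: parseval[OF ul] uc[abs_def])
 have uL: "L2Q T u" using um uE fin[of 0] by (simp add: L2Q_iff)
 have gc: "continuous_on UNIV (\<lambda>t. conv F (\<lambda>l. c l t) k)" for k by (rule conv_continuous[OF f(2) c(1,4)])
 have tc: "continuous_on UNIV (tder \<theta> F c 1 k)" for k
  using gc[of k] c(1)[of k] by (auto intro!: continuous_intros)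
 have der': "(c k has_vector_derivative tder \<theta> F c 1 k t) (at t within {0..T})" if "t \<in> {0..T}" for k t
  using der[OF that] by simp
 have base: "wder T (c k) (tder \<theta> F c 1 k)" for k by (rule wder_smooth[OF T c(1) tc der'])
 show wd: "wder T (tder \<theta> F c j k) (tder \<theta> F c (Suc j) k)" if "j \<le> m" for j k
  by (rule tder_wder[OF f(2) K cm base fin that])
 \<comment> \<open>Derivatives are moved from the test function to the coefficients, one
   \<open>wder\<close> step and one sign at a time.\<close>
 have wit: "(\<integral>t. c k t * of_real ((deriv ^^ j) \<eta> t) \<partial>timeM T) = (-1)^j * (\<integral>t. tder \<theta> F c j k t * of_real (\<eta> t) \<partial>timeM T)"
  if "j \<le> m" "test_fun T \<eta>" for j k \<eta>
  using that
 proof (induction j arbitrary: \<eta>)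
  case (Suc j)
  have "(\<integral>t. c k t * of_real ((deriv ^^ Suc j) \<eta> t) \<partial>timeM T) = (-1)^j * (\<integral>t. tder \<theta> F c j k t * of_real (deriv \<eta> t) \<partial>timeM T)"
   unfolding funpow_Suc_right comp_def using Suc by (intro Suc.IH test_fun_deriv) auto
  also have "(\<integral>t. tder \<theta> F c j k t * of_real (deriv \<eta> t) \<partial>timeM T) = - (\<integral>t. tder \<theta> F c (Suc j) k t * of_real (\<eta> t) \<partial>timeM T)"
   using wd[of j k] Suc.prems unfolding wder_def by auto
  finally show ?case by simp
 qed simp
 define P where "P j w \<longleftrightarrow> L2Q T w \<and> L2Q_energy T w \<le> tE T 0 (tder \<theta> F c j) \<and> (AE t in timeM T. \<forall>k. fcoef (\<lambda>x. w x t) k = tder \<theta> F c j k t)" for j w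
 \<comment> \<open>\<open>time_energy\<close> requires the entry of order 0 to be \<open>u\<close>
   itself, not merely a function equal to it almost everywhere.\<close>
 have "\<exists>w. P j w \<and> (j = 0 \<longrightarrow> w = u)" if j: "j \<le> m" for j
 proof (cases "j = 0")
  case True
  then show ?thesis using uL uE uc by (auto simp: P_def)
 next
  case False
  obtain w where "L2Q T w" "L2Q_energy T w \<le> tE T 0 (tder \<theta> F c j)" "AE t in timeM T. \<forall>k. fcoef (\<lambda>x. w x t) k = tder \<theta> F c j k t"
   by (rule riesz_fischer[OF tm tder_herm[OF Fh c(2)] fin[OF j]])
  then show ?thesis using False by (auto simp: P_def)
 qed
 then have "\<forall>j\<in>{..m}. \<exists>w. P j w \<and> (j = 0 \<longrightarrow> w = u)" by simp
 then obtain w where w: "\<And>j. j \<le> m \<Longrightarrow> P j (w j)" "w 0 = u" unfolding bchoice_iff by auto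
 have wL: "L2Q T (w j)" and wE: "L2Q_energy T (w j) \<le> tE T 0 (tder \<theta> F c j)"
  and wA: "AE t in timeM T. \<forall>k. fcoef (\<lambda>x. w j x t) k = tder \<theta> F c j k t" if "j \<le> m" for j
  using w(1)[OF that] by (auto simp: P_def)
 have wdt: "weak_dt T j u (w j)" if j: "j \<le> m" for j
 proof (rule weak_dtI[OF uL wL[OF j]])
  fix k \<eta> assume \<eta>: "test_fun T \<eta>"
  note [measurable] = tcoef_facts(1)[OF wL[OF j], of k] test_fun_measurable[OF \<eta>]
  have "(\<integral>t. fcoef (\<lambda>x. w j x t) k * of_real (\<eta> t) \<partial>timeM T) = (\<integral>t. tder \<theta> F c j k t * of_real (\<eta> t) \<partial>timeM T)"
   by (rule integral_cong_AE) (use wA[OF j] in \<open>measurable, eventually_elim, auto\<close>)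
  then show "(\<integral>t. fcoef (\<lambda>x. u x t) k * of_real ((deriv ^^ j) \<eta> t) \<partial>timeM T) = (-1)^j * (\<integral>t. fcoef (\<lambda>x. w j x t) k * of_real (\<eta> t) \<partial>timeM T)"
   unfolding uc using wit[OF j \<eta>, of k] by simp
 qed
 show "\<exists>w. w 0 = u \<and> (\<forall>j\<le>m. L2Q T (w j) \<and> weak_dt T j u (w j) \<and> L2Q_energy T (w j) \<le> tE T 0 (tder \<theta> F c j)
     \<and> (AE t in timeM T. \<forall>k. fcoef (\<lambda>x. w j x t) k = tder \<theta> F c j k t))"
  using w(2) wL wE wA wdt by blast
 \<comment> \<open>The coefficients of the Laplacian, \<open>- (4 * pi^2 * ksq k)\<close> times
   those of \<open>u\<close>, written through \<open>symb\<close> so that \<open>sE_symb_le\<close>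
   bounds them.\<close>
 define z where "z k t = of_real (- 2 / \<theta>) * (of_real (symb \<theta> k) * c k t)" for k t
 have zm: "z k \<in> bmeas" for k unfolding z_def by measurable
 have zh: "herm (\<lambda>k. z k t)" for t using c(2)[of t] by (simp add: z_def herm_def symb_minus)
 have zfin: "tE T 0 z < \<infinity>"
 proof -
  have "tE T 0 z \<le> (\<integral>\<^sup>+t. esq (of_real (- 2 / \<theta>)) * (ennreal ((2 * pi^2 * \<theta>)^2) * sE 2 (\<lambda>k. c k t)) \<partial>timeM T)"
   unfolding tE_def z_def sE_cmult by (intro nn_integral_mono mult_left_mono order_trans[OF sE_symb_le]) auto
  also have "\<dots> = esq (of_real (- 2 / \<theta>)) * (ennreal ((2 * pi^2 * \<theta>)^2) * tE T 2 c)"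
   unfolding tE_def using sE_measurable[of c, OF cm, of 2] by (simp add: nn_integral_cmult)
  also have "\<dots> < \<infinity>" using fin2 by (simp add: ennreal_mult_less_top)
  finally show ?thesis .
 qed
 obtain L where L: "L2Q T L" "AE t in timeM T. \<forall>k. fcoef (\<lambda>x. L x t) k = z k t"
  by (rule riesz_fischer[OF zm zh zfin])
 have zz: "z k t = of_real (- (4 * pi^2 * ksq k)) * c k t" for k t
  using \<theta> by (simp add: z_def symb_def)
 have wl: "weak_lap T u L"
  unfolding weak_lap_iff[OF uL L(1)]
 proof (intro allI impI)
  fix k \<eta> assume \<eta>: "test_fun T \<eta>"
  note [measurable] = tcoef_facts(1)[OF L(1), of k] test_fun_measurable[OF \<eta>] zm
  have "(\<integral>t. fcoef (\<lambda>x. L x t) k * of_real (\<eta> t) \<partial>timeM T) = (\<integral>t. of_real (- (4 * pi^2 * ksq k)) * (c k t * of_real (\<eta> t)) \<partial>timeM T)"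
   by (rule integral_cong_AE) (use L(2) in \<open>measurable, eventually_elim, auto simp: zz\<close>)
  then show "of_real (-(4 * pi^2 * ksq k)) * (\<integral>t. fcoef (\<lambda>x. u x t) k * of_real (\<eta> t) \<partial>timeM T)
   = (\<integral>t. fcoef (\<lambda>x. L x t) k * of_real (\<eta> t) \<partial>timeM T)"
   unfolding uc by simp
 qed
 have fm [measurable]: "f \<in> bmeas" using f(1) by (simp add: l2_def)
 have [measurable]: "case_prod L \<in> bmeas2" "case_prod (w 1) \<in> bmeas2"
  using L(1) wL[OF m] by (auto simp: L2Q_iff)
 have "AE t in timeM T. AE x in cubeM. \<theta>/2 * L x t - w 1 x t - f x * u x t = 0"
  using L(2) wA[OF m] L2Q_slice[OF L(1)] L2Q_slice[OF wL[OF m]]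
 proof eventually_elim
  case (elim t)
  have i: "integrable cubeM (\<lambda>x. \<theta>/2 * L x t)" "integrable cubeM (\<lambda>x. w 1 x t)"
   using integrable_mult_right[OF l2_integrable[OF elim(3)], of "\<theta>/2"] l2_integrable[OF elim(4)] by auto
  obtain b where b: "l1 (\<lambda>k. c k t) = ennreal b" "b \<ge> 0" using c(3)[of t] by (cases "l1 (\<lambda>k. c k t)") auto
  have bu: "\<bar>u x t\<bar> \<le> b" for x using abs_synth_le[of "\<lambda>k. c k t" x] b by (simp add: u_def)
  have [measurable]: "(\<lambda>x. u x t) \<in> bmeas" using ul[of t] by (simp add: l2_def)
  have i2: "integrable cubeM (\<lambda>x. f x * u x t)"
  proof (rule Bochner_Integration.integrable_bound[OF integrable_mult_right[OF integrable_norm[OF l2_integrable[OF f(1)]], of b]])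
   show "AE x in cubeM. norm (f x * u x t) \<le> norm (b * norm (f x))"
    using bu b(2) by (intro AE_I2) (simp add: abs_mult mult.commute[of "\<bar>f _\<bar>"] mult_right_mono)
  qed simp
  have "fcoef (\<lambda>x. \<theta>/2 * L x t - w 1 x t) k = fcoef (\<lambda>x. f x * u x t) k" for k
  proof -
   have "of_real (\<theta>/2) * z k t = - of_real (symb \<theta> k) * c k t" using \<theta> by (simp add: z_def)
   moreover have "fcoef (\<lambda>x. \<theta>/2 * L x t - w 1 x t) k = of_real (\<theta>/2) * z k t - tder \<theta> F c 1 k t"
    using elim(1,2) by (simp only: fcoef_diff[OF i] fcoef_cmult)
   moreover have "fcoef (\<lambda>x. f x * u x t) k = conv F (\<lambda>l. c l t) k"
    using fcoef_mult[OF l2_integrable[OF f(1)] f(2)[unfolded F_def] l2_integrable[OF ul], of t k] by (simp add: F_def uc[abs_def])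
   ultimately show ?thesis by simp
  qed
  from AE_eq_of_fcoef_eq[OF Bochner_Integration.integrable_diff[OF i] i2 this]
  show ?case by eventually_elim simp
 qed
 moreover have "Measurable.pred (borel \<Otimes>\<^sub>M borel) (\<lambda>p. \<theta>/2 * case_prod L p - case_prod (w 1) p - f (fst p) * case_prod u p = 0)" by measurable
 ultimately have eq: "AE p in lborel. p \<in> Qset T \<longrightarrow> \<theta>/2 * L (fst p) (snd p) - w 1 (fst p) (snd p) - f (fst p) * u (fst p) (snd p) = 0"
  using AE_Q_iff[of "\<lambda>p. \<theta>/2 * case_prod L p - case_prod (w 1) p - f (fst p) * case_prod u p = 0" T] by (simp add: split_beta')
 have "\<exists>\<delta>>0. AE t in lborel. 0 < t \<and> t < \<delta> \<and> t < T \<longrightarrow> (\<integral>\<^sup>+ x. indicator tcube x * ennreal ((u x t - u0 x)^2) \<partial>lborel) < ennreal \<epsilon>"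
  if \<epsilon>: "\<epsilon> > 0" for \<epsilon>
 proof -
  \<comment> \<open>The squared distance from \<open>u0\<close> at time \<open>t\<close> is at most
    \<open>t * e1\<close>, hence the choice \<open>\<delta> = \<epsilon> / (e1 + 1)\<close>, whose
    denominator is positive.\<close>
  obtain e1 where e1: "tE T 0 (tder \<theta> F c 1) = ennreal e1" "e1 \<ge> 0" using fin[OF m] by (cases "tE T 0 (tder \<theta> F c 1)") auto
  have "(\<integral>\<^sup>+ x. indicator tcube x * ennreal ((u x t - u0 x)^2) \<partial>lborel) < ennreal \<epsilon>" if t: "0 < t" "t < \<epsilon> / (e1 + 1)" "t < T" for t
  proof -
   have l: "l2 (\<lambda>x. u x t - u0 x)" by (rule l2_diff[OF ul u0])
   then have [measurable]: "(\<lambda>x. u x t - u0 x) \<in> bmeas" by (simp add: l2_def)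
   have "(\<integral>\<^sup>+ x. indicator tcube x * ennreal ((u x t - u0 x)^2) \<partial>lborel) = (\<integral>\<^sup>+x. ennreal ((u x t - u0 x)^2) \<partial>cubeM)"
    by (rule nn_integral_cubeM[symmetric]) measurable
   also have "\<dots> = (\<integral>\<^sup>+k. esq (c k t - c k 0) \<partial>cntM)"
    unfolding parseval[OF l] sE_0_eq fcoef_diff[OF l2_integrable[OF ul] l2_integrable[OF u0]] uc c0 ..
   also have "\<dots> \<le> (\<integral>\<^sup>+k. ennreal t * (\<integral>\<^sup>+s. esq (tder \<theta> F c 1 k s) \<partial>timeM T) \<partial>cntM)"
    by (intro nn_integral_mono vderiv_increment_sq_le[OF tc t(1,3) der'])
   also have "\<dots> = ennreal t * tE T 0 (tder \<theta> F c 1)"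
    unfolding tE_eq_count[of "tder \<theta> F c 1", OF tm] by (subst nn_integral_cmult) (simp_all del: tder.simps One_nat_def)
   also have "\<dots> = ennreal (t * e1)" using t e1 by (simp add: ennreal_mult)
   also have "\<dots> < ennreal \<epsilon>"
   proof (rule ennreal_lessI[OF \<epsilon>])
    have "t * e1 \<le> t * (e1 + 1)" using t by simp
    also have "\<dots> < \<epsilon>" using t(2) e1(2) by (simp add: pos_less_divide_eq)
    finally show "t * e1 < \<epsilon>" .
   qed
   finally show ?thesis .
  qed
  then show ?thesis using \<epsilon> e1(2) by (intro exI[of _ "\<epsilon> / (e1 + 1)"] conjI AE_I2) auto
 qed
 then show "strong_sol \<theta> T f u0 u"
  unfolding strong_sol_def using uL L(1) wL[OF m] wl wdt[OF m] eq by blast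
qed

section \<open>Assembling constants independent of the potential\<close>

lemma conv_Hs_bound:
 fixes f :: "real^'d \<Rightarrow> real"
 assumes f: "in_Hs \<beta> f" and Kc: "2 * ennreal (4 powr \<beta>) * bracket_sum TYPE('d) \<beta> = ennreal Kc" "Kc \<ge> 0" and s: "0 \<le> s" "s \<le> \<beta>"
 shows "sE s (conv (fcoef f) v) \<le> ennreal (Kc * (1 + Hs_norm \<beta> f)^2) * sE s v"
proof -
 have h0: "Hs_norm \<beta> f \<ge> 0" by (simp add: Hs_norm_def)
 have "sE \<beta> (fcoef f) = ennreal ((Hs_norm \<beta> f)^2)"
  using f by (simp add: Hs_norm_def in_Hs_def sob_energy_eq less_top)
 also have "\<dots> \<le> ennreal ((1 + Hs_norm \<beta> f)^2)" using h0 by (intro ennreal_leI power_mono) auto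
 finally have F: "sE \<beta> (fcoef f) \<le> ennreal ((1 + Hs_norm \<beta> f)^2)" .
 have "sE s (conv (fcoef f) v) \<le> ennreal Kc * sE \<beta> (fcoef f) * sE s v" using sE_conv_le[OF s, of "fcoef f" v] unfolding Kc(1) .
 also have "\<dots> \<le> ennreal Kc * ennreal ((1 + Hs_norm \<beta> f)^2) * sE s v" by (intro mult_right_mono mult_left_mono F) auto
 finally show ?thesis using Kc(2) by (simp add: ennreal_mult)
qed

lemma bracket_const_finite:
 assumes "\<beta> > real CARD('d) / 2"
 obtains Kc where "2 * ennreal (4 powr \<beta>) * bracket_sum TYPE('d::finite) \<beta> = ennreal Kc" "Kc \<ge> 0"
proof -
 have "2 * ennreal (4 powr \<beta>) * bracket_sum TYPE('d) \<beta> < \<infinity>" using bracket_sum_finite[OF assms] by (simp add: ennreal_mult_less_top)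
 then show thesis using that by (cases "2 * ennreal (4 powr \<beta>) * bracket_sum TYPE('d) \<beta>") auto
qed

text \<open>All three terms of \<open>slob_total\<close> scale alike: the factor \<open>M^2\<close>
  of the potential meets \<open>M powr (2 * \<sigma> - 2)\<close>, and the other two carry
  \<open>M powr (2 * \<sigma>)\<close>, one through its order and one explicitly.\<close>

lemma slob_energy_bound:
 fixes w :: "real^'d \<Rightarrow> real \<Rightarrow> real"
 assumes T: "T > 0" and \<theta>: "\<theta> \<ge> 0" and \<sigma>: "0 < \<sigma>" "\<sigma> < 1" and M: "M \<ge> 1" and H: "H \<ge> 0" and Kc: "Kc \<ge> 0"
  and K: "\<And>v. sE 0 (conv F v) \<le> ennreal (Kc * M^2) * sE 0 v"
  and am: "\<And>k. a k \<in> bmeas"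
  and a: "tE T (2 * \<sigma>) a \<le> ennreal (H * M powr (2 * \<sigma> + 2 * real m))" "tE T 0 a \<le> ennreal (H * M powr (2 * real m))"
  and wd: "\<And>k. wder T (a k) (\<lambda>t. - of_real (symb \<theta> k) * a k t - conv F (\<lambda>l. a l t) k)"
  and w: "L2Q T w" "AE t in timeM T. \<forall>k. fcoef (\<lambda>x. w x t) k = a k t"
 shows "slob_energy T \<sigma> w \<le> ennreal (H * ((16 / \<sigma> + 2 * (2 * pi^2 * \<theta>)^2 / (1 - \<sigma>)) + 16 / \<sigma> + 2 / (1 - \<sigma>) * Kc) * M powr (2 * \<sigma> + 2 * real m))"
proof -
 let ?c3 = "16 / \<sigma> + 2 * (2 * pi^2 * \<theta>)^2 / (1 - \<sigma>)" and ?c4 = "16 / \<sigma>" and ?c5 = "2 / (1 - \<sigma>)"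
 let ?b = "\<lambda>k t. conv F (\<lambda>l. a l t) k" and ?W = "M powr (2 * \<sigma> + 2 * real m)" and ?X = "H * M powr (2 * real m)"
 have pos: "?c3 \<ge> 0" "?c4 \<ge> 0" "?c5 \<ge> 0" using \<sigma> by auto
 have "tE T 0 ?b \<le> ennreal (Kc * M^2) * tE T 0 a" by (rule tE_conv_le[OF K am])
 also have "\<dots> \<le> ennreal (Kc * M^2) * ennreal ?X" by (intro mult_left_mono a) auto
 also have "\<dots> = ennreal (Kc * M^2 * ?X)" using Kc H by (intro ennreal_mult[symmetric]) auto
 finally have b: "tE T 0 ?b \<le> ennreal (Kc * M^2 * ?X)" .
 have af: "tE T 0 a < \<infinity>" and bf: "tE T 0 ?b < \<infinity>" by (rule le_less_trans[OF a(2)], simp, rule le_less_trans[OF b], simp)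
 have "slob_energy T \<sigma> w \<le> ennreal ?c3 * tE T (2 * \<sigma>) a + ennreal (?c4 * M powr (2 * \<sigma>)) * tE T 0 a + ennreal (?c5 * M powr (2 * \<sigma> - 2)) * tE T 0 ?b"
  unfolding slob_energy_eq[OF w] by (rule slob_total[OF T \<theta> \<sigma> M am conv_time_measurable[OF am] af bf wd])
 also have "\<dots> \<le> ennreal ?c3 * ennreal (H * ?W) + ennreal (?c4 * M powr (2 * \<sigma>)) * ennreal ?X + ennreal (?c5 * M powr (2 * \<sigma> - 2)) * ennreal (Kc * M^2 * ?X)"
  by (intro add_mono mult_left_mono a b) auto
 also have "\<dots> = ennreal (?c3 * (H * ?W) + ?c4 * M powr (2 * \<sigma>) * ?X + ?c5 * M powr (2 * \<sigma> - 2) * (Kc * M^2 * ?X))"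
 proof -
  have e: "ennreal p * ennreal q + ennreal p' * ennreal q' + ennreal p'' * ennreal q'' = ennreal (p * q + p' * q' + p'' * q'')"
   if "p \<ge> 0" "q \<ge> 0" "p' \<ge> 0" "q' \<ge> 0" "p'' \<ge> 0" "q'' \<ge> 0" for p q p' q' p'' q''
   using that by (simp add: ennreal_mult ennreal_plus)
  show ?thesis using pos H Kc by (intro e) auto
 qed
 also have "?c3 * (H * ?W) + ?c4 * M powr (2 * \<sigma>) * ?X + ?c5 * M powr (2 * \<sigma> - 2) * (Kc * M^2 * ?X) = H * (?c3 + ?c4 + ?c5 * Kc) * ?W"
 proof -
  have W: "?W = M powr (2 * \<sigma>) * M powr (2 * real m)" by (rule powr_add)
  moreover have "M powr (2 * \<sigma> - 2) * M^2 = M powr (2 * \<sigma>)" using M by (simp add: powr_diff)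
  ultimately have "M powr (2 * \<sigma> - 2) * (M^2 * M powr (2 * real m)) = ?W" by (simp only: mult.assoc[symmetric])
  moreover have "?c5 * M powr (2 * \<sigma> - 2) * (Kc * M^2 * ?X) = ?c5 * Kc * H * (M powr (2 * \<sigma> - 2) * (M^2 * M powr (2 * real m)))" by (simp only: ac_simps)
  ultimately have "?c5 * M powr (2 * \<sigma> - 2) * (Kc * M^2 * ?X) = ?c5 * Kc * H * ?W" by simp
  moreover have "?c4 * M powr (2 * \<sigma>) * ?X = ?c4 * H * ?W" unfolding W by (simp only: ac_simps)
  ultimately show ?thesis by (simp only: distrib_left distrib_right ac_simps)
 qed
 finally show ?thesis .
qed

text \<open>The infimum in \<open>time_energy\<close> is bounded by exhibiting one family of
  derivatives. The constant is chosen before \<open>f\<close> and may depend on the initial datum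
  and the parameters.\<close>

lemma solution_exists_bounded:
 fixes u0 :: "real^'d \<Rightarrow> real"
 assumes T: "T > 0" and \<theta>: "\<theta> > 0" and \<beta>: "\<beta> > real CARD('d) / 2" "\<beta> \<ge> 2" and u0: "in_Hs (1 + \<beta>) u0"
 obtains C where "C > 0" "\<And>f. in_Hs \<beta> f \<Longrightarrow> (\<And>x. f x \<ge> 0) \<Longrightarrow>
  \<exists>u. in_par (2 + \<beta>) T u \<and> strong_sol \<theta> T f u0 u \<and> par_energy (2 + \<beta>) T u \<le> ennreal (C * (1 + Hs_norm \<beta> f) powr (\<beta> + 2))"
proof -
 obtain Kc where Kc: "2 * ennreal (4 powr \<beta>) * bracket_sum TYPE('d) \<beta> = ennreal Kc" "Kc \<ge> 0" by (rule bracket_const_finite[OF \<beta>(1)])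
 have u0l: "l2 u0" by (rule in_Hs_l2[OF u0])
 have a0: "sE (\<beta> + 1) (fcoef u0) < \<infinity>" using u0 by (simp add: in_Hs_def sob_energy_eq add.commute)
 have a0\<beta>: "sE \<beta> (fcoef u0) < \<infinity>" using sE_mono_exp[of \<beta> "\<beta> + 1" "fcoef u0"] a0 by (auto intro: le_less_trans)
 have a0h: "herm (fcoef u0)" using u0l by (intro herm_fcoef) (simp add: l2_def)
 obtain C0 where C0: "C0 \<ge> 0" and ap: "\<And>f c M R s. \<lbrakk>integrable cubeM f; l1 (fcoef f) < \<infinity>; \<And>x. f x \<ge> 0; M \<ge> 1;
   \<And>s v. 0 \<le> s \<Longrightarrow> s \<le> \<beta> \<Longrightarrow> sE s (conv (fcoef f) v) \<le> ennreal (Kc * M^2) * sE s v;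
   \<And>k. continuous_on UNIV (c k); \<And>t. herm (\<lambda>k. c k t); \<And>t. sE \<beta> (\<lambda>k. c k t) \<le> ennreal R; R \<ge> 0; \<And>k. c k 0 = fcoef u0 k;
   \<And>k. continuous_on UNIV (\<lambda>t. conv (fcoef f) (\<lambda>l. c l t) k);
   \<And>k t. t \<in> {0..T} \<Longrightarrow> (c k has_vector_derivative
    (- of_real (symb \<theta> k) * c k t - conv (fcoef f) (\<lambda>l. c l t) k)) (at t within {0..T});
   0 \<le> s; s \<le> \<beta> + 2\<rbrakk> \<Longrightarrow> tE T s c \<le> ennreal (C0 * M powr s)"
  by (rule coef_apriori[OF T \<theta> \<beta>(1) Kc(2) a0]) blast
 define G where "G = 2 * (2 * pi^2 * \<theta>)^2 + 2 * Kc"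
 have G: "G \<ge> 0" using Kc by (simp add: G_def)
 \<comment> \<open>\<open>m\<close> and \<open>\<sigma>\<close> are the integral and fractional
   parts that \<open>time_energy\<close> forms from \<open>(2 + \<beta>) / 2\<close>, so that
   \<open>2 * \<sigma> + 2 * m\<close> is exactly the top order \<open>\<beta> + 2\<close> of the a
   priori bound.\<close>
 define m where "m = nat \<lfloor>(2 + \<beta>) / 2\<rfloor>"
 define \<sigma> where "\<sigma> = (2 + \<beta>) / 2 - real m"
 have m1: "m \<ge> 1" using \<beta>(2) by (auto simp: m_def le_nat_iff le_floor_iff)
 have rm: "real m = of_int \<lfloor>(2 + \<beta>) / 2\<rfloor>" using \<beta>(2) by (simp add: m_def)
 have \<sigma>: "0 \<le> \<sigma>" "\<sigma> < 1" unfolding \<sigma>_def rm by linarith+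
 have m\<beta>: "2 * \<sigma> + 2 * real m = \<beta> + 2" by (simp add: \<sigma>_def)
 \<comment> \<open>For \<open>\<sigma> = 0\<close> the quotients by \<open>\<sigma>\<close> are 0 by
   convention, and the fractional term is absent.\<close>
 define Cs where "Cs = (16 / \<sigma> + 2 * (2 * pi^2 * \<theta>)^2 / (1 - \<sigma>)) + 16 / \<sigma> + 2 / (1 - \<sigma>) * Kc"
 have Cs: "Cs \<ge> 0" using \<sigma> Kc by (simp add: Cs_def)
 \<comment> \<open>One summand for each piece of the energy: order \<open>2 + \<beta>\<close> in
   space, the time derivatives up to \<open>m\<close>, and the fractional remainder; the 1 makes it
   positive.\<close>
 define C where "C = 1 + C0 + (\<Sum>j\<le>m. C0 * G^j) + C0 * G^m * Cs"
 have sum0: "(\<Sum>j\<le>m. C0 * G^j) \<ge> 0" using C0 G by (intro sum_nonneg) auto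
 show thesis
 proof (rule that[of C])
  show "C > 0" using C0 G Cs sum0 by (simp add: C_def add_pos_nonneg)
  fix f :: "real^'d \<Rightarrow> real" assume f: "in_Hs \<beta> f" and f0: "\<And>x. f x \<ge> 0"
  define M where "M = 1 + Hs_norm \<beta> f"
  have M: "M \<ge> 1" by (simp add: M_def Hs_norm_def)
  let ?F = "fcoef f"
  have fl: "l2 f" by (rule in_Hs_l2[OF f])
  have Fs: "sE \<beta> ?F < \<infinity>" using f by (simp add: in_Hs_def sob_energy_eq)
  have Fl: "l1 ?F < \<infinity>" by (rule l1_finite[OF \<beta>(1) Fs])
  have Fh: "herm ?F" using fl by (intro herm_fcoef) (simp add: l2_def)
  have K: "sE s (conv ?F v) \<le> ennreal (Kc * M^2) * sE s v" if "0 \<le> s" "s \<le> \<beta>" for s v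
   unfolding M_def by (rule conv_Hs_bound[OF f Kc that])
  have K0: "sE 0 (conv ?F v) \<le> ennreal (Kc * M^2) * sE 0 v" for v using K[of 0] \<beta>(2) by simp
  obtain c R where c: "\<And>k. continuous_on UNIV (c k)" "\<And>t. herm (\<lambda>k. c k t)" and R: "R \<ge> 0"
   "\<And>t. sE \<beta> (\<lambda>k. c k t) \<le> ennreal R" and c0: "\<And>k. c k 0 = fcoef u0 k"
   and der: "\<And>k t. t \<in> {0..T} \<Longrightarrow> (c k has_vector_derivative
    (- of_real (symb \<theta> k) * c k t - conv ?F (\<lambda>l. c l t) k)) (at t within {0..T})"
   by (rule coef_solution_exists[OF T \<theta> \<beta>(1) Fh Fs a0h a0\<beta>]) blast
  have cl: "l1 (\<lambda>k. c k t) < \<infinity>" for t by (rule l1_finite[OF \<beta>(1)]) (rule le_less_trans[OF R(2)], simp)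
  have cb: "cmod (c k t) \<le> sqrt R" for k t
   using sE_mono_exp[of 0 \<beta> "\<lambda>k. c k t"] \<beta>(2) R by (intro cmod_le_sE_0) (auto intro: order_trans)
  have gc: "continuous_on UNIV (\<lambda>t. conv ?F (\<lambda>l. c l t) k)" for k by (rule conv_continuous[OF Fl c(1) cb])
  have cm: "c k \<in> bmeas" for k by (rule borel_measurable_continuous_onI[OF c(1)])
  have est: "tE T s c \<le> ennreal (C0 * M powr s)" if "0 \<le> s" "s \<le> \<beta> + 2" for s
   by (rule ap[OF l2_integrable[OF fl] Fl f0 M K c R(2,1) c0 gc der that])
  have td: "tE T s (tder \<theta> ?F c j) \<le> ennreal (C0 * G^j * M powr (s + 2 * real j))" if "0 \<le> s" "s + 2 * real j \<le> \<beta> + 2" for s j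
   by (rule tder_apriori[OF K Kc(2) M cm C0 est G_def that])
  have jm: "2 * real j \<le> \<beta> + 2" if "j \<le> m" for j using that m\<beta> \<sigma>(1) of_nat_mono[OF that, where 'a=real] by linarith
  have fin: "tE T 0 (tder \<theta> ?F c j) < \<infinity>" if "j \<le> m" for j
   by (rule le_less_trans[OF td]) (use jm[OF that] in auto)
  have fin2: "tE T 2 c < \<infinity>" by (rule le_less_trans[OF est]) (use \<beta>(2) in auto)
  define u where "u = (\<lambda>x t. synth (\<lambda>k. c k t) x)"
  note sol = synth_strong_solution[OF T \<theta> fl Fl u0l K0 c cl cb c0 der m1 fin fin2, folded u_def]
  have uc: "fcoef (\<lambda>x. u x t) = (\<lambda>k. c k t)" for t unfolding u_def by (rule ext, rule sol(2)) auto
  obtain w where w: "w 0 = u" "\<And>j. j \<le> m \<Longrightarrow> L2Q T (w j) \<and> weak_dt T j u (w j) \<and> L2Q_energy T (w j) \<le> tE T 0 (tder \<theta> ?F c j)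
     \<and> (AE t in timeM T. \<forall>k. fcoef (\<lambda>x. w j x t) k = tder \<theta> ?F c j k t)"
   using sol(5) by blast
  let ?W = "M powr (\<beta> + 2)"
  have S: "(\<Sum>j\<le>m. L2Q_energy T (w j)) \<le> ennreal ((\<Sum>j\<le>m. C0 * G^j) * ?W)"
  proof -
   have "(\<Sum>j\<le>m. L2Q_energy T (w j)) \<le> (\<Sum>j\<le>m. ennreal (C0 * G^j * ?W))"
   proof (rule sum_mono)
    fix j assume "j \<in> {..m}"
    then have j: "j \<le> m" by simp
    have "L2Q_energy T (w j) \<le> ennreal (C0 * G^j * M powr (0 + 2 * real j))"
     using w(2)[OF j] td[of 0 j] jm[OF j] by (auto intro: order_trans)
    also have "\<dots> \<le> ennreal (C0 * G^j * ?W)" using M C0 G jm[OF j] by (intro ennreal_leI mult_left_mono powr_mono) auto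
    finally show "L2Q_energy T (w j) \<le> ennreal (C0 * G^j * ?W)" .
   qed
   also have "\<dots> = ennreal ((\<Sum>j\<le>m. C0 * G^j) * ?W)" using C0 G by (subst sum_ennreal) (auto simp: sum_distrib_right)
   finally show ?thesis .
  qed
  have sl: "(if \<sigma> > 0 then slob_energy T \<sigma> (w m) else 0) \<le> ennreal (C0 * G^m * Cs * ?W)"
  proof (cases "\<sigma> > 0")
   case True
   have H: "C0 * G^m \<ge> 0" using C0 G by simp
   have "tE T (2 * \<sigma>) (tder \<theta> ?F c m) \<le> ennreal (C0 * G^m * M powr (2 * \<sigma> + 2 * real m))"
    using td[of "2 * \<sigma>" m] \<sigma>(1) m\<beta> by simp
   moreover have "tE T 0 (tder \<theta> ?F c m) \<le> ennreal (C0 * G^m * M powr (2 * real m))" using td[of 0 m] jm[of m] by simp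
   moreover have "wder T (tder \<theta> ?F c m k) (\<lambda>t. - of_real (symb \<theta> k) * tder \<theta> ?F c m k t - conv ?F (\<lambda>l. tder \<theta> ?F c m l t) k)" for k
    using sol(4)[of m k] by simp
   ultimately have "slob_energy T \<sigma> (w m) \<le> ennreal (C0 * G^m * Cs * M powr (2 * \<sigma> + 2 * real m))"
    unfolding Cs_def using w(2)[of m] \<theta>
    by (intro slob_energy_bound[OF T _ True \<sigma>(2) M H Kc(2) K0 tder_measurable[OF cm]]) auto
   then show ?thesis using True unfolding m\<beta> by simp
  qed simp
  have "time_energy ((2 + \<beta>) / 2) T u \<le> (\<Sum>j\<le>m. L2Q_energy T (w j)) + (if \<sigma> > 0 then slob_energy T \<sigma> (w m) else 0)"
   unfolding time_energy_def Let_def m_def[symmetric] \<sigma>_def[symmetric] using w by (intro INF_lower) auto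
  also have "\<dots> \<le> ennreal ((\<Sum>j\<le>m. C0 * G^j) * ?W) + ennreal (C0 * G^m * Cs * ?W)" by (intro add_mono S sl)
  finally have te: "time_energy ((2 + \<beta>) / 2) T u \<le> ennreal ((\<Sum>j\<le>m. C0 * G^j) * ?W) + ennreal (C0 * G^m * Cs * ?W)" .
  have "(\<integral>\<^sup>+t. indicator {0<..<T} t * sob_energy (2 + \<beta>) (\<lambda>x. u x t) \<partial>lborel) = tE T (2 + \<beta>) c"
   unfolding tE_def sob_energy_eq uc by (rule nn_integral_timeM[symmetric]) (rule sE_measurable[OF cm])
  also have "\<dots> \<le> ennreal (C0 * ?W)" using est[of "2 + \<beta>"] \<beta>(2) by (simp add: add.commute)
  finally have "par_energy (2 + \<beta>) T u \<le> ennreal (C0 * ?W) + (ennreal ((\<Sum>j\<le>m. C0 * G^j) * ?W) + ennreal (C0 * G^m * Cs * ?W))"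
   unfolding par_energy_def by (intro add_mono te)
  also have "\<dots> = ennreal (C0 * ?W + ((\<Sum>j\<le>m. C0 * G^j) * ?W + C0 * G^m * Cs * ?W))"
   using C0 G Cs sum0 by (simp add: ennreal_plus)
  also have "\<dots> \<le> ennreal (C * ?W)" by (intro ennreal_leI) (simp add: C_def algebra_simps)
  finally have pe: "par_energy (2 + \<beta>) T u \<le> ennreal (C * ?W)" .
  have "in_par (2 + \<beta>) T u"
   unfolding in_par_def
  proof (intro conjI allI)
   show "periodic_x (\<lambda>x. u x t)" for t unfolding u_def by (rule synth_periodic)
   show "case_prod u \<in> borel_measurable lborel" using sol(1) by (simp add: strong_sol_def L2Q_def)
   show "par_energy (2 + \<beta>) T u < \<infinity>" by (rule le_less_trans[OF pe]) simp
  qed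
  then show "\<exists>u. in_par (2 + \<beta>) T u \<and> strong_sol \<theta> T f u0 u \<and> par_energy (2 + \<beta>) T u \<le> ennreal (C * (1 + Hs_norm \<beta> f) powr (\<beta> + 2))"
   using sol(1) pe unfolding M_def by blast
 qed
qed

theorem mainTheorem9:
  fixes \<theta> T \<beta> fmin :: real and u0 :: "real^'d \<Rightarrow> real"
  assumes "T > 0" and "\<theta> > 0" and "\<beta> > 2 + real CARD('d) / 2" and "fmin > 0"
    and "in_Hs (1 + \<beta>) u0"
  shows "(\<forall>f. in_Hs \<beta> f \<and> (\<forall>x. f x \<ge> fmin) \<longrightarrow>
            (\<exists>u. in_par (2 + \<beta>) T u \<and> strong_sol \<theta> T f u0 u \<and>
               (\<forall>v. in_par (2 + \<beta>) T v \<and> strong_sol \<theta> T f u0 v \<longrightarrow>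
                  (AE p in lborel. p \<in> Qset T \<longrightarrow> case_prod v p = case_prod u p))))
       \<and> (\<exists>C>0. \<forall>f u. in_Hs \<beta> f \<and> (\<forall>x. f x \<ge> fmin) \<and>
                  in_par (2 + \<beta>) T u \<and> strong_sol \<theta> T f u0 u \<longrightarrow>
                  par_norm (2 + \<beta>) T u \<le> C * (1 + Hs_norm \<beta> f powr (1 + \<beta> / 2)))"
proof -
 have \<beta>: "\<beta> > real CARD('d) / 2" "\<beta> \<ge> 2" using assms(3) by (auto intro: add_increasing2 less_imp_le order_trans[of _ "2 + real CARD('d) / 2"])
 obtain C where C: "C > 0" and ex: "\<And>f. in_Hs \<beta> f \<Longrightarrow> (\<And>x. f x \<ge> 0) \<Longrightarrow>
  \<exists>u. in_par (2 + \<beta>) T u \<and> strong_sol \<theta> T f u0 u \<and> par_energy (2 + \<beta>) T u \<le> ennreal (C * (1 + Hs_norm \<beta> f) powr (\<beta> + 2))"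
  using solution_exists_bounded[OF assms(1,2) \<beta> assms(5)] by metis
 obtain Kc where Kc: "2 * ennreal (4 powr \<beta>) * bracket_sum TYPE('d) \<beta> = ennreal Kc" "Kc \<ge> 0" by (rule bracket_const_finite[OF \<beta>(1)])
 have f0: "f x \<ge> 0" if "\<forall>x. f x \<ge> fmin" for f :: "real^'d \<Rightarrow> real" and x using that assms(4) by (meson less_imp_le order_trans)
 have uniq: "AE p in lborel. p \<in> Qset T \<longrightarrow> case_prod v p = case_prod u p"
  if f: "in_Hs \<beta> f" and u: "strong_sol \<theta> T f u0 u" and v: "strong_sol \<theta> T f u0 v" for f :: "real^'d \<Rightarrow> real" and u v
 proof (rule strong_sol_unique[OF assms(1) _ _ _ less_imp_le[OF assms(2)] _ _ in_Hs_l2[OF assms(5)] u v])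
  let ?K = "Kc * (1 + Hs_norm \<beta> f)^2"
  have "sE \<beta> (fcoef f) < \<infinity>" using f by (simp add: in_Hs_def sob_energy_eq)
  then show "l1 (fcoef f) < \<infinity>" by (rule l1_finite[OF \<beta>(1)])
  show "f \<in> bmeas" "integrable cubeM f" using in_Hs_l2[OF f] l2_integrable by (auto simp: l2_def)
  \<comment> \<open>Adding 1 makes the constant strictly positive, as the Gronwall argument
    asks.\<close>
  show "sE 0 (conv (fcoef f) z) \<le> ennreal (?K + 1) * sE 0 z" for z
  proof -
   have "sE 0 (conv (fcoef f) z) \<le> ennreal ?K * sE 0 z" by (rule conv_Hs_bound[OF f Kc]) (use \<beta> in auto)
   also have "\<dots> \<le> ennreal (?K + 1) * sE 0 z" by (intro mult_right_mono ennreal_leI) auto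
   finally show ?thesis .
  qed
  show "?K + 1 > 0" using Kc(2) by (simp add: add_nonneg_pos)
 qed
 have "par_norm (2 + \<beta>) T u \<le> sqrt C * 2 powr (1 + \<beta> / 2) * (1 + Hs_norm \<beta> f powr (1 + \<beta> / 2))"
  if f: "in_Hs \<beta> f" "\<forall>x. f x \<ge> fmin" and u: "in_par (2 + \<beta>) T u" "strong_sol \<theta> T f u0 u" for f u
 proof -
  obtain v where v: "in_par (2 + \<beta>) T v" "strong_sol \<theta> T f u0 v" "par_energy (2 + \<beta>) T v \<le> ennreal (C * (1 + Hs_norm \<beta> f) powr (\<beta> + 2))"
   using ex[OF f(1) f0[OF f(2)]] by blast
  have "case_prod u \<in> bmeas2" "case_prod v \<in> bmeas2"
   using u(2) v(2) by (auto simp: strong_sol_def L2Q_iff)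
  \<comment> \<open>The bound is known for the constructed solution \<open>v\<close> and passes to
    the arbitrary solution \<open>u\<close>, since the energy does not see null sets.\<close>
  then have "par_energy (2 + \<beta>) T u \<le> par_energy (2 + \<beta>) T v"
   by (rule par_energy_mono_AE[OF _ _ uniq[OF f(1) v(2) u(2)]]) (use \<beta> in auto)
  also note v(3)
  finally have "enn2real (par_energy (2 + \<beta>) T u) \<le> C * (1 + Hs_norm \<beta> f) powr (\<beta> + 2)"
   using C by (intro enn2real_leI) auto
  then have "par_norm (2 + \<beta>) T u \<le> sqrt (C * (1 + Hs_norm \<beta> f) powr (\<beta> + 2))" unfolding par_norm_def by (rule real_sqrt_le_mono)
  also have "\<dots> = sqrt C * (1 + Hs_norm \<beta> f) powr (1 + \<beta> / 2)"
   by (simp add: real_sqrt_mult powr_half_sqrt[symmetric] powr_powr add_divide_distrib add.commute)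
  also have "(1 + Hs_norm \<beta> f) powr (1 + \<beta> / 2) \<le> 2 powr (1 + \<beta> / 2) * (1 + Hs_norm \<beta> f powr (1 + \<beta> / 2))"
  proof -
   have h: "Hs_norm \<beta> f \<ge> 0" by (simp add: Hs_norm_def)
   \<comment> \<open>\<open>1 + h \<le> 2 * max 1 h\<close> separates the powers of 1 and of the
     norm, at the price of the factor \<open>2 powr (1 + \<beta> / 2)\<close>.\<close>
   have "(1 + Hs_norm \<beta> f) powr (1 + \<beta> / 2) \<le> (2 * max 1 (Hs_norm \<beta> f)) powr (1 + \<beta> / 2)"
    using h \<beta>(2) by (intro powr_mono2) auto
   also have "\<dots> = 2 powr (1 + \<beta> / 2) * max 1 (Hs_norm \<beta> f) powr (1 + \<beta> / 2)" by (simp add: powr_mult)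
   also have "max 1 (Hs_norm \<beta> f) powr (1 + \<beta> / 2) \<le> 1 + Hs_norm \<beta> f powr (1 + \<beta> / 2)" by (auto simp: max_def)
   finally show ?thesis by simp
  qed
  finally show ?thesis using C by (simp add: mult.assoc)
 qed
 moreover have "sqrt C * 2 powr (1 + \<beta> / 2) > 0" using C by simp
 moreover have "\<exists>u. in_par (2 + \<beta>) T u \<and> strong_sol \<theta> T f u0 u \<and>
        (\<forall>v. in_par (2 + \<beta>) T v \<and> strong_sol \<theta> T f u0 v \<longrightarrow>
         (AE p in lborel. p \<in> Qset T \<longrightarrow> case_prod v p = case_prod u p))"
  if f: "in_Hs \<beta> f" "\<forall>x. f x \<ge> fmin" for f
  using ex[OF f(1) f0[OF f(2)]] uniq[OF f(1)] by blast
 ultimately show ?thesis by blast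
qed

end
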